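(* Let $\mu>0$, let $\phi:\mathbb R_+\to\mathbb R_+$ be locally bounded with $\int_0^\infty\phi(t)dt=1$ and $\int_0^\infty t\phi(t)dt=m<\infty$. For $T>1$ let $a_T\in(0,1)$ be given by $T(1-a_T)=1$, let $\phi^T=a_T\phi$, and let $\lambda^T$ be the intensity of the nearly unstable linear Hawkes process with empty history, $$\lambda^T_t=\mu+\iint_{(0,t)\times\mathbb R_+}\phi^T(t-s)\mathbf 1_{\{\theta\le\lambda^T_s\}}N(ds,d\theta),\qquad t\in[0,T].$$ Set $F^T=\iint_{[0,T]\times\mathbb R_+}\frac{\mathbf 1_{\{\theta\le\lambda^T_t\}}}{\sqrt{T\lambda^T_t}}(N(dt,d\theta)-dt\,d\theta)$ and let $G\sim\mathcal N(0,1)$. Then there exists $C>0$ such that for all $T>1$, $$d_W(F^T,G)\le\frac{C}{\sqrt T}+\frac CT\,\mathbb E\Bigg[\int_0^T\sqrt{\lambda^T_t}\sqrt{\int_t^T\mathbb E_t\Big[\Big|1-\frac{\lambda^T_s}{\lambda^T_s\circ\varepsilon^+_{(t,0)}}\Big|^2\Big]ds}\;dt\Bigg].$$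
   Context: $\mathbb R_+=[0,\infty)$. $\Omega$ is the space of point configurations $\omega$ on $\mathbb R\times\mathbb R_+$, $N(B)(\omega)=\omega(B)$, and under $\mathbb P$ the measure $N$ is a Poisson random measure with intensity the Lebesgue measure $dt\,d\theta$. $\mathcal F^N_t=\sigma(N(\mathcal T\times B):\mathcal T\in\mathcal B((-\infty,t]),B\in\mathcal B(\mathbb R_+))$, $\mathbb F^N=(\mathcal F^N_t)_t$, $\mathbb E_t[\cdot]=\mathbb E[\cdot\mid\mathcal F^N_t]$. $\lambda^T$ is the unique $\mathbb F^N$-predictable solution of the displayed equation. Shift operator: $\varepsilon^+_{(t,\theta)}(\omega)(A)=\omega(A\setminus\{(t,\theta)\})+\mathbf 1_A(t,\theta)$. Wasserstein distance: $d_W(F,G)=\sup_u|\mathbb E[u(F)]-\mathbb E[u(G)]|$ over $1$-Lipschitz $u:\mathbb R\to\mathbb R$. *)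

theory Defs
  imports "HOL-Probability.Probability"
begin

section \<open>Point configurations and the Poisson measure\<close>

text \<open>The intensity measure \<open>dt d\<theta>\<close> on \<open>\<real> \<times> \<real>\<^sub>+\<close>; its \<open>\<sigma>\<close>-algebra consists of the Borel subsets
  of \<open>\<real> \<times> \<real>\<^sub>+\<close>.\<close>

definition half_plane :: "(real \<times> real) measure" where
  "half_plane = restrict_space lborel (UNIV \<times> {0..})"

type_synonym config = "(real \<times> real) measure"

definition configs :: "config set" where
  "configs = {\<omega>. sets \<omega> = sets half_plane \<and>
     (\<forall>B\<in>sets half_plane. bounded B \<longrightarrow> emeasure \<omega> B \<in> \<nat>)}"

definition config_space :: "config measure" where
  "config_space = sigma configs
     {{\<omega> \<in> configs. emeasure \<omega> B \<in> E} |B E. B \<in> sets half_plane \<and> E \<in> sets borel}"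

text \<open>The filtration \<open>\<F>\<^sup>N\<close>; note that the time index runs over all of \<open>\<real>\<close>.\<close>

definition past :: "real \<Rightarrow> config measure" where
  "past t = sigma configs
     {{\<omega> \<in> configs. emeasure \<omega> (S \<times> B) \<in> E} |S B E.
        S \<in> sets borel \<and> S \<subseteq> {..t} \<and> B \<in> sets borel \<and> B \<subseteq> {0..} \<and> E \<in> sets borel}"

text \<open>\<open>P\<close> is the law on the canonical space under which \<open>N(B)(\<omega>) = \<omega>(B)\<close> is a Poisson random
  measure with intensity \<open>dt d\<theta>\<close>. The distribution is only prescribed for sets of finite intensity;
  that \<open>N(B) = \<infinity>\<close> almost surely for the other sets is a consequence.\<close>

definition poisson_law :: "config measure \<Rightarrow> bool" where
  "poisson_law P \<longleftrightarrow>
     prob_space P \<and> space P = space config_space \<and> sets P = sets config_space \<and>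
     (\<forall>B\<in>sets half_plane. emeasure half_plane B < \<infinity> \<longrightarrow>
        (\<forall>k::nat. measure P {\<omega> \<in> space P. emeasure \<omega> B = of_nat k} =
           exp (- measure half_plane B) * measure half_plane B ^ k / fact k)) \<and>
     (\<forall>(I :: nat set) B. (\<forall>i\<in>I. B i \<in> sets half_plane) \<and> disjoint_family_on B I \<longrightarrow>
        prob_space.indep_vars P (\<lambda>_. borel) (\<lambda>i \<omega>. emeasure \<omega> (B i)) I)"

text \<open>The shift operator \<open>\<epsilon>\<^sup>+\<^bsub>z\<^esub>\<close>, for \<open>z \<in> \<real> \<times> \<real>\<^sub>+\<close>.\<close>

definition add_point :: "real \<times> real \<Rightarrow> config \<Rightarrow> config" where
  "add_point z \<omega> = measure_of (space half_plane) (sets half_plane)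
     (\<lambda>A. emeasure \<omega> (A - {z}) + indicator A z)"

lemma space_half_plane: "space half_plane = UNIV \<times> {0..}"
  by (simp add: half_plane_def space_restrict_space)

lemma sets_half_plane_iff: "A \<in> sets half_plane \<longleftrightarrow> A \<in> sets borel \<and> A \<subseteq> UNIV \<times> {0..}"
proof -
  have "UNIV \<times> {0..} \<in> sets (borel :: (real \<times> real) measure)"
    by (intro borel_closed closed_Times) auto
  then show ?thesis
    unfolding half_plane_def by (subst sets_restrict_space_iff) auto
qed

lemma sets_add_point [simp]: "sets (add_point z \<omega>) = sets half_plane"
  unfolding add_point_def by (simp add: sets.space_closed sets.sigma_sets_eq)

lemma emeasure_add_point:
  assumes \<omega>: "\<omega> \<in> configs" and A: "A \<in> sets half_plane"
  shows "emeasure (add_point z \<omega>) A = emeasure \<omega> (A - {z}) + indicator A z"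
proof -
  have s: "sets \<omega> = sets half_plane"
    using \<omega> by (simp add: configs_def)
  have minus: "B - {z} \<in> sets half_plane" if "B \<in> sets half_plane" for B
    using that by (auto simp: sets_half_plane_iff)
  have "countably_additive (sets half_plane) (\<lambda>A. emeasure \<omega> (A - {z}) + indicator A z)"
  proof (rule countably_additiveI)
    fix D :: "nat \<Rightarrow> (real \<times> real) set"
    assume D: "range D \<subseteq> sets half_plane" "disjoint_family D"
    have D': "range (\<lambda>i. D i - {z}) \<subseteq> sets \<omega>" "disjoint_family (\<lambda>i. D i - {z})"
      using D minus s by (auto simp: disjoint_family_on_def)
    have "(\<Sum>i. emeasure \<omega> (D i - {z}) + indicator (D i) z) =
        (\<Sum>i. emeasure \<omega> (D i - {z})) + (\<Sum>i. indicator (D i) z)"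
      by (simp add: suminf_add)
    also have "(\<Sum>i. emeasure \<omega> (D i - {z})) = emeasure \<omega> ((\<Union>i. D i) - {z})"
      unfolding suminf_emeasure[OF D'] by (rule arg_cong[where f = "emeasure \<omega>"]) auto
    also have "(\<Sum>i. indicator (D i) z) = (indicator (\<Union>i. D i) z :: ennreal)"
      using D(2) by (rule suminf_indicator)
    finally show "(\<Sum>i. emeasure \<omega> (D i - {z}) + indicator (D i) z) =
        emeasure \<omega> ((\<Union>i. D i) - {z}) + indicator (\<Union>i. D i) z" .
  qed
  then show ?thesis
    by (intro emeasure_measure_of[OF add_point_def])
       (use A in \<open>auto simp: positive_def sets.space_closed\<close>)
qed

lemma add_point_in_configs:
  assumes "\<omega> \<in> configs"
  shows "add_point z \<omega> \<in> configs"
proof -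
  have "emeasure (add_point z \<omega>) B \<in> \<nat>" if B: "B \<in> sets half_plane" "bounded B" for B
  proof -
    have "B - {z} \<in> sets half_plane" "bounded (B - {z})"
      using B by (auto simp: sets_half_plane_iff intro: bounded_subset)
    then have "emeasure \<omega> (B - {z}) \<in> \<nat>"
      using assms by (auto simp: configs_def)
    then show ?thesis
      by (simp add: emeasure_add_point[OF assms B(1)] indicator_def)
  qed
  then show ?thesis
    by (auto simp: configs_def)
qed

lemma subalgebra_past: "subalgebra config_space (past t)"
proof -
  let ?X = "{{\<omega> \<in> configs. emeasure \<omega> (S \<times> B) \<in> E} |S B E.
        S \<in> sets borel \<and> S \<subseteq> {..t} \<and> B \<in> sets borel \<and> B \<subseteq> {0..} \<and> E \<in> sets borel}"
  let ?Y = "{{\<omega> \<in> configs. emeasure \<omega> B \<in> E} |B E. B \<in> sets half_plane \<and> E \<in> sets borel}"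
  have prod: "S \<times> B \<in> sets half_plane"
    if "S \<in> sets borel" "B \<in> sets borel" "B \<subseteq> {0..}" for S B :: "real set"
  proof -
    have "S \<times> B \<in> sets (borel \<Otimes>\<^sub>M borel)"
      using that by (intro pair_measureI)
    then have "S \<times> B \<in> sets borel"
      unfolding borel_prod .
    then show ?thesis
      using that by (auto simp: sets_half_plane_iff)
  qed
  have "?X \<subseteq> ?Y"
    using prod by blast
  then have "sigma_sets configs ?X \<subseteq> sigma_sets configs ?Y"
    by (rule sigma_sets_mono')
  moreover have "?X \<subseteq> Pow configs" "?Y \<subseteq> Pow configs"
    by auto
  ultimately show ?thesis
    unfolding subalgebra_def past_def config_space_def
    by (simp only: space_measure_of sets_measure_of)
qed


section \<open>The linear Hawkes intensity\<close>

definition predictable_sigma :: "real \<Rightarrow> (real \<times> config) measure" where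
  "predictable_sigma T = sigma ({0..T} \<times> configs)
     ({{0} \<times> A |A. A \<in> sets (past 0)} \<union>
      {{s<..t} \<times> A |s t A. 0 \<le> s \<and> s < t \<and> t \<le> T \<and> A \<in> sets (past s)})"

text \<open>The Hawkes equation with empty history along one configuration. It is an identity in
  \<open>[0,\<infinity>]\<close>, so for real-valued \<open>lam\<close> it includes the finiteness of the integral. It also forces
  \<open>lam \<ge> \<mu>\<close> if \<open>\<mu> > 0\<close>.\<close>

definition hawkes_equation ::
  "real \<Rightarrow> (real \<Rightarrow> real) \<Rightarrow> real \<Rightarrow> (real \<Rightarrow> config \<Rightarrow> real) \<Rightarrow> config \<Rightarrow> bool" where
  "hawkes_equation \<mu> \<phi> T lam \<omega> \<longleftrightarrow>
     (\<forall>t\<in>{0..T}. ennreal (lam t \<omega>) = ennreal \<mu> +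
        (\<integral>\<^sup>+(s, \<theta>)\<in>{0<..<t} \<times> {0..}. ennreal (\<phi> (t - s) * of_bool (\<theta> \<le> lam s \<omega>)) \<partial>\<omega>))"

text \<open>The predictable solution. Exceptional configurations cannot be avoided, since on a
  \<open>P\<close>-null set the solution explodes. However, the law of
  \<open>add_point (u, 0) \<omega>\<close> is singular to \<open>P\<close>, so a version of \<open>lam\<close> that solves the equation merely
  \<open>P\<close>-almost surely would leave \<open>lam\<^bsub>s\<^esub> \<circ> \<epsilon>\<^sup>+\<^bsub>(u,0)\<^esub>\<close> completely arbitrary. As usual, \<open>lam\<close> is
  understood pathwise as a functional of the driving configuration: the equation also holds along
  almost every configuration to which a point \<open>(u, 0)\<close> has been added.\<close>

definition hawkes_intensity ::
  "config measure \<Rightarrow> real \<Rightarrow> (real \<Rightarrow> real) \<Rightarrow> real \<Rightarrow> (real \<Rightarrow> config \<Rightarrow> real) \<Rightarrow> bool" where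
  "hawkes_intensity P \<mu> \<phi> T lam \<longleftrightarrow>
     (\<lambda>(t, \<omega>). lam t \<omega>) \<in> borel_measurable (predictable_sigma T) \<and>
     (AE \<omega> in P. hawkes_equation \<mu> \<phi> T lam \<omega>) \<and>
     (\<forall>u\<in>{0..T}. AE \<omega> in P. hawkes_equation \<mu> \<phi> T lam (add_point (u, 0) \<omega>))"

definition normalized_martingale :: "real \<Rightarrow> (real \<Rightarrow> config \<Rightarrow> real) \<Rightarrow> config \<Rightarrow> real" where
  "normalized_martingale T lam \<omega> =
     (LINT (t, \<theta>):{0..T} \<times> {0..}|\<omega>. of_bool (\<theta> \<le> lam t \<omega>) / sqrt (T * lam t \<omega>)) -
     (LINT (t, \<theta>):{0..T} \<times> {0..}|half_plane. of_bool (\<theta> \<le> lam t \<omega>) / sqrt (T * lam t \<omega>))"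

text \<open>\<open>E t s\<close> is a version of \<open>\<bbbE>\<^sub>t[X t s]\<close> for all \<open>0 \<le> t \<le> s \<le> T\<close>. Conditional expectations are only
  determined up to null sets depending on \<open>(t, s)\<close>; joint measurability of the version is what gives a
  meaning to integrals over \<open>s\<close> and \<open>t\<close>.\<close>

definition cond_exp_version ::
  "config measure \<Rightarrow> real \<Rightarrow> (real \<Rightarrow> real \<Rightarrow> config \<Rightarrow> real) \<Rightarrow> (real \<Rightarrow> real \<Rightarrow> config \<Rightarrow> real) \<Rightarrow> bool"
where
  "cond_exp_version P T X E \<longleftrightarrow>
     (\<lambda>(t, s, \<omega>). E t s \<omega>) \<in> borel_measurable (borel \<Otimes>\<^sub>M borel \<Otimes>\<^sub>M P) \<and>
     (\<forall>t s. 0 \<le> t \<and> t \<le> s \<and> s \<le> T \<longrightarrow>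
        (AE \<omega> in P. E t s \<omega> = real_cond_exp P (past t) (X t s) \<omega>))"


section \<open>Wasserstein distance\<close>

definition wasserstein ::
  "'a measure \<Rightarrow> ('a \<Rightarrow> real) \<Rightarrow> 'b measure \<Rightarrow> ('b \<Rightarrow> real) \<Rightarrow> ennreal" where
  "wasserstein P F Q G =
     (SUP u\<in>{u :: real \<Rightarrow> real. 1-lipschitz_on UNIV u}.
        ennreal \<bar>(\<integral>x. u (F x) \<partial>P) - (\<integral>y. u (G y) \<partial>Q)\<bar>)"

end

theory Submission
  imports Defs
begin

text \<open>The left hand side is at most \<open>2\<close>, because \<open>F\<^sup>T\<close> and \<open>G\<close> have second moment \<open>1\<close> (for \<open>F\<^sup>T\<close> by the
  isometry of compensated Poisson integrals). The last term on the right hand side is bounded below by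
  a positive constant for large \<open>T\<close>; for small \<open>T\<close> the term \<open>C / \<surd>T\<close> suffices.

  For the lower bound let \<open>\<lambda>'\<close> be the intensity after the point \<open>(u, 0)\<close> has been added. Then
  \<open>D = \<lambda>' - \<lambda> \<ge> 0\<close> solves the linear Volterra equation driven by \<open>k (\<cdot> - u)\<close> and by the points in the band
  \<open>\<lambda> < \<theta> \<le> \<lambda>'\<close>. Convolving with the resolvent \<open>\<psi>\<close> of \<open>k = \<phi>\<^sup>T\<close> turns \<open>D\<close>, and every smaller functional
  \<open>D\<^sup>~\<close> in which one step of \<open>k\<close> is replaced by a truncation \<open>\<kappa>\<close> of \<open>k\<close> to a bounded interval, into a deterministic
  part plus a compensated integral. With \<open>\<eta>\<close> of order \<open>T\<close>, the inequality
  \<open>1 - \<lambda> / \<lambda>' = D / \<lambda>' \<ge> (2 D\<^sup>~ - D\<^sup>~ \<lambda>' / \<eta>) / \<eta>\<close> reduces the expectation of the sensitivity, weighted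
  by \<open>W = min (\<surd>\<lambda>\<^sub>u) (\<surd>T)\<close>, to first and second moments of such integrals. The truncation is needed since \<open>\<phi>\<close> is only
  locally bounded: the response to \<open>\<kappa>\<close> is bounded uniformly in \<open>T\<close>, the resolvent need not be.
  The first moment \<open>m\<close> of \<open>\<phi>\<close> enters through the renewal estimate \<open>\<integral>\<^sub>0\<^sup>S \<psi> \<ge> c S\<close>. Finally the conditional Jensen
  and the Cauchy-Schwarz inequality lead from \<open>1 - \<lambda> / \<lambda>'\<close> to the square roots in the statement.\<close>

section \<open>Predictable integrands\<close>

text \<open>The scaling decides everything. Since \<open>1 - a T = 1 / T\<close>, the resolvent of
  \<open>k\<close> has mass less than \<open>T\<close> and the mean intensity is at most
  \<open>\<mu> * T\<close>. An added point raises the intensity by an amount of order one in mean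
  over a time of order \<open>T\<close>, so the relative increase is of order \<open>1 / T\<close>
  at each time and of order one after integration over \<open>s\<close>. The weight, of order
  \<open>sqrt T\<close>, pays for the \<open>sqrt T\<close> lost in Cauchy-Schwarz, and
  \<open>t\<close> in \<open>{T / 4..T / 2}\<close> supplies the factor \<open>T\<close> that the
  prefactor \<open>C / T\<close> removes. Two obstacles shape the proof. The equation does not say
  that only finitely many points are accepted: non-explosion and a finite second moment must be
  derived before any variance can be computed, so the moment identities are first stated in
  \<open>[0, \<infinity>]\<close> without subtraction. And the bound \<open>B\<close> of
  \<open>k\<close> may grow with \<open>T\<close>: it serves finiteness only, while the constants of
  the final estimate come from \<open>\<mu>\<close>, \<open>m\<close>, a median \<open>A\<close> of
  \<open>\<phi>\<close> and a bound of \<open>\<phi>\<close> up to \<open>A\<close>.\<close>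

definition predictable_gen :: "(real \<times> config) set set" where
  "predictable_gen = {S \<times> configs |S. S \<in> sets borel \<and> S \<subseteq> {..0}} \<union>
     {{s<..t} \<times> A |s t A. 0 \<le> s \<and> A \<in> sets (past s)}"

text \<open>The time axis is all of \<open>\<real>\<close>, which keeps integrands total; nothing happens up to time \<open>0\<close>.\<close>

definition predictable :: "(real \<times> config) measure" where
  "predictable = sigma (UNIV \<times> configs) predictable_gen"

definition marked :: "((real \<times> config) \<times> real) measure" where
  "marked = predictable \<Otimes>\<^sub>M borel"

text \<open>The configuration travels with the point: integrating \<open>h (mark w z)\<close> over
  \<open>z\<close> against \<open>w\<close> evaluates a random integrand along the very
  configuration that it is integrated against.\<close>

definition mark :: "config \<Rightarrow> real \<times> real \<Rightarrow> (real \<times> config) \<times> real" where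
  "mark w z = ((fst z, w), snd z)"

lemma mark_simps [simp]: "fst (fst (mark w z)) = fst z" "snd (fst (mark w z)) = w" "snd (mark w z) = snd z"
  by (auto simp: mark_def)

lemma space_past: "space (past t) = configs"
  unfolding past_def by (rule space_measure_of) auto

lemma space_config_space: "space config_space = configs"
  unfolding config_space_def by (rule space_measure_of) auto

lemma sets_past: "sets (past t) = sigma_sets configs {{w \<in> configs. emeasure w (S \<times> B) \<in> E} |S B E.
        S \<in> sets borel \<and> S \<subseteq> {..t} \<and> B \<in> sets borel \<and> B \<subseteq> {0..} \<and> E \<in> sets borel}"
  unfolding past_def by (intro sets_measure_of) auto

lemma past_subset_configs: "A \<in> sets (past t) \<Longrightarrow> A \<subseteq> configs"
  using sets.sets_into_space space_past by blast

lemma past_mono: "s \<le> t \<Longrightarrow> sets (past s) \<subseteq> sets (past t)"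
  unfolding sets_past by (intro sigma_sets_mono') (blast intro: order_trans)

lemma past_config: "A \<in> sets (past t) \<Longrightarrow> A \<in> sets config_space"
  using subalgebra_past[of t] by (auto simp: subalgebra_def)

lemma measurable_past_config: "X \<in> borel_measurable (past t) \<Longrightarrow> X \<in> borel_measurable config_space"
  using measurable_from_subalg[OF subalgebra_past] .

lemma measurable_emeasure_past:
  assumes "S \<in> sets borel" "S \<subseteq> {..t}" "B \<in> sets borel" "B \<subseteq> {0..}"
  shows "(\<lambda>w. emeasure w (S \<times> B)) \<in> borel_measurable (past t)"
proof (rule measurableI)
  fix E :: "ennreal set" assume "E \<in> sets borel"
  then have "{w \<in> configs. emeasure w (S \<times> B) \<in> E} \<in> sets (past t)"
    unfolding sets_past using assms by (intro sigma_sets.Basic) blast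
  then show "(\<lambda>w. emeasure w (S \<times> B)) -` E \<inter> space (past t) \<in> sets (past t)"
    by (simp add: space_past vimage_def Int_def conj_commute)
qed auto

lemma measurable_emeasure_config:
  assumes "B \<in> sets half_plane"
  shows "(\<lambda>w. emeasure w B) \<in> borel_measurable config_space"
proof (rule measurableI)
  fix E :: "ennreal set" assume "E \<in> sets borel"
  then have "{w \<in> configs. emeasure w B \<in> E} \<in> sets config_space"
    unfolding config_space_def using assms by (subst sets_measure_of) auto
  then show "(\<lambda>w. emeasure w B) -` E \<inter> space config_space \<in> sets config_space"
    by (simp add: space_config_space vimage_def Int_def conj_commute)
qed auto

lemma sets_config: "w \<in> configs \<Longrightarrow> sets w = sets half_plane"
  by (simp add: configs_def)

lemma space_config: "w \<in> configs \<Longrightarrow> space w = UNIV \<times> {0..}"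
  using sets_config sets_eq_imp_space_eq space_half_plane by metis

lemma Times_half_plane:
  "S \<in> sets borel \<Longrightarrow> B \<in> sets borel \<Longrightarrow> B \<subseteq> {0..} \<Longrightarrow> S \<times> B \<in> sets half_plane"
  for S B :: "real set"
proof -
  assume a: "S \<in> sets borel" "B \<in> sets borel" "B \<subseteq> {0..}"
  have "S \<times> B \<in> sets (borel \<Otimes>\<^sub>M borel)" using a by (intro pair_measureI)
  then have "S \<times> B \<in> sets borel" unfolding borel_prod .
  then show ?thesis using a by (auto simp: sets_half_plane_iff)
qed

lemma fst_half_plane [measurable]: "fst \<in> borel_measurable half_plane"
  and snd_half_plane [measurable]: "snd \<in> borel_measurable half_plane"
  unfolding half_plane_def by (auto intro!: measurable_restrict_space1 borel_measurable_continuous_onI continuous_intros)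

lemma sets_predictable: "sets predictable = sigma_sets (UNIV \<times> configs) predictable_gen"
  and space_predictable: "space predictable = UNIV \<times> configs"
proof -
  have "predictable_gen \<subseteq> Pow (UNIV \<times> configs)"
    using past_subset_configs by (fastforce simp: predictable_gen_def)
  then show "sets predictable = sigma_sets (UNIV \<times> configs) predictable_gen"
    "space predictable = UNIV \<times> configs"
    by (auto simp: predictable_def sets_measure_of)
qed

lemma predictable_gen_closed: "predictable_gen \<subseteq> Pow (UNIV \<times> configs)"
  using past_subset_configs by (fastforce simp: predictable_gen_def)

lemma predictable_genE:
  assumes "y \<in> predictable_gen"
  obtains S where "y = S \<times> configs" "S \<in> sets borel" "S \<subseteq> {..0}"
  | s t A where "y = {s<..t} \<times> A" "0 \<le> s" "A \<in> sets (past s)"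
  using assms unfolding predictable_gen_def by blast

lemma predictable_gen_rect: "0 \<le> s \<Longrightarrow> A \<in> sets (past s) \<Longrightarrow> {s<..t} \<times> A \<in> predictable_gen"
  by (auto simp: predictable_gen_def)

lemma predictable_rect: "0 \<le> s \<Longrightarrow> A \<in> sets (past s) \<Longrightarrow> {s<..t} \<times> A \<in> sets predictable"
  unfolding sets_predictable by (intro sigma_sets.Basic predictable_gen_rect)

lemma predictable_rect_greaterThan:
  assumes "0 \<le> s" "A \<in> sets (past s)" shows "{s<..} \<times> A \<in> sets predictable"
proof -
  have "{s<..} \<times> A = (\<Union>n::nat. {s<..real n} \<times> A)"
    by (auto intro: real_arch_simple)
  then show ?thesis using predictable_rect[OF assms] by auto
qed

lemma space_marked: "space marked = (UNIV \<times> configs) \<times> UNIV"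
  by (simp add: marked_def space_pair_measure space_predictable)

text \<open>Products of generators suffice because \<open>predictable_gen\<close> contains a
  countable cover of the space. They form the pi-system on which the later Dynkin arguments
  start.\<close>

lemma sets_marked: "sets marked = sigma_sets (space marked) {R \<times> B |R B. R \<in> predictable_gen \<and> B \<in> sets (borel :: real measure)}"
proof -
  have "sets marked = sets (sigma (space predictable \<times> space (borel :: real measure)) {R \<times> B |R B. R \<in> predictable_gen \<and> B \<in> sets borel})"
    unfolding marked_def
  proof (rule sets_pair_eq)
    show "predictable_gen \<subseteq> Pow (space predictable)"
      using predictable_gen_closed by (simp add: space_predictable)
    show "sets predictable = sigma_sets (space predictable) predictable_gen"
      by (simp add: sets_predictable space_predictable)
    let ?C = "insert ({..0} \<times> configs) ((\<lambda>n::nat. {0<..real n} \<times> configs) ` UNIV)"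
    show "countable ?C" by auto
    have "configs \<in> sets (past 0)" using sets.top[of "past 0"] by (simp add: space_past)
    then show "?C \<subseteq> predictable_gen" by (auto simp: predictable_gen_def)
    show "\<Union>?C = space predictable"
    proof -
      have "p \<in> \<Union>?C" if p: "snd p \<in> configs" for p :: "real \<times> config"
      proof -
        obtain n :: nat where "fst p \<le> real n" using real_arch_simple by blast
        then have "p \<in> {0<..real n} \<times> configs \<or> p \<in> {..0} \<times> configs"
          using p by (cases p) auto
        then show ?thesis by blast
      qed
      moreover have "\<Union>?C \<subseteq> UNIV \<times> configs" by auto
      ultimately show ?thesis unfolding space_predictable by (intro equalityI) (assumption, force)
    qed
    show "sets (borel::real measure) = sigma_sets (space borel) (sets borel)"
      by (rule sets.sigma_sets_eq[symmetric])
    show "countable {UNIV :: real set}" "{UNIV} \<subseteq> sets (borel :: real measure)" "\<Union>{UNIV} = space (borel :: real measure)" by auto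
  qed auto
  then show ?thesis
    using predictable_gen_closed by (subst (asm) sets_measure_of) (auto simp: space_marked space_predictable)
qed

lemma Int_stable_marked: "Int_stable {R \<times> B |R B. R \<in> predictable_gen \<and> B \<in> sets (borel :: real measure)}"
proof -
  have *: "R \<inter> R' \<in> predictable_gen" if R: "R \<in> predictable_gen" "R' \<in> predictable_gen" for R R'
  proof -
    have e: "{} \<in> predictable_gen"
      using predictable_gen_rect[of 0 "{}" 0] by auto
    have r: "({s<..t} \<times> A) \<inter> ({s'<..t'} \<times> A') \<in> predictable_gen"
      if "0 \<le> s" "A \<in> sets (past s)" "0 \<le> s'" "A' \<in> sets (past s')" for s t A s' t' A'
    proof -
      have "A \<inter> A' \<in> sets (past (max s s'))"
        using that past_mono[of s "max s s'"] past_mono[of s' "max s s'"] by auto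
      moreover have "({s<..t} \<times> A) \<inter> ({s'<..t'} \<times> A') = {max s s'<..min t t'} \<times> (A \<inter> A')" by auto
      ultimately show ?thesis using predictable_gen_rect[of "max s s'"] that by auto
    qed
    have e1: "(S \<times> configs) \<inter> ({s<..t} \<times> A) = {}" "({s<..t} \<times> A) \<inter> (S \<times> configs) = {}"
      if "0 \<le> s" "S \<subseteq> {..0}" for s t A and S :: "real set"
      using that by auto
    have b: "(S \<times> configs) \<inter> (S' \<times> configs) \<in> predictable_gen"
      if "S \<in> sets borel" "S' \<in> sets borel" "S \<subseteq> {..0}" for S S'
    proof -
      have "(S \<times> configs) \<inter> (S' \<times> configs) = (S \<inter> S') \<times> configs" by auto
      moreover have "S \<inter> S' \<in> sets borel" "S \<inter> S' \<subseteq> {..0}" using that by auto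
      ultimately show ?thesis unfolding predictable_gen_def by blast
    qed
    have c: "(\<exists>S. X = S \<times> configs \<and> S \<in> sets borel \<and> S \<subseteq> {..0}) \<or>
       (\<exists>s t A. X = {s<..t} \<times> A \<and> 0 \<le> s \<and> A \<in> sets (past s))" if "X \<in> predictable_gen" for X
      using that unfolding predictable_gen_def by blast
    show ?thesis
      using c[OF R(1)] c[OF R(2)]
    proof (elim disjE exE conjE, goal_cases)
      case 1 then show ?case using b by simp
    next
      case 2 then show ?case using e1 e by simp
    next
      case 3 then show ?case using e1 e by simp
    next
      case 4 then show ?case using r by simp
    qed
  qed
  show ?thesis
  proof (rule Int_stableI)
    fix a b :: "((real \<times> config) \<times> real) set"
    assume "a \<in> {R \<times> B |R B. R \<in> predictable_gen \<and> B \<in> sets borel}" "b \<in> {R \<times> B |R B. R \<in> predictable_gen \<and> B \<in> sets borel}"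
    then obtain R B R' B' where ab: "a = R \<times> B" "b = R' \<times> B'" "R \<in> predictable_gen" "R' \<in> predictable_gen"
      "B \<in> sets borel" "B' \<in> sets borel" by auto
    have "a \<inter> b = (R \<inter> R') \<times> (B \<inter> B')" using ab by auto
    moreover have "R \<inter> R' \<in> predictable_gen" "B \<inter> B' \<in> sets borel" using * ab by auto
    ultimately show "a \<inter> b \<in> {R \<times> B |R B. R \<in> predictable_gen \<and> B \<in> sets borel}" by blast
  qed
qed

lemma measurable_section_predictable:
  assumes "w \<in> configs" shows "(\<lambda>t. (t, w)) \<in> measurable borel predictable"
  unfolding predictable_def
proof (rule measurable_measure_of)
  show "predictable_gen \<subseteq> Pow (UNIV \<times> configs)" by (rule predictable_gen_closed)
  show "(\<lambda>t. (t, w)) \<in> space borel \<rightarrow> UNIV \<times> configs" using assms by auto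
  fix y assume "y \<in> predictable_gen"
  then show "(\<lambda>t. (t, w)) -` y \<inter> space borel \<in> sets borel"
  proof (cases rule: predictable_genE)
    case (1 S)
    moreover from this have "(\<lambda>t. (t, w)) -` y = S" using assms by auto
    ultimately show ?thesis by simp
  next
    case (2 s t A)
    then have "(\<lambda>t. (t, w)) -` y = (if w \<in> A then {s<..t} else {})" by auto
    then show ?thesis by simp
  qed
qed

lemma measurable_mark [measurable (raw)]:
  assumes "w \<in> configs" shows "mark w \<in> measurable half_plane marked"
proof -
  have 1: "(\<lambda>z. (fst z, w)) \<in> measurable half_plane predictable"
    by (rule measurable_compose[OF fst_half_plane measurable_section_predictable[OF assms]])
  have "(\<lambda>z. ((fst z, w), snd z)) \<in> measurable half_plane marked"
    unfolding marked_def by (rule measurable_Pair[OF 1 snd_half_plane])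
  then show ?thesis by (simp add: mark_def[abs_def])
qed

lemma measurable_const_time:
  "(\<lambda>w. (t, w)) \<in> measurable config_space predictable"
  unfolding predictable_def
proof (rule measurable_measure_of)
  show "predictable_gen \<subseteq> Pow (UNIV \<times> configs)" by (rule predictable_gen_closed)
  show "(\<lambda>w. (t, w)) \<in> space config_space \<rightarrow> UNIV \<times> configs" by (auto simp: space_config_space)
  fix y assume "y \<in> predictable_gen"
  then show "(\<lambda>w. (t, w)) -` y \<inter> space config_space \<in> sets config_space"
  proof (cases rule: predictable_genE)
    case (1 S)
    then have "(\<lambda>w. (t, w)) -` y \<inter> space config_space = (if t \<in> S then space config_space else {})"
      by (auto simp: space_config_space)
    then show ?thesis by simp
  next
    case (2 s t' A)
    note y = 2(1) and A = 2(3)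
    have "(\<lambda>w. (t, w)) -` y \<inter> space config_space = (if s < t \<and> t \<le> t' then A else {})"
      using y past_subset_configs[OF A] by (auto simp: space_config_space)
    then show ?thesis using past_config[OF A] by simp
  qed
qed

lemma measurable_const_time_past:
  assumes "0 \<le> t"
  shows "(\<lambda>w. (t, w)) \<in> measurable (past t) predictable"
  unfolding predictable_def
proof (rule measurable_measure_of)
  show "predictable_gen \<subseteq> Pow (UNIV \<times> configs)" by (rule predictable_gen_closed)
  show "(\<lambda>w. (t, w)) \<in> space (past t) \<rightarrow> UNIV \<times> configs" by (auto simp: space_past)
  fix y assume "y \<in> predictable_gen"
  then show "(\<lambda>w. (t, w)) -` y \<inter> space (past t) \<in> sets (past t)"
  proof (cases rule: predictable_genE)
    case (1 S)
    then have "(\<lambda>w. (t, w)) -` y \<inter> space (past t) = (if t \<in> S then space (past t) else {})"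
      by (auto simp: space_past)
    then show ?thesis by simp
  next
    case (2 s t' A)
    note y = 2(1) and A = 2(3)
    have "(\<lambda>w. (t, w)) -` y \<inter> space (past t) = (if s < t \<and> t \<le> t' then A else {})"
      using y past_subset_configs[OF A] by (auto simp: space_past)
    then show ?thesis using past_mono[of s t] A by auto
  qed
qed

text \<open>The elementary predictable integrand: a variable known at time \<open>q\<close>,
  switched on strictly after \<open>q\<close>. On that part of the space the preimages of events in
  \<open>past q\<close> are rectangles.\<close>

lemma measurable_predictable_adapted:
  assumes X: "X \<in> borel_measurable (past q)" and q: "0 \<le> q"
  shows "(\<lambda>(s, w). indicator {q<..} s * X w :: ennreal) \<in> borel_measurable predictable"
proof -
  have s: "({q<..} \<times> configs) \<inter> space predictable = {q<..} \<times> configs" by (auto simp: space_predictable)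
  have m: "{q<..} \<times> configs \<in> sets predictable"
    using predictable_rect_greaterThan[OF q, of configs] sets.top[of "past q"] by (simp add: space_past)
  have "snd \<in> measurable (restrict_space predictable ({q<..} \<times> configs)) (past q)"
    unfolding past_def
  proof (rule measurable_measure_of, goal_cases)
    case 2 then show ?case by (auto simp: space_restrict_space space_predictable)
  next
    case (3 y)
    then have y: "y \<in> sets (past q)" unfolding sets_past by (rule sigma_sets.Basic)
    have "snd -` y \<inter> space (restrict_space predictable ({q<..} \<times> configs)) = {q<..} \<times> y"
      using past_subset_configs[OF y] by (auto simp: space_restrict_space space_predictable)
    moreover have "{q<..} \<times> y \<in> sets predictable" by (rule predictable_rect_greaterThan[OF q y])
    ultimately show ?case
      using past_subset_configs[OF y] by (subst sets_restrict_space_iff) (auto simp: s m)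
  qed auto
  from measurable_compose[OF this X]
  have "(\<lambda>p. X (snd p)) \<in> borel_measurable (restrict_space predictable ({q<..} \<times> configs))" .
  then have "(\<lambda>p. X (snd p) * indicator ({q<..} \<times> configs) p) \<in> borel_measurable predictable"
    by (subst (asm) borel_measurable_restrict_space_iff_ennreal) (auto simp: s m)
  then show ?thesis
    by (rule measurable_cong[THEN iffD1, rotated]) (auto simp: space_predictable indicator_def)
qed

lemma borel_measurable_fst_predictable [measurable]: "fst \<in> borel_measurable predictable"
proof (rule measurableI)
  fix E :: "real set" assume E: "E \<in> sets borel"
  have c: "configs \<in> sets (past s)" for s using sets.top[of "past s"] by (simp add: space_past)
  have pos: "(E \<inter> {0<..}) \<times> configs \<in> sets predictable"
    using E
  proof (induction E rule: borel_set_induct)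
    case empty then show ?case by simp
  next
    case (interval a b)
    \<comment> \<open>Closed intervals are limits of left-open ones; \<open>max 0\<close> keeps the
      left end point in the range that the generators allow.\<close>
    have "({a..b} \<inter> {0<..}) \<times> configs = (if 0 < a then (\<Inter>n::nat. {max 0 (a - 1 / Suc n)<..b} \<times> configs) else {0<..b} \<times> configs)"
    proof (cases "0 < a")
      case True
      have "a \<le> x" if x: "\<And>n::nat. max 0 (a - 1 / Suc n) < x" for x
      proof (rule ccontr)
        assume "\<not> a \<le> x"
        then obtain n :: nat where "1 / Suc n < a - x" using nat_approx_posE[of "a - x"] by auto
        then show False using x[of n] by auto
      qed
      moreover have "max 0 (a - 1 / Suc n) < x" if "a \<le> x" for x and n :: nat
        using that True by (auto simp: max_def intro: less_le_trans[of _ a])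
      ultimately show ?thesis using True by (auto 4 3)
    qed auto
    then show ?case using predictable_rect[OF _ c] by auto
  next
    case (compl A)
    have "(- A \<inter> {0<..}) \<times> configs = ({0<..} \<times> configs) - ((A \<inter> {0<..}) \<times> configs)" by auto
    then show ?case using compl predictable_rect_greaterThan[OF order_refl c] by auto
  next
    case (union f)
    have "((\<Union>i. f i) \<inter> {0<..}) \<times> configs = (\<Union>i. (f i \<inter> {0<..}) \<times> configs)" by auto
    then show ?case using union by auto
  qed
  have "(E \<inter> {..0}) \<times> configs \<in> sets predictable"
    unfolding sets_predictable
  proof (rule sigma_sets.Basic)
    have "E \<inter> {..0} \<in> sets borel" "E \<inter> {..0} \<subseteq> {..0}" using E by auto
    then show "(E \<inter> {..0}) \<times> configs \<in> predictable_gen" unfolding predictable_gen_def by blast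
  qed
  with pos have "((E \<inter> {0<..}) \<times> configs) \<union> ((E \<inter> {..0}) \<times> configs) \<in> sets predictable" by auto
  moreover have "fst -` E \<inter> space predictable = ((E \<inter> {0<..}) \<times> configs) \<union> ((E \<inter> {..0}) \<times> configs)"
    by (auto simp: space_predictable)
  ultimately show "fst -` E \<inter> space predictable \<in> sets predictable" by simp
qed auto

text \<open>Instantiated below with the configuration itself and with its intensity.\<close>

definition adapted_kernel :: "(config \<Rightarrow> config) \<Rightarrow> bool" where
  "adapted_kernel \<kappa> \<longleftrightarrow>
    (\<forall>w\<in>configs. sets (\<kappa> w) = sets half_plane \<and>
       (\<forall>B\<in>sets half_plane. bounded B \<longrightarrow> emeasure (\<kappa> w) B < \<infinity>)) \<and>
    (\<forall>a q B. B \<in> sets borel \<and> B \<subseteq> {0..} \<longrightarrow>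
       (\<lambda>w. emeasure (\<kappa> w) ({a<..q} \<times> B)) \<in> borel_measurable (past q))"

lemma adapted_kernel_config: "adapted_kernel (\<lambda>w. w)"
  unfolding adapted_kernel_def
proof (intro conjI ballI allI impI)
  fix w :: config and B assume "w \<in> configs" "B \<in> sets half_plane" "bounded B"
  then have "emeasure w B \<in> \<nat>" by (simp add: configs_def)
  then show "emeasure w B < \<infinity>" by (auto elim!: Nats_cases simp: of_nat_less_top)
next
  fix a q :: real and B :: "real set" assume "B \<in> sets borel \<and> B \<subseteq> {0..}"
  then show "(\<lambda>w. emeasure w ({a<..q} \<times> B)) \<in> borel_measurable (past q)"
    by (intro measurable_emeasure_past) auto
qed (simp add: sets_config)

lemma emeasure_half_plane: "A \<in> sets half_plane \<Longrightarrow> emeasure half_plane A = emeasure lborel A"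
proof -
  have "UNIV \<times> {0..} \<in> sets (borel :: (real \<times> real) measure)"
    by (intro borel_closed closed_Times) auto
  then show "A \<in> sets half_plane \<Longrightarrow> emeasure half_plane A = emeasure lborel A"
    unfolding half_plane_def by (intro emeasure_restrict_space) (auto simp: sets_half_plane_iff half_plane_def[symmetric])
qed

lemma adapted_kernel_half_plane: "adapted_kernel (\<lambda>_. half_plane)"
  unfolding adapted_kernel_def
proof (intro conjI ballI allI impI)
  fix B :: "(real \<times> real) set" assume "B \<in> sets half_plane" "bounded B"
  then show "emeasure half_plane B < \<infinity>"
    unfolding emeasure_half_plane[OF \<open>B \<in> sets half_plane\<close>] by (intro emeasure_bounded_finite)
qed auto

lemma bounded_strip: "B \<subseteq> {0..real n} \<Longrightarrow> bounded ({a<..b::real} \<times> B)"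
  by (rule bounded_subset[OF bounded_Times[OF compact_imp_bounded[OF compact_Icc[of a b]] compact_imp_bounded[OF compact_Icc[of 0 "real n"]]]]) auto

lemma sigma_finite_locally_finite:
  assumes "sets \<nu> = sets half_plane" and fin: "\<And>B. B \<in> sets half_plane \<Longrightarrow> bounded B \<Longrightarrow> emeasure \<nu> B < \<infinity>"
  shows "sigma_finite_measure \<nu>"
proof
  let ?A = "(\<lambda>n::nat. {- real n - 1<..real n} \<times> {0..real n}) ` UNIV"
  have m: "{- real n - 1<..real n} \<times> {0..real n} \<in> sets half_plane" for n
    by (rule Times_half_plane) auto
  have sp: "space \<nu> = UNIV \<times> {0..}"
    using sets_eq_imp_space_eq[OF assms(1)] space_half_plane by simp
  show "\<exists>A. countable A \<and> A \<subseteq> sets \<nu> \<and> \<Union>A = space \<nu> \<and> (\<forall>a\<in>A. emeasure \<nu> a \<noteq> \<infinity>)"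
  proof (intro exI[of _ ?A] conjI ballI)
    show "?A \<subseteq> sets \<nu>" using m assms by auto
    show "\<Union>?A = space \<nu>"
    proof (intro equalityI subsetI)
      fix z assume z: "z \<in> space \<nu>"
      obtain n :: nat where "\<bar>fst z\<bar> + \<bar>snd z\<bar> \<le> real n" using real_arch_simple by blast
      then have "z \<in> {- real n - 1<..real n} \<times> {0..real n}" using z sp by (cases z) auto
      then show "z \<in> \<Union>?A" by blast
    qed (auto simp: sp)
    show "emeasure \<nu> a \<noteq> \<infinity>" if "a \<in> ?A" for a
    proof -
      from that obtain n :: nat where "a = {- real n - 1<..real n} \<times> {0..real n}" by (rule imageE)
      then show ?thesis using fin[OF m bounded_strip[OF order_refl], of n] by (simp add: less_top)
    qed
  qed auto
qed

lemma adapted_kernelD: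
  assumes "adapted_kernel \<kappa>" "w \<in> configs"
  shows "sets (\<kappa> w) = sets half_plane" "space (\<kappa> w) = UNIV \<times> {0..}" "sigma_finite_measure (\<kappa> w)"
    "\<And>B. B \<in> sets half_plane \<Longrightarrow> bounded B \<Longrightarrow> emeasure (\<kappa> w) B < \<infinity>"
proof -
  show 1: "sets (\<kappa> w) = sets half_plane" and 2: "\<And>B. B \<in> sets half_plane \<Longrightarrow> bounded B \<Longrightarrow> emeasure (\<kappa> w) B < \<infinity>"
    using assms by (auto simp: adapted_kernel_def)
  show "space (\<kappa> w) = UNIV \<times> {0..}" using sets_eq_imp_space_eq[OF 1] space_half_plane by simp
  show "sigma_finite_measure (\<kappa> w)" by (rule sigma_finite_locally_finite[OF 1 2])
qed

text \<open>The limits on time and mark make the section bounded, hence of finite measure under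
  every locally finite kernel; otherwise the complement step of the Dynkin arguments would subtract
  infinities. The strict inequality at \<open>s\<close> is what makes the measure predictable in
  \<open>s\<close>.\<close>

definition cut :: "((real \<times> config) \<times> real) set \<Rightarrow> nat \<Rightarrow> real \<Rightarrow> config \<Rightarrow> (real \<times> real) set" where
  "cut G n s w = {z \<in> space half_plane. mark w z \<in> G \<and> 0 < fst z \<and> fst z < s \<and> snd z \<le> real n}"

lemma cut_sets:
  assumes "G \<in> sets marked" "w \<in> configs" shows "cut G n s w \<in> sets half_plane"
proof -
  have "mark w -` G \<inter> space half_plane \<in> sets half_plane"
    by (rule measurable_sets[OF measurable_mark[OF assms(2)] assms(1)])
  moreover have "{z \<in> space half_plane. 0 < fst z \<and> fst z < s \<and> snd z \<le> real n} \<in> sets half_plane"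
    by measurable
  moreover have "cut G n s w = (mark w -` G \<inter> space half_plane) \<inter> {z \<in> space half_plane. 0 < fst z \<and> fst z < s \<and> snd z \<le> real n}"
    by (auto simp: cut_def)
  ultimately show ?thesis by auto
qed

lemma cut_bounded: "bounded (cut G n s w)"
  by (rule bounded_subset[OF bounded_Times[OF compact_imp_bounded[OF compact_Icc[of 0 s]] compact_imp_bounded[OF compact_Icc[of 0 "real n"]]]])
     (auto simp: cut_def space_half_plane)

text \<open>Left limits in \<open>s\<close>: the measure of the part before \<open>s\<close> is a
  supremum over countably many \<open>q < s\<close> of measures of
  \<open>{a<..q} \<times> B'\<close>, and each of those is known at \<open>q\<close> and switched on
  after \<open>q\<close>.\<close>

lemma cut_rect_predictable:
  assumes \<kappa>: "adapted_kernel \<kappa>" and R: "R \<in> predictable_gen" and B: "B \<in> sets borel"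
  shows "(\<lambda>(s, w). emeasure (\<kappa> w) (cut (R \<times> B) n s w)) \<in> borel_measurable predictable"
  using R
proof (cases rule: predictable_genE)
  case (1 S)
  then have "cut (R \<times> B) n s w = {}" for s w by (auto simp: cut_def mark_def)
  then show ?thesis by simp
next
  case (2 a b A)
  define B' where "B' = B \<inter> {0..real n}"
  have B': "B' \<in> sets borel" "B' \<subseteq> {0..}" "B' \<subseteq> {0..real n}" using B by (auto simp: B'_def)
  \<comment> \<open>\<open>b\<close> joins the rationals because for \<open>s > b\<close> the
    supremum has to be attained at the full interval \<open>{a<..b}\<close>.\<close>
  define Q where "Q = {q \<in> insert b \<rat>. 0 \<le> q \<and> a \<le> q \<and> q \<le> b}"
  have Q: "countable Q"
    by (rule countable_subset[of _ "insert b \<rat>"]) (auto simp: Q_def countable_rat)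
  let ?X = "\<lambda>q w. indicator A w * emeasure (\<kappa> w) ({a<..q} \<times> B')"
  have X: "?X q \<in> borel_measurable (past q)" if "q \<in> Q" for q
  proof -
    have "A \<in> sets (past q)" using 2 past_mono[of a q] that by (auto simp: Q_def)
    moreover have "(\<lambda>w. emeasure (\<kappa> w) ({a<..q} \<times> B')) \<in> borel_measurable (past q)"
      using \<kappa> B' by (auto simp: adapted_kernel_def)
    ultimately show ?thesis by simp
  qed
  have "(\<lambda>(s, w). SUP q\<in>Q. indicator {q<..} s * ?X q w) \<in> borel_measurable predictable"
    unfolding case_prod_beta
  proof (rule borel_measurable_SUP[OF Q])
    fix q assume q: "q \<in> Q"
    then have "0 \<le> q" by (simp add: Q_def)
    from measurable_predictable_adapted[OF X[OF q] this]
    show "(\<lambda>p. indicator {q<..} (fst p) * ?X q (snd p)) \<in> borel_measurable predictable"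
      by (simp only: split_beta')
  qed
  also have "?this \<longleftrightarrow> ?thesis"
  proof (rule measurable_cong)
    fix p :: "real \<times> config" assume "p \<in> space predictable"
    then obtain s w where p: "p = (s, w)" and w: "w \<in> configs" by (auto simp: space_predictable)
    note k = adapted_kernelD[OF \<kappa> w]
    let ?c = "cut (R \<times> B) n s w"
    have cm: "?c \<in> sets (\<kappa> w)"
    proof -
      have "R \<times> B \<in> sets marked" unfolding sets_marked using R B by (intro sigma_sets.Basic) auto
      then show ?thesis using cut_sets[OF _ w] k by simp
    qed
    have c: "?c = (if w \<in> A then {r. a < r \<and> r \<le> b \<and> r < s} \<times> B' else {})"
      using 2 by (auto simp: cut_def mark_def B'_def space_half_plane)
    have m: "S \<times> B' \<in> sets (\<kappa> w)" if "S \<in> sets borel" for S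
      using Times_half_plane[OF that B'(1,2)] k by simp
    have "(SUP q\<in>Q. indicator {q<..} s * ?X q w) = emeasure (\<kappa> w) ?c"
    proof (rule antisym)
      show "(SUP q\<in>Q. indicator {q<..} s * ?X q w) \<le> emeasure (\<kappa> w) ?c"
      proof (rule SUP_least)
        fix q assume q: "q \<in> Q"
        show "indicator {q<..} s * ?X q w \<le> emeasure (\<kappa> w) ?c"
        proof (cases "q < s \<and> w \<in> A")
          case True
          then have "emeasure (\<kappa> w) ({a<..q} \<times> B') \<le> emeasure (\<kappa> w) ?c"
            using q by (intro emeasure_mono cm) (auto simp: c Q_def)
          then show ?thesis using True by simp
        qed (auto simp: indicator_def)
      qed
      show "emeasure (\<kappa> w) ?c \<le> (SUP q\<in>Q. indicator {q<..} s * ?X q w)"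
      proof (cases "w \<in> A \<and> a < s \<and> a < b")
        case False
        then have "?c = {}" by (auto simp: c)
        then show ?thesis by simp
      next
        case True
        show ?thesis
        proof (cases "b < s")
          case bs: True
          have "?c = {a<..b} \<times> B'" using True bs by (auto simp: c)
          moreover have "b \<in> Q" using True 2 by (auto simp: Q_def)
          ultimately show ?thesis using True bs by (intro SUP_upper2[of b]) auto
        next
          case False
          define D where "D = (\<lambda>i::nat. {a<..s - 1 / Suc i} \<times> B')"
          have cD: "?c = (\<Union>i. D i)"
          proof -
            have "\<exists>i::nat. r \<le> s - 1 / Suc i" if "r < s" for r
            proof -
              have "0 < s - r" using that by simp
              then obtain i where "1 / real (Suc i) < s - r" by (rule nat_approx_posE)
              then have "r \<le> s - 1 / Suc i" by linarith
              then show ?thesis by blast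
            qed
            moreover have "r < s" if "r \<le> s - 1 / Suc i" for r and i :: nat
              using that by (rule le_less_trans) simp
            ultimately have e: "r < s \<longleftrightarrow> (\<exists>i::nat. r \<le> s - 1 / Suc i)" for r
              by blast
            have "?c = {a<..<s} \<times> B'" using True False by (auto simp: c)
            also have "\<dots> = (\<Union>i. D i)"
              unfolding D_def greaterThanLessThan_def lessThan_def e by auto
            finally show ?thesis .
          qed
          have "emeasure (\<kappa> w) ?c = (SUP i. emeasure (\<kappa> w) (D i))"
            unfolding cD
          proof (rule SUP_emeasure_incseq[symmetric])
            show "range D \<subseteq> sets (\<kappa> w)" using m by (auto simp: D_def)
            show "incseq D"
            proof (rule incseq_SucI)
              fix i
              have "1 / real (Suc (Suc i)) \<le> 1 / real (Suc i)" by (simp add: frac_le)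
              then show "D i \<subseteq> D (Suc i)" by (auto simp: D_def)
            qed
          qed
          also have "\<dots> \<le> (SUP q\<in>Q. indicator {q<..} s * ?X q w)"
          proof (rule SUP_least)
            fix i :: nat
            have "max a (s - 1 / Suc i) < s" using True by auto
            then obtain q where q: "q \<in> \<rat>" "max a (s - 1 / Suc i) < q" "q < s" using Rats_dense_in_real by blast
            then have qQ: "q \<in> Q" using 2 False by (auto simp: Q_def)
            have "emeasure (\<kappa> w) (D i) \<le> emeasure (\<kappa> w) ({a<..q} \<times> B')"
              using q m by (intro emeasure_mono) (auto simp: D_def)
            also have "\<dots> = indicator {q<..} s * ?X q w" using True q by simp
            also have "\<dots> \<le> (SUP q\<in>Q. indicator {q<..} s * ?X q w)" by (rule SUP_upper[OF qQ])
            finally show "emeasure (\<kappa> w) (D i) \<le> (SUP q\<in>Q. indicator {q<..} s * ?X q w)" .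
          qed
          finally show ?thesis .
        qed
      qed
    qed
    then show "(case p of (s, w) \<Rightarrow> SUP q\<in>Q. indicator {q<..} s * ?X q w) = (case p of (s, w) \<Rightarrow> emeasure (\<kappa> w) (cut (R \<times> B) n s w))"
      by (simp add: p)
  qed
  finally show ?thesis .
qed

lemma cut_disjoint_UN: "cut (\<Union>i. G i) n s w = (\<Union>i. cut (G i) n s w)"
  by (auto simp: cut_def)

lemma cut_predictable:
  assumes \<kappa>: "adapted_kernel \<kappa>" and G: "G \<in> sets marked"
  shows "(\<lambda>(s, w). emeasure (\<kappa> w) (cut G n s w)) \<in> borel_measurable predictable"
proof -
  let ?G = "{R \<times> B |R B. R \<in> predictable_gen \<and> B \<in> sets (borel :: real measure)}"
  have cl: "?G \<subseteq> Pow (space marked)" using predictable_gen_closed by (auto simp: space_marked)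
  \<comment> \<open>The complement step subtracts from the whole space, which is no generator; it is
    exhausted by rectangles over bounded time intervals.\<close>
  have top: "(\<lambda>(s, w). emeasure (\<kappa> w) (cut (space marked) n s w)) \<in> borel_measurable predictable"
  proof -
    have gen: "{0<..real m} \<times> configs \<in> predictable_gen" for m
      using predictable_gen_rect[of 0 configs] sets.top[of "past 0"] by (simp add: space_past)
    have "(\<lambda>(s, w). SUP m. emeasure (\<kappa> w) (cut (({0<..real m} \<times> configs) \<times> UNIV) n s w)) \<in> borel_measurable predictable"
      unfolding split_beta'
      using cut_rect_predictable[OF \<kappa> gen, of UNIV, unfolded split_beta']
      by (intro borel_measurable_SUP) auto
    also have "?this \<longleftrightarrow> ?thesis"
    proof (rule measurable_cong)
      fix p :: "real \<times> config" assume "p \<in> space predictable"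
      then obtain s w where p: "p = (s, w)" and w: "w \<in> configs" by (auto simp: space_predictable)
      have "(SUP m. emeasure (\<kappa> w) (cut (({0<..real m} \<times> configs) \<times> UNIV) n s w)) =
         emeasure (\<kappa> w) (\<Union>m. cut (({0<..real m} \<times> configs) \<times> UNIV) n s w)"
      proof (rule SUP_emeasure_incseq)
        have "({0<..real m} \<times> configs) \<times> UNIV \<in> sets marked" for m
          unfolding sets_marked by (intro sigma_sets.Basic CollectI exI conjI, rule refl, rule gen) auto
        then show "range (\<lambda>m. cut (({0<..real m} \<times> configs) \<times> UNIV) n s w) \<subseteq> sets (\<kappa> w)"
          using cut_sets[OF _ w] adapted_kernelD(1)[OF \<kappa> w] by auto
        show "incseq (\<lambda>m. cut (({0<..real m} \<times> configs) \<times> UNIV) n s w)"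
          by (auto simp: incseq_def cut_def mark_def)
      qed
      also have "(\<Union>m. cut (({0<..real m} \<times> configs) \<times> UNIV) n s w) = cut (space marked) n s w"
        using w by (auto simp: cut_def mark_def space_marked intro: real_arch_simple)
      finally show "(case p of (s, w) \<Rightarrow> SUP m. emeasure (\<kappa> w) (cut (({0<..real m} \<times> configs) \<times> UNIV) n s w)) =
          (case p of (s, w) \<Rightarrow> emeasure (\<kappa> w) (cut (space marked) n s w))" by (simp add: p)
    qed
    finally show ?thesis .
  qed
  from Int_stable_marked cl G[unfolded sets_marked] show ?thesis
  proof (induction rule: sigma_sets_induct_disjoint)
    case (basic A)
    then show ?case using cut_rect_predictable[OF \<kappa>] by auto
  next
    case empty
    then show ?case by (simp add: cut_def)
  next
    case (compl A)
    then have A: "A \<in> sets marked" by (simp add: sets_marked)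
    have "(\<lambda>p. (case p of (s, w) \<Rightarrow> emeasure (\<kappa> w) (cut (space marked) n s w)) - (case p of (s, w) \<Rightarrow> emeasure (\<kappa> w) (cut A n s w))) \<in> borel_measurable predictable"
      using top compl by measurable
    also have "?this \<longleftrightarrow> ?case"
    proof (rule measurable_cong)
      fix p :: "real \<times> config" assume "p \<in> space predictable"
      then obtain s w where p: "p = (s, w)" and w: "w \<in> configs" by (auto simp: space_predictable)
      note k = adapted_kernelD[OF \<kappa> w]
      have "cut (space marked - A) n s w = cut (space marked) n s w - cut A n s w" by (auto simp: cut_def)
      moreover have "emeasure (\<kappa> w) (cut (space marked) n s w - cut A n s w) = emeasure (\<kappa> w) (cut (space marked) n s w) - emeasure (\<kappa> w) (cut A n s w)"
        using k(4)[OF cut_sets[OF A w] cut_bounded, of n s] cut_sets[OF A w] cut_sets[OF sets.top w] sets.sets_into_space[OF A]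
        by (intro emeasure_Diff) (auto simp: k(1) cut_def)
      ultimately show "(case p of (s, w) \<Rightarrow> emeasure (\<kappa> w) (cut (space marked) n s w)) - (case p of (s, w) \<Rightarrow> emeasure (\<kappa> w) (cut A n s w))
         = (case p of (s, w) \<Rightarrow> emeasure (\<kappa> w) (cut (space marked - A) n s w))"
        by (simp add: p)
    qed
    finally show ?case .
  next
    case (union A)
    then have A: "A i \<in> sets marked" for i unfolding sets_marked by auto
    have "(\<lambda>p. \<Sum>i. (case p of (s, w) \<Rightarrow> emeasure (\<kappa> w) (cut (A i) n s w))) \<in> borel_measurable predictable"
      using union(3) by measurable
    also have "?this \<longleftrightarrow> ?case"
    proof (rule measurable_cong)
      fix p :: "real \<times> config" assume "p \<in> space predictable"
      then obtain s w where p: "p = (s, w)" and w: "w \<in> configs" by (auto simp: space_predictable)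
      have "(\<Sum>i. emeasure (\<kappa> w) (cut (A i) n s w)) = emeasure (\<kappa> w) (\<Union>i. cut (A i) n s w)"
        using union(1) cut_sets[OF A w] adapted_kernelD(1)[OF \<kappa> w]
        by (intro suminf_emeasure) (auto simp: disjoint_family_on_def cut_def)
      then show "(\<Sum>i. (case p of (s, w) \<Rightarrow> emeasure (\<kappa> w) (cut (A i) n s w))) = (case p of (s, w) \<Rightarrow> emeasure (\<kappa> w) (cut (\<Union>i. A i) n s w))"
        by (simp add: p cut_disjoint_UN)
    qed
    finally show ?case .
  qed
qed

text \<open>With the identity kernel this is the sum of \<open>h\<close> over the points in
  \<open>{0<..<s}\<close>, with the constant kernel \<open>half_plane\<close> it is the compensator;
  one notion for both lets each measurability and product rule be proved once. The open right end
  makes it predictable in \<open>s\<close>.\<close>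

definition kint :: "(config \<Rightarrow> config) \<Rightarrow> ((real \<times> config) \<times> real \<Rightarrow> ennreal) \<Rightarrow> real \<Rightarrow> config \<Rightarrow> ennreal" where
  "kint \<kappa> h s w = (\<integral>\<^sup>+z. h (mark w z) * indicator {0<..<s} (fst z) \<partial>\<kappa> w)"

lemma measurable_mark_comp:
  assumes "h \<in> borel_measurable marked" "w \<in> configs"
  shows "(\<lambda>z. h (mark w z)) \<in> borel_measurable half_plane"
  by (rule measurable_compose[OF measurable_mark[OF assms(2)] assms(1)])

lemma kint_indicator:
  assumes \<kappa>: "adapted_kernel \<kappa>" and w: "w \<in> configs" and G: "G \<in> sets marked"
  shows "kint \<kappa> (indicator G) s w = (SUP n. emeasure (\<kappa> w) (cut G n s w))"
proof -
  note k = adapted_kernelD[OF \<kappa> w]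
  have c: "cut G n s w \<in> sets (\<kappa> w)" for n using cut_sets[OF G w] k by simp
  have "(SUP n. emeasure (\<kappa> w) (cut G n s w)) = emeasure (\<kappa> w) (\<Union>n. cut G n s w)"
    using c by (intro SUP_emeasure_incseq) (auto simp: incseq_def cut_def)
  also have "\<dots> = (\<integral>\<^sup>+z. indicator (\<Union>n. cut G n s w) z \<partial>\<kappa> w)"
    using c by (intro nn_integral_indicator[symmetric]) auto
  also have "\<dots> = kint \<kappa> (indicator G) s w"
    unfolding kint_def
  proof (rule nn_integral_cong)
    fix z assume "z \<in> space (\<kappa> w)"
    then have z: "z \<in> space half_plane" by (simp add: k space_half_plane)
    obtain n :: nat where "snd z \<le> real n" using real_arch_simple by blast
    then have "z \<in> (\<Union>n. cut G n s w) \<longleftrightarrow> mark w z \<in> G \<and> fst z \<in> {0<..<s}"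
      using z by (auto simp: cut_def)
    then show "indicator (\<Union>n. cut G n s w) z = (indicator G (mark w z) * indicator {0<..<s} (fst z) :: ennreal)"
      by (auto simp: indicator_def)
  qed
  finally show ?thesis by simp
qed

text \<open>An integral over the points so far may thus serve as an integrand again, which is what
  iterated integrals require.\<close>

lemma kint_predictable:
  assumes \<kappa>: "adapted_kernel \<kappa>" and h: "h \<in> borel_measurable marked"
  shows "(\<lambda>(s, w). kint \<kappa> h s w) \<in> borel_measurable predictable"
  using h
proof (induction rule: borel_measurable_induct)
  case (cong f g)
  have "kint \<kappa> f s w = kint \<kappa> g s w" if "w \<in> configs" for s w
    unfolding kint_def using cong(3) that by (intro nn_integral_cong) (auto simp: space_marked mark_def)
  then show ?case using cong(4) by (subst measurable_cong[where g = "\<lambda>(s, w). kint \<kappa> g s w"]) (auto simp: space_predictable)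
next
  case (set A)
  have "(\<lambda>p. SUP n. (case p of (s, w) \<Rightarrow> emeasure (\<kappa> w) (cut A n s w))) \<in> borel_measurable predictable"
    using cut_predictable[OF \<kappa> set] by measurable
  then show ?case
    using kint_indicator[OF \<kappa> _ set] by (subst measurable_cong[where g = "\<lambda>p. SUP n. (case p of (s, w) \<Rightarrow> emeasure (\<kappa> w) (cut A n s w))"]) (auto simp: space_predictable)
next
  case (mult u c)
  have "kint \<kappa> (\<lambda>x. c * u x) s w = c * kint \<kappa> u s w" if "w \<in> configs" for s w
    unfolding kint_def
    using measurable_mark_comp[OF mult(2) that]
    by (subst nn_integral_cmult[symmetric])
       (auto simp: mult.assoc measurable_cong_sets[OF adapted_kernelD(1)[OF \<kappa> that] refl])
  then show ?case using mult(4) by (subst measurable_cong[where g = "\<lambda>p. c * (case p of (s, w) \<Rightarrow> kint \<kappa> u s w)"]) (auto simp: space_predictable)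
next
  case (add u v)
  have "kint \<kappa> (\<lambda>x. v x + u x) s w = kint \<kappa> v s w + kint \<kappa> u s w" if "w \<in> configs" for s w
    unfolding kint_def
    using measurable_mark_comp[OF add(1) that] measurable_mark_comp[OF add(3) that]
    by (subst nn_integral_add[symmetric])
       (auto simp: distrib_right measurable_cong_sets[OF adapted_kernelD(1)[OF \<kappa> that] refl])
  then show ?case using add by (subst measurable_cong[where g = "\<lambda>p. (case p of (s, w) \<Rightarrow> kint \<kappa> v s w) + (case p of (s, w) \<Rightarrow> kint \<kappa> u s w)"]) (auto simp: space_predictable)
next
  case (seq U)
  have "kint \<kappa> (SUP i. U i) s w = (SUP i. kint \<kappa> (U i) s w)" if "w \<in> configs" for s w
  proof -
    have "kint \<kappa> (SUP i. U i) s w = (\<integral>\<^sup>+z. (SUP i. U i (mark w z) * indicator {0<..<s} (fst z)) \<partial>\<kappa> w)"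
      unfolding kint_def by (auto simp: image_comp SUP_mult_right_ennreal intro!: nn_integral_cong)
    also have "\<dots> = (SUP i. kint \<kappa> (U i) s w)"
      unfolding kint_def using seq(3) measurable_mark_comp[OF seq(1) that]
      by (intro nn_integral_monotone_convergence_SUP)
         (auto simp: mark_def incseq_def le_fun_def measurable_cong_sets[OF adapted_kernelD(1)[OF \<kappa> that] refl]
           intro!: mult_right_mono)
    finally show ?thesis .
  qed
  then show ?case using seq.IH by (subst measurable_cong[where g = "\<lambda>p. SUP i. (case p of (s, w) \<Rightarrow> kint \<kappa> (U i) s w)"]) (auto simp: space_predictable)
qed

section \<open>Measurability of integrals against the configuration itself\<close>

lemma measurable_emeasure_section:
  assumes G: "G \<in> sets (config_space \<Otimes>\<^sub>M half_plane)"
  shows "(\<lambda>w. emeasure w (Pair w -` G \<inter> {- real n..real n} \<times> {0..real n})) \<in> borel_measurable config_space"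
proof -
  let ?D = "{- real n..real n} \<times> {0..real n}"
  let ?G = "{a \<times> b |a b. a \<in> sets config_space \<and> b \<in> sets half_plane}"
  let ?\<Omega> = "space config_space \<times> space half_plane"
  have D: "?D \<in> sets half_plane" by (rule Times_half_plane) auto
  have bD: "bounded ?D" by (rule bounded_Times[OF compact_imp_bounded[OF compact_Icc] compact_imp_bounded[OF compact_Icc]])
  have cl: "?G \<subseteq> Pow ?\<Omega>" using sets.space_closed[of config_space] sets.space_closed[of half_plane] by blast
  have sec: "Pair w -` G \<in> sets half_plane" if "G \<in> sets (config_space \<Otimes>\<^sub>M half_plane)" for w G
    using sets_Pair1[OF that] .
  from Int_stable_pair_measure_generator cl G[unfolded sets_pair_measure] show ?thesis
  proof (induction rule: sigma_sets_induct_disjoint)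
    case (basic A)
    then obtain a b where A: "A = a \<times> b" "a \<in> sets config_space" "b \<in> sets half_plane" by auto
    have "(\<lambda>w. indicator a w * emeasure w (b \<inter> ?D)) \<in> borel_measurable config_space"
      using A D by (intro borel_measurable_times_ennreal borel_measurable_indicator measurable_emeasure_config) auto
    also have "?this \<longleftrightarrow> ?case"
      by (rule measurable_cong) (auto simp: A indicator_def intro!: arg_cong2[where f = emeasure])
    finally show ?case .
  next
    case empty then show ?case by simp
  next
    case (compl A)
    then have A: "A \<in> sets (config_space \<Otimes>\<^sub>M half_plane)" by (simp add: sets_pair_measure)
    have "(\<lambda>w. emeasure w ?D - emeasure w (Pair w -` A \<inter> ?D)) \<in> borel_measurable config_space"
      using compl D by (auto intro!: borel_measurable_minus_ennreal measurable_emeasure_config)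
    also have "?this \<longleftrightarrow> ?case"
    proof (rule measurable_cong)
      fix w assume "w \<in> space config_space"
      then have w: "w \<in> configs" by (simp add: space_config_space)
      note k = adapted_kernelD[OF adapted_kernel_config w]
      have "emeasure w (?D - (Pair w -` A \<inter> ?D)) = emeasure w ?D - emeasure w (Pair w -` A \<inter> ?D)"
      proof (rule emeasure_Diff)
        have "bounded (Pair w -` A \<inter> ?D)" by (rule bounded_subset[OF bD]) auto
        then show "emeasure w (Pair w -` A \<inter> ?D) \<noteq> \<infinity>" using k(4)[of "Pair w -` A \<inter> ?D"] sec[OF A] D by auto
      qed (use k(1) D sec[OF A] in auto)
      moreover have "?D - (Pair w -` A \<inter> ?D) = Pair w -` (?\<Omega> - A) \<inter> ?D"
        using w by (auto simp: space_config_space space_half_plane)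
      ultimately show "emeasure w ?D - emeasure w (Pair w -` A \<inter> ?D) = emeasure w (Pair w -` (?\<Omega> - A) \<inter> ?D)" by simp
    qed
    finally show ?case .
  next
    case (union A)
    then have A: "A i \<in> sets (config_space \<Otimes>\<^sub>M half_plane)" for i by (auto simp: sets_pair_measure)
    have "(\<lambda>w. \<Sum>i. emeasure w (Pair w -` A i \<inter> ?D)) \<in> borel_measurable config_space"
      using union(3) by measurable
    also have "?this \<longleftrightarrow> ?case"
    proof (rule measurable_cong)
      fix w assume "w \<in> space config_space"
      then have w: "w \<in> configs" by (simp add: space_config_space)
      have "(\<Sum>i. emeasure w (Pair w -` A i \<inter> ?D)) = emeasure w (\<Union>i. Pair w -` A i \<inter> ?D)"
        using union(1) sec[OF A] D sets_config[OF w]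
        by (intro suminf_emeasure) (auto simp: disjoint_family_on_def)
      also have "(\<Union>i. Pair w -` A i \<inter> ?D) = Pair w -` (\<Union>i. A i) \<inter> ?D" by auto
      finally show "(\<Sum>i. emeasure w (Pair w -` A i \<inter> ?D)) = emeasure w (Pair w -` (\<Union>i. A i) \<inter> ?D)" .
    qed
    finally show ?case .
  qed
qed

text \<open>For integrands that are merely jointly measurable, such as the one in
  \<open>normalized_martingale\<close>, which involves \<open>lam\<close> itself on the closed
  interval \<open>{0..T}\<close> rather than a predictable version.\<close>

lemma measurable_nn_integral_config:
  assumes h: "h \<in> borel_measurable (config_space \<Otimes>\<^sub>M half_plane)"
  shows "(\<lambda>w. \<integral>\<^sup>+z. h (w, z) \<partial>w) \<in> borel_measurable config_space"
  using h
proof (induction rule: borel_measurable_induct)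
  case (cong f g)
  then show ?case
    by (subst measurable_cong[where g = "\<lambda>w. \<integral>\<^sup>+z. g (w, z) \<partial>w"])
       (auto simp: space_config_space space_config space_pair_measure space_half_plane intro!: nn_integral_cong)
next
  case (set A)
  have "(\<lambda>w. SUP n. emeasure w (Pair w -` A \<inter> {- real n..real n} \<times> {0..real n})) \<in> borel_measurable config_space"
    using measurable_emeasure_section[OF set] by measurable
  also have "?this \<longleftrightarrow> ?case"
  proof (rule measurable_cong)
    fix w assume "w \<in> space config_space"
    then have w: "w \<in> configs" by (simp add: space_config_space)
    have s: "Pair w -` A \<in> sets half_plane" by (rule sets_Pair1[OF set])
    have D: "{- real n..real n} \<times> {0..real n} \<in> sets half_plane" for n by (rule Times_half_plane) auto
    have "(SUP n. emeasure w (Pair w -` A \<inter> {- real n..real n} \<times> {0..real n})) =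
        emeasure w (\<Union>n. Pair w -` A \<inter> {- real n..real n} \<times> {0..real n})"
      using s D sets_config[OF w] by (intro SUP_emeasure_incseq) (auto simp: incseq_def)
    also have "(\<Union>n. Pair w -` A \<inter> {- real n..real n} \<times> {0..real n}) = Pair w -` A"
    proof (intro equalityI subsetI)
      fix z assume z: "z \<in> Pair w -` A"
      then have "z \<in> space half_plane" using sets.sets_into_space[OF s] by auto
      moreover obtain n :: nat where "\<bar>fst z\<bar> + \<bar>snd z\<bar> \<le> real n" using real_arch_simple by blast
      ultimately have "z \<in> {- real n..real n} \<times> {0..real n}" by (cases z) (auto simp: space_half_plane)
      then show "z \<in> (\<Union>n. Pair w -` A \<inter> {- real n..real n} \<times> {0..real n})" using z by blast
    qed auto
    also have "emeasure w (Pair w -` A) = (\<integral>\<^sup>+z. indicator A (w, z) \<partial>w)"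
    proof -
      have "(\<integral>\<^sup>+z. indicator A (w, z) \<partial>w) = (\<integral>\<^sup>+z. indicator (Pair w -` A) z \<partial>w)"
        by (rule nn_integral_cong) (simp add: indicator_def)
      then show ?thesis using s sets_config[OF w] by simp
    qed
    finally show "(SUP n. emeasure w (Pair w -` A \<inter> {- real n..real n} \<times> {0..real n})) = (\<integral>\<^sup>+z. indicator A (w, z) \<partial>w)" .
  qed
  finally show ?case .
next
  case (mult u c)
  have "(\<lambda>w. c * (\<integral>\<^sup>+z. u (w, z) \<partial>w)) \<in> borel_measurable config_space" using mult.IH by measurable
  also have "?this \<longleftrightarrow> ?case"
    using measurable_Pair2[OF mult(2)]
    by (intro measurable_cong nn_integral_cmult[symmetric]) (auto simp: space_config_space measurable_cong_sets[OF sets_config refl])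
  finally show ?case .
next
  case (add u v)
  have "(\<lambda>w. (\<integral>\<^sup>+z. v (w, z) \<partial>w) + (\<integral>\<^sup>+z. u (w, z) \<partial>w)) \<in> borel_measurable config_space" using add.IH by measurable
  also have "?this \<longleftrightarrow> ?case"
    using measurable_Pair2[OF add(1)] measurable_Pair2[OF add(3)]
    by (intro measurable_cong nn_integral_add[symmetric]) (auto simp: space_config_space measurable_cong_sets[OF sets_config refl])
  finally show ?case .
next
  case (seq U)
  have "(\<lambda>w. SUP i. (\<integral>\<^sup>+z. U i (w, z) \<partial>w)) \<in> borel_measurable config_space" using seq.IH by measurable
  also have "?this \<longleftrightarrow> ?case"
  proof (rule measurable_cong)
    fix w assume "w \<in> space config_space"
    then show "(SUP i. (\<integral>\<^sup>+z. U i (w, z) \<partial>w)) = (\<integral>\<^sup>+z. (SUP i. U i) (w, z) \<partial>w)"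
      using measurable_Pair2[OF seq(1)] seq(3)
      by (simp add: image_comp, intro nn_integral_monotone_convergence_SUP[symmetric])
         (auto simp: space_config_space incseq_def le_fun_def measurable_cong_sets[OF sets_config refl])
  qed
  finally show ?case .
qed

section \<open>Independence of the past and the compensation formula\<close>

lemma sums_poisson_mean: "(\<lambda>k. real k * (exp (- x) * x ^ k / fact k)) sums (x :: real)"
proof -
  have "(\<lambda>k. x * exp (- x) * (x ^ k / fact k)) sums (x * exp (- x) * exp x)"
    using exp_converges[of x] by (intro sums_mult) (simp add: field_simps)
  then have "(\<lambda>k. real (Suc k) * (exp (- x) * x ^ Suc k / fact (Suc k))) sums (x * exp (- x) * exp x)"
    by (rule sums_cong[THEN iffD1, rotated]) (simp add: field_simps del: of_nat_Suc)
  then have "(\<lambda>k. real (Suc k) * (exp (- x) * x ^ Suc k / fact (Suc k))) sums x"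
    by (simp add: exp_minus_inverse mult.assoc exp_add[symmetric])
  then show ?thesis by (subst (asm) sums_Suc_iff) simp
qed

text \<open>Finite intersections of generators of \<open>past s\<close>: unlike single count events
  they are closed under intersection, as Dynkin's theorem requires.\<close>

definition past_cyl :: "real \<Rightarrow> config set set" where
  "past_cyl s = {{w \<in> configs. \<forall>i<m. emeasure w (R i) \<in> E i} |(m::nat) R E.
     \<forall>i<m. (\<exists>S B. R i = S \<times> B \<and> S \<in> sets borel \<and> S \<subseteq> {..s} \<and> B \<in> sets borel \<and> B \<subseteq> {0..}) \<and> E i \<in> sets borel}"

lemma Int_stable_past_cyl: "Int_stable (past_cyl s)"
proof (rule Int_stableI)
  fix a b assume "a \<in> past_cyl s" "b \<in> past_cyl s"
  then obtain m m' :: nat and R E R' E' where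
    a: "a = {w \<in> configs. \<forall>i<m. emeasure w (R i) \<in> E i}"
      "\<forall>i<m. (\<exists>S B. R i = S \<times> B \<and> S \<in> sets borel \<and> S \<subseteq> {..s} \<and> B \<in> sets borel \<and> B \<subseteq> {0..}) \<and> E i \<in> sets borel" and
    b: "b = {w \<in> configs. \<forall>i<m'. emeasure w (R' i) \<in> E' i}"
      "\<forall>i<m'. (\<exists>S B. R' i = S \<times> B \<and> S \<in> sets borel \<and> S \<subseteq> {..s} \<and> B \<in> sets borel \<and> B \<subseteq> {0..}) \<and> E' i \<in> sets borel"
    unfolding past_cyl_def by blast
  define R'' where "R'' = (\<lambda>i. if i < m then R i else R' (i - m))"
  define E'' where "E'' = (\<lambda>i. if i < m then E i else E' (i - m))"
  have 1: "(\<forall>i<m + m'. Q (R'' i) (E'' i)) \<longleftrightarrow> (\<forall>i<m. Q (R i) (E i)) \<and> (\<forall>i<m'. Q (R' i) (E' i))" for Q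
  proof (intro iffI conjI allI impI)
    assume *: "\<forall>i<m + m'. Q (R'' i) (E'' i)"
    show "Q (R i) (E i)" if "i < m" for i using *[rule_format, of i] that by (simp add: R''_def E''_def)
    show "Q (R' i) (E' i)" if "i < m'" for i using *[rule_format, of "m + i"] that by (simp add: R''_def E''_def)
  next
    fix i assume "(\<forall>i<m. Q (R i) (E i)) \<and> (\<forall>i<m'. Q (R' i) (E' i))" "i < m + m'"
    then show "Q (R'' i) (E'' i)" by (auto simp: R''_def E''_def)
  qed
  have "a \<inter> b = {w \<in> configs. \<forall>i<m + m'. emeasure w (R'' i) \<in> E'' i}"
    unfolding a b using 1[of "\<lambda>R E. emeasure _ R \<in> E"] by auto
  moreover have "\<forall>i<m + m'. (\<exists>S B. R'' i = S \<times> B \<and> S \<in> sets borel \<and> S \<subseteq> {..s} \<and> B \<in> sets borel \<and> B \<subseteq> {0..}) \<and> E'' i \<in> sets borel"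
    using 1[of "\<lambda>R E. (\<exists>S B. R = S \<times> B \<and> S \<in> sets borel \<and> S \<subseteq> {..s} \<and> B \<in> sets borel \<and> B \<subseteq> {0..}) \<and> E \<in> sets borel"] a(2) b(2) by blast
  ultimately show "a \<inter> b \<in> past_cyl s" unfolding past_cyl_def by blast
qed

lemma past_cyl_closed: "past_cyl s \<subseteq> Pow configs"
  by (auto simp: past_cyl_def)

lemma sets_past_cyl: "sets (past s) \<subseteq> sigma_sets configs (past_cyl s)"
proof -
  have "{w \<in> configs. emeasure w (S \<times> B) \<in> E} \<in> past_cyl s"
    if "S \<in> sets borel" "S \<subseteq> {..s}" "B \<in> sets borel" "B \<subseteq> {0..}" "E \<in> sets borel" for S B E
    unfolding past_cyl_def
    by (rule CollectI, rule exI[of _ 1], rule exI[of _ "\<lambda>_. S \<times> B"], rule exI[of _ "\<lambda>_. E"]) (use that in auto)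
  then show ?thesis unfolding sets_past by (intro sigma_sets_mono') blast
qed

locale poisson =
  fixes P :: "config measure"
  assumes P: "poisson_law P"
begin

sublocale prob_space P using P by (simp add: poisson_law_def)

lemma space_P: "space P = configs" and sets_P: "sets P = sets config_space"
  using P by (auto simp: poisson_law_def space_config_space)

lemma measurable_P: "f \<in> measurable config_space N \<Longrightarrow> f \<in> measurable P N"
  by (simp add: measurable_cong_sets[OF sets_P refl])

lemma emeasure_count_measurable: "B \<in> sets half_plane \<Longrightarrow> (\<lambda>w. emeasure w B) \<in> borel_measurable P"
  by (rule measurable_P[OF measurable_emeasure_config])

lemma half_plane_finite: "B \<in> sets half_plane \<Longrightarrow> bounded B \<Longrightarrow> emeasure half_plane B < \<infinity>"
  using emeasure_half_plane emeasure_bounded_finite by metis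

lemma indep_counts:
  fixes I :: "nat set"
  assumes "\<And>i. i \<in> I \<Longrightarrow> B i \<in> sets half_plane" "disjoint_family_on B I"
  shows "indep_vars (\<lambda>_. borel) (\<lambda>i w. emeasure w (B i)) I"
  using P assms unfolding poisson_law_def by blast

lemma count_nat: "w \<in> configs \<Longrightarrow> B \<in> sets half_plane \<Longrightarrow> bounded B \<Longrightarrow> emeasure w B \<in> \<nat>"
  by (simp add: configs_def)

lemma prob_count:
  assumes "B \<in> sets half_plane" "bounded B"
  shows "prob {w \<in> space P. emeasure w B = of_nat k} =
    exp (- measure half_plane B) * measure half_plane B ^ k / fact k"
  using P assms half_plane_finite[OF assms] unfolding poisson_law_def by blast

text \<open>\<open>poisson_law\<close> speaks of disjoint sets, whereas the rectangles
  \<open>R i\<close> may overlap. They are cut into the atoms of the finite algebra they generate,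
  each indexed by the code of the set of rectangles that contain it. Every count is a sum of atom
  counts, and these are independent of the count on \<open>B\<close>.\<close>

lemma past_cyl_indep:
  assumes A: "A \<in> past_cyl s" and B: "B \<in> sets half_plane" "B \<subseteq> {s<..} \<times> UNIV" and E: "E \<in> sets borel"
  shows "prob (A \<inter> {w \<in> space P. emeasure w B \<in> E}) = prob A * prob {w \<in> space P. emeasure w B \<in> E}"
proof -
  obtain m :: nat and R F where A: "A = {w \<in> configs. \<forall>i<m. emeasure w (R i) \<in> F i}"
    and *: "\<forall>i<m. (\<exists>S B. R i = S \<times> B \<and> S \<in> sets borel \<and> S \<subseteq> {..s} \<and> B \<in> sets borel \<and> B \<subseteq> {0..}) \<and> F i \<in> sets borel"
    using A unfolding past_cyl_def by blast
  have R: "R i \<in> sets half_plane" "R i \<subseteq> {..s} \<times> UNIV" "F i \<in> sets borel" if "i < m" for i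
  proof -
    from * that obtain S B where "R i = S \<times> B" "S \<in> sets borel" "S \<subseteq> {..s}" "B \<in> sets borel" "B \<subseteq> {0..}" "F i \<in> sets borel"
      by blast
    then show "R i \<in> sets half_plane" "R i \<subseteq> {..s} \<times> UNIV" "F i \<in> sets borel"
      using Times_half_plane by auto
  qed
  \<comment> \<open>Code \<open>0\<close> would stand for the complement of all rectangles, which no
    \<open>R i\<close> meets; this index is free to carry \<open>B\<close>.\<close>
  define atm where "atm j = (if j = 0 then B else {z \<in> space half_plane. set_decode j \<subseteq> {..<m} \<and> (\<forall>i<m. z \<in> R i \<longleftrightarrow> i \<in> set_decode j)})" for j
  let ?I = "{..<2 ^ m} :: nat set"
  let ?J = "{1..<2 ^ m} :: nat set"
  have at_sets: "atm j \<in> sets half_plane" for j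
  proof (cases "j = 0 \<or> \<not> set_decode j \<subseteq> {..<m}")
    case True
    then have "atm j = B \<or> atm j = {}" unfolding atm_def by (cases "j = 0") auto
    then show ?thesis using B by auto
  next
    case False
    then have "atm j = {z \<in> space half_plane. \<forall>i\<in>{..<m}. z \<in> R i \<longleftrightarrow> i \<in> set_decode j}"
      unfolding atm_def Ball_def lessThan_iff by (simp only: if_False simp_thms HOL.not_not de_Morgan_disj)
    also have "\<dots> \<in> sets half_plane"
    proof (rule sets.sets_Collect_finite_All)
      fix i assume "i \<in> {..<m}"
      then have "R i \<in> sets half_plane" "R i \<subseteq> space half_plane"
        using R(1)[of i] sets.sets_into_space[OF R(1)[of i]] by auto
      moreover have "{z \<in> space half_plane. z \<in> R i \<longleftrightarrow> i \<in> set_decode j} =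
          (if i \<in> set_decode j then R i else space half_plane - R i)"
        using calculation(2) by auto
      ultimately show "{z \<in> space half_plane. z \<in> R i \<longleftrightarrow> i \<in> set_decode j} \<in> sets half_plane" by auto
    qed auto
    finally show ?thesis .
  qed
  have at_past: "atm j \<subseteq> {..s} \<times> UNIV" if "j \<noteq> 0" for j
  proof
    fix z assume z: "z \<in> atm j"
    have "set_decode j \<noteq> {}" using that set_decode_inverse[of j] by (metis set_encode_empty)
    then obtain i where "i \<in> set_decode j" "i < m" using z that by (auto simp: atm_def split: if_splits)
    then have "z \<in> R i" using z that by (auto simp: atm_def split: if_splits)
    then show "z \<in> {..s} \<times> UNIV" using R(2)[OF \<open>i < m\<close>] by auto
  qed
  have disj: "disjoint_family_on atm ?I"
    unfolding disjoint_family_on_def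
  proof (intro ballI impI)
    fix j k :: nat assume jk: "j \<noteq> k"
    show "atm j \<inter> atm k = {}"
    proof (cases "j = 0 \<or> k = 0")
      case True
      have "atm 0 = B" by (simp add: atm_def)
      then show ?thesis using True at_past[of j] at_past[of k] B(2) jk by fastforce
    next
      case False
      have "set_decode j \<noteq> set_decode k" using jk by (metis set_decode_inverse)
      then obtain i where i: "i \<in> set_decode j \<longleftrightarrow> i \<notin> set_decode k" by blast
      show ?thesis
      proof (rule ccontr)
        assume "atm j \<inter> atm k \<noteq> {}"
        then obtain z where z: "z \<in> atm j" "z \<in> atm k" by blast
        have dj: "set_decode j \<subseteq> {..<m}" "\<forall>i<m. z \<in> R i \<longleftrightarrow> i \<in> set_decode j"
          using z(1) False by (auto simp: atm_def)
        have dk: "set_decode k \<subseteq> {..<m}" "\<forall>i<m. z \<in> R i \<longleftrightarrow> i \<in> set_decode k"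
          using z(2) False by (auto simp: atm_def)
        have "i < m" using i dj(1) dk(1) by blast
        then show False using i dj(2) dk(2) by blast
      qed
    qed
  qed
  have ind: "indep_vars (\<lambda>_. borel) (\<lambda>i w. emeasure w (atm i)) ?I"
    using at_sets disj by (intro indep_counts) auto
  have pos: "0 < (2::nat) ^ m" by simp
  have iv: "indep_var (PiM ?J (\<lambda>_. borel)) (\<lambda>w. \<lambda>i\<in>?J. emeasure w (atm i)) (PiM {0} (\<lambda>_. borel)) (\<lambda>w. \<lambda>i\<in>{0}. emeasure w (atm i))"
    using pos by (intro indep_var_restrict[OF ind]) (auto simp del: zero_less_power)
  have decomp: "emeasure w (R i) = (\<Sum>j\<in>{j\<in>?J. i \<in> set_decode j}. emeasure w (atm j))" if w: "w \<in> configs" and i: "i < m" for w i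
  proof -
    have "(\<Sum>j\<in>{j\<in>?J. i \<in> set_decode j}. emeasure w (atm j)) = emeasure w (\<Union>j\<in>{j\<in>?J. i \<in> set_decode j}. atm j)"
      using at_sets disj sets_config[OF w] by (intro sum_emeasure) (auto simp: disjoint_family_on_def)
    also have "(\<Union>j\<in>{j\<in>?J. i \<in> set_decode j}. atm j) = R i"
    proof (intro equalityI subsetI)
      fix z assume "z \<in> (\<Union>j\<in>{j\<in>?J. i \<in> set_decode j}. atm j)"
      then show "z \<in> R i" using i by (auto simp: atm_def)
    next
      fix z assume z: "z \<in> R i"
      let ?K = "{l. l < m \<and> z \<in> R l}"
      have fin: "finite ?K" by auto
      let ?j = "set_encode ?K"
      have dec: "set_decode ?j = ?K" using fin by simp
      have "i \<in> set_decode ?j" using dec i z by simp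
      then have "?j \<noteq> 0" by (intro notI) simp
      have "?j < 2 ^ m"
      proof -
        have "?j \<le> set_encode {..<m}"
          unfolding set_encode_def by (intro sum_mono2) auto
        also have "\<dots> = (\<Sum>l<m. 2 ^ l)" by (simp add: set_encode_def)
        also have "\<dots> < 2 ^ m" by (induction m) auto
        finally show ?thesis .
      qed
      with \<open>?j \<noteq> 0\<close> have "?j \<in> {j\<in>?J. i \<in> set_decode j}" using dec i z by auto
      moreover have "z \<in> atm ?j" unfolding atm_def using \<open>?j \<noteq> 0\<close> dec z R(1)[OF i] sets.sets_into_space by auto
      ultimately show "z \<in> (\<Union>j\<in>{j\<in>?J. i \<in> set_decode j}. atm j)" by blast
    qed
    finally show ?thesis by simp
  qed
  let ?XA = "{x \<in> space (PiM ?J (\<lambda>_. borel :: ennreal measure)). \<forall>i\<in>{..<m}. (\<Sum>j\<in>{j\<in>?J. i \<in> set_decode j}. x j) \<in> F i}"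
  let ?XB = "{x \<in> space (PiM {0::nat} (\<lambda>_. borel :: ennreal measure)). x 0 \<in> E}"
  have XA: "?XA \<in> sets (PiM ?J (\<lambda>_. borel))"
  proof (rule sets.sets_Collect_finite_All)
    fix i assume i: "i \<in> {..<m}"
    have "(\<lambda>x. \<Sum>j\<in>{j\<in>?J. i \<in> set_decode j}. x j) \<in> borel_measurable (PiM ?J (\<lambda>_. borel :: ennreal measure))"
      by (intro borel_measurable_sum measurable_component_singleton) auto
    from measurable_sets[OF this] R(3)[of i] i
    show "{x \<in> space (PiM ?J (\<lambda>_. borel)). (\<Sum>j\<in>{j\<in>?J. i \<in> set_decode j}. x j) \<in> F i} \<in> sets (PiM ?J (\<lambda>_. borel :: ennreal measure))"
      by (simp add: vimage_def Int_def conj_commute)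
  qed auto
  have XB: "?XB \<in> sets (PiM {0} (\<lambda>_. borel))"
    using measurable_sets[OF measurable_component_singleton[of 0 "{0}" "\<lambda>_. borel"] E]
    by (simp add: vimage_def Int_def conj_commute)
  have eA: "(\<lambda>w. \<lambda>i\<in>?J. emeasure w (atm i)) -` ?XA \<inter> space P = A"
    unfolding A using decomp by (auto simp: space_P space_PiM PiE_def)
  have eB: "(\<lambda>w. \<lambda>i\<in>{0}. emeasure w (atm i)) -` ?XB \<inter> space P = {w \<in> space P. emeasure w B \<in> E}"
    by (auto simp: space_P space_PiM PiE_def atm_def)
  have "prob ((\<lambda>w. \<lambda>i\<in>?J. emeasure w (atm i)) -` ?XA \<inter> (\<lambda>w. \<lambda>i\<in>{0}. emeasure w (atm i)) -` ?XB \<inter> space P) =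
     prob ((\<lambda>w. \<lambda>i\<in>?J. emeasure w (atm i)) -` ?XA \<inter> space P) * prob ((\<lambda>w. \<lambda>i\<in>{0}. emeasure w (atm i)) -` ?XB \<inter> space P)"
    using indep_varD[OF iv XA XB] by (simp add: vimage_Times[symmetric] vimage_def Int_def conj_ac)
  moreover have "(\<lambda>w. \<lambda>i\<in>?J. emeasure w (atm i)) -` ?XA \<inter> (\<lambda>w. \<lambda>i\<in>{0}. emeasure w (atm i)) -` ?XB \<inter> space P =
     A \<inter> {w \<in> space P. emeasure w B \<in> E}"
    using eA eB by blast
  ultimately show ?thesis unfolding eA eB by simp
qed

text \<open>Dynkin's theorem in \<open>A\<close>. A single future set \<open>B\<close> is enough,
  since a generating predictable rectangle multiplies an event of the past by one count.\<close>

lemma past_indep: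
  assumes A: "A \<in> sets (past s)" and B: "B \<in> sets half_plane" "B \<subseteq> {s<..} \<times> UNIV" and E: "E \<in> sets borel"
  shows "prob (A \<inter> {w \<in> space P. emeasure w B \<in> E}) = prob A * prob {w \<in> space P. emeasure w B \<in> E}"
proof -
  have C: "{w \<in> space P. emeasure w B \<in> E} \<in> events" (is "?C \<in> _")
    using measurable_sets[OF emeasure_count_measurable[OF B(1)] E] by (simp add: vimage_def Int_def conj_commute)
  have cs: "sigma_sets configs (past_cyl s) \<subseteq> events"
    unfolding sets_P
  proof (rule sets.sigma_sets_subset')
    show "past_cyl s \<subseteq> sets config_space"
    proof
      fix a assume "a \<in> past_cyl s"
      then obtain m :: nat and R F where a: "a = {w \<in> configs. \<forall>i<m. emeasure w (R i) \<in> F i}"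
        and *: "\<forall>i<m. (\<exists>S B. R i = S \<times> B \<and> S \<in> sets borel \<and> S \<subseteq> {..s} \<and> B \<in> sets borel \<and> B \<subseteq> {0..}) \<and> F i \<in> sets borel"
        unfolding past_cyl_def by blast
      have "{w \<in> space config_space. \<forall>i\<in>{..<m}. emeasure w (R i) \<in> F i} \<in> sets config_space"
      proof (rule sets.sets_Collect_finite_All)
        fix i assume "i \<in> {..<m}"
        then obtain S B where "R i = S \<times> B" "S \<in> sets borel" "B \<in> sets borel" "B \<subseteq> {0..}" "F i \<in> sets borel"
          using * by blast
        then have "R i \<in> sets half_plane" "F i \<in> sets borel" using Times_half_plane by auto
        then have "(\<lambda>w. emeasure w (R i)) -` F i \<inter> space config_space \<in> sets config_space"
          by (intro measurable_sets[OF measurable_emeasure_config])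
        moreover have "(\<lambda>w. emeasure w (R i)) -` F i \<inter> space config_space = {w \<in> space config_space. emeasure w (R i) \<in> F i}"
          by blast
        ultimately show "{w \<in> space config_space. emeasure w (R i) \<in> F i} \<in> sets config_space"
          by (simp only:)
      qed auto
      then show "a \<in> sets config_space" by (simp only: a space_config_space Ball_def lessThan_iff)
    qed
    show "configs \<in> sets config_space" using sets.top[of config_space] by (simp add: space_config_space)
  qed
  from Int_stable_past_cyl past_cyl_closed set_mp[OF sets_past_cyl A]
  show ?thesis
  proof (induction rule: sigma_sets_induct_disjoint)
    case (basic A) then show ?case using past_cyl_indep B E by blast
  next
    case empty then show ?case by simp
  next
    case (compl A)
    then have A: "A \<in> events" using cs by auto
    have "(configs - A) \<inter> ?C = ?C - (A \<inter> ?C)" by (auto simp: space_P)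
    then have "prob ((configs - A) \<inter> ?C) = prob ?C - prob (A \<inter> ?C)"
      using A C by (simp add: finite_measure_Diff)
    moreover have "prob (configs - A) = 1 - prob A" using prob_compl[OF A] by (simp add: space_P)
    ultimately show ?case using compl(2) by (simp add: left_diff_distrib)
  next
    case (union A)
    then have A: "A i \<in> events" for i using cs by auto
    have "(\<lambda>i. prob (A i \<inter> ?C)) sums prob (\<Union>i. A i \<inter> ?C)"
      using A C union(1) by (intro finite_measure_UNION) (auto simp: disjoint_family_on_def)
    moreover have "(\<lambda>i. prob (A i) * prob ?C) sums (prob (\<Union>i. A i) * prob ?C)"
      using A union(1) by (intro sums_mult2 finite_measure_UNION) auto
    ultimately show ?case using union(3) by (simp add: sums_unique2)
  qed
qed

text \<open>The expectation is summed over the values \<open>k\<close> of the count, so that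
  independence is applied to events; the Poisson mean then replaces the count by the
  intensity.\<close>

lemma nn_integral_count_past:
  assumes A: "A \<in> sets (past s)" and B: "B \<in> sets half_plane" "B \<subseteq> {s<..} \<times> UNIV" "bounded B"
  shows "(\<integral>\<^sup>+w. indicator A w * emeasure w B \<partial>P) = emeasure P A * emeasure half_plane B"
proof -
  let ?C = "\<lambda>k::nat. {w \<in> space P. emeasure w B = of_nat k}"
  have AP: "A \<in> events" using past_config[OF A] by (simp add: sets_P)
  have C: "?C k \<in> events" for k
    using measurable_sets[OF emeasure_count_measurable[OF B(1)], of "{of_nat k}"] by (simp add: vimage_def Int_def conj_commute)
  let ?x = "measure half_plane B"
  have "(\<integral>\<^sup>+w. indicator A w * emeasure w B \<partial>P) = (\<integral>\<^sup>+w. (\<Sum>k. of_nat k * indicator (A \<inter> ?C k) w) \<partial>P)"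
  proof (rule nn_integral_cong)
    fix w assume w: "w \<in> space P"
    then obtain n where n: "emeasure w B = of_nat n" using count_nat[OF _ B(1,3)] by (auto simp: space_P elim!: Nats_cases)
    have "(\<Sum>k. of_nat k * indicator (A \<inter> ?C k) w) = (\<Sum>k\<in>{n}. of_nat k * indicator (A \<inter> ?C k) w :: ennreal)"
      using w n by (intro suminf_finite) (auto simp: indicator_def)
    then show "indicator A w * emeasure w B = (\<Sum>k. of_nat k * indicator (A \<inter> ?C k) w)"
      using w n by (auto simp: indicator_def)
  qed
  also have "\<dots> = (\<Sum>k. of_nat k * emeasure P (A \<inter> ?C k))"
    using AP C by (subst nn_integral_suminf) (auto simp: nn_integral_cmult_indicator)
  also have "\<dots> = (\<Sum>k. ennreal (prob A) * ennreal (real k * (exp (- ?x) * ?x ^ k / fact k)))"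
  proof (rule arg_cong[where f = suminf], rule ext)
    fix k
    have "prob (A \<inter> ?C k) = prob A * prob (?C k)" using past_indep[OF A B(1,2), of "{of_nat k}"] by simp
    then have "emeasure P (A \<inter> ?C k) = ennreal (prob A * (exp (- ?x) * ?x ^ k / fact k))"
      using prob_count[OF B(1,3)] by (simp add: emeasure_eq_measure)
    then show "of_nat k * emeasure P (A \<inter> ?C k) = ennreal (prob A) * ennreal (real k * (exp (- ?x) * ?x ^ k / fact k))"
      by (simp add: ennreal_mult[symmetric] ennreal_of_nat_eq_real_of_nat mult_ac del: ennreal_mult')
  qed
  also have "\<dots> = ennreal (prob A) * (\<Sum>k. ennreal (real k * (exp (- ?x) * ?x ^ k / fact k)))" by simp
  also have "(\<Sum>k. ennreal (real k * (exp (- ?x) * ?x ^ k / fact k))) = ennreal ?x"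
    using sums_poisson_mean[of ?x] by (subst suminf_ennreal2) (auto simp: sums_iff)
  also have "ennreal ?x = emeasure half_plane B"
    using half_plane_finite[OF B(1,3)] by (simp add: emeasure_eq_ennreal_measure less_top)
  finally show ?thesis by (simp add: emeasure_eq_measure)
qed

end

section \<open>Products of integrals, split by the order in time\<close>

abbreviation "Sint \<equiv> kint (\<lambda>w. w)"
abbreviation "Aint \<equiv> kint (\<lambda>_. half_plane)"

text \<open>The two variables are compared by their times: earlier, later or equal. In each ordered
  part the inner integral stops strictly before the outer time, hence is predictable there.\<close>

lemma nn_integral_product_split:
  fixes \<alpha> \<beta> :: config
  assumes \<alpha>: "sigma_finite_measure \<alpha>" "sets \<alpha> = sets half_plane"
    and \<beta>: "sigma_finite_measure \<beta>" "sets \<beta> = sets half_plane"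
    and F: "F \<in> borel_measurable half_plane" and G: "G \<in> borel_measurable half_plane"
  shows "(\<integral>\<^sup>+z. F z \<partial>\<alpha>) * (\<integral>\<^sup>+z. G z \<partial>\<beta>) =
    (\<integral>\<^sup>+z'. G z' * (\<integral>\<^sup>+z. F z * indicator {..<fst z'} (fst z) \<partial>\<alpha>) \<partial>\<beta>) +
    (\<integral>\<^sup>+z. F z * (\<integral>\<^sup>+z'. G z' * indicator {..<fst z} (fst z') \<partial>\<beta>) \<partial>\<alpha>) +
    (\<integral>\<^sup>+z. F z * (\<integral>\<^sup>+z'. G z' * indicator {fst z} (fst z') \<partial>\<beta>) \<partial>\<alpha>)"
proof -
  interpret A: sigma_finite_measure \<alpha> by fact
  interpret B: sigma_finite_measure \<beta> by fact
  interpret pair_sigma_finite \<alpha> \<beta> ..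
  have ms: "measurable \<alpha> = measurable half_plane" "measurable \<beta> = measurable half_plane"
    using measurable_cong_sets[OF \<alpha>(2) refl] measurable_cong_sets[OF \<beta>(2) refl] by (auto simp: fun_eq_iff)
  have F': "F \<in> borel_measurable \<alpha>" and G': "G \<in> borel_measurable \<beta>" using F G by (auto simp: ms)
  have f1: "fst \<in> borel_measurable \<alpha>" "fst \<in> borel_measurable \<beta>" by (auto simp: ms)
  note [measurable] = F' G' f1
  have "(\<integral>\<^sup>+z. F z \<partial>\<alpha>) * (\<integral>\<^sup>+z. G z \<partial>\<beta>) = (\<integral>\<^sup>+z. (\<integral>\<^sup>+z'. F z * G z' \<partial>\<beta>) \<partial>\<alpha>)"
    by (simp add: nn_integral_cmult nn_integral_multc)
  also have "\<dots> = (\<integral>\<^sup>+z. (\<integral>\<^sup>+z'. F z * G z' * indicator {..<fst z'} (fst z) \<partial>\<beta>) +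
     (\<integral>\<^sup>+z'. F z * (G z' * indicator {..<fst z} (fst z')) \<partial>\<beta>) +
     (\<integral>\<^sup>+z'. F z * (G z' * indicator {fst z} (fst z')) \<partial>\<beta>) \<partial>\<alpha>)"
  proof (rule nn_integral_cong)
    fix z
    have "(\<integral>\<^sup>+z'. F z * G z' \<partial>\<beta>) = (\<integral>\<^sup>+z'. F z * G z' * indicator {..<fst z'} (fst z) + F z * (G z' * indicator {..<fst z} (fst z')) + F z * (G z' * indicator {fst z} (fst z')) \<partial>\<beta>)"
      by (rule nn_integral_cong) (auto simp: indicator_def)
    also have "\<dots> = (\<integral>\<^sup>+z'. F z * G z' * indicator {..<fst z'} (fst z) \<partial>\<beta>) +
     (\<integral>\<^sup>+z'. F z * (G z' * indicator {..<fst z} (fst z')) \<partial>\<beta>) +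
     (\<integral>\<^sup>+z'. F z * (G z' * indicator {fst z} (fst z')) \<partial>\<beta>)"
      by (simp add: nn_integral_add indicator_def)
    finally show "(\<integral>\<^sup>+z'. F z * G z' \<partial>\<beta>) = \<dots>" .
  qed
  also have "\<dots> = (\<integral>\<^sup>+z. (\<integral>\<^sup>+z'. F z * G z' * indicator {..<fst z'} (fst z) \<partial>\<beta>) \<partial>\<alpha>) +
     (\<integral>\<^sup>+z. (\<integral>\<^sup>+z'. F z * (G z' * indicator {..<fst z} (fst z')) \<partial>\<beta>) \<partial>\<alpha>) +
     (\<integral>\<^sup>+z. (\<integral>\<^sup>+z'. F z * (G z' * indicator {fst z} (fst z')) \<partial>\<beta>) \<partial>\<alpha>)"
    by (simp add: nn_integral_add indicator_def)
  also have "(\<integral>\<^sup>+z. (\<integral>\<^sup>+z'. F z * G z' * indicator {..<fst z'} (fst z) \<partial>\<beta>) \<partial>\<alpha>) =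
     (\<integral>\<^sup>+z'. (\<integral>\<^sup>+z. F z * G z' * indicator {..<fst z'} (fst z) \<partial>\<alpha>) \<partial>\<beta>)"
    by (rule Fubini'[symmetric]) (simp add: indicator_def)
  also have "\<dots> = (\<integral>\<^sup>+z'. G z' * (\<integral>\<^sup>+z. F z * indicator {..<fst z'} (fst z) \<partial>\<alpha>) \<partial>\<beta>)"
    by (subst nn_integral_cmult[symmetric]) (auto simp: mult_ac indicator_def)
  also have "(\<integral>\<^sup>+z. (\<integral>\<^sup>+z'. F z * (G z' * indicator {..<fst z} (fst z')) \<partial>\<beta>) \<partial>\<alpha>) =
     (\<integral>\<^sup>+z. F z * (\<integral>\<^sup>+z'. G z' * indicator {..<fst z} (fst z') \<partial>\<beta>) \<partial>\<alpha>)"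
    by (subst nn_integral_cmult) (auto simp: indicator_def)
  also have "(\<integral>\<^sup>+z. (\<integral>\<^sup>+z'. F z * (G z' * indicator {fst z} (fst z')) \<partial>\<beta>) \<partial>\<alpha>) =
     (\<integral>\<^sup>+z. F z * (\<integral>\<^sup>+z'. G z' * indicator {fst z} (fst z') \<partial>\<beta>) \<partial>\<alpha>)"
    by (subst nn_integral_cmult) (auto simp: indicator_def)
  finally show ?thesis .
qed

text \<open>The inner integral up to the time of \<open>x\<close>, read as an integrand, so that the
  compensation formula applies to the outer integral of an iterated one.\<close>

definition low :: "(config \<Rightarrow> config) \<Rightarrow> ((real \<times> config) \<times> real \<Rightarrow> ennreal) \<Rightarrow> (real \<times> config) \<times> real \<Rightarrow> ennreal" where
  "low \<kappa> f x = kint \<kappa> f (fst (fst x)) (snd (fst x))"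

lemma low_measurable [measurable]:
  assumes "adapted_kernel \<kappa>" "f \<in> borel_measurable marked"
  shows "low \<kappa> f \<in> borel_measurable marked"
  using measurable_compose[OF measurable_fst[of predictable "borel :: real measure"] kint_predictable[OF assms]]
  by (simp add: low_def[abs_def] marked_def split_beta)

lemma kint_product:
  assumes \<kappa>: "adapted_kernel \<kappa>" "adapted_kernel \<kappa>'" and f: "f \<in> borel_measurable marked" "g \<in> borel_measurable marked"
    and w: "w \<in> configs"
  shows "kint \<kappa> f s w * kint \<kappa>' g s w = kint \<kappa>' (\<lambda>x. g x * low \<kappa> f x) s w + kint \<kappa> (\<lambda>x. f x * low \<kappa>' g x) s w +
    (\<integral>\<^sup>+z. f (mark w z) * indicator {0<..<s} (fst z) * (\<integral>\<^sup>+z'. g (mark w z') * indicator {0<..<s} (fst z') * indicator {fst z} (fst z') \<partial>\<kappa>' w) \<partial>\<kappa> w)"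
proof -
  note k = adapted_kernelD[OF \<kappa>(1) w] and k' = adapted_kernelD[OF \<kappa>(2) w]
  have m: "(\<lambda>z. f (mark w z) * indicator {0<..<s} (fst z)) \<in> borel_measurable half_plane"
      "(\<lambda>z. g (mark w z) * indicator {0<..<s} (fst z)) \<in> borel_measurable half_plane"
    using measurable_mark_comp[OF f(1) w] measurable_mark_comp[OF f(2) w] by (auto simp: indicator_def)
  have *: "(\<integral>\<^sup>+z. F (mark w z) * indicator {0<..<s} (fst z) * indicator {..<r} (fst z) \<partial>\<nu>) = (\<integral>\<^sup>+z. F (mark w z) * indicator {0<..<r} (fst z) \<partial>\<nu>)"
    if "r < s" for r and F :: "(real \<times> config) \<times> real \<Rightarrow> ennreal" and \<nu> :: config
    using that by (intro nn_integral_cong) (auto simp: indicator_def)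
  have "kint \<kappa>' (\<lambda>x. g x * low \<kappa> f x) s w = (\<integral>\<^sup>+z'. g (mark w z') * indicator {0<..<s} (fst z') * (\<integral>\<^sup>+z. f (mark w z) * indicator {0<..<s} (fst z) * indicator {..<fst z'} (fst z) \<partial>\<kappa> w) \<partial>\<kappa>' w)"
    unfolding kint_def low_def using *[where F = f and \<nu> = "\<kappa> w"] by (intro nn_integral_cong) (auto simp: indicator_def kint_def)
  moreover have "kint \<kappa> (\<lambda>x. f x * low \<kappa>' g x) s w = (\<integral>\<^sup>+z. f (mark w z) * indicator {0<..<s} (fst z) * (\<integral>\<^sup>+z'. g (mark w z') * indicator {0<..<s} (fst z') * indicator {..<fst z} (fst z') \<partial>\<kappa>' w) \<partial>\<kappa> w)"
    unfolding kint_def low_def using *[where F = g and \<nu> = "\<kappa>' w"] by (intro nn_integral_cong) (auto simp: indicator_def kint_def)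
  ultimately show ?thesis
    using nn_integral_product_split[OF k(3,1) k'(3,1) m] by (simp add: kint_def)
qed

lemma kint_cong:
  "(\<And>z. 0 < fst z \<Longrightarrow> fst z < s \<Longrightarrow> 0 \<le> snd z \<Longrightarrow> f (mark w z) = g (mark w z)) \<Longrightarrow> adapted_kernel \<kappa> \<Longrightarrow> w \<in> configs \<Longrightarrow> kint \<kappa> f s w = kint \<kappa> g s w"
  unfolding kint_def by (intro nn_integral_cong) (auto simp: indicator_def adapted_kernelD(2))

lemma kint_cmult:
  assumes "adapted_kernel \<kappa>" "f \<in> borel_measurable marked" "w \<in> configs"
  shows "kint \<kappa> (\<lambda>x. c * f x) s w = c * kint \<kappa> f s w"
  using measurable_mark_comp[OF assms(2,3)] unfolding kint_def
  by (subst nn_integral_cmult[symmetric])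
     (auto simp: mult.assoc measurable_cong_sets[OF adapted_kernelD(1)[OF assms(1,3)] refl] indicator_def)

lemma kint_add:
  assumes "adapted_kernel \<kappa>" "f \<in> borel_measurable marked" "g \<in> borel_measurable marked" "w \<in> configs"
  shows "kint \<kappa> (\<lambda>x. f x + g x) s w = kint \<kappa> f s w + kint \<kappa> g s w"
  using measurable_mark_comp[OF assms(2,4)] measurable_mark_comp[OF assms(3,4)] unfolding kint_def
  by (subst nn_integral_add[symmetric])
     (auto simp: distrib_right measurable_cong_sets[OF adapted_kernelD(1)[OF assms(1,4)] refl] indicator_def)

lemma kint_SUP:
  assumes "adapted_kernel \<kappa>" "\<And>i. f i \<in> borel_measurable marked" "w \<in> configs" "incseq f"
  shows "kint \<kappa> (\<lambda>x. SUP i. f i x) s w = (SUP i::nat. kint \<kappa> (f i) s w)"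
proof -
  have "kint \<kappa> (\<lambda>x. SUP i. f i x) s w = (\<integral>\<^sup>+z. (SUP i. f i (mark w z) * indicator {0<..<s} (fst z)) \<partial>\<kappa> w)"
    unfolding kint_def by (auto simp: SUP_mult_right_ennreal intro!: nn_integral_cong)
  also have "\<dots> = (SUP i. kint \<kappa> (f i) s w)"
    unfolding kint_def using assms(4) measurable_mark_comp[OF assms(2,3)]
    by (intro nn_integral_monotone_convergence_SUP)
       (auto simp: mark_def incseq_def le_fun_def measurable_cong_sets[OF adapted_kernelD(1)[OF assms(1,3)] refl] indicator_def)
  finally show ?thesis .
qed

lemma kint_measurable_config:
  assumes "adapted_kernel \<kappa>" "f \<in> borel_measurable marked"
  shows "(\<lambda>w. kint \<kappa> f s w) \<in> borel_measurable config_space"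
  using measurable_compose[OF measurable_const_time kint_predictable[OF assms]] by simp

lemma kint_mono:
  assumes "\<And>z. 0 < fst z \<Longrightarrow> fst z < s \<Longrightarrow> 0 \<le> snd z \<Longrightarrow> f (mark w z) \<le> g (mark w z)" "adapted_kernel \<kappa>" "w \<in> configs"
  shows "kint \<kappa> f s w \<le> kint \<kappa> g s w"
  unfolding kint_def using assms adapted_kernelD(2)[OF assms(2,3)]
  by (intro nn_integral_mono) (auto simp: indicator_def)

section \<open>The compensation formula\<close>

context poisson
begin

lemma kint_measurable_P [measurable]:
  "adapted_kernel \<kappa> \<Longrightarrow> f \<in> borel_measurable marked \<Longrightarrow> (\<lambda>w. kint \<kappa> f s w) \<in> borel_measurable P"
  by (rule measurable_P[OF kint_measurable_config])

text \<open>On generators this is the independence of a future count from the past. Dynkin's theorem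
  does the rest; its complement step cancels an expectation that is finite by the truncation in
  \<open>cut\<close>.\<close>

lemma compensation_cut:
  assumes G: "G \<in> sets marked"
  shows "(\<integral>\<^sup>+w. emeasure w (cut G n s w) \<partial>P) = (\<integral>\<^sup>+w. emeasure half_plane (cut G n s w) \<partial>P)"
proof -
  have cl: "{R \<times> B |R B. R \<in> predictable_gen \<and> B \<in> sets (borel :: real measure)} \<subseteq> Pow (space marked)"
    using predictable_gen_closed by (auto simp: space_marked)
  let ?Q = "\<lambda>G. (\<integral>\<^sup>+w. emeasure w (cut G n s w) \<partial>P) = (\<integral>\<^sup>+w. emeasure half_plane (cut G n s w) \<partial>P)"
  have rect: "?Q (R \<times> B)" if R: "R \<in> predictable_gen" and B: "B \<in> sets borel" for R B
    using R
  proof (cases rule: predictable_genE)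
    case (1 S)
    then have "cut (R \<times> B) n s w = {}" for w by (auto simp: cut_def mark_def)
    then show ?thesis by simp
  next
    case (2 a b A)
    define Z where "Z = {r. a < r \<and> r \<le> b \<and> r < s} \<times> (B \<inter> {0..real n})"
    have Zm: "Z \<in> sets half_plane" unfolding Z_def using B by (intro Times_half_plane) auto
    have Zb: "bounded Z" by (rule bounded_subset[OF bounded_strip[OF order_refl, of a b n]]) (auto simp: Z_def)
    have Zs: "Z \<subseteq> {a<..} \<times> UNIV" by (auto simp: Z_def)
    have c: "cut (R \<times> B) n s w = (if w \<in> A then Z else {})" for w
      using 2 by (auto simp: cut_def mark_def Z_def space_half_plane)
    have "(\<integral>\<^sup>+w. emeasure w (cut (R \<times> B) n s w) \<partial>P) = (\<integral>\<^sup>+w. indicator A w * emeasure w Z \<partial>P)"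
      by (rule nn_integral_cong) (simp add: c)
    also have "\<dots> = emeasure P A * emeasure half_plane Z"
      by (rule nn_integral_count_past[OF 2(3) Zm Zs Zb])
    also have "\<dots> = (\<integral>\<^sup>+w. indicator A w * emeasure half_plane Z \<partial>P)"
      using past_config[OF 2(3)] by (subst nn_integral_multc) (auto simp: sets_P intro!: borel_measurable_indicator)
    also have "\<dots> = (\<integral>\<^sup>+w. emeasure half_plane (cut (R \<times> B) n s w) \<partial>P)"
      by (rule nn_integral_cong) (simp add: c)
    finally show ?thesis .
  qed
  have gen: "{0<..s} \<times> configs \<in> predictable_gen"
    using predictable_gen_rect[of 0 configs] sets.top[of "past 0"] by (simp add: space_past)
  have top: "?Q (space marked)"
  proof -
    have "cut (space marked) n s w = cut (({0<..s} \<times> configs) \<times> UNIV) n s w" for w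
      by (auto simp: cut_def mark_def space_marked)
    then show ?thesis using rect[OF gen, of UNIV] by simp
  qed
  have meas: "(\<lambda>w. emeasure (\<kappa> w) (cut G n s w)) \<in> borel_measurable P"
    if "adapted_kernel \<kappa>" "G \<in> sets marked" for \<kappa> G
    using measurable_compose[OF measurable_const_time cut_predictable[OF that]] by (intro measurable_P) simp
  note k1 = adapted_kernel_config and k2 = adapted_kernel_half_plane
  have fin: "(\<integral>\<^sup>+w. emeasure half_plane (cut G n s w) \<partial>P) < \<infinity>" for G
  proof -
    have D: "{0<..s} \<times> {0..real n} \<in> sets half_plane" by (rule Times_half_plane) auto
    have "(\<integral>\<^sup>+w. emeasure half_plane (cut G n s w) \<partial>P) \<le> (\<integral>\<^sup>+w. emeasure half_plane ({0<..s} \<times> {0..real n}) \<partial>P)"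
      using D by (intro nn_integral_mono emeasure_mono) (auto simp: cut_def space_half_plane)
    also have "\<dots> < \<infinity>" using half_plane_finite[OF D bounded_strip[OF order_refl]] by (simp add: emeasure_space_1)
    finally show ?thesis .
  qed
  have sub: "cut A n s w \<subseteq> cut (space marked) n s w" if "A \<in> sets marked" for A w
    using sets.sets_into_space[OF that] by (auto simp: cut_def)
  have csplit: "(\<integral>\<^sup>+w. emeasure (\<kappa> w) (cut (space marked) n s w) \<partial>P) =
      (\<integral>\<^sup>+w. emeasure (\<kappa> w) (cut (space marked - A) n s w) \<partial>P) + (\<integral>\<^sup>+w. emeasure (\<kappa> w) (cut A n s w) \<partial>P)"
    if \<kappa>: "adapted_kernel \<kappa>" and A: "A \<in> sets marked" for \<kappa> A
  proof -
    have A': "space marked - A \<in> sets marked" using A by auto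
    have "(\<integral>\<^sup>+w. emeasure (\<kappa> w) (cut (space marked) n s w) \<partial>P) = (\<integral>\<^sup>+w. emeasure (\<kappa> w) (cut (space marked - A) n s w) + emeasure (\<kappa> w) (cut A n s w) \<partial>P)"
    proof (rule nn_integral_cong)
      fix w assume "w \<in> space P" then have w: "w \<in> configs" by (simp add: space_P)
      have "cut (space marked) n s w = cut (space marked - A) n s w \<union> cut A n s w"
        using sub[OF A] by (auto simp: cut_def)
      then show "emeasure (\<kappa> w) (cut (space marked) n s w) = emeasure (\<kappa> w) (cut (space marked - A) n s w) + emeasure (\<kappa> w) (cut A n s w)"
        using cut_sets[OF A w] cut_sets[OF A' w] adapted_kernelD(1)[OF \<kappa> w]
        by (subst plus_emeasure) (auto simp: cut_def)
    qed
    also have "\<dots> = (\<integral>\<^sup>+w. emeasure (\<kappa> w) (cut (space marked - A) n s w) \<partial>P) + (\<integral>\<^sup>+w. emeasure (\<kappa> w) (cut A n s w) \<partial>P)"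
      by (intro nn_integral_add meas \<kappa> A A')
    finally show ?thesis .
  qed
  from Int_stable_marked cl G[unfolded sets_marked] show ?thesis
  proof (induction rule: sigma_sets_induct_disjoint)
    case (basic A)
    then show ?case using rect by auto
  next
    case empty
    then show ?case by (simp add: cut_def)
  next
    case (compl A)
    then have A: "A \<in> sets marked" by (simp add: sets_marked)
    show ?case
      using csplit[OF k1 A] csplit[OF k2 A] top compl(2) fin[of A] by (auto simp: ennreal_add_left_cancel add.commute)
  next
    case (union A)
    then have A: "A i \<in> sets marked" for i unfolding sets_marked by auto
    have "(\<integral>\<^sup>+w. emeasure (\<kappa> w) (cut (\<Union>i. A i) n s w) \<partial>P) = (\<Sum>i. \<integral>\<^sup>+w. emeasure (\<kappa> w) (cut (A i) n s w) \<partial>P)"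
      if \<kappa>: "adapted_kernel \<kappa>" for \<kappa>
    proof -
      have "(\<integral>\<^sup>+w. emeasure (\<kappa> w) (cut (\<Union>i. A i) n s w) \<partial>P) = (\<integral>\<^sup>+w. (\<Sum>i. emeasure (\<kappa> w) (cut (A i) n s w)) \<partial>P)"
      proof (rule nn_integral_cong)
        fix w assume "w \<in> space P" then have w: "w \<in> configs" by (simp add: space_P)
        show "emeasure (\<kappa> w) (cut (\<Union>i. A i) n s w) = (\<Sum>i. emeasure (\<kappa> w) (cut (A i) n s w))"
          unfolding cut_disjoint_UN
          using union(1) cut_sets[OF A w] adapted_kernelD(1)[OF \<kappa> w]
          by (intro suminf_emeasure[symmetric]) (auto simp: disjoint_family_on_def cut_def)
      qed
      also have "\<dots> = (\<Sum>i. \<integral>\<^sup>+w. emeasure (\<kappa> w) (cut (A i) n s w) \<partial>P)"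
        by (intro nn_integral_suminf meas \<kappa> A)
      finally show ?thesis .
    qed
    from this[OF k1] this[OF k2] union(3) show ?case by simp
  qed
qed

text \<open>Predictability is the reason: the value of \<open>h\<close> at a point is fixed before
  the point occurs. Both sides may be infinite.\<close>

theorem compensation:
  assumes h: "h \<in> borel_measurable marked"
  shows "(\<integral>\<^sup>+w. Sint h s w \<partial>P) = (\<integral>\<^sup>+w. Aint h s w \<partial>P)"
proof -
  note k1 = adapted_kernel_config and k2 = adapted_kernel_half_plane
  note km = kint_measurable_P
  from h show ?thesis
  proof (induction rule: borel_measurable_induct)
    case (cong f g)
    have "kint \<kappa> f s w = kint \<kappa> g s w" if "w \<in> space P" for s w \<kappa>
      unfolding kint_def using cong(3) that by (intro nn_integral_cong) (auto simp: space_P space_marked mark_def)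
    then have "(\<integral>\<^sup>+w. kint \<kappa> f s w \<partial>P) = (\<integral>\<^sup>+w. kint \<kappa> g s w \<partial>P)" for \<kappa> by (intro nn_integral_cong)
    then show ?case using cong.IH by simp
  next
    case (set A)
    have "(\<integral>\<^sup>+w. kint \<kappa> (indicator A) s w \<partial>P) = (SUP n. \<integral>\<^sup>+w. emeasure (\<kappa> w) (cut A n s w) \<partial>P)"
      if \<kappa>: "adapted_kernel \<kappa>" for \<kappa>
    proof -
      have "(\<integral>\<^sup>+w. kint \<kappa> (indicator A) s w \<partial>P) = (\<integral>\<^sup>+w. (SUP n. emeasure (\<kappa> w) (cut A n s w \<inter> {x. w \<in> configs})) \<partial>P)"
        using kint_indicator[OF \<kappa> _ set] by (intro nn_integral_cong) (auto simp: space_P)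
      also have "\<dots> = (SUP n. \<integral>\<^sup>+w. emeasure (\<kappa> w) (cut A n s w \<inter> {x. w \<in> configs}) \<partial>P)"
      proof (rule nn_integral_monotone_convergence_SUP)
        show "incseq (\<lambda>n w. emeasure (\<kappa> w) (cut A n s w \<inter> {x. w \<in> configs}))"
        proof (intro incseq_SucI le_funI)
          fix n w
          show "emeasure (\<kappa> w) (cut A n s w \<inter> {x. w \<in> configs}) \<le> emeasure (\<kappa> w) (cut A (Suc n) s w \<inter> {x. w \<in> configs})"
          proof (cases "w \<in> configs")
            case True
            have "emeasure (\<kappa> w) (cut A n s w) \<le> emeasure (\<kappa> w) (cut A (Suc n) s w)"
            proof (rule emeasure_mono)
              show "cut A n s w \<subseteq> cut A (Suc n) s w" by (auto simp: cut_def)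
            qed (simp add: cut_sets[OF set True] adapted_kernelD(1)[OF \<kappa> True])
            then show ?thesis using True by simp
          qed simp
        qed
        show "(\<lambda>w. emeasure (\<kappa> w) (cut A n s w \<inter> {x. w \<in> configs})) \<in> borel_measurable P" for n
          using measurable_P[OF measurable_compose[OF measurable_const_time cut_predictable[OF \<kappa> set]]]
          by (subst measurable_cong[where g = "\<lambda>w. emeasure (\<kappa> w) (cut A n s w)"]) (auto simp: space_P)
      qed
      also have "\<dots> = (SUP n. \<integral>\<^sup>+w. emeasure (\<kappa> w) (cut A n s w) \<partial>P)"
        by (intro SUP_cong refl nn_integral_cong) (auto simp: space_P)
      finally show ?thesis .
    qed
    from this[OF k1] this[OF k2] compensation_cut[OF set] show ?case by simp
  next
    case (mult u c)
    have "(\<integral>\<^sup>+w. kint \<kappa> (\<lambda>x. c * u x) s w \<partial>P) = c * (\<integral>\<^sup>+w. kint \<kappa> u s w \<partial>P)" if \<kappa>: "adapted_kernel \<kappa>" for \<kappa>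
      using kint_cmult[OF \<kappa> mult(2)] km[OF \<kappa> mult(2)]
      by (subst nn_integral_cmult[symmetric]) (auto simp: space_P intro!: nn_integral_cong)
    from this[OF k1] this[OF k2] mult.IH show ?case by simp
  next
    case (add u v)
    have "(\<integral>\<^sup>+w. kint \<kappa> (\<lambda>x. v x + u x) s w \<partial>P) = (\<integral>\<^sup>+w. kint \<kappa> v s w \<partial>P) + (\<integral>\<^sup>+w. kint \<kappa> u s w \<partial>P)" if \<kappa>: "adapted_kernel \<kappa>" for \<kappa>
      using kint_add[OF \<kappa> add(3,1)] km[OF \<kappa> add(1)] km[OF \<kappa> add(3)]
      by (subst nn_integral_add[symmetric]) (auto simp: space_P intro!: nn_integral_cong)
    from this[OF k1] this[OF k2] add.IH show ?case by simp
  next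
    case (seq U)
    have "(\<integral>\<^sup>+w. kint \<kappa> (SUP i. U i) s w \<partial>P) = (SUP i. \<integral>\<^sup>+w. kint \<kappa> (U i) s w \<partial>P)" if \<kappa>: "adapted_kernel \<kappa>" for \<kappa>
    proof -
      have "(\<integral>\<^sup>+w. kint \<kappa> (SUP i. U i) s w \<partial>P) = (\<integral>\<^sup>+w. (SUP i. kint \<kappa> (U i) s w) \<partial>P)"
        using kint_SUP[OF \<kappa> seq(1) _ seq(3)] by (intro nn_integral_cong) (auto simp: space_P image_comp SUP_apply[abs_def])
      also have "\<dots> = (SUP i. \<integral>\<^sup>+w. kint \<kappa> (U i) s w \<partial>P)"
      proof (rule nn_integral_monotone_convergence_SUP)
        show "incseq (\<lambda>i w. kint \<kappa> (U i) s w)"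
          using seq(3) unfolding incseq_def le_fun_def kint_def by (auto simp: mark_def intro!: nn_integral_mono mult_right_mono)
      qed (rule km[OF \<kappa> seq(1)])
      finally show ?thesis .
    qed
    from this[OF k1] this[OF k2] show ?case by (simp only: seq.IH)
  qed
qed

end

section \<open>Second moments of compensated integrals\<close>

definition dyadic_cell :: "nat \<Rightarrow> nat \<Rightarrow> nat \<Rightarrow> (real \<times> real) set" where
  "dyadic_cell n K j = {real j / 2 ^ n<..real (Suc j) / 2 ^ n} \<times> {0..real K}"

text \<open>No two points at positive times share their time, expressed through countably many
  counts: for times and marks up to \<open>K\<close> some dyadic partition of time leaves at most
  one point per cell.\<close>

definition separated :: "config \<Rightarrow> bool" where
  "separated w \<longleftrightarrow> (\<forall>K. \<exists>n. \<forall>j<K * 2 ^ n. emeasure w (dyadic_cell n K j) \<le> 1)"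

lemma dyadic_cell_sets: "dyadic_cell n K j \<in> sets half_plane"
  unfolding dyadic_cell_def by (intro Times_half_plane) auto

lemma dyadic_cell_bounded: "bounded (dyadic_cell n K j)"
  unfolding dyadic_cell_def by (rule bounded_strip) auto

lemma emeasure_half_plane_rect:
  assumes "a \<le> b" "0 \<le> c" shows "emeasure half_plane ({a<..b} \<times> {0..c}) = ennreal ((b - a) * c)"
proof -
  have "{a<..b} \<times> {0..c} \<in> sets half_plane" by (rule Times_half_plane) auto
  then have "emeasure half_plane ({a<..b} \<times> {0..c}) = emeasure (lborel \<Otimes>\<^sub>M lborel) ({a<..b} \<times> {0..c})"
    by (simp add: emeasure_half_plane lborel_prod)
  also have "\<dots> = emeasure lborel {a<..b} * emeasure lborel {0..c}"
    by (intro lborel.emeasure_pair_measure_Times) auto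
  also have "\<dots> = ennreal ((b - a) * c)" using assms by (simp add: ennreal_mult)
  finally show ?thesis .
qed

context poisson
begin

text \<open>The bound is quadratic in the area, so the sum over \<open>K * 2 ^ n\<close> dyadic
  cells of area \<open>K / 2 ^ n\<close> still tends to zero.\<close>

lemma prob_two_points:
  assumes B: "B \<in> sets half_plane" "bounded B"
  shows "prob {w \<in> space P. \<not> emeasure w B \<le> 1} \<le> (measure half_plane B)\<^sup>2"
proof -
  let ?x = "measure half_plane B"
  let ?C = "\<lambda>k::nat. {w \<in> space P. emeasure w B = of_nat k}"
  have C: "?C k \<in> events" for k
    using measurable_sets[OF emeasure_count_measurable[OF B(1)], of "{of_nat k}"] by (simp add: vimage_def Int_def conj_commute)
  have "{w \<in> space P. \<not> emeasure w B \<le> 1} \<subseteq> space P - (?C 0 \<union> ?C 1)" by auto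
  then have "prob {w \<in> space P. \<not> emeasure w B \<le> 1} \<le> prob (space P - (?C 0 \<union> ?C 1))"
    using C[of 0] C[of 1] by (intro finite_measure_mono) auto
  also have "\<dots> = 1 - prob (?C 0 \<union> ?C 1)"
    using C[of 0] C[of 1] by (intro prob_compl) auto
  also have "prob (?C 0 \<union> ?C 1) = prob (?C 0) + prob (?C 1)"
    by (intro finite_measure_Union C) auto
  also have "prob (?C 0) = exp (- ?x)" using prob_count[OF B, of 0] by simp
  also have "prob (?C 1) = exp (- ?x) * ?x" using prob_count[OF B, of 1] by simp
  also have "1 - (exp (- ?x) + exp (- ?x) * ?x) \<le> ?x\<^sup>2"
  proof -
    have "(1 - ?x) * (1 + ?x) \<le> exp (- ?x) * (1 + ?x)"
      using exp_ge_add_one_self[of "- ?x"] by (intro mult_right_mono) auto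
    then show ?thesis by (simp add: algebra_simps power2_eq_square)
  qed
  finally show ?thesis .
qed

lemma AE_separated: "AE w in P. separated w"
proof -
  have "AE w in P. \<exists>n. \<forall>j<K * 2 ^ n. emeasure w (dyadic_cell n K j) \<le> 1" for K
  proof -
    let ?bad = "\<lambda>n. \<Union>j\<in>{..<K * 2 ^ n}. {w \<in> space P. \<not> emeasure w (dyadic_cell n K j) \<le> 1}"
    have bm: "{w \<in> space P. \<not> emeasure w (dyadic_cell n K j) \<le> 1} \<in> events" for n j
      using emeasure_count_measurable[OF dyadic_cell_sets[of n K j]] by measurable
    have b: "?bad n \<in> events" for n using bm by auto
    have mc: "measure half_plane (dyadic_cell n K j) = real K / 2 ^ n" for n j
      unfolding dyadic_cell_def measure_def
      by (subst emeasure_half_plane_rect) (auto simp: divide_right_mono diff_divide_distrib[symmetric])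
    have pb: "prob (?bad n) \<le> real K ^ 3 / 2 ^ n" for n
    proof -
      have "prob (?bad n) \<le> (\<Sum>j<K * 2 ^ n. prob {w \<in> space P. \<not> emeasure w (dyadic_cell n K j) \<le> 1})"
        using bm by (intro finite_measure_subadditive_finite) auto
      also have "\<dots> \<le> (\<Sum>j<K * 2 ^ n. (real K / 2 ^ n)\<^sup>2)"
        using prob_two_points[OF dyadic_cell_sets dyadic_cell_bounded, of _ K] by (intro sum_mono) (simp add: mc)
      also have "\<dots> = real K ^ 3 / 2 ^ n" by (simp add: power2_eq_square power3_eq_cube field_simps)
      finally show ?thesis .
    qed
    have "prob (\<Inter>n. ?bad n) \<le> real K ^ 3 / 2 ^ n" for n
    proof -
      have "prob (\<Inter>n. ?bad n) \<le> prob (?bad n)" using b by (intro finite_measure_mono) auto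
      then show ?thesis using pb[of n] by simp
    qed
    moreover have "(\<lambda>n. real K ^ 3 / 2 ^ n) \<longlonglongrightarrow> 0"
      by (rule LIMSEQ_divide_realpow_zero) simp
    ultimately have "prob (\<Inter>n. ?bad n) \<le> 0" by (intro LIMSEQ_le_const[of _ 0]) auto
    then have "prob (\<Inter>n. ?bad n) = 0" using measure_nonneg[of P "\<Inter>n. ?bad n"] by linarith
    moreover have "(\<Inter>n. ?bad n) \<in> events" using b by auto
    ultimately have "(\<Inter>n. ?bad n) \<in> null_sets P" by (auto simp: null_sets_def emeasure_eq_measure)
    then show ?thesis
      by (rule AE_I') auto
  qed
  then have "AE w in P. \<forall>K. \<exists>n. \<forall>j<K * 2 ^ n. emeasure w (dyadic_cell n K j) \<le> 1"
    by (simp add: AE_all_countable)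
  then show ?thesis by (simp add: separated_def)
qed

end

text \<open>A configuration is an integer-valued measure, not a listed set of points. Restricted to
  a cell of mass at most one it takes only the values \<open>0\<close> and \<open>1\<close>, hence
  acts like a Dirac measure. The quantifier over \<open>G\<close> stands inside \<open>AE\<close>,
  so one null set serves all integrands.\<close>

lemma AE_single_point:
  assumes w: "w \<in> configs" and C: "C \<in> sets half_plane" "bounded C" "emeasure w C \<le> 1"
  shows "AE z in w. z \<in> C \<longrightarrow> (\<forall>G\<in>borel_measurable half_plane. (\<integral>\<^sup>+z'. G z' * indicator C z' * indicator {fst z} (fst z') \<partial>w) = G z)"
proof -
  have s: "sets w = sets half_plane" using sets_config[OF w] .
  have vals: "emeasure w A = 0 \<or> emeasure w A = 1" if "A \<in> sets half_plane" "A \<subseteq> C" for A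
  proof -
    have "bounded A" using C(2) that(2) by (rule bounded_subset)
    then have "emeasure w A \<in> \<nat>" using w that(1) by (simp add: configs_def)
    then obtain n where n: "emeasure w A = of_nat n" by (rule Nats_cases)
    have "emeasure w A \<le> emeasure w C" using that C s by (intro emeasure_mono) auto
    then have "of_nat n \<le> (1 :: ennreal)" using C(3) n by (metis order_trans)
    then have "n \<le> 1" by (metis of_nat_1 of_nat_le_iff)
    then have "n = 0 \<or> n = 1" by linarith
    then show ?thesis using n by auto
  qed
  define \<nu> where "\<nu> = density w (indicator C)"
  have ns: "sets \<nu> = sets half_plane" by (simp add: \<nu>_def s)
  have Cs: "C \<in> sets w" using C s by simp
  have ne: "emeasure \<nu> A = emeasure w (A \<inter> C)" if "A \<in> sets half_plane" for A
    using that C s unfolding \<nu>_def by (subst emeasure_density) (auto simp: Int_commute nn_integral_indicator[symmetric] indicator_inter_arith[symmetric] mult.commute simp del: nn_integral_indicator)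
  have fin: "finite_measure \<nu>"
  proof (rule finite_measureI)
    have sp: "space \<nu> = space half_plane" by (rule sets_eq_imp_space_eq[OF ns])
    have "emeasure \<nu> (space \<nu>) = emeasure w C"
      unfolding sp using sets.sets_into_space[OF C(1)] by (simp add: ne Int_absorb1)
    then show "emeasure \<nu> (space \<nu>) \<noteq> \<infinity>" using vals[OF C(1) order_refl] by auto
  qed
  interpret N: finite_measure \<nu> by fact
  interpret NN: pair_sigma_finite \<nu> \<nu> ..
  \<comment> \<open>For a measure with values \<open>0\<close> and \<open>1\<close> the measure of
    an intersection is the product of the measures, so the product measure lives on the
    diagonal.\<close>
  have "\<nu> \<Otimes>\<^sub>M \<nu> = distr \<nu> (\<nu> \<Otimes>\<^sub>M \<nu>) (\<lambda>z. (z, z))"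
  proof (rule pair_measure_eqI)
    fix A B assume AB: "A \<in> sets \<nu>" "B \<in> sets \<nu>"
    let ?A = "A \<inter> C" and ?B = "B \<inter> C"
    have m: "?A \<in> sets half_plane" "?B \<in> sets half_plane" using AB C ns by auto
    have "emeasure w ?A * emeasure w ?B = emeasure w (?A \<inter> ?B)"
    proof (cases "emeasure w ?A = 0 \<or> emeasure w ?B = 0")
      case True
      moreover have "emeasure w (?A \<inter> ?B) \<le> emeasure w ?A" "emeasure w (?A \<inter> ?B) \<le> emeasure w ?B"
        using m s by (auto intro!: emeasure_mono)
      ultimately show ?thesis by auto
    next
      case False
      then have 1: "emeasure w ?A = 1" "emeasure w ?B = 1" using vals[of ?A] vals[of ?B] m by auto
      have "emeasure w ?A + emeasure w ?B = emeasure w (?A \<union> ?B) + emeasure w (?A \<inter> ?B)"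
        using m s by (intro emeasure_Un_Int) auto
      moreover have "emeasure w (?A \<union> ?B) = 0 \<or> emeasure w (?A \<union> ?B) = 1" using m by (intro vals) auto
      moreover have "emeasure w (?A \<inter> ?B) = 0 \<or> emeasure w (?A \<inter> ?B) = 1" using m by (intro vals) auto
      ultimately show ?thesis using 1 by auto
    qed
    moreover have "(A \<inter> B) \<inter> C = ?A \<inter> ?B" by auto
    moreover have "emeasure (distr \<nu> (\<nu> \<Otimes>\<^sub>M \<nu>) (\<lambda>z. (z, z))) (A \<times> B) = emeasure \<nu> (A \<inter> B)"
      using AB sets.sets_into_space[OF AB(1)] by (subst emeasure_distr) (auto intro!: arg_cong2[where f = emeasure])
    ultimately show "emeasure \<nu> A * emeasure \<nu> B = emeasure (distr \<nu> (\<nu> \<Otimes>\<^sub>M \<nu>) (\<lambda>z. (z, z))) (A \<times> B)"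
      using AB ns by (simp add: ne)
  qed (auto intro: N.sigma_finite_measure_axioms)
  have id: "(\<lambda>z. z) \<in> measurable \<nu> borel"
  proof (rule measurableI)
    fix A :: "(real \<times> real) set" assume "A \<in> sets borel"
    moreover have "UNIV \<times> {0..} \<in> sets (borel :: (real \<times> real) measure)"
      by (intro borel_closed closed_Times) auto
    ultimately have "A \<inter> (UNIV \<times> {0..}) \<in> sets half_plane"
      by (simp add: sets_half_plane_iff)
    moreover have "space \<nu> = UNIV \<times> {0..}" using space_config[OF w] by (simp add: \<nu>_def)
    ultimately show "(\<lambda>z. z) -` A \<inter> space \<nu> \<in> sets \<nu>" by (simp add: ns)
  qed auto
  let ?D = "{p \<in> space (\<nu> \<Otimes>\<^sub>M \<nu>). fst p \<noteq> snd p}"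
  have Dm: "?D \<in> sets (\<nu> \<Otimes>\<^sub>M \<nu>)"
    using measurable_compose[OF measurable_fst id] measurable_compose[OF measurable_snd id] by measurable
  have "emeasure (\<nu> \<Otimes>\<^sub>M \<nu>) ?D = emeasure (distr \<nu> (\<nu> \<Otimes>\<^sub>M \<nu>) (\<lambda>z. (z, z))) ?D"
    using \<open>\<nu> \<Otimes>\<^sub>M \<nu> = distr \<nu> (\<nu> \<Otimes>\<^sub>M \<nu>) (\<lambda>z. (z, z))\<close> by simp
  also have "\<dots> = 0" using Dm by (subst emeasure_distr) auto
  finally have "AE p in \<nu> \<Otimes>\<^sub>M \<nu>. fst p = snd p" using Dm by (intro AE_I'[of ?D]) (auto simp: null_sets_def)
  then have "AE z in \<nu>. AE z' in \<nu>. z = z'"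
    using NN.AE_pair[of "\<lambda>p. fst p = snd p"] by simp
  moreover have "0 < (indicator C z :: ennreal) \<longleftrightarrow> z \<in> C" for z by (cases "z \<in> C") auto
  ultimately have "AE z in w. z \<in> C \<longrightarrow> (AE z' in w. z' \<in> C \<longrightarrow> z = z')"
    unfolding \<nu>_def using Cs by (simp only: AE_density borel_measurable_indicator)
  moreover have "AE z in w. z \<in> C \<longrightarrow> emeasure w C = 1"
  proof (cases "emeasure w C = 1")
    case False
    then have "emeasure w C = 0" using vals[OF C(1)] by auto
    then show ?thesis using Cs by (intro AE_I'[of C]) (auto simp: null_sets_def)
  qed auto
  ultimately show ?thesis
  proof eventually_elim
    case (elim z)
    show ?case
    proof (intro impI ballI)
      fix G :: "real \<times> real \<Rightarrow> ennreal" assume z: "z \<in> C" and "G \<in> borel_measurable half_plane"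
      have "(\<integral>\<^sup>+z'. G z' * indicator C z' * indicator {fst z} (fst z') \<partial>w) = (\<integral>\<^sup>+z'. G z * indicator C z' \<partial>w)"
        using elim z by (intro nn_integral_cong_AE) (auto simp: indicator_def)
      also have "\<dots> = G z" using Cs elim z by (simp add: nn_integral_cmult_indicator)
      finally show "(\<integral>\<^sup>+z'. G z' * indicator C z' * indicator {fst z} (fst z') \<partial>w) = G z" .
    qed
  qed
qed

lemma dyadic_cell_cover:
  assumes "0 < r" "r \<le> real K"
  obtains j where "j < K * 2 ^ n" "real j / 2 ^ n < r" "r \<le> real (Suc j) / 2 ^ n"
proof
  \<comment> \<open>Cells are left-open, so a grid point belongs to the cell on its left: ceiling
    minus one.\<close>
  let ?j = "nat (\<lceil>r * 2 ^ n\<rceil> - 1)"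
  have pos: "0 < r * 2 ^ n" using assms by simp
  then have c: "1 \<le> \<lceil>r * 2 ^ n\<rceil>" by linarith
  then have j: "real ?j = real_of_int \<lceil>r * 2 ^ n\<rceil> - 1" by simp
  have 1: "real ?j < r * 2 ^ n" "r * 2 ^ n \<le> real (Suc ?j)" using j by linarith+
  then show "real ?j / 2 ^ n < r" "r \<le> real (Suc ?j) / 2 ^ n" by (auto simp: field_simps)
  have "r * 2 ^ n \<le> real K * 2 ^ n" using assms by (intro mult_right_mono) auto
  with 1(1) have "real ?j < real K * 2 ^ n" by (rule less_le_trans)
  also have "\<dots> = real (K * 2 ^ n)" by simp
  finally show "?j < K * 2 ^ n" by (simp only: of_nat_less_iff)
qed

text \<open>Points with the time of \<open>z\<close> lie in the dyadic column of \<open>z\<close>,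
  where \<open>z\<close> is the only point; the boxes grow with \<open>K\<close> to cover all
  marks.\<close>

lemma AE_diagonal:
  assumes w: "w \<in> configs" "separated w"
  shows "AE z in w. 0 < fst z \<longrightarrow> (\<forall>G\<in>borel_measurable half_plane. (\<integral>\<^sup>+z'. G z' * indicator {0<..} (fst z') * indicator {fst z} (fst z') \<partial>w) = G z)"
proof -
  have s: "sets w = sets half_plane" using sets_config[OF w(1)] .
  have sp: "space w = UNIV \<times> {0..}" using space_config[OF w(1)] .
  have 1: "AE z in w. z \<in> {0<..real K} \<times> {0..real K} \<longrightarrow>
      (\<forall>G\<in>borel_measurable half_plane. (\<integral>\<^sup>+z'. G z' * indicator ({0<..real K} \<times> {0..real K}) z' * indicator {fst z} (fst z') \<partial>w) = G z)" for K
  proof -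
    obtain n where n: "\<And>j. j < K * 2 ^ n \<Longrightarrow> emeasure w (dyadic_cell n K j) \<le> 1"
      using w(2) unfolding separated_def by blast
    have "AE z in w. \<forall>j\<in>{..<K * 2 ^ n}. z \<in> dyadic_cell n K j \<longrightarrow>
      (\<forall>G\<in>borel_measurable half_plane. (\<integral>\<^sup>+z'. G z' * indicator (dyadic_cell n K j) z' * indicator {fst z} (fst z') \<partial>w) = G z)"
      using AE_single_point[OF w(1) dyadic_cell_sets dyadic_cell_bounded n] by (intro AE_finite_allI) auto
    then show ?thesis
    proof eventually_elim
      case (elim z)
      show ?case
      proof (intro impI ballI)
        fix G :: "real \<times> real \<Rightarrow> ennreal" assume z: "z \<in> {0<..real K} \<times> {0..real K}" and G: "G \<in> borel_measurable half_plane"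
        from z have "0 < fst z" "fst z \<le> real K" by auto
        then obtain j where j: "j < K * 2 ^ n" "real j / 2 ^ n < fst z" "fst z \<le> real (Suc j) / 2 ^ n"
          by (rule dyadic_cell_cover)
        have "real (Suc j) \<le> real (K * 2 ^ n)" using j(1) by (intro of_nat_mono) simp
        then have jK: "fst z \<le> real K" using z by auto
        have "z \<in> dyadic_cell n K j" using j z by (cases z) (auto simp: dyadic_cell_def)
        then have "(\<integral>\<^sup>+z'. G z' * indicator (dyadic_cell n K j) z' * indicator {fst z} (fst z') \<partial>w) = G z"
          using elim j(1) G by auto
        moreover have "indicator (dyadic_cell n K j) z' * indicator {fst z} (fst z') = (indicator ({0<..real K} \<times> {0..real K}) z' * indicator {fst z} (fst z') :: ennreal)" for z'
          using z j by (cases z') (auto simp: dyadic_cell_def indicator_def)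
        ultimately show "(\<integral>\<^sup>+z'. G z' * indicator ({0<..real K} \<times> {0..real K}) z' * indicator {fst z} (fst z') \<partial>w) = G z"
          by (simp add: mult.assoc)
      qed
    qed
  qed
  have "AE z in w. \<forall>K::nat. z \<in> {0<..real K} \<times> {0..real K} \<longrightarrow>
      (\<forall>G\<in>borel_measurable half_plane. (\<integral>\<^sup>+z'. G z' * indicator ({0<..real K} \<times> {0..real K}) z' * indicator {fst z} (fst z') \<partial>w) = G z)"
    using 1 by (simp only: AE_all_countable) simp
  moreover have "AE z in w. z \<in> space w" by simp
  ultimately show ?thesis
  proof eventually_elim
    case (elim z)
    show ?case
    proof (intro impI ballI)
      fix G :: "real \<times> real \<Rightarrow> ennreal" assume z: "0 < fst z" and G: "G \<in> borel_measurable half_plane"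
      obtain K0 :: nat where "\<bar>fst z\<bar> + \<bar>snd z\<bar> \<le> real K0" using real_arch_simple by blast
      then have K0: "z \<in> {0<..real K} \<times> {0..real K}" if "K0 \<le> K" for K
        using z elim(2) sp that by (cases z) auto
      have G': "G \<in> borel_measurable w" using G by (simp add: measurable_cong_sets[OF s refl])
      have ff: "fst \<in> borel_measurable w" by (simp add: measurable_cong_sets[OF s refl])
      let ?g = "\<lambda>K z'. G z' * indicator ({0<..real (K0 + K)} \<times> {0..real (K0 + K)}) z' * indicator {fst z} (fst z')"
      have "(\<integral>\<^sup>+z'. G z' * indicator {0<..} (fst z') * indicator {fst z} (fst z') \<partial>w) = (\<integral>\<^sup>+z'. (SUP K. ?g K z') \<partial>w)"
      proof (rule nn_integral_cong)
        fix z' assume z': "z' \<in> space w"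
        obtain K1 :: nat where K1: "\<bar>fst z'\<bar> + \<bar>snd z'\<bar> \<le> real K1" using real_arch_simple by blast
        show "G z' * indicator {0<..} (fst z') * indicator {fst z} (fst z') = (SUP K. ?g K z')"
        proof (rule antisym)
          have "G z' * indicator {0<..} (fst z') * indicator {fst z} (fst z') \<le> ?g K1 z'"
            using K1 z' sp by (cases z') (auto simp: indicator_def)
          then show "G z' * indicator {0<..} (fst z') * indicator {fst z} (fst z') \<le> (SUP K. ?g K z')"
            by (rule SUP_upper2[rotated]) simp
          show "(SUP K. ?g K z') \<le> G z' * indicator {0<..} (fst z') * indicator {fst z} (fst z')"
            by (rule SUP_least) (cases z', auto simp: indicator_def)
        qed
      qed
      also have "\<dots> = (SUP K. \<integral>\<^sup>+z'. ?g K z' \<partial>w)"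
      proof (rule nn_integral_monotone_convergence_SUP)
        show "incseq ?g" by (auto simp: incseq_def le_fun_def indicator_def)
        have "{0<..real (K0 + K)} \<times> {0..real (K0 + K)} \<in> sets w" for K unfolding s by (rule Times_half_plane) auto
        then show "?g K \<in> borel_measurable w" for K using G' ff by measurable
      qed
      also have "(\<integral>\<^sup>+z'. ?g K z' \<partial>w) = G z" for K by (rule elim(1)[rule_format, OF K0[OF le_add1] G])
      then have "(SUP K. \<integral>\<^sup>+z'. ?g K z' \<partial>w) = G z" by simp
      finally show "(\<integral>\<^sup>+z'. G z' * indicator {0<..} (fst z') * indicator {fst z} (fst z') \<partial>w) = G z" .
    qed
  qed
qed

lemma kint_diag_config:
  assumes w: "w \<in> configs" "separated w" and f: "f \<in> borel_measurable marked" "g \<in> borel_measurable marked"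
  shows "(\<integral>\<^sup>+z. f (mark w z) * indicator {0<..<s} (fst z) * (\<integral>\<^sup>+z'. g (mark w z') * indicator {0<..<s} (fst z') * indicator {fst z} (fst z') \<partial>w) \<partial>w)
    = Sint (\<lambda>x. f x * g x) s w"
  unfolding kint_def
proof (rule nn_integral_cong_AE)
  have m: "(\<lambda>z. g (mark w z)) \<in> borel_measurable half_plane" by (rule measurable_mark_comp[OF f(2) w(1)])
  show "AE z in w. f (mark w z) * indicator {0<..<s} (fst z) * (\<integral>\<^sup>+z'. g (mark w z') * indicator {0<..<s} (fst z') * indicator {fst z} (fst z') \<partial>w)
      = f (mark w z) * g (mark w z) * indicator {0<..<s} (fst z)"
    using AE_diagonal[OF w]
  proof eventually_elim
    case (elim z)
    show ?case
    proof (cases "0 < fst z \<and> fst z < s")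
      case True
      have "(\<integral>\<^sup>+z'. g (mark w z') * indicator {0<..<s} (fst z') * indicator {fst z} (fst z') \<partial>w) =
        (\<integral>\<^sup>+z'. g (mark w z') * indicator {0<..} (fst z') * indicator {fst z} (fst z') \<partial>w)"
        using True by (intro nn_integral_cong) (auto simp: indicator_def)
      then show ?thesis using elim True m by auto
    qed (auto simp: indicator_def)
  qed
qed

lemma half_plane_vertical_line: "{r :: real} \<times> {0 :: real..} \<in> null_sets half_plane"
proof -
  have m: "{r} \<times> {0..} \<in> sets half_plane" by (rule Times_half_plane) auto
  then have "emeasure half_plane ({r} \<times> {0..}) = emeasure (lborel \<Otimes>\<^sub>M lborel) ({r} \<times> {0::real..})"
    by (simp add: emeasure_half_plane lborel_prod)
  also have "\<dots> = emeasure lborel {r} * emeasure lborel {0::real..}"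
    by (intro lborel.emeasure_pair_measure_Times) auto
  finally show ?thesis using m by (auto simp: null_sets_def)
qed

text \<open>Vertical lines are null for the intensity, so a diagonal term survives only when both
  integrals run over the configuration.\<close>

lemma kint_diag_half_plane:
  "(\<integral>\<^sup>+z. F z * (\<integral>\<^sup>+z'. G z' * indicator {fst z} (fst z') \<partial>half_plane) \<partial>\<nu>) = 0"
proof -
  have "(\<integral>\<^sup>+z'. G z' * indicator {r} (fst z') \<partial>half_plane) = 0" for r
  proof -
    have "AE z' in half_plane. z' \<notin> {r} \<times> {0..}" by (rule AE_not_in[OF half_plane_vertical_line])
    moreover have "AE z' in half_plane. z' \<in> space half_plane" by simp
    ultimately have "AE z' in half_plane. G z' * indicator {r} (fst z') = 0"
      by eventually_elim (auto simp: space_half_plane indicator_def)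
    then show ?thesis by (subst nn_integral_cong_AE[where v = "\<lambda>_. 0"]) auto
  qed
  then show ?thesis by simp
qed

context poisson
begin

text \<open>The last summand is the diagonal, every point paired with itself; it has this simple
  form because almost surely the points have distinct times.\<close>

lemma Sint_product:
  assumes f [measurable]: "f \<in> borel_measurable marked" and g [measurable]: "g \<in> borel_measurable marked"
  shows "(\<integral>\<^sup>+w. Sint f s w * Sint g s w \<partial>P) = (\<integral>\<^sup>+w. Aint (\<lambda>x. g x * low (\<lambda>w. w) f x) s w \<partial>P) +
    (\<integral>\<^sup>+w. Aint (\<lambda>x. f x * low (\<lambda>w. w) g x) s w \<partial>P) + (\<integral>\<^sup>+w. Aint (\<lambda>x. f x * g x) s w \<partial>P)"
proof -
  let ?S = "low (\<lambda>w. w)"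
  note k1 = adapted_kernel_config
  have lm [measurable]: "?S f \<in> borel_measurable marked" "?S g \<in> borel_measurable marked"
    using low_measurable[OF k1] f g by auto
  have "(\<integral>\<^sup>+w. Sint f s w * Sint g s w \<partial>P) = (\<integral>\<^sup>+w. Sint (\<lambda>x. g x * ?S f x) s w + Sint (\<lambda>x. f x * ?S g x) s w + Sint (\<lambda>x. f x * g x) s w \<partial>P)"
  proof (rule nn_integral_cong_AE)
    have "AE w in P. w \<in> configs" using AE_space[of P] by (simp add: space_P)
    with AE_separated show "AE w in P. Sint f s w * Sint g s w = Sint (\<lambda>x. g x * ?S f x) s w + Sint (\<lambda>x. f x * ?S g x) s w + Sint (\<lambda>x. f x * g x) s w"
      by eventually_elim (simp add: kint_product[OF k1 k1 f g] kint_diag_config[OF _ _ f g])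
  qed
  also have "\<dots> = (\<integral>\<^sup>+w. Sint (\<lambda>x. g x * ?S f x) s w \<partial>P) + (\<integral>\<^sup>+w. Sint (\<lambda>x. f x * ?S g x) s w \<partial>P) + (\<integral>\<^sup>+w. Sint (\<lambda>x. f x * g x) s w \<partial>P)"
    using kint_measurable_P[OF k1] by (subst nn_integral_add | simp)+
  finally show ?thesis by (simp add: compensation)
qed

text \<open>The covariance identity E[(S_f - A_f)(S_g - A_g)] = E[A_fg] with the negative terms
  moved across, valid in \<open>[0, \<infinity>]\<close> without integrability. All products are
  split by time order and the outer sums compensated; the iterated terms then agree on both sides,
  and the diagonal of S_f S_g remains.\<close>

theorem compensated_product:
  assumes f: "f \<in> borel_measurable marked" and g: "g \<in> borel_measurable marked"
  shows "(\<integral>\<^sup>+w. Sint f s w * Sint g s w \<partial>P) + (\<integral>\<^sup>+w. Aint f s w * Aint g s w \<partial>P) =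
    (\<integral>\<^sup>+w. Aint (\<lambda>x. f x * g x) s w \<partial>P) + (\<integral>\<^sup>+w. Sint f s w * Aint g s w \<partial>P) + (\<integral>\<^sup>+w. Aint f s w * Sint g s w \<partial>P)"
proof -
  note k1 = adapted_kernel_config and k2 = adapted_kernel_half_plane
  note [measurable] = f g k1 k2
  let ?S = "low (\<lambda>w. w)" and ?A = "low (\<lambda>_. half_plane)"
  have lm [measurable]: "?S f \<in> borel_measurable marked" "?S g \<in> borel_measurable marked"
    "?A f \<in> borel_measurable marked" "?A g \<in> borel_measurable marked"
    using low_measurable[OF k1] low_measurable[OF k2] f g by auto
  note SS = Sint_product[OF f g, of s]
  have mixed: "(\<integral>\<^sup>+w. Sint F s w * Aint G s w \<partial>P) = (\<integral>\<^sup>+w. Aint (\<lambda>x. G x * ?S F x) s w \<partial>P) + (\<integral>\<^sup>+w. Aint (\<lambda>x. F x * ?A G x) s w \<partial>P)"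
    if FG [measurable]: "F \<in> borel_measurable marked" "G \<in> borel_measurable marked" for F G
  proof -
    have [measurable]: "?S F \<in> borel_measurable marked" "?A G \<in> borel_measurable marked"
      using low_measurable[OF k1] low_measurable[OF k2] FG by auto
    have "(\<integral>\<^sup>+w. Sint F s w * Aint G s w \<partial>P) = (\<integral>\<^sup>+w. Aint (\<lambda>x. G x * ?S F x) s w + Sint (\<lambda>x. F x * ?A G x) s w \<partial>P)"
      by (intro nn_integral_cong) (simp add: space_P kint_product[OF k1 k2 FG] kint_diag_half_plane)
    also have "\<dots> = (\<integral>\<^sup>+w. Aint (\<lambda>x. G x * ?S F x) s w \<partial>P) + (\<integral>\<^sup>+w. Sint (\<lambda>x. F x * ?A G x) s w \<partial>P)"
      using kint_measurable_P[OF k1] kint_measurable_P[OF k2] by (subst nn_integral_add) auto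
    finally show ?thesis by (simp add: compensation)
  qed
  have AA: "(\<integral>\<^sup>+w. Aint f s w * Aint g s w \<partial>P) = (\<integral>\<^sup>+w. Aint (\<lambda>x. g x * ?A f x) s w \<partial>P) + (\<integral>\<^sup>+w. Aint (\<lambda>x. f x * ?A g x) s w \<partial>P)"
  proof -
    have "(\<integral>\<^sup>+w. Aint f s w * Aint g s w \<partial>P) = (\<integral>\<^sup>+w. Aint (\<lambda>x. g x * ?A f x) s w + Aint (\<lambda>x. f x * ?A g x) s w \<partial>P)"
      by (intro nn_integral_cong) (simp add: space_P kint_product[OF k2 k2 f g] kint_diag_half_plane)
    also have "\<dots> = (\<integral>\<^sup>+w. Aint (\<lambda>x. g x * ?A f x) s w \<partial>P) + (\<integral>\<^sup>+w. Aint (\<lambda>x. f x * ?A g x) s w \<partial>P)"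
      using kint_measurable_P[OF k2] by (subst nn_integral_add) auto
    finally show ?thesis .
  qed
  have "(\<integral>\<^sup>+w. Aint f s w * Sint g s w \<partial>P) = (\<integral>\<^sup>+w. Aint (\<lambda>x. f x * ?S g x) s w \<partial>P) + (\<integral>\<^sup>+w. Aint (\<lambda>x. g x * ?A f x) s w \<partial>P)"
    using mixed[OF g f] by (simp add: mult.commute)
  then show ?thesis unfolding SS AA mixed[OF f g] by (simp add: ac_simps)
qed

end

section \<open>Processes driven by accepted points\<close>

lemma nn_integral_half_plane:
  assumes f: "f \<in> borel_measurable half_plane"
  shows "(\<integral>\<^sup>+z. f z \<partial>half_plane) = (\<integral>\<^sup>+r. (\<integral>\<^sup>+\<theta>. f (r, \<theta>) * indicator {0..} \<theta> \<partial>lborel) \<partial>lborel)"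
proof -
  let ?\<Omega> = "UNIV \<times> {0..} :: (real \<times> real) set"
  have \<Omega>: "?\<Omega> \<inter> space lborel \<in> sets lborel" by (simp add: borel_closed closed_Times)
  have m: "(\<lambda>z. f z * indicator ?\<Omega> z) \<in> borel_measurable lborel"
    using f unfolding half_plane_def borel_measurable_restrict_space_iff_ennreal[OF \<Omega>] .
  have "(\<integral>\<^sup>+z. f z \<partial>half_plane) = (\<integral>\<^sup>+z. f z * indicator ?\<Omega> z \<partial>lborel)"
    unfolding half_plane_def using \<Omega> by (rule nn_integral_restrict_space)
  also have "\<dots> = (\<integral>\<^sup>+z. f z * indicator ?\<Omega> z \<partial>(lborel \<Otimes>\<^sub>M lborel))" by (simp add: lborel_prod)
  also have "\<dots> = (\<integral>\<^sup>+r. (\<integral>\<^sup>+\<theta>. f (r, \<theta>) * indicator ?\<Omega> (r, \<theta>) \<partial>lborel) \<partial>lborel)"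
    using m by (intro lborel.nn_integral_fst[symmetric]) (simp add: lborel_prod)
  finally show ?thesis by (simp add: indicator_def)
qed

definition accept :: "(real \<Rightarrow> config \<Rightarrow> real) \<Rightarrow> (real \<times> config) \<times> real \<Rightarrow> ennreal" where
  "accept L x = indicator {..L (fst (fst x)) (snd (fst x))} (snd x)"

lemma accept_mark: "accept L (mark w z) = indicator {..L (fst z) w} (snd z)"
  by (simp add: accept_def)

lemma accept_measurable:
  assumes "(\<lambda>p. L (fst p) (snd p)) \<in> borel_measurable predictable"
  shows "accept L \<in> borel_measurable marked"
proof -
  have [measurable]: "(\<lambda>x. L (fst (fst x)) (snd (fst x))) \<in> borel_measurable marked"
    unfolding marked_def by (rule measurable_compose[OF measurable_fst assms])
  have [measurable]: "snd \<in> borel_measurable marked" unfolding marked_def by simp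
  have "(\<lambda>x. indicator {x \<in> space marked. snd x \<le> L (fst (fst x)) (snd (fst x))} x :: ennreal) \<in> borel_measurable marked"
    by measurable
  then show ?thesis
    by (rule measurable_cong[THEN iffD1, rotated]) (auto simp: accept_def indicator_def)
qed

abbreviation lag :: "(real \<Rightarrow> real) \<Rightarrow> real \<Rightarrow> ((real \<times> config) \<times> real \<Rightarrow> ennreal) \<Rightarrow> (real \<times> config) \<times> real \<Rightarrow> ennreal" where
  "lag g s f x \<equiv> ennreal (g (s - fst (fst x))) * f x"

lemma measurable_marked_fst: "F \<in> borel_measurable predictable \<Longrightarrow> (\<lambda>x. F (fst x)) \<in> borel_measurable marked"
  unfolding marked_def by (rule measurable_compose[OF measurable_fst])

lemma measurable_marked_time: "F \<in> borel_measurable borel \<Longrightarrow> (\<lambda>x. F (fst (fst x))) \<in> borel_measurable marked"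
  by (rule measurable_marked_fst[OF measurable_compose[OF borel_measurable_fst_predictable]])

text \<open>Fubini in the mark: a region of marks at each time contributes its length.\<close>

lemma Aint_slice:
  assumes F: "F \<in> borel_measurable predictable" and S: "(\<lambda>x. indicator (S (fst x)) (snd x) :: ennreal) \<in> borel_measurable marked"
    and Sb: "\<And>p. S p \<in> sets borel" and w: "w \<in> configs"
  shows "Aint (\<lambda>x. F (fst x) * indicator (S (fst x)) (snd x)) s w = (\<integral>\<^sup>+r\<in>{0<..<s}. F (r, w) * emeasure lborel (S (r, w) \<inter> {0..}) \<partial>lborel)"
proof -
  let ?h = "\<lambda>x. F (fst x) * indicator (S (fst x)) (snd x)"
  have m: "?h \<in> borel_measurable marked" using measurable_marked_fst[OF F] S by simp
  have "Aint ?h s w = (\<integral>\<^sup>+r. (\<integral>\<^sup>+\<theta>. ?h (mark w (r, \<theta>)) * indicator {0<..<s} r * indicator {0..} \<theta> \<partial>lborel) \<partial>lborel)"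
    unfolding kint_def using measurable_mark_comp[OF m w] by (subst nn_integral_half_plane) (auto simp: mark_def)
  also have "\<dots> = (\<integral>\<^sup>+r\<in>{0<..<s}. F (r, w) * emeasure lborel (S (r, w) \<inter> {0..}) \<partial>lborel)"
  proof (rule nn_integral_cong)
    fix r
    have "(\<integral>\<^sup>+\<theta>. ?h (mark w (r, \<theta>)) * indicator {0<..<s} r * indicator {0..} \<theta> \<partial>lborel) = (\<integral>\<^sup>+\<theta>. F (r, w) * indicator {0<..<s} r * indicator (S (r, w) \<inter> {0..}) \<theta> \<partial>lborel)"
      by (rule nn_integral_cong) (auto simp: mark_def indicator_def)
    also have "\<dots> = F (r, w) * indicator {0<..<s} r * emeasure lborel (S (r, w) \<inter> {0..})"
      using Sb[of "(r, w)"] by (intro nn_integral_cmult_indicator) auto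
    finally show "(\<integral>\<^sup>+\<theta>. ?h (mark w (r, \<theta>)) * indicator {0<..<s} r * indicator {0..} \<theta> \<partial>lborel) = F (r, w) * emeasure lborel (S (r, w) \<inter> {0..}) * indicator {0<..<s} r"
      by (simp add: mult_ac)
  qed
  finally show ?thesis .
qed

lemma Aint_strip:
  assumes F: "F \<in> borel_measurable predictable" and L: "(\<lambda>p. L (fst p) (snd p)) \<in> borel_measurable predictable"
    and nn: "\<And>r. 0 \<le> L r w" and w: "w \<in> configs"
  shows "Aint (\<lambda>x. F (fst x) * accept L x) s w = (\<integral>\<^sup>+r\<in>{0<..<s}. F (r, w) * ennreal (L r w) \<partial>lborel)"
proof -
  have "{..L r w} \<inter> {0..} = {0..L r w}" for r by auto
  then show ?thesis
    using Aint_slice[OF F _ _ w, of "\<lambda>p. {..L (fst p) (snd p)}" s] accept_measurable[OF L] nn by (simp add: accept_def[abs_def])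
qed

lemma predictable_joint: "(\<lambda>p. p) \<in> measurable (borel \<Otimes>\<^sub>M config_space) predictable"
proof -
  have "(\<lambda>p. p) \<in> measurable (borel \<Otimes>\<^sub>M config_space) (sigma (UNIV \<times> configs) predictable_gen)"
  proof (rule measurable_measure_of)
    show "predictable_gen \<subseteq> Pow (UNIV \<times> configs)" by (rule predictable_gen_closed)
    show "(\<lambda>p. p) \<in> space (borel \<Otimes>\<^sub>M config_space) \<rightarrow> UNIV \<times> configs"
      by (auto simp: space_pair_measure space_config_space)
    fix y assume "y \<in> predictable_gen"
    then have "y \<in> sets (borel \<Otimes>\<^sub>M config_space)"
    proof (cases rule: predictable_genE)
      case (1 S)
      moreover have "configs \<in> sets config_space" using sets.top[of config_space] by (simp add: space_config_space)
      ultimately show ?thesis by (auto intro: pair_measureI)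
    next
      case (2 s t A)
      then show ?thesis using past_config[OF 2(3)] by (auto intro: pair_measureI)
    qed
    then show "(\<lambda>p. p) -` y \<inter> space (borel \<Otimes>\<^sub>M config_space) \<in> sets (borel \<Otimes>\<^sub>M config_space)" by auto
  qed
  then show ?thesis by (simp add: predictable_def)
qed

context poisson
begin

lemma predictable_joint_P: "F \<in> borel_measurable predictable \<Longrightarrow> F \<in> borel_measurable (borel \<Otimes>\<^sub>M P)"
  using measurable_compose[OF predictable_joint]
  by (simp add: measurable_cong_sets[OF sets_pair_measure_cong[OF refl sets_P] refl])

lemma expect_time_integral:
  assumes G: "G \<in> borel_measurable predictable"
  shows "(\<integral>\<^sup>+w. (\<integral>\<^sup>+r\<in>{0<..<s}. G (r, w) \<partial>lborel) \<partial>P) = (\<integral>\<^sup>+r\<in>{0<..<s}. (\<integral>\<^sup>+w. G (r, w) \<partial>P) \<partial>lborel)"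
proof -
  interpret pair_sigma_finite lborel P ..
  have [measurable]: "G \<in> borel_measurable (lborel \<Otimes>\<^sub>M P)"
    using predictable_joint_P[OF G] by (simp add: measurable_cong_sets[OF sets_pair_measure_cong[OF sets_lborel refl] refl])
  have "(\<integral>\<^sup>+w. (\<integral>\<^sup>+r\<in>{0<..<s}. G (r, w) \<partial>lborel) \<partial>P) = (\<integral>\<^sup>+r. (\<integral>\<^sup>+w. G (r, w) * indicator {0<..<s} r \<partial>P) \<partial>lborel)"
    by (rule Fubini') measurable
  also have "\<dots> = (\<integral>\<^sup>+r\<in>{0<..<s}. (\<integral>\<^sup>+w. G (r, w) \<partial>P) \<partial>lborel)"
    using measurable_P[OF measurable_compose[OF measurable_const_time G]] by (intro nn_integral_cong nn_integral_multc)
  finally show ?thesis .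
qed

lemma expect_Aint:
  assumes F: "F \<in> borel_measurable predictable" and L: "(\<lambda>p. L (fst p) (snd p)) \<in> borel_measurable predictable"
    and nn: "\<And>r w. 0 \<le> L r w"
  shows "(\<integral>\<^sup>+w. Aint (\<lambda>x. F (fst x) * accept L x) s w \<partial>P) =
    (\<integral>\<^sup>+r\<in>{0<..<s}. (\<integral>\<^sup>+w. F (r, w) * ennreal (L r w) \<partial>P) \<partial>lborel)"
proof -
  have "(\<integral>\<^sup>+w. Aint (\<lambda>x. F (fst x) * accept L x) s w \<partial>P) = (\<integral>\<^sup>+w. (\<integral>\<^sup>+r\<in>{0<..<s}. F (r, w) * ennreal (L r w) \<partial>lborel) \<partial>P)"
    by (intro nn_integral_cong Aint_strip F L nn) (simp add: space_P)
  then show ?thesis using expect_time_integral[of "\<lambda>p. F p * ennreal (L (fst p) (snd p))" s] F L by simp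
qed

end

section \<open>Intensities with a general forcing: first moments\<close>

lemma nn_integral_lborel_reflect:
  fixes f :: "real \<Rightarrow> ennreal" assumes "f \<in> borel_measurable borel"
  shows "(\<integral>\<^sup>+r. f (t - r) \<partial>lborel) = (\<integral>\<^sup>+r. f r \<partial>lborel)"
  using nn_integral_real_affine[OF assms, of "-1" t] by simp

text \<open>The forcing \<open>b\<close> is general so that the original intensity (forcing
  \<open>\<mu>\<close>) and the intensity after adding a point at \<open>u\<close> (forcing
  \<open>\<mu> + k (t - u)\<close>) are both instances. Predictability and nonnegativity of
  \<open>L\<close> are required everywhere, the equation almost surely and up to
  \<open>T\<close>.\<close>

locale hawkes = poisson P for P +
  fixes T q B c :: real and k b :: "real \<Rightarrow> real" and L :: "real \<Rightarrow> config \<Rightarrow> real"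
  assumes T: "0 < T" and q: "0 \<le> q" "q < 1" and B: "0 \<le> B" and c: "0 \<le> c"
    and k_meas [measurable]: "k \<in> borel_measurable borel" and k_nonneg: "\<And>t. 0 \<le> k t" and k_le: "\<And>t. k t \<le> B"
    and k_zero: "\<And>t. t \<le> 0 \<Longrightarrow> k t = 0" and k_int: "(\<integral>\<^sup>+t. ennreal (k t) \<partial>lborel) \<le> ennreal q"
    and b_meas [measurable]: "b \<in> borel_measurable borel" and b_nonneg: "\<And>t. 0 \<le> b t" and b_le: "\<And>t. b t \<le> c"
    and L_pred: "(\<lambda>p. L (fst p) (snd p)) \<in> borel_measurable predictable" and L_nonneg: "\<And>t w. 0 \<le> L t w"
    and L_eq: "AE w in P. \<forall>t\<in>{0<..T}. ennreal (L t w) = ennreal (b t) + Sint (lag k t (accept L)) t w"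
begin

abbreviation "N s w \<equiv> Sint (accept L) s w"

lemma acc_meas [measurable]: "accept L \<in> borel_measurable marked"
  by (rule accept_measurable[OF L_pred])

lemma k_shift_meas [measurable]: "(\<lambda>x. ennreal (k (t - fst (fst x)))) \<in> borel_measurable marked"
  by (rule measurable_marked_time) simp

lemma N_pred [measurable]: "(\<lambda>p. N (fst p) (snd p)) \<in> borel_measurable predictable"
  using kint_predictable[OF adapted_kernel_config acc_meas] by (simp add: split_beta')

lemma L_pred_ennreal [measurable]: "(\<lambda>p. ennreal (L (fst p) (snd p))) \<in> borel_measurable predictable"
  using L_pred by simp

lemma L_P [measurable]: "(\<lambda>w. L t w) \<in> borel_measurable P"
  using measurable_compose[OF measurable_const_time L_pred] by (intro measurable_P) simp

lemma N_P [measurable]: "(\<lambda>w. N t w) \<in> borel_measurable P"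
  by (rule kint_measurable_P[OF adapted_kernel_config acc_meas])

lemma kint_mono_time: "s \<le> t \<Longrightarrow> kint \<kappa> h s w \<le> kint \<kappa> h t w"
  unfolding kint_def by (intro nn_integral_mono mult_left_mono) (auto simp: indicator_def)

lemma k_conv_le:
  assumes "\<And>r. 0 < r \<Longrightarrow> r < t \<Longrightarrow> y r \<le> M"
  shows "(\<integral>\<^sup>+r\<in>{0<..<t}. ennreal (k (t - r)) * y r \<partial>lborel) \<le> ennreal q * M"
proof -
  have "(\<integral>\<^sup>+r\<in>{0<..<t}. ennreal (k (t - r)) * y r \<partial>lborel) \<le> (\<integral>\<^sup>+r. ennreal (k (t - r)) * M \<partial>lborel)"
    using assms by (intro nn_integral_mono) (auto simp: indicator_def intro!: mult_left_mono)
  also have "\<dots> = (\<integral>\<^sup>+r. ennreal (k r) \<partial>lborel) * M"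
    using nn_integral_lborel_reflect[of "\<lambda>r. ennreal (k r)" t] by (simp add: nn_integral_multc)
  also have "\<dots> \<le> ennreal q * M" using k_int by (rule mult_right_mono) simp
  finally show ?thesis .
qed

text \<open>The supremum \<open>M\<close> of \<open>y\<close> satisfies
  \<open>M \<le> d + q * M\<close>. The crude bound \<open>K\<close> ensures that \<open>M\<close>
  is finite, so that \<open>q * M\<close> can be absorbed.\<close>

lemma renewal_sup_bound:
  assumes bd: "\<And>t. 0 < t \<Longrightarrow> t \<le> T \<Longrightarrow> y t \<le> ennreal K"
    and rec: "\<And>t. 0 < t \<Longrightarrow> t \<le> T \<Longrightarrow> y t \<le> ennreal d + (\<integral>\<^sup>+r\<in>{0<..<t}. ennreal (k (t - r)) * y r \<partial>lborel)"
    and t: "0 < t" "t \<le> T" and d: "0 \<le> d"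
  shows "y t \<le> ennreal (d / (1 - q))"
proof -
  define M where "M = (SUP t\<in>{0<..T}. y t)"
  have M1: "M \<le> ennreal K" unfolding M_def using bd by (auto intro!: SUP_least)
  then have "M < \<infinity>" by (rule le_less_trans) simp
  then obtain m where m: "M = ennreal m" "0 \<le> m" by (cases M) auto
  have yM: "y t \<le> M" if "0 < t" "t \<le> T" for t unfolding M_def using that by (auto intro: SUP_upper)
  have "M \<le> ennreal d + ennreal q * M"
    unfolding M_def
  proof (rule SUP_least)
    fix t assume t: "t \<in> {0<..T}"
    have "(\<integral>\<^sup>+r\<in>{0<..<t}. ennreal (k (t - r)) * y r \<partial>lborel) \<le> ennreal q * M"
      using t yM by (intro k_conv_le) auto
    then show "y t \<le> ennreal d + ennreal q * (SUP t\<in>{0<..T}. y t)"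
      using rec[of t] t unfolding M_def by (auto intro: order_trans add_left_mono)
  qed
  then have "ennreal m \<le> ennreal (d + q * m)" using m d q by (simp add: ennreal_mult)
  then have "m \<le> d + q * m" using d q m by (subst (asm) ennreal_le_iff) auto
  then have "m \<le> d / (1 - q)" using q by (simp add: field_simps)
  then have "M \<le> ennreal (d / (1 - q))" using m by (simp add: ennreal_leI)
  then show ?thesis using yM[OF t] by simp
qed

lemma L_le_N: "AE w in P. \<forall>t\<in>{0<..T}. ennreal (L t w) \<le> ennreal c + ennreal B * N t w"
  using L_eq AE_space
proof eventually_elim
  case (elim w)
  then have w: "w \<in> configs" by (simp add: space_P)
  show ?case
  proof
    fix t assume "t \<in> {0<..T}"
    then have "ennreal (L t w) = ennreal (b t) + Sint (lag k t (accept L)) t w" using elim by auto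
    also have "\<dots> \<le> ennreal c + Sint (\<lambda>x. ennreal B * accept L x) t w"
      using b_le k_le by (intro add_mono kint_mono[OF _ adapted_kernel_config w]) (auto intro!: ennreal_leI mult_right_mono)
    also have "Sint (\<lambda>x. ennreal B * accept L x) t w = ennreal B * N t w"
      by (rule kint_cmult[OF adapted_kernel_config acc_meas w])
    finally show "ennreal (L t w) \<le> ennreal c + ennreal B * N t w" .
  qed
qed

text \<open>Localisation: as long as at most \<open>n\<close> points are accepted the intensity is
  at most \<open>c + B * n\<close>, so the truncated intensity has a finite mean before explosion is
  excluded.\<close>

definition Lfin :: "nat \<Rightarrow> real \<Rightarrow> config \<Rightarrow> ennreal" where
  "Lfin n t w = ennreal (L t w) * indicator {..of_nat n} (N t w)"

lemma Lfin_le: "AE w in P. \<forall>t\<in>{0<..T}. Lfin n t w \<le> ennreal (c + B * n)"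
  using L_le_N
proof eventually_elim
  case (elim w)
  show ?case
  proof
    fix t assume t: "t \<in> {0<..T}"
    show "Lfin n t w \<le> ennreal (c + B * n)"
    proof (cases "N t w \<le> of_nat n")
      case True
      have "ennreal (L t w) \<le> ennreal c + ennreal B * N t w" using elim t by auto
      also have "\<dots> \<le> ennreal c + ennreal B * of_nat n" using True by (intro add_left_mono mult_left_mono) auto
      also have "\<dots> = ennreal (c + B * n)" using c B by (simp add: ennreal_mult ennreal_of_nat_eq_real_of_nat)
      finally show ?thesis using True by (simp add: Lfin_def)
    qed (simp add: Lfin_def)
  qed
qed

lemma low_config: "low (\<lambda>w. w) h (mark w z) = Sint h (fst z) w"
  by (simp add: low_def)

text \<open>The truncation is hereditary: if at most \<open>n\<close> points are accepted before
  \<open>t\<close>, then also before each \<open>r < t\<close>. Hence the truncated intensity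
  satisfies a closed renewal inequality, and the resulting bound does not depend on
  \<open>n\<close>.\<close>

lemma Lfin_expect:
  assumes t: "0 < t" "t \<le> T"
  shows "(\<integral>\<^sup>+w. Lfin n t w \<partial>P) \<le> ennreal (c / (1 - q))"
proof (rule renewal_sup_bound[of "\<lambda>t. \<integral>\<^sup>+w. Lfin n t w \<partial>P" _ c, OF _ _ t c])
  fix t assume t: "0 < t" "t \<le> T"
  have "(\<integral>\<^sup>+w. Lfin n t w \<partial>P) \<le> (\<integral>\<^sup>+w. ennreal (c + B * n) \<partial>P)"
    using Lfin_le[of n] t by (intro nn_integral_mono_AE) (auto elim!: eventually_mono)
  then show "(\<integral>\<^sup>+w. Lfin n t w \<partial>P) \<le> ennreal (c + B * n)" by (simp add: emeasure_space_1)
  let ?G = "\<lambda>p. ennreal (k (t - fst p)) * indicator {..of_nat n} (N (fst p) (snd p))"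
  have Gm: "?G \<in> borel_measurable predictable" by measurable
  have hm: "(\<lambda>x. ?G (fst x) * accept L x) \<in> borel_measurable marked"
    using measurable_marked_fst[OF Gm] by measurable
  have "(\<integral>\<^sup>+w. Lfin n t w \<partial>P) \<le> (\<integral>\<^sup>+w. ennreal c + Sint (\<lambda>x. ?G (fst x) * accept L x) t w \<partial>P)"
  proof (rule nn_integral_mono_AE)
    show "AE w in P. Lfin n t w \<le> ennreal c + Sint (\<lambda>x. ?G (fst x) * accept L x) t w"
      using L_eq AE_space
    proof eventually_elim
      case (elim w)
      then have w: "w \<in> configs" by (simp add: space_P)
      show ?case
      proof (cases "N t w \<le> of_nat n")
        case True
        have le: "N r w \<le> of_nat n" if "r < t" for r using kint_mono_time[of r t "\<lambda>w. w" "accept L" w] True that by simp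
        have "Lfin n t w = ennreal (b t) + Sint (lag k t (accept L)) t w"
          using elim(1) t True by (simp add: Lfin_def)
        also have "\<dots> \<le> ennreal c + Sint (\<lambda>x. ?G (fst x) * accept L x) t w"
          using b_le le by (intro add_mono kint_mono[OF _ adapted_kernel_config w]) (auto intro!: ennreal_leI)
        finally show ?thesis .
      qed (simp add: Lfin_def)
    qed
  qed
  also have "\<dots> = ennreal c + (\<integral>\<^sup>+w. Sint (\<lambda>x. ?G (fst x) * accept L x) t w \<partial>P)"
    using kint_measurable_P[OF adapted_kernel_config hm] by (subst nn_integral_add) (auto simp: emeasure_space_1)
  also have "(\<integral>\<^sup>+w. Sint (\<lambda>x. ?G (fst x) * accept L x) t w \<partial>P) = (\<integral>\<^sup>+r\<in>{0<..<t}. (\<integral>\<^sup>+w. ?G (r, w) * ennreal (L r w) \<partial>P) \<partial>lborel)"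
    unfolding compensation[OF hm] by (rule expect_Aint[OF Gm L_pred L_nonneg])
  also have "\<dots> = (\<integral>\<^sup>+r\<in>{0<..<t}. ennreal (k (t - r)) * (\<integral>\<^sup>+w. Lfin n r w \<partial>P) \<partial>lborel)"
    unfolding Lfin_def by (subst nn_integral_cmult[symmetric]) (auto simp: mult_ac)
  finally show "(\<integral>\<^sup>+w. Lfin n t w \<partial>P) \<le> ennreal c + (\<integral>\<^sup>+r\<in>{0<..<t}. ennreal (k (t - r)) * (\<integral>\<^sup>+w. Lfin n r w \<partial>P) \<partial>lborel)" .
qed

lemma L_finite_expect:
  assumes t: "0 < t" "t \<le> T"
  shows "(\<integral>\<^sup>+w. ennreal (L t w) * indicator {..<\<infinity>} (N t w) \<partial>P) \<le> ennreal (c / (1 - q))"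
proof -
  have "(\<integral>\<^sup>+w. ennreal (L t w) * indicator {..<\<infinity>} (N t w) \<partial>P) = (\<integral>\<^sup>+w. (SUP n. Lfin n t w) \<partial>P)"
  proof (rule nn_integral_cong)
    fix w
    show "ennreal (L t w) * indicator {..<\<infinity>} (N t w) = (SUP n. Lfin n t w)"
    proof (cases "N t w < \<infinity>")
      case True
      then obtain x where "N t w = ennreal x" "0 \<le> x" by (cases "N t w") auto
      moreover obtain n :: nat where "x \<le> real n" using real_arch_simple by blast
      ultimately have n: "N t w \<le> of_nat n" by (simp add: ennreal_of_nat_eq_real_of_nat ennreal_leI)
      show ?thesis
      proof (rule antisym)
        show "ennreal (L t w) * indicator {..<\<infinity>} (N t w) \<le> (SUP n. Lfin n t w)"
          using n True by (intro SUP_upper2[of n]) (auto simp: Lfin_def)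
        show "(SUP n. Lfin n t w) \<le> ennreal (L t w) * indicator {..<\<infinity>} (N t w)"
          using True by (intro SUP_least) (auto simp: Lfin_def indicator_def)
      qed
    next
      case False
      then have "Lfin n t w = 0" for n by (auto simp: Lfin_def indicator_def top_unique less_top[symmetric] ennreal_of_nat_neq_top)
      then show ?thesis using False by simp
    qed
  qed
  also have "\<dots> = (SUP n. \<integral>\<^sup>+w. Lfin n t w \<partial>P)"
  proof (rule nn_integral_monotone_convergence_SUP)
    show "incseq (\<lambda>n. Lfin n t)"
      by (auto simp: incseq_def le_fun_def Lfin_def indicator_def intro: order_trans)
    show "Lfin n t \<in> borel_measurable P" for n unfolding Lfin_def[abs_def] by measurable
  qed
  also have "\<dots> \<le> ennreal (c / (1 - q))" using Lfin_expect[OF t] by (intro SUP_least)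
  finally show ?thesis .
qed

text \<open>Points accepted while the count is still finite are finite in number, so they cannot
  accumulate at the first explosion time from the left; only accumulation immediately to its right
  remains to be excluded.\<close>

lemma finite_accepted_finite: "AE w in P. Sint (\<lambda>x. indicator {..<\<infinity>} (low (\<lambda>w. w) (accept L) x) * accept L x) T w < \<infinity>"
proof -
  let ?G = "\<lambda>p. indicator {..<\<infinity>} (N (fst p) (snd p)) :: ennreal"
  have Gm: "?G \<in> borel_measurable predictable" by measurable
  have hm: "(\<lambda>x. ?G (fst x) * accept L x) \<in> borel_measurable marked"
    using measurable_marked_fst[OF Gm] by measurable
  have "(\<integral>\<^sup>+w. Sint (\<lambda>x. ?G (fst x) * accept L x) T w \<partial>P) = (\<integral>\<^sup>+r\<in>{0<..<T}. (\<integral>\<^sup>+w. ?G (r, w) * ennreal (L r w) \<partial>P) \<partial>lborel)"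
    unfolding compensation[OF hm] by (rule expect_Aint[OF Gm L_pred L_nonneg])
  also have "\<dots> \<le> (\<integral>\<^sup>+r\<in>{0<..<T}. ennreal (c / (1 - q)) \<partial>lborel)"
    using L_finite_expect by (intro nn_integral_mono) (auto simp: indicator_def mult.commute)
  also have "\<dots> < \<infinity>" using T by (subst nn_integral_cmult_indicator) (auto simp: ennreal_mult_less_top)
  finally have "(\<integral>\<^sup>+w. Sint (\<lambda>x. ?G (fst x) * accept L x) T w \<partial>P) \<noteq> \<infinity>" by simp
  from nn_integral_noteq_infinite[OF kint_measurable_P[OF adapted_kernel_config hm] this]
  show ?thesis by (simp add: low_def less_top)
qed

end

section \<open>Non-explosion and the second moment of the number of accepted points\<close>

context hawkes
begin

lemma L_section: "w \<in> configs \<Longrightarrow> (\<lambda>t. L t w) \<in> borel_measurable borel"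
  using measurable_compose[OF measurable_section_predictable L_pred] by simp

text \<open>Accepted points cannot accumulate at \<open>\<sigma>\<close> from the right: \<open>L\<close> is bounded on a set \<open>V\<close> of times with
  \<open>\<integral>\<^bsub>V\<^esub> k (t - \<sigma>) dt > 0\<close>, and each of the infinitely many points close to \<open>\<sigma>\<close> would contribute a fixed
  amount to \<open>\<integral>\<^bsub>V\<^esub> L\<close>.\<close>

lemma no_right_accumulation:
  assumes w: "w \<in> configs"
    and eq: "\<And>t. 0 < t \<Longrightarrow> t \<le> T \<Longrightarrow> ennreal (L t w) = ennreal (b t) + Sint (lag k t (accept L)) t w"
    and \<sigma>: "0 \<le> \<sigma>" "\<sigma> < T"
    and inf: "\<And>r. \<sigma> < r \<Longrightarrow> r \<le> T \<Longrightarrow> Sint (\<lambda>x. indicator {\<sigma><..} (fst (fst x)) * accept L x) r w = \<infinity>"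
  shows "(\<integral>\<^sup>+v\<in>{0<..<T - \<sigma>}. ennreal (k v) \<partial>lborel) = 0"
proof (rule ccontr)
  assume pos: "(\<integral>\<^sup>+v\<in>{0<..<T - \<sigma>}. ennreal (k v) \<partial>lborel) \<noteq> 0"
  have [measurable]: "(\<lambda>t. L t w) \<in> borel_measurable borel" by (rule L_section[OF w])
  \<comment> \<open>Delays \<open>v\<close> at which the kernel is bounded below and the intensity
    at \<open>\<sigma> + v\<close> bounded above; if the kernel has mass, one of these sets has
    positive measure.\<close>
  define E where "E n = {v. 0 < v \<and> v < T - \<sigma> \<and> 1 / Suc n \<le> k v \<and> L (\<sigma> + v) w \<le> real n}" for n
  have Em [measurable]: "E n \<in> sets borel" for n unfolding E_def by measurable
  have "\<exists>n. emeasure lborel (E n) \<noteq> 0"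
  proof (rule ccontr)
    assume "\<not> ?thesis"
    then have "AE v in lborel. v \<notin> E n" for n by (intro AE_not_in) (simp add: null_sets_def)
    then have "AE v in lborel. \<forall>n. v \<notin> E n" by (simp add: AE_all_countable)
    then have "AE v in lborel. ennreal (k v) * indicator {0<..<T - \<sigma>} v = 0"
    proof eventually_elim
      case (elim v)
      show ?case
      proof (rule ccontr)
        assume "ennreal (k v) * indicator {0<..<T - \<sigma>} v \<noteq> 0"
        then have v: "0 < v" "v < T - \<sigma>" "0 < k v" using k_nonneg[of v] by (auto simp: indicator_def split: if_splits)
        obtain n1 :: nat where "1 / Suc n1 < k v" using nat_approx_posE[OF v(3)] by blast
        moreover obtain n2 :: nat where "L (\<sigma> + v) w \<le> real n2" using real_arch_simple by blast
        moreover have "1 / Suc (max n1 n2) \<le> 1 / Suc n1" by (simp add: frac_le)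
        ultimately have "v \<in> E (max n1 n2)" using v unfolding E_def by (simp del: of_nat_Suc)
        then show False using elim by blast
      qed
    qed
    then have "(\<integral>\<^sup>+v\<in>{0<..<T - \<sigma>}. ennreal (k v) \<partial>lborel) = 0"
      by (simp add: nn_integral_0_iff_AE)
    then show False using pos by simp
  qed
  then obtain n where n: "emeasure lborel (E n) \<noteq> 0" by blast
  have "emeasure lborel (E n) \<le> emeasure lborel {0<..<T - \<sigma>}" by (intro emeasure_mono) (auto simp: E_def)
  also have "\<dots> < \<infinity>" using \<sigma> by simp
  finally obtain m where m: "emeasure lborel (E n) = ennreal m" "0 < m"
    using n by (cases "emeasure lborel (E n)") auto
  \<comment> \<open>Thirds leave room for a contradiction: the neighbourhood \<open>U\<close> of
    \<open>S\<close> costs one \<open>e\<close>, a failing sequence of translates another, while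
    Fatou's lemma demands all of \<open>m = 3 * e\<close>.\<close>
  define e where "e = m / 3"
  have e: "0 < e" "m = 3 * e" using m by (auto simp: e_def)
  define S where "S = {v. 0 < v \<and> 1 / Suc n \<le> k v}"
  have S [measurable]: "S \<in> sets borel" unfolding S_def by measurable
  obtain U where U: "open U" "S \<subseteq> U" "emeasure lborel (U - S) < ennreal e"
    using outer_regular_lborel[OF S, of e] e by auto
  have [measurable]: "U \<in> sets borel" using U by simp
  define Q where "Q = {t. \<sigma> < t \<and> t < T \<and> L t w \<le> real n}"
  have Q [measurable]: "Q \<in> sets borel" unfolding Q_def by measurable
  define g where "g r = emeasure lborel {t \<in> Q. t - r \<in> S}" for r
  define V where "V = {t. t - \<sigma> \<in> E n}"
  have V [measurable]: "V \<in> sets borel" unfolding V_def by measurable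
  have VQ: "V \<subseteq> {t \<in> Q. t - \<sigma> \<in> S}" by (auto simp: V_def Q_def E_def S_def)
  have translate: "emeasure lborel {t. t - r \<in> A} = emeasure lborel A" if [measurable]: "A \<in> sets borel" for A and r :: real
  proof -
    have "emeasure lborel A = (\<integral>\<^sup>+t. indicator A (- r + 1 * t) \<partial>lborel)"
      using nn_integral_real_affine[of "indicator A" 1 "- r"] by simp
    also have "\<dots> = (\<integral>\<^sup>+t. indicator {t. t - r \<in> A} t \<partial>lborel)" by (intro nn_integral_cong) (auto simp: indicator_def)
    finally show ?thesis by simp
  qed
  have mV: "emeasure lborel V = ennreal m" unfolding V_def using translate[OF Em] m by simp
  \<comment> \<open>A form of continuity of translation: each point slightly to the right of
    \<open>\<sigma>\<close> acts on times of \<open>Q\<close> of total measure at least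
    \<open>e\<close>. Since \<open>U\<close> is open, membership in \<open>U\<close> passes to
    nearby translates.\<close>
  have "\<exists>\<delta>>0. \<forall>r. \<sigma> < r \<longrightarrow> r < \<sigma> + \<delta> \<longrightarrow> ennreal e \<le> g r"
  proof (rule ccontr)
    assume no: "\<not> ?thesis"
    have "\<exists>r. \<sigma> < r \<and> r < \<sigma> + 1 / Suc j \<and> g r < ennreal e" for j :: nat
      using no[unfolded not_ex, rule_format, of "1 / Suc j"] by (auto simp: not_le simp del: of_nat_Suc)
    then obtain r where r: "\<And>j::nat. \<sigma> < r j" "\<And>j. r j < \<sigma> + 1 / Suc j" "\<And>j. g (r j) < ennreal e" by metis
    have "r \<longlonglongrightarrow> \<sigma>"
    proof (rule tendsto_sandwich[of "\<lambda>_. \<sigma>" _ _ "\<lambda>j. \<sigma> + 1 / Suc j"])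
      show "(\<lambda>j. \<sigma> + 1 / Suc j) \<longlonglongrightarrow> \<sigma>"
        using tendsto_add[OF tendsto_const[of \<sigma>] LIMSEQ_inverse_real_of_nat] by (simp add: inverse_eq_divide)
    qed (use r in \<open>auto intro!: always_eventually less_imp_le simp del: of_nat_Suc\<close>)
    have "ennreal m = (\<integral>\<^sup>+t. indicator V t \<partial>lborel)" using mV by simp
    also have "\<dots> \<le> (\<integral>\<^sup>+t. liminf (\<lambda>j. indicator (V \<inter> {t. t - r j \<in> U}) t) \<partial>lborel)"
    proof (rule nn_integral_mono)
      fix t
      show "indicator V t \<le> liminf (\<lambda>j. indicator (V \<inter> {t. t - r j \<in> U}) t :: ennreal)"
      proof (cases "t \<in> V")
        case True
        then have "t - \<sigma> \<in> U" using VQ U by auto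
        moreover have "(\<lambda>j. t - r j) \<longlonglongrightarrow> t - \<sigma>" by (intro tendsto_intros \<open>r \<longlonglongrightarrow> \<sigma>\<close>)
        ultimately have "eventually (\<lambda>j. t - r j \<in> U) sequentially" using U(1) by (rule topological_tendstoD[rotated 2])
        then have "eventually (\<lambda>j. (1 :: ennreal) \<le> indicator (V \<inter> {t. t - r j \<in> U}) t) sequentially"
          by eventually_elim (use True in auto)
        then show ?thesis using True by (simp add: Liminf_bounded)
      qed simp
    qed
    also have "\<dots> \<le> liminf (\<lambda>j. \<integral>\<^sup>+t. indicator (V \<inter> {t. t - r j \<in> U}) t \<partial>lborel)"
      by (rule nn_integral_liminf) measurable
    also have "\<dots> \<le> ennreal (2 * e)"
    proof -
      have "(\<integral>\<^sup>+t. indicator (V \<inter> {t. t - r j \<in> U}) t \<partial>lborel) \<le> ennreal (2 * e)" for j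
      proof -
        have "(\<integral>\<^sup>+t. indicator (V \<inter> {t. t - r j \<in> U}) t \<partial>lborel) = emeasure lborel (V \<inter> {t. t - r j \<in> U})" by simp
        also have "\<dots> \<le> emeasure lborel ({t \<in> Q. t - r j \<in> S} \<union> {t. t - r j \<in> U - S})"
          using VQ by (intro emeasure_mono) auto
        also have "\<dots> \<le> g (r j) + emeasure lborel {t. t - r j \<in> U - S}"
          unfolding g_def by (intro emeasure_subadditive) auto
        also have "\<dots> \<le> ennreal e + ennreal e"
          using r(3)[of j] U(3) translate[of "U - S" "r j"] by (intro add_mono) auto
        finally show ?thesis using e by (simp add: ennreal_plus[symmetric] del: ennreal_plus)
      qed
      then show ?thesis using Liminf_mono[of "\<lambda>j. \<integral>\<^sup>+t. indicator (V \<inter> {t. t - r j \<in> U}) t \<partial>lborel" "\<lambda>_. ennreal (2 * e)" sequentially]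
        by (simp add: Liminf_const)
    qed
    finally have "m \<le> 2 * e" using e by (subst (asm) ennreal_le_iff) auto
    then show False using e by simp
  qed
  then obtain \<delta> where \<delta>: "0 < \<delta>" "\<And>r. \<sigma> < r \<Longrightarrow> r < \<sigma> + \<delta> \<Longrightarrow> ennreal e \<le> g r" by blast
  define r0 where "r0 = min (\<sigma> + \<delta>) T"
  have r0: "\<sigma> < r0" "r0 \<le> T" using \<delta> \<sigma> by (auto simp: r0_def)
  interpret W: sigma_finite_measure w using adapted_kernelD(3)[OF adapted_kernel_config w] .
  interpret pair_sigma_finite w lborel ..
  have ms: "measurable w = measurable half_plane" using measurable_cong_sets[OF sets_config[OF w] refl] by (auto simp: fun_eq_iff)
  have [measurable]: "(\<lambda>z. accept L (mark w z)) \<in> borel_measurable w" "fst \<in> borel_measurable w"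
    using measurable_mark_comp[OF acc_meas w] by (auto simp: ms)
  let ?h = "\<lambda>z t. ennreal (k (t - fst z)) * accept L (mark w z) * indicator {0<..} (fst z) * indicator Q t"
  have "(\<integral>\<^sup>+t. (\<integral>\<^sup>+z. ?h z t \<partial>w) \<partial>lborel) \<le> (\<integral>\<^sup>+t\<in>{0<..<T}. ennreal n \<partial>lborel)"
  proof (rule nn_integral_mono)
    fix t
    show "(\<integral>\<^sup>+z. ?h z t \<partial>w) \<le> ennreal n * indicator {0<..<T} t"
    proof (cases "t \<in> Q")
      case True
      then have t: "0 < t" "t \<le> T" "L t w \<le> real n" "t < T" using \<sigma> by (auto simp: Q_def)
      have "(\<integral>\<^sup>+z. ?h z t \<partial>w) \<le> Sint (lag k t (accept L)) t w"
        unfolding kint_def using k_zero True by (intro nn_integral_mono) (auto simp: indicator_def not_less)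
      also have "\<dots> \<le> ennreal (L t w)" using eq[OF t(1,2)] by simp
      also have "\<dots> \<le> ennreal n" using t by (intro ennreal_leI) simp
      finally show ?thesis using t by simp
    qed simp
  qed
  also have "\<dots> < \<infinity>" using T by (subst nn_integral_cmult_indicator) (auto simp: ennreal_mult_less_top)
  finally have fin: "(\<integral>\<^sup>+t. (\<integral>\<^sup>+z. ?h z t \<partial>w) \<partial>lborel) < \<infinity>" .
  \<comment> \<open>Infinitely many points, each contributing at least \<open>e / Suc n\<close>,
    against the bound \<open>n * T\<close> for the integral of the intensity over
    \<open>Q\<close>.\<close>
  have "\<infinity> = ennreal (e / Suc n) * Sint (\<lambda>x. indicator {\<sigma><..} (fst (fst x)) * accept L x) r0 w"
    using inf[OF r0] e by (simp add: ennreal_mult_top ennreal_mult_eq_top_iff)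
  also have "\<dots> = (\<integral>\<^sup>+z. ennreal (e / Suc n) * (indicator {\<sigma><..} (fst z) * accept L (mark w z) * indicator {0<..<r0} (fst z)) \<partial>w)"
    unfolding kint_def by (subst nn_integral_cmult[symmetric]) (auto simp: indicator_def)
  also have "\<dots> \<le> (\<integral>\<^sup>+z. (\<integral>\<^sup>+t. ?h z t \<partial>lborel) \<partial>w)"
  proof (rule nn_integral_mono)
    fix z
    show "ennreal (e / Suc n) * (indicator {\<sigma><..} (fst z) * accept L (mark w z) * indicator {0<..<r0} (fst z)) \<le> (\<integral>\<^sup>+t. ?h z t \<partial>lborel)"
    proof (cases "\<sigma> < fst z \<and> fst z < r0")
      case True
      have "ennreal (e / Suc n) = ennreal (1 / Suc n) * ennreal e" using e by (simp add: ennreal_mult[symmetric] del: of_nat_Suc)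
      also have "\<dots> \<le> ennreal (1 / Suc n) * g (fst z)" using \<delta>(2)[of "fst z"] True by (intro mult_left_mono) (auto simp: r0_def)
      finally have 1: "ennreal (e / Suc n) \<le> ennreal (1 / Suc n) * g (fst z)" .
      have "ennreal (e / Suc n) * (indicator {\<sigma><..} (fst z) * accept L (mark w z) * indicator {0<..<r0} (fst z)) = ennreal (e / Suc n) * accept L (mark w z)"
        using True \<sigma> by (auto simp: indicator_def)
      also have "\<dots> \<le> accept L (mark w z) * (ennreal (1 / Suc n) * g (fst z))"
        using mult_left_mono[OF 1, of "accept L (mark w z)"] by (simp add: mult.commute)
      also have "ennreal (1 / Suc n) * g (fst z) = (\<integral>\<^sup>+t. ennreal (1 / Suc n) * indicator {t \<in> Q. t - fst z \<in> S} t \<partial>lborel)"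
        unfolding g_def by (subst nn_integral_cmult_indicator) auto
      also have "accept L (mark w z) * \<dots> = (\<integral>\<^sup>+t. accept L (mark w z) * (ennreal (1 / Suc n) * indicator {t \<in> Q. t - fst z \<in> S} t) \<partial>lborel)"
        by (subst nn_integral_cmult) auto
      also have "\<dots> \<le> (\<integral>\<^sup>+t. ?h z t \<partial>lborel)"
      proof (rule nn_integral_mono)
        fix t
        show "accept L (mark w z) * (ennreal (1 / Suc n) * indicator {t \<in> Q. t - fst z \<in> S} t) \<le> ?h z t"
        proof (cases "t \<in> Q \<and> t - fst z \<in> S")
          case t: True
          then have "ennreal (1 / Suc n) \<le> ennreal (k (t - fst z))" by (intro ennreal_leI) (auto simp: S_def)
          then have "accept L (mark w z) * ennreal (1 / Suc n) \<le> ennreal (k (t - fst z)) * accept L (mark w z)"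
            by (subst mult.commute) (intro mult_right_mono, auto)
          then show ?thesis using t True \<sigma> by (auto simp: indicator_def)
        qed auto
      qed
      finally show ?thesis .
    qed (auto simp: indicator_def)
  qed
  also have "\<dots> = (\<integral>\<^sup>+t. (\<integral>\<^sup>+z. ?h z t \<partial>w) \<partial>lborel)"
    by (rule Fubini'[symmetric]) measurable
  finally show False using fin by simp
qed

text \<open>At the first explosion time \<open>\<sigma>\<close> the count is still finite, so the
  points accumulate to the right of \<open>\<sigma>\<close>, which forces the kernel to have no mass
  on the delays left until \<open>T\<close>. Explosion is thus only conceivable so late that its
  effect is not felt before \<open>T\<close>.\<close>

lemma explosion_dead:
  "AE w in P. \<forall>s\<in>{0<..T}. N s w = \<infinity> \<longrightarrow> (\<integral>\<^sup>+v\<in>{0<..<T - s}. ennreal (k v) \<partial>lborel) = 0"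
  using L_eq finite_accepted_finite AE_space
proof eventually_elim
  case (elim w)
  then have w: "w \<in> configs" by (simp add: space_P)
  note k1 = adapted_kernel_config
  let ?F = "\<lambda>x. indicator {..<\<infinity>} (low (\<lambda>w. w) (accept L) x) * accept L x"
  have Fm: "?F \<in> borel_measurable marked"
    using low_measurable[OF k1 acc_meas] by measurable
  show ?case
  proof (intro ballI impI)
    fix s assume s: "s \<in> {0<..T}" "N s w = \<infinity>"
    let ?A = "{r. 0 < r \<and> N r w = \<infinity>}"
    define \<sigma> where "\<sigma> = Inf ?A"
    have bb: "bdd_below ?A" by (rule bdd_belowI[of _ 0]) auto
    have sA: "s \<in> ?A" using s by auto
    have \<sigma>0: "0 \<le> \<sigma>" unfolding \<sigma>_def using sA by (intro cInf_greatest) auto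
    have \<sigma>s: "\<sigma> \<le> s" unfolding \<sigma>_def using sA bb by (rule cInf_lower)
    have below: "N r w < \<infinity>" if "r < \<sigma>" for r
    proof (cases "0 < r")
      case True
      then have "r \<notin> ?A" using that cInf_lower[OF _ bb, of r] unfolding \<sigma>_def by force
      then show ?thesis using True by (simp add: less_top)
    next
      case False
      then have "N r w = 0" unfolding kint_def by simp
      then show ?thesis by simp
    qed
    have above: "N r w = \<infinity>" if "\<sigma> < r" for r
    proof -
      have "Inf ?A < r" using that by (simp add: \<sigma>_def)
      moreover have "?A \<noteq> {}" using sA by blast
      ultimately obtain r' where r': "r' \<in> ?A" "r' < r" using bb by (meson cInf_less_iff)
      then show ?thesis using kint_mono_time[of r' r "\<lambda>w. w" "accept L" w] by (auto simp: top_unique)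
    qed
    have N\<sigma>: "N \<sigma> w < \<infinity>"
    proof -
      have "N \<sigma> w = Sint ?F \<sigma> w"
        using below by (intro kint_cong[OF _ k1 w]) (simp add: low_config)
      also have "\<dots> \<le> Sint ?F T w" using \<sigma>s s by (intro kint_mono_time) auto
      finally show ?thesis using elim(2) by simp
    qed
    then have \<sigma>s': "\<sigma> < s" using \<sigma>s s by (cases "\<sigma> = s") auto
    have "Sint (\<lambda>x. indicator {\<sigma><..} (fst (fst x)) * accept L x) r w = \<infinity>" if r: "\<sigma> < r" "r \<le> T" for r
    proof -
      have Im: "(\<lambda>x. indicator {\<sigma><..} (fst (fst x)) * accept L x) \<in> borel_measurable marked"
        using measurable_marked_time[of "indicator {\<sigma><..}"] by measurable
      have "N r w \<le> Sint (\<lambda>x. indicator {\<sigma><..} (fst (fst x)) * accept L x + ?F x) r w"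
      proof (rule kint_mono[OF _ k1 w])
        fix z :: "real \<times> real"
        have "N (fst z) w < \<infinity>" if "\<not> \<sigma> < fst z" using that below[of "fst z"] N\<sigma> by (cases "fst z = \<sigma>") auto
        then show "accept L (mark w z) \<le> indicator {\<sigma><..} (fst (fst (mark w z))) * accept L (mark w z) + ?F (mark w z)"
          by (cases "\<sigma> < fst z") (auto simp: low_config intro: add_increasing2)
      qed
      also have "\<dots> = Sint (\<lambda>x. indicator {\<sigma><..} (fst (fst x)) * accept L x) r w + Sint ?F r w"
        by (rule kint_add[OF k1 Im Fm w])
      finally have "\<infinity> \<le> Sint (\<lambda>x. indicator {\<sigma><..} (fst (fst x)) * accept L x) r w + Sint ?F r w"
        using above[OF r(1)] by simp
      moreover have "Sint ?F r w < \<infinity>" using kint_mono_time[OF r(2), of "\<lambda>w. w" ?F w] elim(2) by simp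
      ultimately show ?thesis by (auto simp: top_unique)
    qed
    then have "(\<integral>\<^sup>+v\<in>{0<..<T - \<sigma>}. ennreal (k v) \<partial>lborel) = 0"
      using elim(1) \<sigma>0 \<sigma>s' s by (intro no_right_accumulation[OF w]) auto
    moreover have "(\<integral>\<^sup>+v\<in>{0<..<T - s}. ennreal (k v) \<partial>lborel) \<le> (\<integral>\<^sup>+v\<in>{0<..<T - \<sigma>}. ennreal (k v) \<partial>lborel)"
      using \<sigma>s by (intro nn_integral_mono mult_left_mono) (auto simp: indicator_def)
    ultimately show "(\<integral>\<^sup>+v\<in>{0<..<T - s}. ennreal (k v) \<partial>lborel) = 0" by simp
  qed
qed

lemma L_expect_eq:
  assumes t: "0 < t" "t \<le> T"
  shows "(\<integral>\<^sup>+w. ennreal (L t w) \<partial>P) = ennreal (b t) + (\<integral>\<^sup>+r\<in>{0<..<t}. ennreal (k (t - r)) * (\<integral>\<^sup>+w. ennreal (L r w) \<partial>P) \<partial>lborel)"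
proof -
  have hm: "(lag k t (accept L)) \<in> borel_measurable marked" by measurable
  have "(\<integral>\<^sup>+w. ennreal (L t w) \<partial>P) = (\<integral>\<^sup>+w. ennreal (b t) + Sint (lag k t (accept L)) t w \<partial>P)"
    using L_eq t by (intro nn_integral_cong_AE) (auto elim!: eventually_mono)
  also have "\<dots> = ennreal (b t) + (\<integral>\<^sup>+w. Sint (lag k t (accept L)) t w \<partial>P)"
    using kint_measurable_P[OF adapted_kernel_config hm] by (subst nn_integral_add) (auto simp: emeasure_space_1)
  also have "(\<integral>\<^sup>+w. Sint (lag k t (accept L)) t w \<partial>P) =
      (\<integral>\<^sup>+r\<in>{0<..<t}. (\<integral>\<^sup>+w. ennreal (k (t - fst (r, w))) * ennreal (L r w) \<partial>P) \<partial>lborel)"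
    unfolding compensation[OF hm] by (rule expect_Aint[OF _ L_pred L_nonneg]) measurable
  also have "\<dots> = (\<integral>\<^sup>+r\<in>{0<..<t}. ennreal (k (t - r)) * (\<integral>\<^sup>+w. ennreal (L r w) \<partial>P) \<partial>lborel)"
    by (simp add: nn_integral_cmult)
  finally show ?thesis .
qed

text \<open>So far explosion has only been confined to dead times. For almost every dead
  \<open>r < t\<close> the factor \<open>k (t - r)\<close> vanishes, so dead times do not contribute
  to the renewal equation and the bound at live times carries over to every
  \<open>t\<close>.\<close>

lemma L_expect_le:
  assumes t: "0 < t" "t \<le> T"
  shows "(\<integral>\<^sup>+w. ennreal (L t w) \<partial>P) \<le> ennreal (c / (1 - q))"
proof -
  define dead where "dead s \<longleftrightarrow> (\<integral>\<^sup>+v\<in>{0<..<T - s}. ennreal (k v) \<partial>lborel) = 0" for s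
  have dead_mono: "dead s'" if "dead s" "s \<le> s'" for s s'
  proof -
    have "(\<integral>\<^sup>+v\<in>{0<..<T - s'}. ennreal (k v) \<partial>lborel) \<le> (\<integral>\<^sup>+v\<in>{0<..<T - s}. ennreal (k v) \<partial>lborel)"
      using that by (intro nn_integral_mono mult_left_mono) (auto simp: indicator_def)
    then show ?thesis using that by (simp add: dead_def)
  qed
  have live: "(\<integral>\<^sup>+w. ennreal (L r w) \<partial>P) \<le> ennreal (c / (1 - q))" if r: "0 < r" "r \<le> T" "\<not> dead r" for r
  proof -
    have "(\<integral>\<^sup>+w. ennreal (L r w) \<partial>P) = (\<integral>\<^sup>+w. ennreal (L r w) * indicator {..<\<infinity>} (N r w) \<partial>P)"
      using explosion_dead r by (intro nn_integral_cong_AE) (auto elim!: eventually_mono simp: dead_def indicator_def less_top)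
    then show ?thesis using L_finite_expect[OF r(1,2)] by simp
  qed
  \<comment> \<open>Deadness passes to later times, so a dead \<open>r\<close> lies above a dead
    rational unless it is the very first dead time; this single exception is a null set.\<close>
  let ?X = "{r. dead r \<and> (\<forall>p\<in>\<rat>. p \<le> r \<longrightarrow> \<not> dead p)}"
  have X1: "r1 = r2" if "r1 \<in> ?X" "r2 \<in> ?X" for r1 r2
  proof (rule ccontr)
    assume ne: "r1 \<noteq> r2"
    have no: False if "r1 < r2" "dead r1" "r2 \<in> ?X" for r1 r2
    proof -
      from Rats_dense_in_real[OF that(1)] obtain p where "p \<in> \<rat>" "r1 < p" "p < r2" by blast
      then show False using dead_mono[of r1 p] that by auto
    qed
    have d: "dead r1" "dead r2" using that by auto
    show False
    proof (cases "r1 < r2")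
      case True
      show False by (rule no[OF True d(1) that(2)])
    next
      case False
      then have "r2 < r1" using ne by simp
      then show False by (rule no[OF _ d(2) that(1)])
    qed
  qed
  have AX: "AE r in lborel. r \<notin> ?X"
  proof (cases "?X = {}")
    case False
    then obtain x where "?X = {x}" using X1 by blast
    then show ?thesis using AE_lborel_singleton[of x] by auto
  qed simp
  have "AE r in lborel. \<forall>p\<in>\<rat>. dead p \<longrightarrow> p \<le> r \<longrightarrow> r < t \<longrightarrow> k (t - r) = 0"
  proof (subst AE_ball_countable)
    show "countable (\<rat> :: real set)" by (rule countable_rat)
    show "\<forall>p\<in>\<rat>. AE r in lborel. dead p \<longrightarrow> p \<le> r \<longrightarrow> r < t \<longrightarrow> k (t - r) = 0"
    proof
      fix p
      show "AE r in lborel. dead p \<longrightarrow> p \<le> r \<longrightarrow> r < t \<longrightarrow> k (t - r) = 0"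
      proof (cases "dead p")
        case True
        have "(\<integral>\<^sup>+r. ennreal (k (t - r)) * indicator {0<..<T - p} (t - r) \<partial>lborel) = 0"
          using True nn_integral_lborel_reflect[of "\<lambda>v. ennreal (k v) * indicator {0<..<T - p} v" t] by (simp add: dead_def)
        then have "AE r in lborel. ennreal (k (t - r)) * indicator {0<..<T - p} (t - r) = 0"
          by (subst (asm) nn_integral_0_iff_AE) auto
        moreover have "AE r in lborel. r \<noteq> p" by (rule AE_lborel_singleton)
        ultimately show ?thesis
          by eventually_elim (use t k_nonneg in \<open>auto simp: indicator_def ennreal_eq_0_iff order.antisym split: if_splits\<close>)
      qed simp
    qed
  qed
  with AX have dz: "AE r in lborel. dead r \<longrightarrow> r < t \<longrightarrow> k (t - r) = 0"
    by eventually_elim auto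
  have "(\<integral>\<^sup>+r\<in>{0<..<t}. ennreal (k (t - r)) * (\<integral>\<^sup>+w. ennreal (L r w) \<partial>P) \<partial>lborel) =
     (\<integral>\<^sup>+r\<in>{0<..<t}. ennreal (k (t - r)) * (if dead r then 0 else \<integral>\<^sup>+w. ennreal (L r w) \<partial>P) \<partial>lborel)"
    by (rule nn_integral_cong_AE) (use dz in eventually_elim, auto simp: indicator_def)
  also have "\<dots> \<le> ennreal q * ennreal (c / (1 - q))"
    using live t by (intro k_conv_le) auto
  finally have "(\<integral>\<^sup>+w. ennreal (L t w) \<partial>P) \<le> ennreal c + ennreal q * ennreal (c / (1 - q))"
    unfolding L_expect_eq[OF t] using b_le by (intro add_mono) (auto intro: ennreal_leI)
  also have "\<dots> = ennreal (c + q * (c / (1 - q)))" using q c by (simp add: ennreal_mult[symmetric] del: ennreal_mult')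
  also have "c + q * (c / (1 - q)) = c / (1 - q)" using q by (simp add: field_simps)
  finally show ?thesis .
qed

text \<open>Only here is explosion excluded: the mean count is the integral of the mean
  intensity.\<close>

lemma N_finite: "AE w in P. N T w < \<infinity>"
proof -
  have hm: "(\<lambda>x. 1 * accept L x) \<in> borel_measurable marked" by simp
  have "(\<integral>\<^sup>+w. N T w \<partial>P) = (\<integral>\<^sup>+r\<in>{0<..<T}. (\<integral>\<^sup>+w. 1 * ennreal (L r w) \<partial>P) \<partial>lborel)"
    using compensation[OF hm, of T] expect_Aint[OF _ L_pred L_nonneg, of "\<lambda>_. 1" T] by simp
  also have "\<dots> \<le> (\<integral>\<^sup>+r\<in>{0<..<T}. ennreal (c / (1 - q)) \<partial>lborel)"
    using L_expect_le by (intro nn_integral_mono) (auto simp: indicator_def)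
  also have "\<dots> < \<infinity>" using T by (subst nn_integral_cmult_indicator) (auto simp: ennreal_mult_less_top)
  finally have "(\<integral>\<^sup>+w. N T w \<partial>P) \<noteq> \<infinity>" by simp
  from nn_integral_noteq_infinite[OF N_P this] show ?thesis by (simp add: less_top)
qed

end

section \<open>Second moment of the count by a Gronwall argument\<close>

lemma gronwall_bound:
  fixes u :: "real \<Rightarrow> ennreal"
  assumes K: "0 < K" and bd: "\<And>t. 0 < t \<Longrightarrow> t \<le> T \<Longrightarrow> u t \<le> ennreal R"
    and rec: "\<And>t. 0 < t \<Longrightarrow> t \<le> T \<Longrightarrow> u t \<le> (\<integral>\<^sup>+r\<in>{0<..<t}. ennreal K * (1 + u r) \<partial>lborel)"
    and t: "0 < t" "t \<le> T"
  shows "u t \<le> ennreal (2 * exp (2 * K * T))"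
proof -
  \<comment> \<open>The exponential weight with rate \<open>2 * K\<close> turns integration into a
    contraction with factor one half; the bound \<open>R\<close> makes \<open>M\<close> finite, so
    that \<open>M / 2\<close> can be absorbed.\<close>
  define M where "M = (SUP t\<in>{0<..T}. (1 + u t) * ennreal (exp (- 2 * K * t)))"
  have le: "1 + u r \<le> M * ennreal (exp (2 * K * r))" if "0 < r" "r \<le> T" for r
  proof -
    have "(1 + u r) * ennreal (exp (- 2 * K * r)) \<le> M" unfolding M_def using that by (intro SUP_upper) auto
    then have "(1 + u r) * ennreal (exp (- 2 * K * r)) * ennreal (exp (2 * K * r)) \<le> M * ennreal (exp (2 * K * r))"
      by (rule mult_right_mono) simp
    then show ?thesis by (simp add: mult.assoc ennreal_mult[symmetric] exp_add[symmetric] del: ennreal_mult')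
  qed
  have "M \<le> 1 + ennreal R"
    unfolding M_def
  proof (rule SUP_least)
    fix t assume t: "t \<in> {0<..T}"
    have "(1 + u t) * ennreal (exp (- 2 * K * t)) \<le> (1 + u t) * 1" using t K by (intro mult_left_mono) auto
    also have "\<dots> \<le> 1 + ennreal R" using bd[of t] t by (auto intro: add_left_mono)
    finally show "(1 + u t) * ennreal (exp (- 2 * K * t)) \<le> 1 + ennreal R" .
  qed
  then have "M < \<infinity>" by (rule le_less_trans) (simp add: ennreal_add_less_top)
  then obtain m where m: "M = ennreal m" "0 \<le> m" by (cases M) auto
  have int: "(\<integral>\<^sup>+r\<in>{0<..<t}. ennreal (exp (2 * K * r)) \<partial>lborel) \<le> ennreal (exp (2 * K * t) / (2 * K))" if "0 < t" for t
  proof -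
    have "(\<integral>\<^sup>+r\<in>{0<..<t}. ennreal (exp (2 * K * r)) \<partial>lborel) \<le> (\<integral>\<^sup>+r\<in>{0..t}. ennreal (exp (2 * K * r)) \<partial>lborel)"
      by (intro nn_integral_mono) (auto simp: indicator_def)
    also have "\<dots> = ennreal (exp (2 * K * t) / (2 * K) - exp (2 * K * 0) / (2 * K))"
      using that K by (intro nn_integral_FTC_Icc) (auto intro!: derivative_eq_intros simp: field_simps)
    also have "\<dots> \<le> ennreal (exp (2 * K * t) / (2 * K))" using K by (intro ennreal_leI) auto
    finally show ?thesis .
  qed
  have "M \<le> ennreal (1 + m / 2)"
    unfolding M_def
  proof (rule SUP_least)
    fix t assume t: "t \<in> {0<..T}"
    have "u t \<le> (\<integral>\<^sup>+r\<in>{0<..<t}. ennreal K * (1 + u r) \<partial>lborel)" using rec t by auto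
    also have "\<dots> \<le> (\<integral>\<^sup>+r. ennreal K * M * (ennreal (exp (2 * K * r)) * indicator {0<..<t} r) \<partial>lborel)"
      using le t by (intro nn_integral_mono) (auto simp: indicator_def mult.assoc intro!: mult_left_mono)
    also have "\<dots> = ennreal K * M * (\<integral>\<^sup>+r\<in>{0<..<t}. ennreal (exp (2 * K * r)) \<partial>lborel)"
      by (intro nn_integral_cmult) auto
    also have "\<dots> \<le> ennreal K * M * ennreal (exp (2 * K * t) / (2 * K))"
      using int[of t] t by (intro mult_left_mono) auto
    also have "\<dots> = ennreal (m / 2 * exp (2 * K * t))" using K m by (simp add: ennreal_mult[symmetric] del: ennreal_mult')
    finally have "1 + u t \<le> ennreal (1 + m / 2 * exp (2 * K * t))" using m by (simp add: add_left_mono)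
    then have "(1 + u t) * ennreal (exp (- 2 * K * t)) \<le> ennreal (1 + m / 2 * exp (2 * K * t)) * ennreal (exp (- 2 * K * t))"
      by (rule mult_right_mono) simp
    also have "\<dots> = ennreal (exp (- 2 * K * t) + m / 2 * (exp (2 * K * t) * exp (- 2 * K * t)))"
      using m by (simp add: ennreal_mult[symmetric] algebra_simps del: ennreal_mult')
    also have "\<dots> \<le> ennreal (1 + m / 2)" using K t m by (intro ennreal_leI) (simp add: exp_add[symmetric])
    finally show "(1 + u t) * ennreal (exp (- 2 * K * t)) \<le> ennreal (1 + m / 2)" .
  qed
  then have "m \<le> 1 + m / 2" using m by (subst (asm) m(1), subst (asm) ennreal_le_iff) auto
  then have "m \<le> 2" by simp
  have "u t \<le> 1 + u t" by (cases "u t") auto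
  also have "\<dots> \<le> M * ennreal (exp (2 * K * t))" using le t by auto
  also have "\<dots> = ennreal (m * exp (2 * K * t))" using m by (simp add: ennreal_mult)
  also have "\<dots> \<le> ennreal (2 * exp (2 * K * T))" using \<open>m \<le> 2\<close> m t K by (intro ennreal_leI mult_mono) auto
  finally show ?thesis .
qed

lemma quadratic_growth_bound:
  fixes c B y :: real
  assumes "0 \<le> c" "0 \<le> B" "0 \<le> y"
  shows "(1 + 2 * y) * (c + B * y) \<le> (3 * c + 3 * B + 1) * (1 + y * y)"
proof -
  \<comment> \<open>The coefficients of \<open>c\<close> and \<open>B\<close> in the difference of
    the two sides, completed to sums of squares.\<close>
  have "0 \<le> c * (1 + (1 - y)\<^sup>2 + 2 * y\<^sup>2) + B * ((y - 1 / 2)\<^sup>2 + 11 / 4) + 1 + y\<^sup>2"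
    using assms by (intro add_nonneg_nonneg mult_nonneg_nonneg) auto
  also have "\<dots> = (3 * c + 3 * B + 1) * (1 + y * y) - (1 + 2 * y) * (c + B * y)"
    by (simp add: power2_eq_square algebra_simps)
  finally show ?thesis by simp
qed

context hawkes
begin

text \<open>Acceptance is stopped once more than \<open>n\<close> points have been accepted. By the
  product formula the second moment of the stopped count S is the time integral of E[(1 + 2 S) L]
  over the unstopped event, where \<open>L\<close> is at most affine in S. This closes a Gronwall
  inequality with a constant independent of \<open>n\<close>; its exponential growth in
  \<open>T\<close> is harmless, since only finiteness is asserted.\<close>

lemma N_second_moment: "(\<integral>\<^sup>+w. N T w * N T w \<partial>P) < \<infinity>"
proof -
  note k1 = adapted_kernel_config
  define f where "f n x = indicator {..of_nat n} (low (\<lambda>w. w) (accept L) x) * accept L x" for n :: nat and x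
  have lm [measurable]: "low (\<lambda>w. w) (accept L) \<in> borel_measurable marked" by (rule low_measurable[OF k1 acc_meas])
  have fm [measurable]: "f n \<in> borel_measurable marked" for n unfolding f_def by measurable
  define Sn where "Sn n t w = Sint (f n) t w" for n t w
  define u where "u n t = (\<integral>\<^sup>+w. Sn n t w * Sn n t w \<partial>P)" for n t
  define K where "K = 3 * c + 3 * B + 1"
  have K: "0 < K" using c B by (simp add: K_def)
  have Snm [measurable]: "Sn n t \<in> borel_measurable P" for n t unfolding Sn_def by (rule kint_measurable_P[OF k1 fm])
  have Sn_eq: "Sn n r w = N r w" if "N r w \<le> of_nat n" "w \<in> configs" for n r w
    unfolding Sn_def f_def
  proof (rule kint_cong[OF _ k1 that(2)])
    fix z :: "real \<times> real" assume "fst z < r"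
    then have "N (fst z) w \<le> of_nat n"
      using that(1) kint_mono_time[of "fst z" r "\<lambda>w. w" "accept L" w] by (meson less_imp_le order_trans)
    then show "indicator {..of_nat n} (low (\<lambda>w. w) (accept L) (mark w z)) * accept L (mark w z) = accept L (mark w z)"
      by (simp add: low_config)
  qed
  have fin: "\<exists>R. \<forall>t. 0 < t \<longrightarrow> t \<le> T \<longrightarrow> u n t \<le> ennreal R" for n
  proof -
    \<comment> \<open>Gronwall needs a finite bound to start from: the stopped count is at most the
      count in a strip of constant height \<open>R\<close>, whose second moment is explicit.\<close>
    define R where "R = c + B * n"
    have R: "0 \<le> R" using c B by (simp add: R_def)
    define h where "h = accept (\<lambda>_ (_ :: config). R)"
    have hm [measurable]: "h \<in> borel_measurable marked" unfolding h_def by (rule accept_measurable) simp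
    have ES: "(\<integral>\<^sup>+w. Sint h s w \<partial>P) = ennreal (R * max 0 s)" for s
    proof -
      have "(\<integral>\<^sup>+w. Sint h s w \<partial>P) = (\<integral>\<^sup>+r\<in>{0<..<s}. (\<integral>\<^sup>+w. 1 * ennreal R \<partial>P) \<partial>lborel)"
        using compensation[OF hm] expect_Aint[of "\<lambda>_. 1" "\<lambda>_ _. R" s] R by (simp add: h_def)
      also have "\<dots> = ennreal (R * max 0 s)" using R by (cases "0 \<le> s") (auto simp: emeasure_space_1 nn_integral_cmult_indicator ennreal_mult)
      finally show ?thesis .
    qed
    have hs: "h x * h x = h x" for x by (simp add: h_def accept_def indicator_def)
    have "(\<integral>\<^sup>+w. Sint h T w * Sint h T w \<partial>P) = (\<integral>\<^sup>+w. Aint (\<lambda>x. h x * low (\<lambda>w. w) h x) T w \<partial>P) + (\<integral>\<^sup>+w. Aint (\<lambda>x. h x * low (\<lambda>w. w) h x) T w \<partial>P) + (\<integral>\<^sup>+w. Aint h T w \<partial>P)"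
      using Sint_product[OF hm hm, of T] by (simp add: hs)
    also have "(\<integral>\<^sup>+w. Aint h T w \<partial>P) = ennreal (R * T)" using compensation[OF hm, of T] ES[of T] T by simp
    also have "(\<integral>\<^sup>+w. Aint (\<lambda>x. h x * low (\<lambda>w. w) h x) T w \<partial>P) = (\<integral>\<^sup>+r\<in>{0<..<T}. (\<integral>\<^sup>+w. Sint h r w * ennreal R \<partial>P) \<partial>lborel)"
      using expect_Aint[of "\<lambda>p. Sint h (fst p) (snd p)" "\<lambda>_ _. R" T] kint_predictable[OF k1 hm] R
      by (simp add: h_def low_def mult.commute split_beta')
    also have "\<dots> \<le> (\<integral>\<^sup>+r\<in>{0<..<T}. ennreal (R * T * R) \<partial>lborel)"
      using kint_measurable_P[OF k1 hm] R
      by (intro nn_integral_mono) (auto simp: indicator_def nn_integral_multc ES ennreal_mult[symmetric] intro!: ennreal_leI mult_right_mono mult_left_mono simp del: ennreal_mult')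
    also have "\<dots> = ennreal (R * T * R * T)" using R T by (subst nn_integral_cmult_indicator) (auto simp: ennreal_mult)
    finally have bound: "(\<integral>\<^sup>+w. Sint h T w * Sint h T w \<partial>P) \<le> ennreal (R * T * R * T) + ennreal (R * T * R * T) + ennreal (R * T)"
      by (simp add: add_mono)
    have "u n t \<le> (\<integral>\<^sup>+w. Sint h T w * Sint h T w \<partial>P)" if t: "0 < t" "t \<le> T" for t
      unfolding u_def
    proof (rule nn_integral_mono_AE)
      show "AE w in P. Sn n t w * Sn n t w \<le> Sint h T w * Sint h T w"
        using Lfin_le[of n] AE_space
      proof eventually_elim
        case (elim w)
        then have w: "w \<in> configs" by (simp add: space_P)
        have "Sn n t w \<le> Sint h t w"
          unfolding Sn_def
        proof (rule kint_mono[OF _ k1 w])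
          fix z :: "real \<times> real" assume z: "0 < fst z" "fst z < t"
          then have "Lfin n (fst z) w \<le> ennreal R" using elim t by (auto simp: R_def)
          then have "L (fst z) w \<le> R" if "N (fst z) w \<le> of_nat n" using that R by (simp add: Lfin_def)
          then show "f n (mark w z) \<le> h (mark w z)"
            by (auto simp: f_def h_def low_config accept_mark indicator_def)
        qed
        also have "\<dots> \<le> Sint h T w" using t by (intro kint_mono_time)
        finally show ?case by (intro mult_mono) auto
      qed
    qed
    then have "\<forall>t. 0 < t \<longrightarrow> t \<le> T \<longrightarrow> u n t \<le> ennreal (R * T * R * T + R * T * R * T + R * T)"
      using bound R T by (simp add: ennreal_plus[symmetric] del: ennreal_plus) (meson order_trans)
    then show ?thesis by blast
  qed
  have rec: "u n t \<le> (\<integral>\<^sup>+r\<in>{0<..<t}. ennreal K * (1 + u n r) \<partial>lborel)" if t: "0 < t" "t \<le> T" for n t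
  proof -
    let ?G = "\<lambda>p. indicator {..of_nat n} (N (fst p) (snd p)) * (1 + 2 * Sint (f n) (fst p) (snd p))"
    have [measurable]: "(\<lambda>p. Sint (f n) (fst p) (snd p)) \<in> borel_measurable predictable"
      using kint_predictable[OF k1 fm] by (simp add: split_beta')
    have Gm: "?G \<in> borel_measurable predictable" by measurable
    have lfm: "low (\<lambda>w. w) (f n) \<in> borel_measurable marked" by (rule low_measurable[OF k1 fm])
    have "u n t = (\<integral>\<^sup>+w. Aint (\<lambda>x. f n x * low (\<lambda>w. w) (f n) x) t w \<partial>P) + (\<integral>\<^sup>+w. Aint (\<lambda>x. f n x * low (\<lambda>w. w) (f n) x) t w \<partial>P) + (\<integral>\<^sup>+w. Aint (\<lambda>x. f n x * f n x) t w \<partial>P)"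
      unfolding u_def Sn_def by (rule Sint_product) measurable
    also have "\<dots> = (\<integral>\<^sup>+w. Aint (\<lambda>x. f n x * low (\<lambda>w. w) (f n) x) t w + Aint (\<lambda>x. f n x * low (\<lambda>w. w) (f n) x) t w + Aint (\<lambda>x. f n x * f n x) t w \<partial>P)"
      using lfm kint_measurable_P[OF adapted_kernel_half_plane] by (simp add: nn_integral_add)
    also have "\<dots> = (\<integral>\<^sup>+w. Aint (\<lambda>x. ?G (fst x) * accept L x) t w \<partial>P)"
    proof (rule nn_integral_cong)
      fix w assume "w \<in> space P" then have w: "w \<in> configs" by (simp add: space_P)
      have "Aint (\<lambda>x. f n x * low (\<lambda>w. w) (f n) x) t w + Aint (\<lambda>x. f n x * low (\<lambda>w. w) (f n) x) t w + Aint (\<lambda>x. f n x * f n x) t w =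
        Aint (\<lambda>x. (f n x * low (\<lambda>w. w) (f n) x + f n x * low (\<lambda>w. w) (f n) x) + f n x * f n x) t w"
        using lfm by (simp add: kint_add[OF adapted_kernel_half_plane _ _ w])
      also have "\<dots> = Aint (\<lambda>x. ?G (fst x) * accept L x) t w"
        by (intro arg_cong[where f = "\<lambda>h. Aint h t w"] ext) (auto simp: f_def low_def accept_def indicator_def mult_2 algebra_simps)
      finally show "Aint (\<lambda>x. f n x * low (\<lambda>w. w) (f n) x) t w + Aint (\<lambda>x. f n x * low (\<lambda>w. w) (f n) x) t w + Aint (\<lambda>x. f n x * f n x) t w
        = Aint (\<lambda>x. ?G (fst x) * accept L x) t w" .
    qed
    also have "\<dots> = (\<integral>\<^sup>+r\<in>{0<..<t}. (\<integral>\<^sup>+w. ?G (r, w) * ennreal (L r w) \<partial>P) \<partial>lborel)"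
      by (rule expect_Aint[OF Gm L_pred L_nonneg])
    also have "\<dots> \<le> (\<integral>\<^sup>+r\<in>{0<..<t}. ennreal K * (1 + u n r) \<partial>lborel)"
    proof (rule nn_integral_mono)
      fix r
      show "(\<integral>\<^sup>+w. ?G (r, w) * ennreal (L r w) \<partial>P) * indicator {0<..<t} r \<le> ennreal K * (1 + u n r) * indicator {0<..<t} r"
      proof (cases "0 < r \<and> r < t")
        case True
        have "(\<integral>\<^sup>+w. ?G (r, w) * ennreal (L r w) \<partial>P) \<le> (\<integral>\<^sup>+w. ennreal K * (1 + Sn n r w * Sn n r w) \<partial>P)"
        proof (rule nn_integral_mono_AE)
          show "AE w in P. ?G (r, w) * ennreal (L r w) \<le> ennreal K * (1 + Sn n r w * Sn n r w)"
            using L_le_N AE_space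
          proof eventually_elim
            case (elim w)
            then have w: "w \<in> configs" by (simp add: space_P)
            show ?case
            proof (cases "N r w \<le> of_nat n")
              case N: True
              then have S: "Sn n r w = N r w" using Sn_eq w by simp
              have "N r w < \<infinity>" using N by (rule le_less_trans) (simp add: of_nat_less_top)
              then obtain y where y: "N r w = ennreal y" "0 \<le> y" by (cases "N r w") auto
              have "ennreal (L r w) \<le> ennreal c + ennreal B * N r w" using elim True t by auto
              then have "L r w \<le> c + B * y" using y c B by (simp add: ennreal_mult[symmetric] ennreal_plus[symmetric] del: ennreal_mult' ennreal_plus)
              then have "(1 + 2 * y) * L r w \<le> (1 + 2 * y) * (c + B * y)" using y by (intro mult_left_mono) auto
              also have "\<dots> \<le> K * (1 + y * y)"
                using quadratic_growth_bound[OF c B y(2)] by (simp add: K_def)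
              finally have "ennreal ((1 + 2 * y) * L r w) \<le> ennreal (K * (1 + y * y))" by (rule ennreal_leI)
              moreover have "?G (r, w) * ennreal (L r w) = ennreal ((1 + 2 * y) * L r w)"
                using N S y L_nonneg[of r w] by (simp add: Sn_def ennreal_mult ennreal_plus)
              moreover have "ennreal (K * (1 + y * y)) = ennreal K * (1 + Sn n r w * Sn n r w)"
                using K y S by (simp add: ennreal_mult ennreal_plus)
              ultimately show ?thesis by simp
            qed simp
          qed
        qed
        also have "\<dots> = ennreal K * (1 + u n r)"
          unfolding u_def by (simp add: nn_integral_cmult nn_integral_add emeasure_space_1)
        finally show ?thesis using True by simp
      qed simp
    qed
    finally show ?thesis .
  qed
  have un: "u n T \<le> ennreal (2 * exp (2 * K * T))" for n
    using fin[of n] rec[of _ n] T by (elim exE) (rule gronwall_bound[OF K, of T "u n"], auto)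
  have "(\<integral>\<^sup>+w. N T w * N T w \<partial>P) \<le> (\<integral>\<^sup>+w. (SUP n. Sn n T w * Sn n T w) \<partial>P)"
  proof (rule nn_integral_mono_AE)
    show "AE w in P. N T w * N T w \<le> (SUP n. Sn n T w * Sn n T w)"
      using N_finite AE_space
    proof eventually_elim
      case (elim w)
      then obtain y where y: "N T w = ennreal y" "0 \<le> y" by (cases "N T w") auto
      obtain n :: nat where "y \<le> real n" using real_arch_simple by blast
      then have "N T w \<le> of_nat n" using y by (simp add: ennreal_of_nat_eq_real_of_nat ennreal_leI)
      then have "Sn n T w = N T w" using elim by (intro Sn_eq) (auto simp: space_P)
      then have "N T w * N T w = Sn n T w * Sn n T w" by simp
      also have "\<dots> \<le> (SUP n. Sn n T w * Sn n T w)" by (rule SUP_upper) simp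
      finally show ?case .
    qed
  qed
  also have "\<dots> = (SUP n. u n T)"
    unfolding u_def
  proof (rule nn_integral_monotone_convergence_SUP_AE)
    have "f n x \<le> f (Suc n) x" for n x
    proof -
      have "(of_nat n :: ennreal) \<le> of_nat (Suc n)" by (rule of_nat_mono) simp
      then have "y \<le> of_nat n \<Longrightarrow> y \<le> of_nat (Suc n)" for y :: ennreal by (rule order_trans[rotated])
      then show ?thesis unfolding f_def by (intro mult_right_mono) (auto simp: indicator_def simp del: of_nat_Suc)
    qed
    then have "Sn n T w \<le> Sn (Suc n) T w" for n w
      unfolding Sn_def kint_def by (intro nn_integral_mono mult_right_mono) auto
    then show "AE w in P. Sn n T w * Sn n T w \<le> Sn (Suc n) T w * Sn (Suc n) T w" for n
      by (intro AE_I2 mult_mono) auto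
  qed measurable
  also have "\<dots> \<le> ennreal (2 * exp (2 * K * T))" using un by (intro SUP_least)
  finally show ?thesis by (rule le_less_trans) simp
qed

end

section \<open>Compensated integrals as square-integrable random variables\<close>

text \<open>\<open>enn2real\<close> sends \<open>\<infinity>\<close> to \<open>0\<close>, so this is
  the compensated integral only where both parts are finite; for \<open>dominated\<close> integrands
  that is almost everywhere.\<close>

definition Mart :: "((real \<times> config) \<times> real \<Rightarrow> ennreal) \<Rightarrow> real \<Rightarrow> config \<Rightarrow> real" where
  "Mart f s w = enn2real (Sint f s w) - enn2real (Aint f s w)"

lemma integral_enn2real_mult:
  assumes [measurable]: "X \<in> borel_measurable M" "Y \<in> borel_measurable M"
    and fin: "(\<integral>\<^sup>+w. X w * Y w \<partial>M) < \<infinity>" and X: "AE w in M. X w < \<infinity>" and Y: "AE w in M. Y w < \<infinity>"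
  shows "integrable M (\<lambda>w. enn2real (X w) * enn2real (Y w))"
    and "(\<integral>w. enn2real (X w) * enn2real (Y w) \<partial>M) = enn2real (\<integral>\<^sup>+w. X w * Y w \<partial>M)"
proof -
  have eq: "(\<integral>\<^sup>+w. ennreal (enn2real (X w) * enn2real (Y w)) \<partial>M) = (\<integral>\<^sup>+w. X w * Y w \<partial>M)"
    using X Y by (intro nn_integral_cong_AE) (auto simp: ennreal_mult)
  show "integrable M (\<lambda>w. enn2real (X w) * enn2real (Y w))"
    using fin by (intro integrableI_nonneg) (auto simp: eq)
  show "(\<integral>w. enn2real (X w) * enn2real (Y w) \<partial>M) = enn2real (\<integral>\<^sup>+w. X w * Y w \<partial>M)"
    by (subst integral_eq_nn_integral) (auto simp: eq)
qed

text \<open>The Volterra equation \<open>x = \<beta> + k \<star> \<nu>\<close> convolved with \<open>\<rho>\<close>, where \<open>\<rho> = \<kappa> + \<rho> \<star> k\<close>.\<close>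

lemma volterra_path:
  fixes x \<beta> k \<kappa> \<rho> :: "real \<Rightarrow> real"
  assumes w: "w \<in> configs" and a: "a \<in> borel_measurable marked"
    and [measurable]: "k \<in> borel_measurable borel" "\<kappa> \<in> borel_measurable borel" "\<rho> \<in> borel_measurable borel" "\<beta> \<in> borel_measurable borel"
    and k0: "\<And>t. t \<le> 0 \<Longrightarrow> k t = 0" and r0: "\<And>t. t \<le> 0 \<Longrightarrow> \<rho> t = 0"
    and \<rho>: "\<And>v. ennreal (\<rho> v) = ennreal (\<kappa> v) + (\<integral>\<^sup>+r. ennreal (\<rho> (v - r)) * ennreal (k r) \<partial>lborel)"
    and x: "\<And>v. 0 < v \<Longrightarrow> v < s \<Longrightarrow> ennreal (x v) = ennreal (\<beta> v) + Sint (lag k v a) v w"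
  shows "(\<integral>\<^sup>+v\<in>{0<..<s}. ennreal (\<rho> (s - v)) * ennreal (x v) \<partial>lborel) + Sint (lag \<kappa> s a) s w
    = (\<integral>\<^sup>+v\<in>{0<..<s}. ennreal (\<rho> (s - v)) * ennreal (\<beta> v) \<partial>lborel) + Sint (\<lambda>y. ennreal (\<rho> (s - fst (fst y))) * a y) s w"
proof -
  interpret W: sigma_finite_measure w using adapted_kernelD(3)[OF adapted_kernel_config w] .
  interpret pair_sigma_finite w lborel ..
  have ms: "measurable w = measurable half_plane" using measurable_cong_sets[OF sets_config[OF w] refl] by (auto simp: fun_eq_iff)
  have [measurable]: "(\<lambda>z. a (mark w z)) \<in> borel_measurable w" "fst \<in> borel_measurable w"
    using measurable_mark_comp[OF a w] by (auto simp: ms)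
  have am [measurable]: "(\<lambda>y. ennreal (F (t - fst (fst y))) * a y) \<in> borel_measurable marked" if [measurable]: "F \<in> borel_measurable borel" for F :: "real \<Rightarrow> real" and t
    using measurable_marked_time[of "\<lambda>r. ennreal (F (t - r))"] a by measurable
  let ?h = "\<lambda>z v. ennreal (\<rho> (s - v)) * ennreal (k (v - fst z)) * (a (mark w z) * indicator {0<..<s} (fst z))"
  \<comment> \<open>The equation for \<open>\<rho>\<close> shifted by \<open>r\<close>: the total
    effect at \<open>s\<close> of a point at \<open>r\<close>, directly through
    \<open>\<kappa>\<close> or through intermediate times \<open>v\<close>.\<close>
  have conv: "(\<integral>\<^sup>+v. ennreal (\<rho> (s - v)) * ennreal (k (v - r)) \<partial>lborel) + ennreal (\<kappa> (s - r)) = ennreal (\<rho> (s - r))" for r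
  proof -
    have "(\<integral>\<^sup>+v. ennreal (\<rho> (s - v)) * ennreal (k (v - r)) \<partial>lborel) = (\<integral>\<^sup>+v. ennreal (\<rho> (s - (r + 1 * v))) * ennreal (k ((r + 1 * v) - r)) \<partial>lborel)"
      using nn_integral_real_affine[of "\<lambda>v. ennreal (\<rho> (s - v)) * ennreal (k (v - r))" 1 r] by simp
    also have "\<dots> = (\<integral>\<^sup>+v. ennreal (\<rho> ((s - r) - v)) * ennreal (k v) \<partial>lborel)" by (simp add: algebra_simps)
    finally show ?thesis using \<rho>[of "s - r"] by (simp add: add.commute)
  qed
  have "(\<integral>\<^sup>+v\<in>{0<..<s}. ennreal (\<rho> (s - v)) * ennreal (x v) \<partial>lborel) =
     (\<integral>\<^sup>+v. ennreal (\<rho> (s - v)) * ennreal (\<beta> v) * indicator {0<..<s} v + (\<integral>\<^sup>+z. ?h z v \<partial>w) \<partial>lborel)"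
  proof (rule nn_integral_cong)
    fix v
    show "ennreal (\<rho> (s - v)) * ennreal (x v) * indicator {0<..<s} v = ennreal (\<rho> (s - v)) * ennreal (\<beta> v) * indicator {0<..<s} v + (\<integral>\<^sup>+z. ?h z v \<partial>w)"
    proof (cases "0 < v \<and> v < s")
      case True
      have "(\<integral>\<^sup>+z. ?h z v \<partial>w) = (\<integral>\<^sup>+z. ennreal (\<rho> (s - v)) * (ennreal (k (v - fst z)) * a (mark w z) * indicator {0<..<v} (fst z)) \<partial>w)"
        using True k0 by (intro nn_integral_cong) (auto simp: indicator_def mult_ac)
      also have "\<dots> = ennreal (\<rho> (s - v)) * Sint (lag k v a) v w"
        unfolding kint_def by (subst nn_integral_cmult) auto
      finally show ?thesis using x[of v] True by (simp add: distrib_left)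
    next
      case False
      have "?h z v = 0" for z using False k0[of "v - fst z"] r0[of "s - v"] by (cases "s \<le> v") (auto simp: indicator_def)
      then have "(\<integral>\<^sup>+z. ?h z v \<partial>w) = (\<integral>\<^sup>+z. 0 \<partial>w)" by (intro nn_integral_cong)
      then show ?thesis using False by simp
    qed
  qed
  also have "\<dots> = (\<integral>\<^sup>+v\<in>{0<..<s}. ennreal (\<rho> (s - v)) * ennreal (\<beta> v) \<partial>lborel) + (\<integral>\<^sup>+v. (\<integral>\<^sup>+z. ?h z v \<partial>w) \<partial>lborel)"
    by (subst nn_integral_add) (auto intro!: borel_measurable_nn_integral)
  also have "(\<integral>\<^sup>+v. (\<integral>\<^sup>+z. ?h z v \<partial>w) \<partial>lborel) = (\<integral>\<^sup>+z. (\<integral>\<^sup>+v. ?h z v \<partial>lborel) \<partial>w)"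
    by (rule Fubini') measurable
  also have "\<dots> = (\<integral>\<^sup>+z. (\<integral>\<^sup>+v. ennreal (\<rho> (s - v)) * ennreal (k (v - fst z)) \<partial>lborel) * (a (mark w z) * indicator {0<..<s} (fst z)) \<partial>w)"
    by (subst nn_integral_multc) auto
  finally have "(\<integral>\<^sup>+v\<in>{0<..<s}. ennreal (\<rho> (s - v)) * ennreal (x v) \<partial>lborel) + Sint (lag \<kappa> s a) s w
    = (\<integral>\<^sup>+v\<in>{0<..<s}. ennreal (\<rho> (s - v)) * ennreal (\<beta> v) \<partial>lborel) +
      ((\<integral>\<^sup>+z. (\<integral>\<^sup>+v. ennreal (\<rho> (s - v)) * ennreal (k (v - fst z)) \<partial>lborel) * (a (mark w z) * indicator {0<..<s} (fst z)) \<partial>w) +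
       Sint (lag \<kappa> s a) s w)"
    by (simp add: add.assoc)
  also have "(\<integral>\<^sup>+z. (\<integral>\<^sup>+v. ennreal (\<rho> (s - v)) * ennreal (k (v - fst z)) \<partial>lborel) * (a (mark w z) * indicator {0<..<s} (fst z)) \<partial>w) +
       Sint (lag \<kappa> s a) s w =
     (\<integral>\<^sup>+z. (\<integral>\<^sup>+v. ennreal (\<rho> (s - v)) * ennreal (k (v - fst z)) \<partial>lborel) * (a (mark w z) * indicator {0<..<s} (fst z)) +
       ennreal (\<kappa> (s - fst z)) * a (mark w z) * indicator {0<..<s} (fst z) \<partial>w)"
    unfolding kint_def by (subst nn_integral_add) auto
  also have "\<dots> = (\<integral>\<^sup>+z. ((\<integral>\<^sup>+v. ennreal (\<rho> (s - v)) * ennreal (k (v - fst z)) \<partial>lborel) + ennreal (\<kappa> (s - fst z))) * (a (mark w z) * indicator {0<..<s} (fst z)) \<partial>w)"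
    by (intro nn_integral_cong) (simp add: distrib_right mult.assoc)
  also have "\<dots> = Sint (\<lambda>y. ennreal (\<rho> (s - fst (fst y))) * a y) s w"
    unfolding kint_def by (simp add: conv mult.assoc)
  finally show ?thesis .
qed

context hawkes
begin

text \<open>For these integrands the sum and the compensator are both bounded by a multiple of the
  square-integrable variable \<open>dom\<close>.\<close>

definition dominated :: "((real \<times> config) \<times> real \<Rightarrow> ennreal) \<Rightarrow> bool" where
  "dominated f \<longleftrightarrow> f \<in> borel_measurable marked \<and> (\<exists>R\<ge>0. \<forall>x. f x \<le> ennreal R * accept L x)"

text \<open>The second summand majorises the compensator of the accepted points by way of
  \<open>L \<le> c + B * N\<close>.\<close>

definition dom :: "config \<Rightarrow> ennreal" where
  "dom w = N T w + ennreal T * (ennreal c + ennreal B * N T w)"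

lemma dom_measurable [measurable]: "dom \<in> borel_measurable P"
  unfolding dom_def by measurable

lemma dom_finite: "AE w in P. dom w < \<infinity>"
  using N_finite
proof eventually_elim
  case (elim w)
  then obtain y where y: "N T w = ennreal y" "0 \<le> y" by (cases "N T w") auto
  have "dom w = ennreal (y + T * (c + B * y))" using y T B c by (simp add: dom_def ennreal_mult ennreal_plus)
  then show ?case by simp
qed

lemma Aint_accept: "w \<in> configs \<Longrightarrow> Aint (accept L) s w = (\<integral>\<^sup>+r\<in>{0<..<s}. ennreal (L r w) \<partial>lborel)"
  using Aint_strip[OF _ L_pred L_nonneg, of "\<lambda>_. 1" w s] by simp

lemma Sint_Aint_le_dom:
  assumes f: "\<And>x. f x \<le> ennreal R * accept L x" and s: "s \<le> T"
  shows "AE w in P. Sint f s w \<le> ennreal R * dom w \<and> Aint f s w \<le> ennreal R * dom w"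
  using L_le_N AE_space
proof eventually_elim
  case (elim w)
  then have w: "w \<in> configs" by (simp add: space_P)
  note k1 = adapted_kernel_config and k2 = adapted_kernel_half_plane
  have "Sint f s w \<le> Sint (\<lambda>x. ennreal R * accept L x) s w" by (intro kint_mono k1 w f)
  also have "\<dots> = ennreal R * N s w" by (rule kint_cmult[OF k1 acc_meas w])
  also have "\<dots> \<le> ennreal R * dom w"
    using kint_mono_time[OF s, of "\<lambda>w. w" "accept L" w] unfolding dom_def by (intro mult_left_mono add_increasing2) auto
  finally have 1: "Sint f s w \<le> ennreal R * dom w" .
  have "Aint f s w \<le> Aint (\<lambda>x. ennreal R * accept L x) s w" by (intro kint_mono k2 w f)
  also have "\<dots> = ennreal R * Aint (accept L) s w" by (rule kint_cmult[OF k2 acc_meas w])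
  also have "\<dots> \<le> ennreal R * dom w"
  proof (rule mult_left_mono)
    have "Aint (accept L) s w \<le> (\<integral>\<^sup>+r\<in>{0<..<T}. (ennreal c + ennreal B * N T w) \<partial>lborel)"
      unfolding Aint_accept[OF w]
    proof (rule nn_integral_mono)
      fix r
      show "ennreal (L r w) * indicator {0<..<s} r \<le> (ennreal c + ennreal B * N T w) * indicator {0<..<T} r"
      proof (cases "0 < r \<and> r < s")
        case True
        then have "ennreal (L r w) \<le> ennreal c + ennreal B * N r w" using elim s by auto
        also have "\<dots> \<le> ennreal c + ennreal B * N T w"
          using True s kint_mono_time[of r T "\<lambda>w. w" "accept L" w] by (intro add_left_mono mult_left_mono) auto
        finally show ?thesis using True s by simp
      qed (auto simp: indicator_def)
    qed
    also have "\<dots> = (ennreal c + ennreal B * N T w) * ennreal T" using T by (subst nn_integral_cmult_indicator) auto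
    also have "\<dots> \<le> dom w" unfolding dom_def by (simp add: mult.commute add_increasing)
    finally show "Aint (accept L) s w \<le> dom w" .
  qed simp
  finally show ?case using 1 by simp
qed

lemma dom_second_moment: "(\<integral>\<^sup>+w. dom w * dom w \<partial>P) < \<infinity>"
proof -
  define R where "R = 1 + T * B + T * c"
  have R: "0 \<le> R" using T B c by (simp add: R_def)
  have "(\<integral>\<^sup>+w. dom w * dom w \<partial>P) \<le> (\<integral>\<^sup>+w. ennreal (2 * R\<^sup>2) * (1 + N T w * N T w) \<partial>P)"
  proof (rule nn_integral_mono_AE)
    show "AE w in P. dom w * dom w \<le> ennreal (2 * R\<^sup>2) * (1 + N T w * N T w)"
      using N_finite
    proof eventually_elim
      case (elim w)
      then obtain y where y: "N T w = ennreal y" "0 \<le> y" by (cases "N T w") auto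
      have d: "dom w = ennreal (y + T * (c + B * y))" using y T B c by (simp add: dom_def ennreal_mult ennreal_plus)
      have "y + T * (c + B * y) \<le> R * (1 + y)" using y T B c by (simp add: R_def algebra_simps)
      then have "(y + T * (c + B * y)) * (y + T * (c + B * y)) \<le> (R * (1 + y)) * (R * (1 + y))"
        using y T B c R by (intro mult_mono) auto
      also have "\<dots> \<le> 2 * R\<^sup>2 * (1 + y * y)"
      proof -
        have "(1 + y) * (1 + y) \<le> 2 * (1 + y * y)" using sum_squares_bound[of 1 y] by (simp add: power2_eq_square algebra_simps)
        then have "R\<^sup>2 * ((1 + y) * (1 + y)) \<le> R\<^sup>2 * (2 * (1 + y * y))" by (rule mult_left_mono) simp
        then show ?thesis by (simp add: power2_eq_square mult_ac)
      qed
      finally have "ennreal ((y + T * (c + B * y)) * (y + T * (c + B * y))) \<le> ennreal (2 * R\<^sup>2 * (1 + y * y))" by (rule ennreal_leI)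
      moreover have "ennreal ((y + T * (c + B * y)) * (y + T * (c + B * y))) = dom w * dom w"
        unfolding d using y T B c by (intro ennreal_mult) auto
      moreover have "ennreal (2 * R\<^sup>2 * (1 + y * y)) = ennreal (2 * R\<^sup>2) * (1 + N T w * N T w)"
        using y by (simp add: ennreal_mult ennreal_plus)
      ultimately show ?case by simp
    qed
  qed
  also have "\<dots> = ennreal (2 * R\<^sup>2) * (1 + (\<integral>\<^sup>+w. N T w * N T w \<partial>P))"
    by (simp add: nn_integral_cmult nn_integral_add emeasure_space_1)
  also have "\<dots> < \<infinity>" using N_second_moment by (auto simp: ennreal_mult_less_top ennreal_add_less_top less_top)
  finally show ?thesis .
qed

lemma dominated_facts:
  assumes f: "dominated f" and s: "s \<le> T"
  obtains R where "0 \<le> R" "AE w in P. Sint f s w \<le> ennreal R * dom w" "AE w in P. Aint f s w \<le> ennreal R * dom w"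
    "AE w in P. Sint f s w < \<infinity>" "AE w in P. Aint f s w < \<infinity>"
    "(\<lambda>w. Sint f s w) \<in> borel_measurable P" "(\<lambda>w. Aint f s w) \<in> borel_measurable P"
proof -
  obtain R where R: "0 \<le> R" "\<And>x. f x \<le> ennreal R * accept L x" and fm: "f \<in> borel_measurable marked"
    using f unfolding dominated_def by blast
  note le = Sint_Aint_le_dom[OF R(2) s]
  from le dom_finite have fin: "AE w in P. Sint f s w < \<infinity> \<and> Aint f s w < \<infinity>"
  proof eventually_elim
    case (elim w)
    then have "ennreal R * dom w < \<infinity>" by (simp add: ennreal_mult_less_top)
    then show ?case using elim by (auto intro: le_less_trans)
  qed
  show thesis
  proof (rule that[OF R(1)])
    show "AE w in P. Sint f s w \<le> ennreal R * dom w" using le by eventually_elim simp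
    show "AE w in P. Aint f s w \<le> ennreal R * dom w" using le by eventually_elim simp
    show "AE w in P. Sint f s w < \<infinity>" using fin by eventually_elim simp
    show "AE w in P. Aint f s w < \<infinity>" using fin by eventually_elim simp
    show "(\<lambda>w. Sint f s w) \<in> borel_measurable P" "(\<lambda>w. Aint f s w) \<in> borel_measurable P"
      by (intro kint_measurable_P adapted_kernel_config adapted_kernel_half_plane fm)+
  qed
qed

lemma dominated_product_finite:
  assumes "0 \<le> R" "0 \<le> R'" "AE w in P. X w \<le> ennreal R * dom w" "AE w in P. Y w \<le> ennreal R' * dom w"
  shows "(\<integral>\<^sup>+w. X w * Y w \<partial>P) < \<infinity>"
proof -
  have "(\<integral>\<^sup>+w. X w * Y w \<partial>P) \<le> (\<integral>\<^sup>+w. ennreal (R * R') * (dom w * dom w) \<partial>P)"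
  proof (rule nn_integral_mono_AE)
    show "AE w in P. X w * Y w \<le> ennreal (R * R') * (dom w * dom w)"
      using assms(3,4)
    proof eventually_elim
      case (elim w)
      have "X w * Y w \<le> (ennreal R * dom w) * (ennreal R' * dom w)" using elim by (intro mult_mono) auto
      then show ?case using assms by (simp add: ennreal_mult mult_ac)
    qed
  qed
  also have "\<dots> = ennreal (R * R') * (\<integral>\<^sup>+w. dom w * dom w \<partial>P)" by (rule nn_integral_cmult) measurable
  also have "\<dots> < \<infinity>" using dom_second_moment by (simp add: ennreal_mult_less_top)
  finally show ?thesis .
qed

text \<open>Domination makes all four products of sums and compensators integrable, so
  \<open>compensated_product\<close> may be rewritten with subtractions.\<close>

lemma Mart_covariance:
  assumes f: "dominated f" and g: "dominated g" and s: "s \<le> T"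
  shows "integrable P (\<lambda>w. Mart f s w * Mart g s w)"
    and "(\<integral>w. Mart f s w * Mart g s w \<partial>P) = enn2real (\<integral>\<^sup>+w. Aint (\<lambda>x. f x * g x) s w \<partial>P)"
    and "(\<integral>\<^sup>+w. Aint (\<lambda>x. f x * g x) s w \<partial>P) < \<infinity>"
proof -
  obtain R where R: "0 \<le> R" "AE w in P. Sint f s w \<le> ennreal R * dom w" "AE w in P. Aint f s w \<le> ennreal R * dom w"
    "AE w in P. Sint f s w < \<infinity>" "AE w in P. Aint f s w < \<infinity>"
    "(\<lambda>w. Sint f s w) \<in> borel_measurable P" "(\<lambda>w. Aint f s w) \<in> borel_measurable P"
    using dominated_facts[OF f s] by blast
  obtain R' where R': "0 \<le> R'" "AE w in P. Sint g s w \<le> ennreal R' * dom w" "AE w in P. Aint g s w \<le> ennreal R' * dom w"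
    "AE w in P. Sint g s w < \<infinity>" "AE w in P. Aint g s w < \<infinity>"
    "(\<lambda>w. Sint g s w) \<in> borel_measurable P" "(\<lambda>w. Aint g s w) \<in> borel_measurable P"
    using dominated_facts[OF g s] by blast
  have fm: "f \<in> borel_measurable marked" "g \<in> borel_measurable marked" using f g by (auto simp: dominated_def)
  have f1: "(\<integral>\<^sup>+w. Sint f s w * Sint g s w \<partial>P) < \<infinity>" using R R' by (intro dominated_product_finite[of R R']) auto
  have f2: "(\<integral>\<^sup>+w. Sint f s w * Aint g s w \<partial>P) < \<infinity>" using R R' by (intro dominated_product_finite[of R R']) auto
  have f3: "(\<integral>\<^sup>+w. Aint f s w * Sint g s w \<partial>P) < \<infinity>" using R R' by (intro dominated_product_finite[of R R']) auto
  have f4: "(\<integral>\<^sup>+w. Aint f s w * Aint g s w \<partial>P) < \<infinity>" using R R' by (intro dominated_product_finite[of R R']) auto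
  note id = compensated_product[OF fm, of s]
  have "(\<integral>\<^sup>+w. Aint (\<lambda>x. f x * g x) s w \<partial>P) \<le> (\<integral>\<^sup>+w. Sint f s w * Sint g s w \<partial>P) + (\<integral>\<^sup>+w. Aint f s w * Aint g s w \<partial>P)"
    unfolding id by (simp add: add.assoc)
  also have "\<dots> < \<infinity>" using f1 f4 by (simp add: ennreal_add_less_top)
  finally show fin: "(\<integral>\<^sup>+w. Aint (\<lambda>x. f x * g x) s w \<partial>P) < \<infinity>" .
  note i1 = integral_enn2real_mult[OF R(6) R'(6) f1 R(4) R'(4)]
  note i2 = integral_enn2real_mult[OF R(6) R'(7) f2 R(4) R'(5)]
  note i3 = integral_enn2real_mult[OF R(7) R'(6) f3 R(5) R'(4)]
  note i4 = integral_enn2real_mult[OF R(7) R'(7) f4 R(5) R'(5)]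
  have exp: "Mart f s w * Mart g s w = enn2real (Sint f s w) * enn2real (Sint g s w) - enn2real (Sint f s w) * enn2real (Aint g s w)
    - enn2real (Aint f s w) * enn2real (Sint g s w) + enn2real (Aint f s w) * enn2real (Aint g s w)" for w
    by (simp add: Mart_def algebra_simps)
  show "integrable P (\<lambda>w. Mart f s w * Mart g s w)"
    unfolding exp using i1 i2 i3 i4 by (intro Bochner_Integration.integrable_add Bochner_Integration.integrable_diff)
  have "(\<integral>w. Mart f s w * Mart g s w \<partial>P) = enn2real (\<integral>\<^sup>+w. Sint f s w * Sint g s w \<partial>P) - enn2real (\<integral>\<^sup>+w. Sint f s w * Aint g s w \<partial>P)
     - enn2real (\<integral>\<^sup>+w. Aint f s w * Sint g s w \<partial>P) + enn2real (\<integral>\<^sup>+w. Aint f s w * Aint g s w \<partial>P)"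
    unfolding exp using i1 i2 i3 i4 by simp
  moreover have "enn2real ((\<integral>\<^sup>+w. Sint f s w * Sint g s w \<partial>P) + (\<integral>\<^sup>+w. Aint f s w * Aint g s w \<partial>P)) =
     enn2real ((\<integral>\<^sup>+w. Aint (\<lambda>x. f x * g x) s w \<partial>P) + (\<integral>\<^sup>+w. Sint f s w * Aint g s w \<partial>P) + (\<integral>\<^sup>+w. Aint f s w * Sint g s w \<partial>P))"
    using id by simp
  ultimately show "(\<integral>w. Mart f s w * Mart g s w \<partial>P) = enn2real (\<integral>\<^sup>+w. Aint (\<lambda>x. f x * g x) s w \<partial>P)"
    using f1 f2 f3 f4 fin by (simp add: enn2real_plus ennreal_add_less_top less_top)
qed

lemma Mart_integrable:
  assumes f: "dominated f" and s: "s \<le> T"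
  shows "integrable P (Mart f s)" and "(\<integral>w. Mart f s w \<partial>P) = 0"
proof -
  obtain R where R: "0 \<le> R" "AE w in P. Sint f s w \<le> ennreal R * dom w" "AE w in P. Aint f s w \<le> ennreal R * dom w"
    "AE w in P. Sint f s w < \<infinity>" "AE w in P. Aint f s w < \<infinity>"
    "(\<lambda>w. Sint f s w) \<in> borel_measurable P" "(\<lambda>w. Aint f s w) \<in> borel_measurable P"
    using dominated_facts[OF f s] by blast
  have fm: "f \<in> borel_measurable marked" using f by (auto simp: dominated_def)
  have "(\<integral>\<^sup>+w. dom w \<partial>P) \<le> (\<integral>\<^sup>+w. 1 + dom w * dom w \<partial>P)"
  proof (rule nn_integral_mono)
    fix w show "dom w \<le> 1 + dom w * dom w"
    proof (cases "dom w \<le> 1")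
      case False
      then have "dom w * 1 \<le> dom w * dom w" by (intro mult_left_mono) auto
      then show ?thesis by (simp add: add_increasing)
    qed (simp add: add_increasing2)
  qed
  also have "\<dots> < \<infinity>" using dom_second_moment by (simp add: nn_integral_add emeasure_space_1 ennreal_add_less_top)
  finally have d: "(\<integral>\<^sup>+w. dom w \<partial>P) < \<infinity>" .
  have fin: "(\<integral>\<^sup>+w. X w * 1 \<partial>P) < \<infinity>" if "AE w in P. X w \<le> ennreal R * dom w" for X
  proof -
    have "(\<integral>\<^sup>+w. X w * 1 \<partial>P) \<le> (\<integral>\<^sup>+w. ennreal R * dom w \<partial>P)" using that by (simp add: nn_integral_mono_AE)
    also have "\<dots> < \<infinity>" using d by (simp add: nn_integral_cmult ennreal_mult_less_top)
    finally show ?thesis .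
  qed
  have one: "(\<lambda>_. 1 :: ennreal) \<in> borel_measurable P" "AE w in P. (1 :: ennreal) < \<infinity>" by auto
  note i1 = integral_enn2real_mult[OF R(6) one(1) fin[OF R(2)] R(4) one(2)]
  note i2 = integral_enn2real_mult[OF R(7) one(1) fin[OF R(3)] R(5) one(2)]
  show "integrable P (Mart f s)" unfolding Mart_def[abs_def] using i1(1) i2(1) by simp
  show "(\<integral>w. Mart f s w \<partial>P) = 0"
    unfolding Mart_def using i1 i2 compensation[OF fm, of s] by simp
qed

end

section \<open>Renewal estimates for the resolvent kernel\<close>

definition conv :: "(real \<Rightarrow> ennreal) \<Rightarrow> (real \<Rightarrow> ennreal) \<Rightarrow> real \<Rightarrow> ennreal" where
  "conv f g v = (\<integral>\<^sup>+r. f (v - r) * g r \<partial>lborel)"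

lemma nn_integral_eq_0I: "(\<And>x. f x = 0) \<Longrightarrow> (\<integral>\<^sup>+x. f x \<partial>M) = 0"
  by simp

lemma nn_integral_lborel_translate:
  fixes f :: "real \<Rightarrow> ennreal" assumes "f \<in> borel_measurable borel"
  shows "(\<integral>\<^sup>+v. f (v - r) \<partial>lborel) = (\<integral>\<^sup>+v. f v \<partial>lborel)"
  using nn_integral_real_affine[OF assms, of 1 "- r"] by simp

lemma measurable_conv [measurable]:
  assumes [measurable]: "f \<in> borel_measurable borel" "g \<in> borel_measurable borel"
  shows "conv f g \<in> borel_measurable borel"
  unfolding conv_def[abs_def] by measurable

lemma conv_commute:
  assumes [measurable]: "f \<in> borel_measurable borel" "g \<in> borel_measurable borel"
  shows "conv f g v = conv g f v"
  using nn_integral_lborel_reflect[of "\<lambda>r. f (v - r) * g r" v] by (simp add: conv_def mult.commute)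

lemma conv_add_left:
  assumes [measurable]: "f \<in> borel_measurable borel" "f' \<in> borel_measurable borel" "g \<in> borel_measurable borel"
  shows "conv (\<lambda>v. f v + f' v) g v = conv f g v + conv f' g v"
  by (simp add: conv_def distrib_right nn_integral_add)

lemma conv_add_right:
  assumes [measurable]: "f \<in> borel_measurable borel" "f' \<in> borel_measurable borel" "g \<in> borel_measurable borel"
  shows "conv g (\<lambda>v. f v + f' v) v = conv g f v + conv g f' v"
  by (simp add: conv_def distrib_left nn_integral_add)

lemma conv_assoc:
  assumes [measurable]: "f \<in> borel_measurable borel" "g \<in> borel_measurable borel" "h \<in> borel_measurable borel"
  shows "conv (conv f g) h v = conv f (conv g h) v"
proof -
  have "conv (conv f g) h v = (\<integral>\<^sup>+r. (\<integral>\<^sup>+u. f (v - r - u) * g u * h r \<partial>lborel) \<partial>lborel)"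
    by (simp add: conv_def nn_integral_multc)
  also have "\<dots> = (\<integral>\<^sup>+r. (\<integral>\<^sup>+u. f (v - u) * g (u - r) * h r \<partial>lborel) \<partial>lborel)"
  proof (rule nn_integral_cong)
    fix r
    show "(\<integral>\<^sup>+u. f (v - r - u) * g u * h r \<partial>lborel) = (\<integral>\<^sup>+u. f (v - u) * g (u - r) * h r \<partial>lborel)"
      using nn_integral_lborel_translate[of "\<lambda>u. f (v - r - u) * g u * h r" r] by simp
  qed
  also have "\<dots> = (\<integral>\<^sup>+u. (\<integral>\<^sup>+r. f (v - u) * g (u - r) * h r \<partial>lborel) \<partial>lborel)"
    by (rule lborel_pair.Fubini') measurable
  also have "\<dots> = conv f (conv g h) v"
    by (simp add: conv_def nn_integral_cmult mult.assoc)
  finally show ?thesis .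
qed

lemma nn_integral_conv:
  assumes [measurable]: "f \<in> borel_measurable borel" "g \<in> borel_measurable borel"
  shows "(\<integral>\<^sup>+v. conv f g v \<partial>lborel) = (\<integral>\<^sup>+v. f v \<partial>lborel) * (\<integral>\<^sup>+v. g v \<partial>lborel)"
proof -
  have "(\<integral>\<^sup>+v. conv f g v \<partial>lborel) = (\<integral>\<^sup>+r. (\<integral>\<^sup>+v. f (v - r) * g r \<partial>lborel) \<partial>lborel)"
    unfolding conv_def by (rule lborel_pair.Fubini') measurable
  also have "\<dots> = (\<integral>\<^sup>+r. (\<integral>\<^sup>+v. f v \<partial>lborel) * g r \<partial>lborel)"
    using nn_integral_lborel_translate[of f] by (simp add: nn_integral_multc)
  finally show ?thesis by (simp add: nn_integral_cmult)
qed

lemma conv_le: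
  assumes [measurable]: "g \<in> borel_measurable borel" and "\<And>v. f v \<le> M"
  shows "conv f g v \<le> M * (\<integral>\<^sup>+r. g r \<partial>lborel)"
proof -
  have "conv f g v \<le> (\<integral>\<^sup>+r. M * g r \<partial>lborel)"
    unfolding conv_def using assms by (intro nn_integral_mono mult_right_mono) auto
  then show ?thesis by (simp add: nn_integral_cmult)
qed

section \<open>The resolvent kernel as a Neumann series\<close>

locale subcritical_kernel =
  fixes k :: "real \<Rightarrow> real" and q B :: real
  assumes k_measurable [measurable]: "k \<in> borel_measurable borel" and k_nn: "\<And>t. 0 \<le> k t" and k_bd: "\<And>t. k t \<le> B"
    and k_supp: "\<And>t. t \<le> 0 \<Longrightarrow> k t = 0" and k_mass: "(\<integral>\<^sup>+t. ennreal (k t) \<partial>lborel) \<le> ennreal q"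
    and q01: "0 \<le> q" "q < 1"
begin

lemma B_nonneg: "0 \<le> B" using k_nn[of 0] k_bd[of 0] by linarith

abbreviation "ek \<equiv> \<lambda>t. ennreal (k t)"

text \<open>Sum of the first \<open>n\<close> convolution powers of \<open>k\<close>, kept in
  \<open>ennreal\<close> so that the limit exists before its finiteness is known.\<close>

primrec iter :: "nat \<Rightarrow> real \<Rightarrow> ennreal" where
  "iter 0 v = 0"
| "iter (Suc n) v = ek v + conv (iter n) ek v"

lemma iter_measurable [measurable]: "iter n \<in> borel_measurable borel"
proof (induction n)
  case 0
  have "iter 0 = (\<lambda>_. 0)" by (rule ext) simp
  then show ?case by simp
next
  case (Suc n)
  note [measurable] = Suc
  have "iter (Suc n) = (\<lambda>v. ek v + conv (iter n) ek v)" by (rule ext) simp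
  then show ?case by simp
qed

lemma iter_mono: "iter n v \<le> iter (Suc n) v"
proof (induction n arbitrary: v)
  case (Suc n)
  have "conv (iter n) ek v \<le> conv (iter (Suc n)) ek v"
    unfolding conv_def by (intro nn_integral_mono mult_right_mono Suc) auto
  then show ?case by (metis iter.simps(2) add_left_mono)
qed simp

text \<open>This bound involves \<open>B\<close> and is not uniform in \<open>T\<close>; its purpose
  is to make the limit finite at every point.\<close>

lemma iter_le: "iter n v \<le> ennreal (B / (1 - q))"
proof (induction n arbitrary: v)
  case (Suc n)
  have "iter (Suc n) v \<le> ennreal B + ennreal (B / (1 - q)) * ennreal q"
  proof -
    have "conv (iter n) ek v \<le> ennreal (B / (1 - q)) * (\<integral>\<^sup>+r. ek r \<partial>lborel)" by (intro conv_le Suc) simp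
    also have "\<dots> \<le> ennreal (B / (1 - q)) * ennreal q" by (intro mult_left_mono k_mass) simp
    finally show ?thesis using k_bd by (auto intro!: add_mono ennreal_leI)
  qed
  also have "\<dots> = ennreal (B + B / (1 - q) * q)" using q01 B_nonneg by (simp add: ennreal_mult[symmetric] del: ennreal_mult')
  also have "B + B / (1 - q) * q = B / (1 - q)" using q01 by (simp add: field_simps)
  finally show ?case .
qed simp

lemma iter_supp: "v \<le> 0 \<Longrightarrow> iter n v = 0"
proof (induction n arbitrary: v)
  case (Suc n)
  have "conv (iter n) ek v = 0"
    unfolding conv_def
  proof -
    have "iter n (v - r) * ek r = 0" for r
      using Suc.IH[of "v - r"] Suc.prems k_supp[of r] by (cases "r \<le> 0") auto
    then show "(\<integral>\<^sup>+r. iter n (v - r) * ek r \<partial>lborel) = 0" by (rule nn_integral_eq_0I)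
  qed
  then show ?case using k_supp Suc.prems by simp
qed simp

lemma iter_mass: "(\<integral>\<^sup>+v. iter n v \<partial>lborel) \<le> ennreal (q / (1 - q))"
proof (induction n)
  case (Suc n)
  have "(\<integral>\<^sup>+v. iter (Suc n) v \<partial>lborel) = (\<integral>\<^sup>+v. ek v \<partial>lborel) + (\<integral>\<^sup>+v. iter n v \<partial>lborel) * (\<integral>\<^sup>+v. ek v \<partial>lborel)"
    by (simp add: nn_integral_add nn_integral_conv)
  also have "\<dots> \<le> ennreal q + ennreal (q / (1 - q)) * ennreal q"
    by (intro add_mono mult_mono k_mass Suc) auto
  also have "\<dots> = ennreal (q + q / (1 - q) * q)" using q01 by (simp add: ennreal_mult[symmetric] del: ennreal_mult')
  also have "q + q / (1 - q) * q = q / (1 - q)" using q01 by (simp add: field_simps)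
  finally show ?case .
qed simp

definition psi :: "real \<Rightarrow> real" where
  "psi v = enn2real (SUP n. iter n v)"

lemma ennreal_psi: "ennreal (psi v) = (SUP n. iter n v)"
proof -
  have "(SUP n. iter n v) \<le> ennreal (B / (1 - q))" by (intro SUP_least iter_le)
  also have "\<dots> < top" by simp
  finally show ?thesis by (simp add: psi_def)
qed

lemma psi_measurable [measurable]: "psi \<in> borel_measurable borel"
  unfolding psi_def[abs_def] by measurable

lemma psi_nonneg: "0 \<le> psi v" by (simp add: psi_def)

lemma psi_supp: "v \<le> 0 \<Longrightarrow> psi v = 0" by (simp add: psi_def iter_supp)

lemma psi_mass: "(\<integral>\<^sup>+v. ennreal (psi v) \<partial>lborel) \<le> ennreal (q / (1 - q))"
proof -
  have "(\<integral>\<^sup>+v. ennreal (psi v) \<partial>lborel) = (SUP n. \<integral>\<^sup>+v. iter n v \<partial>lborel)"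
    unfolding ennreal_psi using iter_mono
    by (intro nn_integral_monotone_convergence_SUP) (auto intro!: incseq_SucI simp: le_fun_def simp del: iter.simps)
  also have "\<dots> \<le> ennreal (q / (1 - q))" by (intro SUP_least iter_mass)
  finally show ?thesis .
qed

abbreviation "epsi \<equiv> \<lambda>t. ennreal (psi t)"

lemma psi_eq: "epsi v = ek v + conv epsi ek v"
proof -
  have "conv epsi ek v = (\<integral>\<^sup>+r. (SUP n. iter n (v - r) * ek r) \<partial>lborel)"
    unfolding conv_def ennreal_psi by (simp add: SUP_mult_right_ennreal)
  also have "\<dots> = (SUP n. conv (iter n) ek v)"
    unfolding conv_def using iter_mono
    by (intro nn_integral_monotone_convergence_SUP) (auto intro!: incseq_SucI mult_right_mono simp: le_fun_def simp del: iter.simps)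
  finally have "ek v + conv epsi ek v = ek v + (SUP n. conv (iter n) ek v)" by simp
  also have "\<dots> = (SUP n. ek v + conv (iter n) ek v)" by (simp add: ennreal_SUP_add_right)
  also have "\<dots> = (SUP n. iter (Suc n) v)" by simp
  also have "\<dots> = (SUP n. iter n v)"
  proof (rule antisym)
    show "(SUP n. iter (Suc n) v) \<le> (SUP n. iter n v)" by (intro SUP_least SUP_upper) simp
    show "(SUP n. iter n v) \<le> (SUP n. iter (Suc n) v)" by (intro SUP_mono) (use iter_mono in blast)
  qed
  finally show ?thesis by (simp add: ennreal_psi)
qed

text \<open>\<open>rho \<kappa>\<close> is the response \<open>\<kappa> + \<kappa> \<star> \<psi>\<close> of the functional with kernel \<open>\<kappa>\<close>.\<close>

definition rho :: "(real \<Rightarrow> real) \<Rightarrow> real \<Rightarrow> real" where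
  "rho \<kappa> v = enn2real (ennreal (\<kappa> v) + conv (\<lambda>t. ennreal (\<kappa> t)) epsi v)"

context
  fixes \<kappa> :: "real \<Rightarrow> real" and R :: real
  assumes \<kappa> [measurable]: "\<kappa> \<in> borel_measurable borel" and \<kappa>_nn: "\<And>t. 0 \<le> \<kappa> t" and \<kappa>_bd: "\<And>t. \<kappa> t \<le> R"
    and \<kappa>_supp: "\<And>t. t \<le> 0 \<Longrightarrow> \<kappa> t = 0"
begin

lemma ennreal_rho: "ennreal (rho \<kappa> v) = ennreal (\<kappa> v) + conv (\<lambda>t. ennreal (\<kappa> t)) epsi v"
proof -
  have "conv (\<lambda>t. ennreal (\<kappa> t)) epsi v \<le> ennreal R * (\<integral>\<^sup>+v. epsi v \<partial>lborel)"
    using \<kappa>_bd by (intro conv_le) (auto intro: ennreal_leI)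
  also have "\<dots> < top" using psi_mass by (auto simp: ennreal_mult_less_top intro: le_less_trans)
  finally show ?thesis by (simp add: rho_def ennreal_add_less_top)
qed

lemma rho_measurable [measurable]: "rho \<kappa> \<in> borel_measurable borel"
  unfolding rho_def[abs_def] by measurable

lemma rho_nonneg: "0 \<le> rho \<kappa> v" by (simp add: rho_def)

lemma rho_supp: "v \<le> 0 \<Longrightarrow> rho \<kappa> v = 0"
proof -
  assume v: "v \<le> 0"
  have "ennreal (\<kappa> (v - r)) * epsi r = 0" for r
    using \<kappa>_supp[of "v - r"] v psi_supp[of r] by (cases "r \<le> 0") auto
  then have "conv (\<lambda>t. ennreal (\<kappa> t)) epsi v = 0" unfolding conv_def by (rule nn_integral_eq_0I)
  then show ?thesis using v \<kappa>_supp by (simp add: rho_def)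
qed

lemma rho_le: "rho \<kappa> v \<le> R / (1 - q)"
proof -
  have R: "0 \<le> R" using \<kappa>_nn[of 0] \<kappa>_bd[of 0] by linarith
  have "conv (\<lambda>t. ennreal (\<kappa> t)) epsi v \<le> ennreal R * (\<integral>\<^sup>+v. epsi v \<partial>lborel)"
    using \<kappa>_bd by (intro conv_le) (auto intro: ennreal_leI)
  also have "\<dots> \<le> ennreal R * ennreal (q / (1 - q))" by (intro mult_left_mono psi_mass) simp
  finally have "ennreal (rho \<kappa> v) \<le> ennreal R + ennreal R * ennreal (q / (1 - q))"
    unfolding ennreal_rho using \<kappa>_bd by (intro add_mono) (auto intro: ennreal_leI)
  also have "\<dots> = ennreal (R + R * (q / (1 - q)))" using R q01 by (simp add: ennreal_mult[symmetric] del: ennreal_mult')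
  also have "R + R * (q / (1 - q)) = R / (1 - q)" using q01 by (simp add: field_simps)
  finally show ?thesis using R q01 by (subst (asm) ennreal_le_iff) auto
qed

text \<open>Associativity of the convolution transfers the resolvent equation of \<open>psi\<close>
  to \<open>rho \<kappa>\<close>, with \<open>k\<close> as the inner factor, the form that
  \<open>volterra_path\<close> asks for.\<close>

lemma rho_eq: "ennreal (rho \<kappa> v) = ennreal (\<kappa> v) + (\<integral>\<^sup>+r. ennreal (rho \<kappa> (v - r)) * ennreal (k r) \<partial>lborel)"
proof -
  let ?\<kappa> = "\<lambda>t. ennreal (\<kappa> t)"
  have "(\<integral>\<^sup>+r. ennreal (rho \<kappa> (v - r)) * ennreal (k r) \<partial>lborel) = conv (\<lambda>t. ?\<kappa> t + conv ?\<kappa> epsi t) ek v"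
    unfolding conv_def[of _ ek] ennreal_rho ..
  also have "\<dots> = conv ?\<kappa> ek v + conv ?\<kappa> (conv epsi ek) v"
    by (simp add: conv_add_left conv_assoc)
  also have "\<dots> = conv ?\<kappa> (\<lambda>t. ek t + conv epsi ek t) v"
    by (simp add: conv_add_right)
  also have "\<dots> = conv ?\<kappa> epsi v" by (simp add: psi_eq[symmetric])
  finally show ?thesis by (simp add: ennreal_rho)
qed

end

lemma rho_k: "rho k = psi"
proof
  fix v
  have "ennreal (rho k v) = ek v + conv ek epsi v" using k_nn k_bd k_supp by (intro ennreal_rho[of k B]) auto
  also have "\<dots> = epsi v" using conv_commute[of ek epsi v] psi_eq[of v] by simp
  finally show "rho k v = psi v"
    using rho_nonneg[of k v] psi_nonneg[of v] by (simp add: rho_def psi_def)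
qed

section \<open>Renewal estimates that do not involve \<open>B\<close>\<close>

definition K :: "real \<Rightarrow> real" where
  "K t = enn2real (\<integral>\<^sup>+r\<in>{..t}. ek r \<partial>lborel)"

lemma ennreal_K: "ennreal (K t) = (\<integral>\<^sup>+r\<in>{..t}. ek r \<partial>lborel)" and K_le: "K t \<le> q" and K_nonneg: "0 \<le> K t"
proof -
  have "(\<integral>\<^sup>+r\<in>{..t}. ek r \<partial>lborel) \<le> (\<integral>\<^sup>+r. ek r \<partial>lborel)"
    by (intro nn_integral_mono) (auto simp: indicator_def)
  also have "\<dots> \<le> ennreal q" by (rule k_mass)
  finally have le: "(\<integral>\<^sup>+r\<in>{..t}. ek r \<partial>lborel) \<le> ennreal q" .
  also have "\<dots> < top" by simp
  finally show e: "ennreal (K t) = (\<integral>\<^sup>+r\<in>{..t}. ek r \<partial>lborel)" by (simp add: K_def)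
  show "0 \<le> K t" by (simp add: K_def)
  show "K t \<le> q" using le q01 unfolding e[symmetric] by (subst (asm) ennreal_le_iff) auto
qed

lemma K_mono: "s \<le> t \<Longrightarrow> K s \<le> K t"
proof -
  assume "s \<le> t"
  then have "ennreal (K s) \<le> ennreal (K t)"
    unfolding ennreal_K by (intro nn_integral_mono mult_left_mono) (auto simp: indicator_def)
  then show "K s \<le> K t" using K_nonneg by (subst (asm) ennreal_le_iff) auto
qed

lemma K_measurable [measurable]: "K \<in> borel_measurable borel"
  by (rule borel_measurable_mono) (simp add: mono_def K_mono)

text \<open>The resolvent equation integrated over \<open>{..t}\<close>; the mass of
  \<open>psi\<close> appears on both sides and is cancelled, which its finiteness permits.
  Probabilistically this is a decomposition by the last renewal before \<open>t\<close>. Both the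
  upper and the lower estimate of \<open>psi\<close> start from it.\<close>

lemma renewal_identity: "(\<integral>\<^sup>+u\<in>{..t}. epsi u * ennreal (1 - K (t - u)) \<partial>lborel) = ennreal (K t)"
proof -
  let ?P = "\<integral>\<^sup>+u\<in>{..t}. epsi u \<partial>lborel"
  have "?P \<le> (\<integral>\<^sup>+u. epsi u \<partial>lborel)" by (intro nn_integral_mono) (auto simp: indicator_def)
  also have "\<dots> < top" using psi_mass by (rule le_less_trans) simp
  finally have Pfin: "?P < top" .
  have "?P = (\<integral>\<^sup>+v. ek v * indicator {..t} v + conv ek epsi v * indicator {..t} v \<partial>lborel)"
    by (subst psi_eq) (simp add: distrib_right conv_commute[of ek epsi])
  also have "\<dots> = ennreal (K t) + (\<integral>\<^sup>+v\<in>{..t}. conv ek epsi v \<partial>lborel)"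
    by (simp add: nn_integral_add ennreal_K)
  also have "(\<integral>\<^sup>+v\<in>{..t}. conv ek epsi v \<partial>lborel) = (\<integral>\<^sup>+v. (\<integral>\<^sup>+u. ek (v - u) * epsi u * indicator {..t} v \<partial>lborel) \<partial>lborel)"
    by (simp add: conv_def nn_integral_multc)
  also have "\<dots> = (\<integral>\<^sup>+u. (\<integral>\<^sup>+v\<in>{..t}. ek (v - u) * epsi u \<partial>lborel) \<partial>lborel)"
    by (rule lborel_pair.Fubini') measurable
  also have "\<dots> = (\<integral>\<^sup>+u\<in>{..t}. epsi u * ennreal (K (t - u)) \<partial>lborel)"
  proof (rule nn_integral_cong)
    fix u
    have "(\<integral>\<^sup>+v\<in>{..t}. ek (v - u) * epsi u \<partial>lborel) = (\<integral>\<^sup>+v. epsi u * (ek (v - u) * indicator {..t - u} (v - u)) \<partial>lborel)"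
      by (intro nn_integral_cong) (auto simp: indicator_def mult.commute)
    also have "\<dots> = epsi u * (\<integral>\<^sup>+v. ek (v - u) * indicator {..t - u} (v - u) \<partial>lborel)" by (rule nn_integral_cmult) measurable
    also have "\<dots> = epsi u * ennreal (K (t - u))"
      using nn_integral_lborel_translate[of "\<lambda>v. ek v * indicator {..t - u} v" u] by (simp add: ennreal_K)
    also have "\<dots> = epsi u * ennreal (K (t - u)) * indicator {..t} u"
    proof (cases "u \<le> t")
      case False
      then have "ek r * indicator {..t - u} r = 0" for r using k_supp[of r] by (auto simp: indicator_def)
      then have "ennreal (K (t - u)) = 0" unfolding ennreal_K by (rule nn_integral_eq_0I)
      then show ?thesis by simp
    qed simp
    finally show "(\<integral>\<^sup>+v\<in>{..t}. ek (v - u) * epsi u \<partial>lborel) = epsi u * ennreal (K (t - u)) * indicator {..t} u" .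
  qed
  finally have P1: "?P = ennreal (K t) + (\<integral>\<^sup>+u\<in>{..t}. epsi u * ennreal (K (t - u)) \<partial>lborel)" .
  have "?P = (\<integral>\<^sup>+u. epsi u * ennreal (1 - K (t - u)) * indicator {..t} u + epsi u * ennreal (K (t - u)) * indicator {..t} u \<partial>lborel)"
  proof (rule nn_integral_cong)
    fix u
    have "ennreal (1 - K (t - u)) + ennreal (K (t - u)) = 1"
      using K_le[of "t - u"] K_nonneg[of "t - u"] q01 by (simp add: ennreal_plus[symmetric] del: ennreal_plus)
    then have "epsi u * indicator {..t} u * (ennreal (1 - K (t - u)) + ennreal (K (t - u))) = epsi u * indicator {..t} u" by simp
    then show "epsi u * indicator {..t} u = epsi u * ennreal (1 - K (t - u)) * indicator {..t} u + epsi u * ennreal (K (t - u)) * indicator {..t} u"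
      by (simp add: distrib_left mult_ac)
  qed
  also have "\<dots> = (\<integral>\<^sup>+u\<in>{..t}. epsi u * ennreal (1 - K (t - u)) \<partial>lborel) + (\<integral>\<^sup>+u\<in>{..t}. epsi u * ennreal (K (t - u)) \<partial>lborel)"
    by (rule nn_integral_add) measurable
  finally have P2: "?P = (\<integral>\<^sup>+u\<in>{..t}. epsi u * ennreal (1 - K (t - u)) \<partial>lborel) + (\<integral>\<^sup>+u\<in>{..t}. epsi u * ennreal (K (t - u)) \<partial>lborel)" .
  have "(\<integral>\<^sup>+u\<in>{..t}. epsi u * ennreal (K (t - u)) \<partial>lborel) < top"
    using Pfin unfolding P2 by (simp add: ennreal_add_less_top)
  then show ?thesis using P1 P2 by (auto simp: add.commute ennreal_add_left_cancel)
qed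

text \<open>On a window of length \<open>A\<close> the factor \<open>1 - K\<close> in
  \<open>renewal_identity\<close> is at least \<open>\<delta>\<close>. This controls the mass of
  \<open>psi\<close> on windows uniformly in \<open>T\<close>, where the pointwise bound on
  \<open>psi\<close> is not uniform.\<close>

lemma psi_window:
  assumes A: "K A \<le> 1 - \<delta>" "0 < \<delta>"
  shows "(\<integral>\<^sup>+u\<in>{t - A..t}. epsi u \<partial>lborel) \<le> ennreal (1 / \<delta>)"
proof -
  have "ennreal \<delta> * (\<integral>\<^sup>+u\<in>{t - A..t}. epsi u \<partial>lborel) = (\<integral>\<^sup>+u. ennreal \<delta> * (epsi u * indicator {t - A..t} u) \<partial>lborel)"
    by (rule nn_integral_cmult[symmetric]) measurable
  also have "\<dots> \<le> (\<integral>\<^sup>+u\<in>{..t}. epsi u * ennreal (1 - K (t - u)) \<partial>lborel)"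
  proof (rule nn_integral_mono)
    fix u
    show "ennreal \<delta> * (epsi u * indicator {t - A..t} u) \<le> epsi u * ennreal (1 - K (t - u)) * indicator {..t} u"
    proof (cases "t - A \<le> u \<and> u \<le> t")
      case True
      then have "\<delta> \<le> 1 - K (t - u)" using K_mono[of "t - u" A] A by simp
      then have "epsi u * ennreal \<delta> \<le> epsi u * ennreal (1 - K (t - u))" by (intro mult_left_mono ennreal_leI) auto
      then show ?thesis using True by (simp add: mult.commute)
    qed (auto simp: indicator_def)
  qed
  also have "\<dots> \<le> 1" unfolding renewal_identity using K_le[of t] q01 by simp
  finally have *: "ennreal \<delta> * (\<integral>\<^sup>+u\<in>{t - A..t}. epsi u \<partial>lborel) \<le> 1" .
  have "(\<integral>\<^sup>+u\<in>{t - A..t}. epsi u \<partial>lborel) = ennreal (1 / \<delta>) * (ennreal \<delta> * (\<integral>\<^sup>+u\<in>{t - A..t}. epsi u \<partial>lborel))"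
    using A by (simp add: mult.assoc[symmetric] ennreal_mult[symmetric] del: ennreal_mult')
  also have "\<dots> \<le> ennreal (1 / \<delta>) * 1" by (intro mult_left_mono *) simp
  finally show ?thesis by simp
qed

text \<open>\<open>renewal_identity\<close> is integrated over \<open>t \<le> S\<close>. One side is
  at most \<open>m\<close> times the mass of \<open>psi\<close>; on the other side the integrand is
  at least \<open>K A\<close> on \<open>{A..S}\<close>. The integrated tail of the kernel, and with
  it the first moment, enters here.\<close>

lemma psi_lower:
  assumes S: "A \<le> S" "0 \<le> A" and m: "(\<integral>\<^sup>+v\<in>{0..S}. ennreal (1 - K v) \<partial>lborel) \<le> ennreal m" "0 < m"
  shows "ennreal ((S - A) * K A / m) \<le> (\<integral>\<^sup>+u\<in>{..S}. epsi u \<partial>lborel)"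
proof -
  let ?P = "\<integral>\<^sup>+u\<in>{..S}. epsi u \<partial>lborel"
  have "ennreal ((S - A) * K A) = (\<integral>\<^sup>+t\<in>{A..S}. ennreal (K A) \<partial>lborel)"
    using S K_nonneg[of A] by (subst nn_integral_cmult_indicator) (auto simp: ennreal_mult mult.commute)
  also have "\<dots> \<le> (\<integral>\<^sup>+t\<in>{..S}. ennreal (K t) \<partial>lborel)"
    using K_mono by (intro nn_integral_mono) (auto simp: indicator_def intro: ennreal_leI)
  also have "\<dots> = (\<integral>\<^sup>+t. (\<integral>\<^sup>+u. epsi u * ennreal (1 - K (t - u)) * indicator {..t} u * indicator {..S} t \<partial>lborel) \<partial>lborel)"
    unfolding renewal_identity[symmetric] by (subst nn_integral_multc) auto
  also have "\<dots> = (\<integral>\<^sup>+u. (\<integral>\<^sup>+t\<in>{..S}. epsi u * ennreal (1 - K (t - u)) * indicator {..t} u \<partial>lborel) \<partial>lborel)"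
    by (rule lborel_pair.Fubini') (simp add: indicator_def)
  also have "\<dots> \<le> (\<integral>\<^sup>+u. epsi u * indicator {..S} u * ennreal m \<partial>lborel)"
  proof (rule nn_integral_mono)
    fix u
    show "(\<integral>\<^sup>+t\<in>{..S}. epsi u * ennreal (1 - K (t - u)) * indicator {..t} u \<partial>lborel) \<le> epsi u * indicator {..S} u * ennreal m"
    proof (cases "0 < u \<and> u \<le> S")
      case True
      have "(\<integral>\<^sup>+t\<in>{..S}. epsi u * ennreal (1 - K (t - u)) * indicator {..t} u \<partial>lborel) \<le>
         (\<integral>\<^sup>+t. epsi u * (ennreal (1 - K (t - u)) * indicator {0..S} (t - u)) \<partial>lborel)"
        using True by (intro nn_integral_mono) (auto simp: indicator_def)
      also have "\<dots> = epsi u * (\<integral>\<^sup>+t. ennreal (1 - K (t - u)) * indicator {0..S} (t - u) \<partial>lborel)"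
        by (rule nn_integral_cmult) measurable
      also have "\<dots> \<le> epsi u * ennreal m"
        using nn_integral_lborel_translate[of "\<lambda>v. ennreal (1 - K v) * indicator {0..S} v" u] m by (intro mult_left_mono) auto
      finally show ?thesis using True by simp
    next
      case False
      have "epsi u * ennreal (1 - K (t - u)) * indicator {..t} u * indicator {..S} t = 0" for t
        using False psi_supp[of u] by (cases "u \<le> 0") (auto simp: indicator_def)
      then have "(\<integral>\<^sup>+t\<in>{..S}. epsi u * ennreal (1 - K (t - u)) * indicator {..t} u \<partial>lborel) = (\<integral>\<^sup>+(t::real). 0 \<partial>lborel)"
        by (intro nn_integral_cong)
      then show ?thesis by simp
    qed
  qed
  also have "\<dots> = ?P * ennreal m" by (rule nn_integral_multc) measurable
  finally have *: "ennreal ((S - A) * K A) \<le> ?P * ennreal m" .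
  have "ennreal ((S - A) * K A / m) = ennreal ((S - A) * K A) * ennreal (1 / m)"
    using S K_nonneg[of A] m by (simp add: ennreal_mult[symmetric] del: ennreal_mult')
  also have "\<dots> \<le> ?P * ennreal m * ennreal (1 / m)" using * by (rule mult_right_mono) simp
  also have "\<dots> = ?P" using m by (simp add: mult.assoc ennreal_mult[symmetric] del: ennreal_mult')
  finally show ?thesis .
qed

definition kt :: "real \<Rightarrow> real \<Rightarrow> real" where
  "kt A v = (if v \<le> A then k v else 0)"

lemma kt_measurable [measurable]: "kt A \<in> borel_measurable borel"
  unfolding kt_def[abs_def] by measurable

lemma kt_facts: "0 \<le> kt A v" "kt A v \<le> k v" "kt A v \<le> B" "v \<le> 0 \<Longrightarrow> kt A v = 0"
  using k_nn[of v] k_bd[of v] k_supp[of v] B_nonneg by (auto simp: kt_def)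

text \<open>A kernel supported in \<open>{0..A}\<close> only averages \<open>psi\<close> over a
  window of length \<open>A\<close>, so \<open>psi_window\<close> yields a bound free of
  \<open>B\<close>.\<close>

lemma rho_kt_le:
  assumes A: "K A \<le> 1 - \<delta>" "0 < \<delta>" and BA: "\<And>v. kt A v \<le> b"
  shows "rho (kt A) v \<le> b * (1 + 1 / \<delta>)"
proof -
  have b: "0 \<le> b" using BA[of 0] kt_facts(1)[of A 0] by linarith
  have "conv (\<lambda>t. ennreal (kt A t)) epsi v \<le> (\<integral>\<^sup>+r. ennreal b * (epsi r * indicator {v - A..v} r) \<partial>lborel)"
    unfolding conv_def
  proof (rule nn_integral_mono)
    fix r
    show "ennreal (kt A (v - r)) * epsi r \<le> ennreal b * (epsi r * indicator {v - A..v} r)"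
    proof (cases "v - A \<le> r \<and> r \<le> v")
      case True
      then show ?thesis using BA[of "v - r"] by (auto intro!: mult_right_mono ennreal_leI)
    next
      case False
      then have "kt A (v - r) = 0" using kt_facts(4)[of "v - r" A] by (auto simp: kt_def)
      then show ?thesis by simp
    qed
  qed
  also have "\<dots> = ennreal b * (\<integral>\<^sup>+r\<in>{v - A..v}. epsi r \<partial>lborel)" by (rule nn_integral_cmult) measurable
  also have "\<dots> \<le> ennreal b * ennreal (1 / \<delta>)" by (intro mult_left_mono psi_window[OF A]) simp
  finally have "ennreal (rho (kt A) v) \<le> ennreal b + ennreal b * ennreal (1 / \<delta>)"
    using BA kt_facts by (subst ennreal_rho[of _ B]) (auto intro!: add_mono ennreal_leI)
  also have "\<dots> = ennreal (b * (1 + 1 / \<delta>))"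
    using b A by (simp add: ennreal_mult[symmetric] ennreal_plus[symmetric] distrib_left del: ennreal_mult' ennreal_plus)
  finally show ?thesis using b A by (subst (asm) ennreal_le_iff) auto
qed

text \<open>The mass of a convolution is the product of the masses. A step of length at most
  \<open>A\<close> added to a time up to \<open>S - A\<close> stays below \<open>S\<close>; this
  costs a second \<open>A\<close> in addition to the one in \<open>psi_lower\<close>.\<close>

lemma rho_kt_lower:
  assumes S: "2 * A \<le> S" "0 \<le> A" and m: "(\<integral>\<^sup>+v\<in>{0..S}. ennreal (1 - K v) \<partial>lborel) \<le> ennreal m" "0 < m"
  shows "ennreal ((S - 2 * A) * (K A)\<^sup>2 / m) \<le> (\<integral>\<^sup>+v\<in>{..S}. ennreal (rho (kt A) v) \<partial>lborel)"
proof -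
  let ?k = "\<lambda>t. ennreal (kt A t)"
  have m': "(\<integral>\<^sup>+v\<in>{0..S - A}. ennreal (1 - K v) \<partial>lborel) \<le> ennreal m"
    using S by (intro order_trans[OF nn_integral_mono m(1)]) (auto simp: indicator_def)
  have "ennreal ((S - 2 * A) * (K A)\<^sup>2 / m) = ennreal (K A) * ennreal ((S - A - A) * K A / m)"
    using S m K_nonneg[of A] by (simp add: ennreal_mult[symmetric] power2_eq_square mult_ac del: ennreal_mult')
  also have "\<dots> \<le> ennreal (K A) * (\<integral>\<^sup>+u\<in>{..S - A}. epsi u \<partial>lborel)"
    using S m' m by (intro mult_left_mono psi_lower) auto
  also have "ennreal (K A) = (\<integral>\<^sup>+t. ?k t \<partial>lborel)"
    unfolding ennreal_K by (intro nn_integral_cong) (auto simp: kt_def indicator_def)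
  also have "(\<integral>\<^sup>+t. ?k t \<partial>lborel) * (\<integral>\<^sup>+u\<in>{..S - A}. epsi u \<partial>lborel) = (\<integral>\<^sup>+v. conv ?k (\<lambda>u. epsi u * indicator {..S - A} u) v \<partial>lborel)"
    by (rule nn_integral_conv[symmetric]) measurable
  also have "\<dots> \<le> (\<integral>\<^sup>+v\<in>{..S}. ennreal (rho (kt A) v) \<partial>lborel)"
  proof (rule nn_integral_mono)
    fix v
    show "conv ?k (\<lambda>u. epsi u * indicator {..S - A} u) v \<le> ennreal (rho (kt A) v) * indicator {..S} v"
    proof (cases "v \<le> S")
      case True
      have "conv ?k (\<lambda>u. epsi u * indicator {..S - A} u) v \<le> conv ?k epsi v"
        unfolding conv_def by (intro nn_integral_mono mult_left_mono) (auto simp: indicator_def)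
      also have "\<dots> \<le> ennreal (rho (kt A) v)" using kt_facts by (subst ennreal_rho[of _ B]) auto
      finally show ?thesis using True by simp
    next
      case False
      have "?k (v - u) * (epsi u * indicator {..S - A} u) = 0" for u using False by (auto simp: kt_def indicator_def)
      then have "conv ?k (\<lambda>u. epsi u * indicator {..S - A} u) v = 0" unfolding conv_def by (rule nn_integral_eq_0I)
      then show ?thesis by simp
    qed
  qed
  finally show ?thesis .
qed

end

section \<open>Response of the intensity to an added point\<close>

definition band :: "(real \<Rightarrow> config \<Rightarrow> real) \<Rightarrow> (real \<Rightarrow> config \<Rightarrow> real) \<Rightarrow> (real \<times> config) \<times> real \<Rightarrow> ennreal" where
  "band L L' x = indicator {L (fst (fst x)) (snd (fst x))<..L' (fst (fst x)) (snd (fst x))} (snd x)"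

lemma band_mark: "band L L' (mark w z) = indicator {L (fst z) w<..L' (fst z) w} (snd z)"
  by (simp add: band_def)

lemma band_measurable:
  assumes "(\<lambda>p. L (fst p) (snd p)) \<in> borel_measurable predictable" "(\<lambda>p. L' (fst p) (snd p)) \<in> borel_measurable predictable"
  shows "band L L' \<in> borel_measurable marked"
proof -
  note [measurable] = accept_measurable[OF assms(1)] accept_measurable[OF assms(2)]
  have "(\<lambda>x. accept L' x * (1 - accept L x)) \<in> borel_measurable marked" by measurable
  then show ?thesis
    by (rule measurable_cong[THEN iffD1, rotated]) (auto simp: accept_def band_def indicator_def)
qed

text \<open>Written without subtraction, so that it holds whichever of the two intensities is
  larger.\<close>

lemma accept_band: "accept L' x + band L' L x = accept L x + band L L' x"
  by (auto simp: accept_def band_def indicator_def)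

lemma Aint_band:
  assumes F: "F \<in> borel_measurable predictable" and L: "(\<lambda>p. L (fst p) (snd p)) \<in> borel_measurable predictable"
    and L': "(\<lambda>p. L' (fst p) (snd p)) \<in> borel_measurable predictable"
    and nn: "\<And>r. 0 \<le> L r w" and w: "w \<in> configs"
  shows "Aint (\<lambda>x. F (fst x) * band L L' x) s w = (\<integral>\<^sup>+r\<in>{0<..<s}. F (r, w) * ennreal (L' r w - L r w) \<partial>lborel)"
proof -
  have "{L r w<..L' r w} \<inter> {0..} = {L r w<..L' r w}" for r using nn[of r] by auto
  moreover have "emeasure lborel {L r w<..L' r w} = ennreal (L' r w - L r w)" for r
    by (cases "L r w \<le> L' r w") (auto simp: ennreal_neg)
  ultimately show ?thesis
    using Aint_slice[OF F _ _ w, of "\<lambda>p. {L (fst p) (snd p)<..L' (fst p) (snd p)}" s] band_measurable[OF L L']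
    by (simp add: band_def[abs_def])
qed

lemma (in poisson) expect_Aint_band:
  assumes F: "F \<in> borel_measurable predictable" and L: "(\<lambda>p. L (fst p) (snd p)) \<in> borel_measurable predictable"
    and L': "(\<lambda>p. L' (fst p) (snd p)) \<in> borel_measurable predictable"
    and nn: "\<And>r w. 0 \<le> L r w"
  shows "(\<integral>\<^sup>+w. Aint (\<lambda>x. F (fst x) * band L L' x) s w \<partial>P) =
    (\<integral>\<^sup>+r\<in>{0<..<s}. (\<integral>\<^sup>+w. F (r, w) * ennreal (L' r w - L r w) \<partial>P) \<partial>lborel)"
proof -
  have "(\<integral>\<^sup>+w. Aint (\<lambda>x. F (fst x) * band L L' x) s w \<partial>P) = (\<integral>\<^sup>+w. (\<integral>\<^sup>+r\<in>{0<..<s}. F (r, w) * ennreal (L' r w - L r w) \<partial>lborel) \<partial>P)"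
    by (intro nn_integral_cong Aint_band F L L' nn) (simp add: space_P)
  then show ?thesis using expect_time_integral[of "\<lambda>p. F p * ennreal (L' (fst p) (snd p) - L (fst p) (snd p))" s] F L L' by simp
qed

sublocale hawkes \<subseteq> subcritical_kernel k q B
  by unfold_locales (use q k_nonneg k_le k_zero k_int in auto)

context hawkes
begin

text \<open>\<open>a\<close> is a predictable set of marks that carries the intensity \<open>x = \<beta> + k \<star> a\<close>.\<close>

lemma response:
  assumes a: "dominated a"
    and \<beta> [measurable]: "\<beta> \<in> borel_measurable borel" and x [measurable]: "\<And>w. w \<in> configs \<Longrightarrow> (\<lambda>v. x v w) \<in> borel_measurable borel"
    and xa: "\<And>w F s. w \<in> configs \<Longrightarrow> F \<in> borel_measurable borel \<Longrightarrow>
      Aint (\<lambda>y. F (fst (fst y)) * a y) s w = (\<integral>\<^sup>+r\<in>{0<..<s}. F r * ennreal (x r w) \<partial>lborel)"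
    and eq: "AE w in P. \<forall>v\<in>{0<..T}. ennreal (x v w) = ennreal (\<beta> v) + Sint (lag k v a) v w"
    and \<kappa> [measurable]: "\<kappa> \<in> borel_measurable borel" and \<kappa>': "\<And>t. 0 \<le> \<kappa> t" "\<And>t. \<kappa> t \<le> R" "\<And>t. t \<le> 0 \<Longrightarrow> \<kappa> t = 0"
    and s: "s \<le> T" and fin: "(\<integral>\<^sup>+v\<in>{0<..<s}. ennreal (rho \<kappa> (s - v)) * ennreal (\<beta> v) \<partial>lborel) < \<infinity>"
  shows "dominated (lag (rho \<kappa>) s a)"
    and "AE w in P. Sint (lag \<kappa> s a) s w < \<infinity>"
    and "AE w in P. enn2real (Sint (lag \<kappa> s a) s w) =
      enn2real (\<integral>\<^sup>+v\<in>{0<..<s}. ennreal (rho \<kappa> (s - v)) * ennreal (\<beta> v) \<partial>lborel) +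
      Mart (lag (rho \<kappa>) s a) s w"
proof -
  note \<kappa>'' = \<kappa> \<kappa>'
  note rm [measurable] = rho_measurable[OF \<kappa>'']
  obtain Ra where am [measurable]: "a \<in> borel_measurable marked" and Ra: "0 \<le> Ra" "\<And>x. a x \<le> ennreal Ra * accept L x"
    using a unfolding dominated_def by auto
  have dom: "dominated (\<lambda>y. ennreal (g (s - fst (fst y))) * a y)" if [measurable]: "g \<in> borel_measurable borel"
    and g: "\<And>t. 0 \<le> g t" "\<And>t. g t \<le> G" for g G
    unfolding dominated_def
  proof (intro conjI exI allI)
    show "(\<lambda>y. ennreal (g (s - fst (fst y))) * a y) \<in> borel_measurable marked"
      using measurable_marked_time[of "\<lambda>r. ennreal (g (s - r))"] by measurable
    have G: "0 \<le> G" using g order_trans by blast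
    show "0 \<le> G * Ra" using G Ra by simp
    show "ennreal (g (s - fst (fst y))) * a y \<le> ennreal (G * Ra) * accept L y" for y
      using mult_mono[OF ennreal_leI[OF g(2)] Ra(2)] G Ra by (simp add: ennreal_mult mult.assoc)
  qed
  show d1: "dominated (lag (rho \<kappa>) s a)"
    by (rule dom[of _ "R / (1 - q)"]) (use rm rho_nonneg[OF \<kappa>''] rho_le[OF \<kappa>''] in auto)
  have d2: "dominated (lag \<kappa> s a)"
    by (rule dom[of _ R]) (use \<kappa>' in auto)
  obtain "AE w in P. Sint (lag \<kappa> s a) s w < \<infinity>"
    by (rule dominated_facts[OF d2 s])
  then show f: "AE w in P. Sint (lag \<kappa> s a) s w < \<infinity>" .
  obtain f1: "AE w in P. Sint (lag (rho \<kappa>) s a) s w < \<infinity>"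
     and f2: "AE w in P. Aint (lag (rho \<kappa>) s a) s w < \<infinity>"
    by (rule dominated_facts[OF d1 s])
  from f f1 f2 eq AE_space
  show "AE w in P. enn2real (Sint (lag \<kappa> s a) s w) =
      enn2real (\<integral>\<^sup>+v\<in>{0<..<s}. ennreal (rho \<kappa> (s - v)) * ennreal (\<beta> v) \<partial>lborel) +
      Mart (lag (rho \<kappa>) s a) s w"
  proof eventually_elim
    case (elim w)
    then have w: "w \<in> configs" by (simp add: space_P)
    have "Aint (lag (rho \<kappa>) s a) s w + Sint (lag \<kappa> s a) s w
      = (\<integral>\<^sup>+v\<in>{0<..<s}. ennreal (rho \<kappa> (s - v)) * ennreal (\<beta> v) \<partial>lborel) + Sint (lag (rho \<kappa>) s a) s w"
      (is "?A + ?S = ?m + ?S'")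
      unfolding xa[OF w, of "\<lambda>r. ennreal (rho \<kappa> (s - r))", simplified]
    proof (rule volterra_path[OF w am k_meas \<kappa> rm \<beta> k_zero rho_supp[OF \<kappa>''] rho_eq[OF \<kappa>'']])
      show "ennreal (x v w) = ennreal (\<beta> v) + Sint (lag k v a) v w" if "0 < v" "v < s" for v
        using elim that s by auto
    qed
    \<comment> \<open>All four terms are finite, so the identity may be read in the reals; moving
      the compensator across produces \<open>Mart\<close>.\<close>
    then have "enn2real (?A + ?S) = enn2real (?m + ?S')" by simp
    then show ?case using elim fin by (simp add: enn2real_plus Mart_def less_top)
  qed
qed

end

text \<open>\<open>L'\<close> is driven by the same points as \<open>L\<close>; the added point
  enters only through the extra forcing. In the application \<open>c'\<close> involves
  \<open>B\<close>, so quantitative estimates of \<open>L'\<close> have to go through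
  \<open>L\<close> and the difference.\<close>

locale hawkes_pair = hawkes P T q B c k b L + H': hawkes P T q B c' k b' L'
  for P T q B c k b L c' b' L' +
  fixes u :: real
  assumes u: "0 < u" "u < T" and b': "\<And>t. b' t = b t + k (t - u)" and L'_eq: "\<And>t w. t \<le> u \<Longrightarrow> L' t w = L t w"
begin

abbreviation "D s w \<equiv> L' s w - L s w"

lemma band_meas [measurable]: "band L L' \<in> borel_measurable marked" "band L' L \<in> borel_measurable marked"
  using L_pred H'.L_pred by (auto intro: band_measurable)

text \<open>The expected excess \<open>y\<close> of \<open>L\<close> over \<open>L'\<close> satisfies \<open>y \<le> k \<star> y\<close> with \<open>\<integral> k < 1\<close>.\<close>

lemma expect_excess:
  assumes t: "0 < t" "t \<le> T"
  shows "(\<integral>\<^sup>+w. ennreal (L t w - L' t w) \<partial>P) = 0"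
proof -
  define y where "y t = (\<integral>\<^sup>+w. ennreal (L t w - L' t w) \<partial>P)" for t
  note k1 = adapted_kernel_config
  have "y t \<le> ennreal (0 / (1 - q))"
  proof (rule renewal_sup_bound[of y "c / (1 - q)" 0, OF _ _ t order_refl])
    fix t assume t: "0 < t" "t \<le> T"
    have "y t \<le> (\<integral>\<^sup>+w. ennreal (L t w) \<partial>P)"
      unfolding y_def using H'.L_nonneg by (intro nn_integral_mono ennreal_leI) auto
    then show "y t \<le> ennreal (c / (1 - q))" using L_expect_le[OF t] by simp
    let ?k = "\<lambda>x. ennreal (k (t - fst (fst x)))"
    have "y t \<le> (\<integral>\<^sup>+w. Sint (\<lambda>x. ?k x * band L' L x) t w \<partial>P)"
      unfolding y_def
    proof (rule nn_integral_mono_AE)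
      show "AE w in P. ennreal (L t w - L' t w) \<le> Sint (\<lambda>x. ?k x * band L' L x) t w"
        using L_eq H'.L_eq AE_space
      proof eventually_elim
        case (elim w)
        then have w: "w \<in> configs" by (simp add: space_P)
        have "ennreal (L t w) = ennreal (b t) + Sint (\<lambda>x. ?k x * accept L x) t w" using elim t by auto
        also have "\<dots> \<le> ennreal (b' t) + Sint (\<lambda>x. ?k x * accept L' x + ?k x * band L' L x) t w"
        proof (intro add_mono kint_mono k1 w ennreal_leI)
          show "b t \<le> b' t" using b' k_nonneg by simp
          fix z
          show "?k (mark w z) * accept L (mark w z) \<le> ?k (mark w z) * accept L' (mark w z) + ?k (mark w z) * band L' L (mark w z)"
            unfolding distrib_left[symmetric] accept_band[of L' "mark w z" L] by (intro mult_left_mono) auto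
        qed
        also have "Sint (\<lambda>x. ?k x * accept L' x + ?k x * band L' L x) t w = Sint (\<lambda>x. ?k x * accept L' x) t w + Sint (\<lambda>x. ?k x * band L' L x) t w"
          by (intro kint_add k1 w) measurable
        also have "ennreal (b' t) + (Sint (\<lambda>x. ?k x * accept L' x) t w + Sint (\<lambda>x. ?k x * band L' L x) t w) = ennreal (L' t w) + Sint (\<lambda>x. ?k x * band L' L x) t w"
          using elim t by (simp add: add.assoc)
        finally show ?case using H'.L_nonneg
          by (simp add: ennreal_minus[symmetric] ennreal_minus_le_iff add.commute)
      qed
    qed
    also have "\<dots> = (\<integral>\<^sup>+w. Aint (\<lambda>x. ?k x * band L' L x) t w \<partial>P)" by (rule compensation) measurable
    also have "\<dots> = (\<integral>\<^sup>+r\<in>{0<..<t}. (\<integral>\<^sup>+w. ennreal (k (t - r)) * ennreal (L r w - L' r w) \<partial>P) \<partial>lborel)"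
      using expect_Aint_band[of "\<lambda>p. ennreal (k (t - fst p))" L' L t] L_pred H'.L_pred H'.L_nonneg by simp
    also have "\<dots> = (\<integral>\<^sup>+r\<in>{0<..<t}. ennreal (k (t - r)) * y r \<partial>lborel)"
      unfolding y_def by (subst nn_integral_cmult) auto
    finally show "y t \<le> ennreal 0 + (\<integral>\<^sup>+r\<in>{0<..<t}. ennreal (k (t - r)) * y r \<partial>lborel)" by simp
  qed
  then show ?thesis by (simp add: y_def)
qed

text \<open>Zero expected excess means that almost surely no point lies in the reversed band, where
  \<open>L'\<close> is below \<open>L\<close>. Subtracting the two equations then leaves only the
  points of \<open>band L L'\<close>.\<close>

lemma D_eq: "AE w in P. \<forall>t\<in>{0<..T}. L t w \<le> L' t w \<and>
  ennreal (D t w) = ennreal (k (t - u)) + Sint (lag k t (band L L')) t w"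
proof -
  note k1 = adapted_kernel_config
  have "(\<integral>\<^sup>+w. Sint (band L' L) T w \<partial>P) = (\<integral>\<^sup>+w. Aint (band L' L) T w \<partial>P)" by (rule compensation) measurable
  also have "\<dots> = (\<integral>\<^sup>+r\<in>{0<..<T}. (\<integral>\<^sup>+w. 1 * ennreal (L r w - L' r w) \<partial>P) \<partial>lborel)"
    using expect_Aint_band[of "\<lambda>p. 1" L' L T] L_pred H'.L_pred H'.L_nonneg by simp
  also have "\<dots> = (\<integral>\<^sup>+(r::real). 0 \<partial>lborel)"
    using expect_excess by (intro nn_integral_cong) (auto simp: indicator_def)
  finally have "(\<integral>\<^sup>+w. Sint (band L' L) T w \<partial>P) = 0" by simp
  then have "AE w in P. Sint (band L' L) T w = 0"
    using nn_integral_0_iff_AE[OF kint_measurable_P[OF k1 band_meas(2)]] by simp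
  then show ?thesis using L_eq H'.L_eq AE_space
  proof eventually_elim
    case (elim w)
    then have w: "w \<in> configs" by (simp add: space_P)
    show ?case
    proof
      fix t assume t: "t \<in> {0<..T}"
      let ?k = "\<lambda>x. ennreal (k (t - fst (fst x)))"
      \<comment> \<open>A bounded kernel transfers the vanishing at \<open>T\<close> to every
        earlier \<open>t\<close>, so one null set serves all times.\<close>
      have "Sint (\<lambda>x. ?k x * band L' L x) t w \<le> Sint (\<lambda>x. ennreal B * band L' L x) t w"
        using k_le by (intro kint_mono k1 w mult_right_mono ennreal_leI) auto
      also have "\<dots> \<le> ennreal B * Sint (band L' L) T w"
        using t by (subst kint_cmult[OF k1 _ w]) (auto intro!: mult_left_mono kint_mono_time)
      finally have z: "Sint (\<lambda>x. ?k x * band L' L x) t w = 0" using elim by simp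
      have "Sint (\<lambda>x. ?k x * accept L' x) t w + Sint (\<lambda>x. ?k x * band L' L x) t w = Sint (\<lambda>x. ?k x * accept L x) t w + Sint (\<lambda>x. ?k x * band L L' x) t w"
        using kint_add[OF k1 _ _ w, of "\<lambda>x. ?k x * accept L' x" "\<lambda>x. ?k x * band L' L x" t]
          kint_add[OF k1 _ _ w, of "\<lambda>x. ?k x * accept L x" "\<lambda>x. ?k x * band L L' x" t]
        unfolding distrib_left[symmetric] accept_band[of L' _ L] by simp
      then have "ennreal (L' t w) = ennreal (b' t) + (Sint (\<lambda>x. ?k x * accept L x) t w + Sint (\<lambda>x. ?k x * band L L' x) t w)"
        using elim t z by simp
      also have "\<dots> = ennreal (L t w) + (ennreal (k (t - u)) + Sint (\<lambda>x. ?k x * band L L' x) t w)"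
        using elim t b_nonneg k_nonneg by (simp add: b' add_ac)
      finally have e: "ennreal (L' t w) = ennreal (L t w) + (ennreal (k (t - u)) + Sint (\<lambda>x. ?k x * band L L' x) t w)" .
      then have "ennreal (L t w) \<le> ennreal (L' t w)" by simp
      then have le: "L t w \<le> L' t w" using H'.L_nonneg by simp
      have "ennreal (L t w) + ennreal (D t w) = ennreal (L' t w)"
        using le L_nonneg by (simp add: ennreal_plus[symmetric] del: ennreal_plus)
      then have "ennreal (D t w) = ennreal (k (t - u)) + Sint (\<lambda>x. ?k x * band L L' x) t w"
        unfolding e by (simp add: ennreal_add_left_cancel)
      with le show "L t w \<le> L' t w \<and> ennreal (D t w) = ennreal (k (t - u)) + Sint (\<lambda>x. ?k x * band L L' x) t w" by simp
    qed
  qed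
qed

lemma band_zero: "t \<le> u \<Longrightarrow> band L L' ((t, w), \<theta>) = 0"
  using L'_eq[of t w] by (simp add: band_def)

lemma dominated_band: "H'.dominated (band L L')"
  unfolding H'.dominated_def using band_meas
  by (auto intro!: exI[of _ 1] simp: band_def accept_def indicator_def)

context
  fixes \<kappa> :: "real \<Rightarrow> real" and R s :: real
  assumes \<kappa> [measurable]: "\<kappa> \<in> borel_measurable borel" and \<kappa>_nn: "\<And>t. 0 \<le> \<kappa> t" and \<kappa>_bd: "\<And>t. \<kappa> t \<le> R"
    and \<kappa>_supp: "\<And>t. t \<le> 0 \<Longrightarrow> \<kappa> t = 0" and s: "s \<le> T"
begin

text \<open>The equation of \<open>rho \<kappa>\<close> at \<open>s - u\<close>, read with the
  forcing \<open>k (v - u)\<close> that the added point creates.\<close>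

lemma rho_shift: "ennreal (rho \<kappa> (s - u)) = ennreal (\<kappa> (s - u)) + (\<integral>\<^sup>+v\<in>{0<..<s}. ennreal (rho \<kappa> (s - v)) * ennreal (k (v - u)) \<partial>lborel)"
proof -
  note \<kappa>' = \<kappa> \<kappa>_nn \<kappa>_bd \<kappa>_supp
  note [measurable] = rho_measurable[OF \<kappa>']
  have "(\<integral>\<^sup>+v\<in>{0<..<s}. ennreal (rho \<kappa> (s - v)) * ennreal (k (v - u)) \<partial>lborel) = (\<integral>\<^sup>+v. ennreal (rho \<kappa> (s - v)) * ennreal (k (v - u)) \<partial>lborel)"
  proof (rule nn_integral_cong)
    fix v show "ennreal (rho \<kappa> (s - v)) * ennreal (k (v - u)) * indicator {0<..<s} v = ennreal (rho \<kappa> (s - v)) * ennreal (k (v - u))"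
      using u k_zero[of "v - u"] rho_supp[OF \<kappa>', of "s - v"] by (cases "v \<le> 0"; cases "s \<le> v") auto
  qed
  also have "\<dots> = (\<integral>\<^sup>+r. ennreal (rho \<kappa> (s - u - r)) * ennreal (k r) \<partial>lborel)"
    using nn_integral_lborel_translate[of "\<lambda>r. ennreal (rho \<kappa> (s - u - r)) * ennreal (k r)" u] by simp
  finally show ?thesis using rho_eq[OF \<kappa>', of "s - u"] by simp
qed

text \<open>The direct effect \<open>\<kappa> (s - u)\<close> of the added point completes the
  deterministic part of the response to \<open>rho \<kappa> (s - u)\<close>.\<close>

lemma band_response:
  shows "H'.dominated (lag (rho \<kappa>) s (band L L'))"
    and "AE w in P. Sint (lag \<kappa> s (band L L')) s w < \<infinity>"
    and "AE w in P. \<kappa> (s - u) + enn2real (Sint (lag \<kappa> s (band L L')) s w) =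
      rho \<kappa> (s - u) + Mart (lag (rho \<kappa>) s (band L L')) s w"
proof -
  note \<kappa>' = \<kappa> \<kappa>_nn \<kappa>_bd \<kappa>_supp
  let ?I = "\<integral>\<^sup>+v\<in>{0<..<s}. ennreal (rho \<kappa> (s - v)) * ennreal (k (v - u)) \<partial>lborel"
  have "?I \<le> ennreal (rho \<kappa> (s - u))" by (simp add: rho_shift)
  then have fin: "?I < \<infinity>" by (rule le_less_trans) simp
  have s1: "AE w in P. \<forall>v\<in>{0<..T}. ennreal (D v w) = ennreal (k (v - u)) + Sint (lag k v (band L L')) v w"
    using D_eq by eventually_elim blast
  have s2: "Aint (\<lambda>y. F (fst (fst y)) * band L L' y) s w = (\<integral>\<^sup>+r\<in>{0<..<s}. F r * ennreal (D r w) \<partial>lborel)"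
    if "w \<in> configs" "F \<in> borel_measurable borel" for w F s
    using Aint_band[of "\<lambda>p. F (fst p)" L L' w s] that L_pred H'.L_pred L_nonneg by simp
  have s3: "(\<lambda>v. D v w) \<in> borel_measurable borel" if "w \<in> configs" for w
    using L_section[OF that] H'.L_section[OF that] by measurable
  have s4: "(\<lambda>v. k (v - u)) \<in> borel_measurable borel" by measurable
  note r = H'.response[OF dominated_band s4 s3 s2 s1 \<kappa>' s fin]
  show "H'.dominated (lag (rho \<kappa>) s (band L L'))" by (rule r(1))
  show "AE w in P. Sint (lag \<kappa> s (band L L')) s w < \<infinity>" by (rule r(2))
  have "enn2real (ennreal (rho \<kappa> (s - u))) = \<kappa> (s - u) + enn2real ?I"
    unfolding rho_shift using fin \<kappa>_nn by (subst enn2real_plus) (auto simp: less_top)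
  then have "rho \<kappa> (s - u) = \<kappa> (s - u) + enn2real ?I" using rho_nonneg[OF \<kappa>'] by simp
  note rho_real = this
  show "AE w in P. \<kappa> (s - u) + enn2real (Sint (lag \<kappa> s (band L L')) s w) =
      rho \<kappa> (s - u) + Mart (lag (rho \<kappa>) s (band L L')) s w"
  proof -
    have "AE w in P. enn2real (Sint (lag \<kappa> s (band L L')) s w) =
      enn2real ?I + Mart (lag (rho \<kappa>) s (band L L')) s w" by (rule r(3))
    then show ?thesis by eventually_elim (simp only: rho_real add.assoc)
  qed
qed

end

end

text \<open>A weight known at time \<open>u\<close> becomes a predictable factor once it is switched
  on after \<open>u\<close>; for integrands that vanish up to \<open>u\<close> the switch changes
  nothing.\<close>

definition weighted :: "real \<Rightarrow> (config \<Rightarrow> real) \<Rightarrow> ((real \<times> config) \<times> real \<Rightarrow> ennreal) \<Rightarrow> (real \<times> config) \<times> real \<Rightarrow> ennreal" where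
  "weighted u W f x = indicator {u<..} (fst (fst x)) * ennreal (W (snd (fst x))) * f x"

lemma weight_predictable:
  assumes W: "W \<in> borel_measurable (past u)" and u: "0 \<le> u"
  shows "(\<lambda>p. indicator {u<..} (fst p) * ennreal (W (snd p))) \<in> borel_measurable predictable"
  using measurable_predictable_adapted[of "\<lambda>w. ennreal (W w)" u] W u by (simp add: split_beta')

lemma weighted_measurable:
  assumes W: "W \<in> borel_measurable (past u)" and u: "0 \<le> u" and [measurable]: "f \<in> borel_measurable marked"
  shows "weighted u W f \<in> borel_measurable marked"
proof -
  have [measurable]: "(\<lambda>x. indicator {u<..} (fst (fst x)) * ennreal (W (snd (fst x)))) \<in> borel_measurable marked"
    using measurable_marked_fst[OF weight_predictable[OF W u]] .
  show ?thesis unfolding weighted_def[abs_def] by measurable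
qed

lemma kint_weighted:
  assumes \<kappa>: "adapted_kernel \<kappa>" and f: "f \<in> borel_measurable marked" and w: "w \<in> configs"
    and z: "\<And>x. fst (fst x) \<le> u \<Longrightarrow> f x = 0"
  shows "kint \<kappa> (weighted u W f) s w = ennreal (W w) * kint \<kappa> f s w"
proof -
  have "kint \<kappa> (weighted u W f) s w = kint \<kappa> (\<lambda>x. ennreal (W w) * f x) s w"
  proof (rule kint_cong[OF _ \<kappa> w])
    fix p :: "real \<times> real"
    show "weighted u W f (mark w p) = ennreal (W w) * f (mark w p)"
      using z[of "mark w p"] by (cases "fst p \<le> u") (auto simp: weighted_def)
  qed
  then show ?thesis by (simp add: kint_cmult[OF \<kappa> f w])
qed

lemma Mart_weighted:
  assumes f: "f \<in> borel_measurable marked" and w: "w \<in> configs" and z: "\<And>x. fst (fst x) \<le> u \<Longrightarrow> f x = 0"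
    and W: "0 \<le> W w"
  shows "Mart (weighted u W f) s w = W w * Mart f s w"
  using kint_weighted[OF adapted_kernel_config f w z] kint_weighted[OF adapted_kernel_half_plane f w z] W
  by (simp add: Mart_def enn2real_mult right_diff_distrib)

context hawkes
begin

lemma dominated_weighted:
  assumes f: "dominated f" and W: "W \<in> borel_measurable (past u)" and u: "0 \<le> u" and wmax: "\<And>w. W w \<le> wmax"
  shows "dominated (weighted u W f)"
proof -
  obtain R where f': "f \<in> borel_measurable marked" and R: "0 \<le> R" "\<And>x. f x \<le> ennreal R * accept L x"
    using f unfolding dominated_def by auto
  have "weighted u W f x \<le> ennreal (max 0 wmax * R) * accept L x" for x
  proof -
    have "ennreal (W (snd (fst x))) \<le> ennreal (max 0 wmax)" using wmax[of "snd (fst x)"] by (intro ennreal_leI) simp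
    then have "ennreal (W (snd (fst x))) * f x \<le> ennreal (max 0 wmax) * (ennreal R * accept L x)"
      using R(2)[of x] by (intro mult_mono) auto
    then show ?thesis using R(1) by (auto simp: weighted_def ennreal_mult mult.assoc indicator_def)
  qed
  then show ?thesis unfolding dominated_def using weighted_measurable[OF W u f'] R
    by (auto intro!: exI[of _ "max 0 wmax * R"])
qed

lemma L_integrable: "0 < t \<Longrightarrow> t \<le> T \<Longrightarrow> integrable P (L t)"
  and L_integral_le: "0 < t \<Longrightarrow> t \<le> T \<Longrightarrow> (\<integral>w. L t w \<partial>P) \<le> c / (1 - q)"
proof -
  assume t: "0 < t" "t \<le> T"
  have "(\<integral>\<^sup>+w. ennreal (L t w) \<partial>P) < \<infinity>" using L_expect_le[OF t] by (rule le_less_trans) simp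
  then show "integrable P (L t)" using L_nonneg by (intro integrableI_nonneg) auto
  have "(\<integral>w. L t w \<partial>P) = enn2real (\<integral>\<^sup>+w. ennreal (L t w) \<partial>P)"
    using L_nonneg by (intro integral_eq_nn_integral) auto
  also have "\<dots> \<le> enn2real (ennreal (c / (1 - q)))" using L_expect_le[OF t] by (intro enn2real_mono) auto
  finally show "(\<integral>w. L t w \<partial>P) \<le> c / (1 - q)" using c q by simp
qed

end

text \<open>Boundedness of \<open>W\<close> keeps weighted integrands dominated, so that the second
  moments already established suffice for the products below.\<close>

locale weighted_pair = hawkes_pair +
  fixes W :: "config \<Rightarrow> real" and wmax :: real
  assumes W_past: "W \<in> borel_measurable (past u)" and W_nn: "\<And>w. 0 \<le> W w" and W_le: "\<And>w. W w \<le> wmax"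
begin

lemma W_meas [measurable]: "W \<in> borel_measurable P"
  using measurable_P[OF measurable_past_config[OF W_past]] .

lemma W_int: "integrable P W"
  by (rule integrable_const_bound[of _ wmax]) (use W_nn W_le in auto)

lemma W_mult_int:
  assumes "integrable P X" shows "integrable P (\<lambda>w. W w * X w)"
proof (rule Bochner_Integration.integrable_bound[of P "\<lambda>w. wmax * X w"])
  show "integrable P (\<lambda>w. wmax * X w)" "(\<lambda>w. W w * X w) \<in> borel_measurable P" using assms by auto
  show "AE w in P. norm (W w * X w) \<le> norm (wmax * X w)"
  proof (rule AE_I2)
    fix w
    have "\<bar>W w\<bar> \<le> \<bar>wmax\<bar>" using W_nn[of w] W_le[of w] by simp
    then show "norm (W w * X w) \<le> norm (wmax * X w)" by (simp add: abs_mult mult_right_mono)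
  qed
qed

text \<open>Pulling \<open>W\<close> into the integrand reduces the weighted mean and covariance to
  the unweighted ones.\<close>

lemma Mart_band_weighted:
  assumes f: "H'.dominated f" and z: "\<And>x. fst (fst x) \<le> u \<Longrightarrow> f x = 0" and s: "s \<le> T"
  shows "integrable P (\<lambda>w. W w * Mart f s w)" and "(\<integral>w. W w * Mart f s w \<partial>P) = 0"
    and "H'.dominated g \<Longrightarrow> integrable P (\<lambda>w. W w * Mart f s w * Mart g s w)"
    and "H'.dominated g \<Longrightarrow> (\<integral>w. W w * Mart f s w * Mart g s w \<partial>P) = enn2real (\<integral>\<^sup>+w. Aint (\<lambda>x. weighted u W f x * g x) s w \<partial>P)"
proof -
  have d: "H'.dominated (weighted u W f)" using f W_past W_le u by (intro H'.dominated_weighted) auto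
  have fm: "f \<in> borel_measurable marked" using f by (simp add: H'.dominated_def)
  have eq: "Mart (weighted u W f) s w = W w * Mart f s w" if "w \<in> space P" for w
    using that W_nn by (intro Mart_weighted fm z) (auto simp: space_P)
  show "integrable P (\<lambda>w. W w * Mart f s w)" "(\<integral>w. W w * Mart f s w \<partial>P) = 0"
    using H'.Mart_integrable[OF d s] eq by (auto cong: Bochner_Integration.integrable_cong Bochner_Integration.integral_cong)
  show "H'.dominated g \<Longrightarrow> integrable P (\<lambda>w. W w * Mart f s w * Mart g s w)"
    "H'.dominated g \<Longrightarrow> (\<integral>w. W w * Mart f s w * Mart g s w \<partial>P) = enn2real (\<integral>\<^sup>+w. Aint (\<lambda>x. weighted u W f x * g x) s w \<partial>P)"
    using H'.Mart_covariance[OF d _ s, of g] eq by (auto cong: Bochner_Integration.integrable_cong Bochner_Integration.integral_cong)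
qed

text \<open>The untruncated case \<open>\<kappa> = k\<close>, in which the functional is the
  increment \<open>D\<close> itself and the response is \<open>psi\<close>.\<close>

lemma psi_band:
  assumes s: "s \<le> T"
  shows "H'.dominated (lag psi s (band L L'))"
    and "0 < s \<Longrightarrow> AE w in P. D s w = psi (s - u) + Mart (lag psi s (band L L')) s w"
proof -
  note r = band_response[of k B s, OF k_meas k_nonneg k_le k_zero s, unfolded rho_k]
  show "H'.dominated (lag psi s (band L L'))" by (rule r(1))
  assume s0: "0 < s"
  have "AE w in P. Sint (lag k s (band L L')) s w < \<infinity>" by (rule r(2))
  moreover have "AE w in P. k (s - u) + enn2real (Sint (lag k s (band L L')) s w) =
      psi (s - u) + Mart (lag psi s (band L L')) s w" by (rule r(3))
  ultimately show "AE w in P. D s w = psi (s - u) + Mart (lag psi s (band L L')) s w"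
    using D_eq
  proof eventually_elim
    case (elim w)
    then have le: "L s w \<le> L' s w" and e: "ennreal (D s w) = ek (s - u) + Sint (lag k s (band L L')) s w"
      using s s0 by auto
    have "D s w = enn2real (ennreal (D s w))" using le by simp
    also have "\<dots> = k (s - u) + enn2real (Sint (lag k s (band L L')) s w)"
      unfolding e using elim k_nonneg by (subst enn2real_plus) (auto simp: less_top)
    finally show ?case using elim by simp
  qed
qed

lemma band_factor_zero: "fst (fst x) \<le> u \<Longrightarrow> g x * band L L' x = 0" for x :: "(real \<times> config) \<times> real" and g :: "(real \<times> config) \<times> real \<Rightarrow> ennreal"
  using band_zero[of "fst (fst x)" "snd (fst x)" "snd x"] by simp

lemma expect_W_D:
  assumes s: "0 < s" "s \<le> T"
  shows "integrable P (\<lambda>w. W w * D s w)" and "(\<integral>w. W w * D s w \<partial>P) = psi (s - u) * (\<integral>w. W w \<partial>P)"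
    and "(\<integral>\<^sup>+w. ennreal (W w * D s w) \<partial>P) = ennreal (psi (s - u) * (\<integral>w. W w \<partial>P))"
proof -
  show i: "integrable P (\<lambda>w. W w * D s w)"
    using L_integrable[OF s] H'.L_integrable[OF s] by (intro W_mult_int) auto
  let ?M = "Mart (lag psi s (band L L')) s"
  have z: "epsi (s - fst (fst x)) * band L L' x = 0" if "fst (fst x) \<le> u" for x :: "(real \<times> config) \<times> real"
    using that by (rule band_factor_zero)
  note m = Mart_band_weighted[OF psi_band(1)[OF s(2)] z s(2)]
  have "(\<integral>w. W w * D s w \<partial>P) = (\<integral>w. psi (s - u) * W w + W w * ?M w \<partial>P)"
    using psi_band(2)[OF s(2) s(1)] i m(1) W_int
    by (intro integral_cong_AE) (auto elim!: eventually_mono simp: algebra_simps)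
  also have "\<dots> = psi (s - u) * (\<integral>w. W w \<partial>P)" using m W_int by simp
  finally show e: "(\<integral>w. W w * D s w \<partial>P) = psi (s - u) * (\<integral>w. W w \<partial>P)" .
  have "AE w in P. 0 \<le> W w * D s w" using D_eq s W_nn by (auto elim!: eventually_mono)
  then show "(\<integral>\<^sup>+w. ennreal (W w * D s w) \<partial>P) = ennreal (psi (s - u) * (\<integral>w. W w \<partial>P))"
    using nn_integral_eq_integral[OF i] e by simp
qed

end

section \<open>Linear response of a single intensity\<close>

context hawkes
begin

lemma accept_response:
  assumes \<kappa> [measurable]: "\<kappa> \<in> borel_measurable borel" and \<kappa>': "\<And>t. 0 \<le> \<kappa> t" "\<And>t. \<kappa> t \<le> R" "\<And>t. t \<le> 0 \<Longrightarrow> \<kappa> t = 0"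
    and s: "s \<le> T"
  shows "dominated (lag (rho \<kappa>) s (accept L))"
    and "AE w in P. Sint (lag \<kappa> s (accept L)) s w < \<infinity>"
    and "AE w in P. enn2real (Sint (lag \<kappa> s (accept L)) s w) =
      enn2real (\<integral>\<^sup>+v\<in>{0<..<s}. ennreal (rho \<kappa> (s - v)) * ennreal (b v) \<partial>lborel) +
      Mart (lag (rho \<kappa>) s (accept L)) s w"
proof -
  note \<kappa>'' = \<kappa> \<kappa>'
  have R: "0 \<le> R" using \<kappa>' order_trans by blast
  have d: "dominated (accept L)" unfolding dominated_def by (auto intro!: exI[of _ 1])
  have "(\<integral>\<^sup>+v\<in>{0<..<s}. ennreal (rho \<kappa> (s - v)) * ennreal (b v) \<partial>lborel) \<le> (\<integral>\<^sup>+v\<in>{0<..<s}. ennreal (R / (1 - q) * c) \<partial>lborel)"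
  proof (intro nn_integral_mono mult_right_mono)
    fix v
    have "rho \<kappa> (s - v) * b v \<le> R / (1 - q) * c"
      using rho_le[OF \<kappa>''] b_le b_nonneg R q by (intro mult_mono) auto
    then show "ennreal (rho \<kappa> (s - v)) * ennreal (b v) \<le> ennreal (R / (1 - q) * c)"
      using rho_nonneg[OF \<kappa>''] b_nonneg by (simp add: ennreal_mult[symmetric] ennreal_leI del: ennreal_mult' times_divide_eq_left)
  qed simp
  also have "\<dots> < \<infinity>" by (cases "0 \<le> s") (auto simp: nn_integral_cmult_indicator ennreal_mult_less_top)
  finally have fin: "(\<integral>\<^sup>+v\<in>{0<..<s}. ennreal (rho \<kappa> (s - v)) * ennreal (b v) \<partial>lborel) < \<infinity>" .
  have xa: "Aint (\<lambda>y. F (fst (fst y)) * accept L y) s w = (\<integral>\<^sup>+r\<in>{0<..<s}. F r * ennreal (L r w) \<partial>lborel)"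
    if "w \<in> configs" "F \<in> borel_measurable borel" for w F s
    using Aint_strip[of "\<lambda>p. F (fst p)" L w s] that L_pred L_nonneg by simp
  note r = response[OF d b_meas L_section xa L_eq \<kappa>'' s fin]
  show "dominated (lag (rho \<kappa>) s (accept L))" by (rule r(1))
  show "AE w in P. Sint (lag \<kappa> s (accept L)) s w < \<infinity>" by (rule r(2))
  show "AE w in P. enn2real (Sint (lag \<kappa> s (accept L)) s w) =
      enn2real (\<integral>\<^sup>+v\<in>{0<..<s}. ennreal (rho \<kappa> (s - v)) * ennreal (b v) \<partial>lborel) +
      Mart (lag (rho \<kappa>) s (accept L)) s w" by (rule r(3))
qed

text \<open>An unspecified constant is enough: it will multiply a weighted band integral of mean
  zero.\<close>

lemma L_psi:
  assumes s: "0 < s" "s \<le> T"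
  shows "dominated (lag psi s (accept L))"
    and "\<exists>m. AE w in P. L s w = m + Mart (lag psi s (accept L)) s w"
proof -
  note r = accept_response[OF k_meas k_nonneg k_le k_zero s(2), unfolded rho_k]
  show "dominated (lag psi s (accept L))" by (rule r(1))
  let ?m = "enn2real (\<integral>\<^sup>+v\<in>{0<..<s}. epsi (s - v) * ennreal (b v) \<partial>lborel)"
  have "AE w in P. Sint (lag k s (accept L)) s w < \<infinity>" by (rule r(2))
  moreover have "AE w in P. enn2real (Sint (lag k s (accept L)) s w) = ?m + Mart (lag psi s (accept L)) s w"
    by (rule r(3))
  ultimately have "AE w in P. L s w = (b s + ?m) + Mart (lag psi s (accept L)) s w"
    using L_eq
  proof eventually_elim
    case (elim w)
    have "L s w = enn2real (ennreal (L s w))" using L_nonneg by simp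
    also have "\<dots> = enn2real (ennreal (b s) + Sint (lag k s (accept L)) s w)"
      using elim(3) s by simp
    also have "\<dots> = b s + enn2real (Sint (lag k s (accept L)) s w)"
      using elim(1) b_nonneg[of s] by (subst enn2real_plus) (simp_all add: less_top)
    finally show ?case using elim by simp
  qed
  then show "\<exists>m. AE w in P. L s w = m + Mart (lag psi s (accept L)) s w" by blast
qed

end

section \<open>The weighted relative increment from below\<close>

context weighted_pair
begin

lemma w_nonneg: "0 \<le> wmax" using W_nn W_le order_trans by blast

lemma EW: "0 \<le> (\<integral>w. W w \<partial>P)" "(\<integral>w. W w \<partial>P) \<le> wmax"
  using W_nn W_le W_int integral_le_const[OF W_int, of wmax] by auto

context
  fixes \<kappa> :: "real \<Rightarrow> real" and R C s :: real
  assumes \<kappa> [measurable]: "\<kappa> \<in> borel_measurable borel" and \<kappa>_nn: "\<And>t. 0 \<le> \<kappa> t" and \<kappa>_bd: "\<And>t. \<kappa> t \<le> R"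
    and \<kappa>_supp: "\<And>t. t \<le> 0 \<Longrightarrow> \<kappa> t = 0" and \<kappa>_k: "\<And>t. \<kappa> t \<le> k t" and C: "\<And>t. rho \<kappa> t \<le> C" and s: "0 < s" "s \<le> T"
begin

definition Dt :: "config \<Rightarrow> real" where
  "Dt w = \<kappa> (s - u) + enn2real (Sint (lag \<kappa> s (band L L')) s w)"

lemmas \<kappa>_facts = \<kappa> \<kappa>_nn \<kappa>_bd \<kappa>_supp

lemma rho_m [measurable]: "rho \<kappa> \<in> borel_measurable borel" by (rule rho_measurable[OF \<kappa>_facts])

lemma C_nonneg: "0 \<le> C" using rho_nonneg[OF \<kappa>_facts] C order_trans by blast

lemma Dt_meas [measurable]: "Dt \<in> borel_measurable P"
proof -
  have [measurable]: "(\<lambda>y. ennreal (\<kappa> (s - fst (fst y)))) \<in> borel_measurable marked"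
    by (rule measurable_marked_time) measurable
  have "(lag \<kappa> s (band L L')) \<in> borel_measurable marked" by measurable
  note [measurable] = kint_measurable_P[OF adapted_kernel_config this]
  show ?thesis unfolding Dt_def[abs_def] by measurable
qed

abbreviation "M\<rho> \<equiv> Mart (lag (rho \<kappa>) s (band L L')) s"

lemma Dt_eq: "AE w in P. Dt w = rho \<kappa> (s - u) + M\<rho> w"
  unfolding Dt_def by (rule band_response(3)[OF \<kappa>_facts s(2)])

lemma dom_\<rho>: "H'.dominated (lag (rho \<kappa>) s (band L L'))"
  by (rule band_response(1)[OF \<kappa>_facts s(2)])

lemma zero_\<rho>: "fst (fst x) \<le> u \<Longrightarrow> ennreal (rho \<kappa> (s - fst (fst x))) * band L L' x = 0" for x :: "(real \<times> config) \<times> real"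
  by (rule band_factor_zero)

lemma Dt_le: "AE w in P. 0 \<le> Dt w \<and> Dt w \<le> D s w"
  using D_eq AE_space
proof eventually_elim
  case (elim w)
  then have w: "w \<in> configs" by (simp add: space_P)
  have e: "L s w \<le> L' s w" "ennreal (D s w) = ek (s - u) + Sint (lag k s (band L L')) s w"
    using elim s by auto
  have "ennreal (\<kappa> (s - u)) + Sint (lag \<kappa> s (band L L')) s w \<le> ennreal (D s w)"
    unfolding e(2) by (intro add_mono kint_mono adapted_kernel_config w mult_right_mono ennreal_leI \<kappa>_k) simp
  moreover from this have "Sint (lag \<kappa> s (band L L')) s w < \<infinity>"
    by (auto simp: less_top[symmetric] top_unique)
  ultimately have "ennreal (Dt w) \<le> ennreal (D s w)"
    unfolding Dt_def using \<kappa>_nn by (simp add: ennreal_plus less_top)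
  then have "Dt w \<le> D s w" by (subst (asm) ennreal_le_iff) (use e(1) in simp_all)
  then show ?case using \<kappa>_nn by (simp add: Dt_def)
qed

lemma expect_W_Dt:
  "(\<integral>\<^sup>+w. ennreal (W w * Dt w) \<partial>P) = ennreal (rho \<kappa> (s - u) * (\<integral>w. W w \<partial>P))"
proof -
  note m = Mart_band_weighted[OF dom_\<rho> zero_\<rho> s(2)]
  have e: "AE w in P. W w * Dt w = rho \<kappa> (s - u) * W w + W w * M\<rho> w"
    using Dt_eq by eventually_elim (simp add: algebra_simps)
  have i: "integrable P (\<lambda>w. rho \<kappa> (s - u) * W w + W w * M\<rho> w)" using m(1) W_int by auto
  have "(\<integral>\<^sup>+w. ennreal (W w * Dt w) \<partial>P) = (\<integral>\<^sup>+w. ennreal (rho \<kappa> (s - u) * W w + W w * M\<rho> w) \<partial>P)"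
    using e by (intro nn_integral_cong_AE) (auto elim!: eventually_mono)
  also have "\<dots> = ennreal (\<integral>w. rho \<kappa> (s - u) * W w + W w * M\<rho> w \<partial>P)"
  proof (rule nn_integral_eq_integral[OF i])
    show "AE w in P. 0 \<le> rho \<kappa> (s - u) * W w + W w * M\<rho> w"
      using e Dt_le
    proof eventually_elim
      case (elim w)
      then show ?case using W_nn[of w] mult_nonneg_nonneg[of "W w" "Dt w"] by simp
    qed
  qed
  also have "(\<integral>w. rho \<kappa> (s - u) * W w + W w * M\<rho> w \<partial>P) = rho \<kappa> (s - u) * (\<integral>w. W w \<partial>P)" using m W_int by simp
  finally show ?thesis .
qed

text \<open>On the band \<open>accept L'\<close> equals \<open>1\<close>, so the product of the two
  integrands is again carried by the band, whose weighted mean width at time \<open>r\<close> is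
  \<open>psi (r - u)\<close> times the mean of \<open>W\<close>. Hence the convolution of
  \<open>psi\<close> with itself.\<close>

lemma covariance_bound:
  "(\<integral>\<^sup>+w. Aint (\<lambda>x. weighted u W (lag (rho \<kappa>) s (band L L')) x * (epsi (s - fst (fst x)) * accept L' x)) s w \<partial>P)
    \<le> ennreal (C * wmax) * conv epsi epsi (s - u)"
proof -
  let ?F = "\<lambda>p. indicator {u<..} (fst p) * ennreal (W (snd p)) * (ennreal (rho \<kappa> (s - fst p)) * epsi (s - fst p))"
  have F: "?F \<in> borel_measurable predictable"
    using weight_predictable[OF W_past less_imp_le[OF u(1)]] by measurable
  have "(\<lambda>x. weighted u W (lag (rho \<kappa>) s (band L L')) x * (epsi (s - fst (fst x)) * accept L' x)) = (\<lambda>x. ?F (fst x) * band L L' x)"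
    by (rule ext) (auto simp: weighted_def band_def accept_def indicator_def mult_ac)
  then have "(\<integral>\<^sup>+w. Aint (\<lambda>x. weighted u W (lag (rho \<kappa>) s (band L L')) x * (epsi (s - fst (fst x)) * accept L' x)) s w \<partial>P)
    = (\<integral>\<^sup>+r\<in>{0<..<s}. (\<integral>\<^sup>+w. ?F (r, w) * ennreal (D r w) \<partial>P) \<partial>lborel)"
    using expect_Aint_band[OF F L_pred H'.L_pred L_nonneg, of s] by simp
  also have "\<dots> \<le> (\<integral>\<^sup>+r. ennreal (C * wmax) * (epsi (s - r) * epsi (r - u)) \<partial>lborel)"
  proof (rule nn_integral_mono)
    fix r
    show "(\<integral>\<^sup>+w. ?F (r, w) * ennreal (D r w) \<partial>P) * indicator {0<..<s} r \<le> ennreal (C * wmax) * (epsi (s - r) * epsi (r - u))"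
    proof (cases "u < r \<and> r < s")
      case True
      then have r: "0 < r" "r \<le> T" using u s by auto
      have "(\<integral>\<^sup>+w. ?F (r, w) * ennreal (D r w) \<partial>P) = (\<integral>\<^sup>+w. (ennreal (rho \<kappa> (s - r)) * epsi (s - r)) * ennreal (W w * D r w) \<partial>P)"
        using True W_nn by (intro nn_integral_cong) (simp add: ennreal_mult' mult_ac)
      also have "\<dots> = (ennreal (rho \<kappa> (s - r)) * epsi (s - r)) * ennreal (psi (r - u) * (\<integral>w. W w \<partial>P))"
        using expect_W_D[OF r] by (subst nn_integral_cmult) auto
      also have "\<dots> \<le> (ennreal C * epsi (s - r)) * ennreal (psi (r - u) * wmax)"
        using C EW psi_nonneg by (intro mult_mono mult_right_mono ennreal_leI mult_left_mono) auto
      also have "\<dots> = ennreal (C * wmax) * (epsi (s - r) * epsi (r - u))"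
        using psi_nonneg w_nonneg C_nonneg by (simp add: ennreal_mult mult_ac)
      finally show ?thesis using True u by simp
    qed (auto simp: indicator_def)
  qed
  also have "\<dots> = ennreal (C * wmax) * (\<integral>\<^sup>+r. epsi (s - r) * epsi (r - u) \<partial>lborel)" by (rule nn_integral_cmult) measurable
  also have "(\<integral>\<^sup>+r. epsi (s - r) * epsi (r - u) \<partial>lborel) = conv epsi epsi (s - u)"
    using nn_integral_lborel_translate[of "\<lambda>r. epsi (s - u - r) * epsi r" u] by (simp add: conv_def)
  finally show ?thesis .
qed

text \<open>\<open>Dt\<close> and \<open>L'\<close> are each a constant plus a compensated integral.
  The constant of \<open>L'\<close> meets a factor of mean zero, and the product of the two
  integrals is estimated by \<open>covariance_bound\<close>.\<close>

lemma expect_W_Dt_L':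
  "(\<integral>\<^sup>+w. ennreal (W w * Dt w * L' s w) \<partial>P) \<le> ennreal (C * wmax) * (ennreal (c / (1 - q)) + epsi (s - u) + conv epsi epsi (s - u))"
proof -
  let ?M = "Mart (lag psi s (accept L')) s"
  obtain m where "AE w in P. L' s w = m + ?M w" using H'.L_psi(2)[OF s] by blast
  note dp = H'.L_psi(1)[OF s]
  note mb = Mart_band_weighted[OF dom_\<rho> zero_\<rho> s(2)]
  let ?X = "\<lambda>w. rho \<kappa> (s - u) * (W w * L' s w) + m * (W w * M\<rho> w) + W w * M\<rho> w * ?M w"
  have e: "AE w in P. W w * Dt w * L' s w = ?X w"
    using Dt_eq \<open>AE w in P. L' s w = m + ?M w\<close> by eventually_elim (simp add: algebra_simps)
  have iL: "integrable P (\<lambda>w. W w * L s w)" "integrable P (\<lambda>w. W w * L' s w)"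
    using W_mult_int L_integrable[OF s] H'.L_integrable[OF s] by auto
  have i3: "integrable P (\<lambda>w. W w * M\<rho> w * ?M w)" by (rule mb(3)[OF _ dp])
  have iX: "integrable P ?X" using iL mb(1) i3 by auto
  let ?I = "\<integral>\<^sup>+w. Aint (\<lambda>x. weighted u W (lag (rho \<kappa>) s (band L L')) x * (epsi (s - fst (fst x)) * accept L' x)) s w \<partial>P"
  have cv: "(\<integral>w. W w * M\<rho> w * ?M w \<partial>P) = enn2real ?I" by (rule mb(4)[OF _ dp])
  \<comment> \<open>The detour through \<open>L\<close> and \<open>D\<close> avoids the bound of the
    forcing of \<open>L'\<close>, which would bring in \<open>B\<close>.\<close>
  have WL': "(\<integral>w. W w * L' s w \<partial>P) \<le> wmax * (c / (1 - q)) + psi (s - u) * wmax"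
  proof -
    have "(\<integral>w. W w * L' s w \<partial>P) = (\<integral>w. W w * L s w \<partial>P) + (\<integral>w. W w * D s w \<partial>P)"
      using iL expect_W_D(1)[OF s] by (subst Bochner_Integration.integral_add[symmetric]) (auto simp: algebra_simps)
    moreover have "(\<integral>w. W w * L s w \<partial>P) \<le> (\<integral>w. wmax * L s w \<partial>P)"
      using iL L_integrable[OF s] W_le L_nonneg by (intro integral_mono mult_right_mono) auto
    moreover have "\<dots> \<le> wmax * (c / (1 - q))" using L_integral_le[OF s] w_nonneg by (simp add: mult_left_mono del: times_divide_eq_right)
    moreover have "(\<integral>w. W w * D s w \<partial>P) \<le> psi (s - u) * wmax"
      unfolding expect_W_D(2)[OF s] using EW psi_nonneg by (intro mult_left_mono) auto
    ultimately show ?thesis by linarith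
  qed
  have "(\<integral>\<^sup>+w. ennreal (W w * Dt w * L' s w) \<partial>P) = (\<integral>\<^sup>+w. ennreal (?X w) \<partial>P)"
    using e by (intro nn_integral_cong_AE) (auto elim!: eventually_mono)
  also have "\<dots> = ennreal (\<integral>w. ?X w \<partial>P)"
  proof (rule nn_integral_eq_integral[OF iX])
    show "AE w in P. 0 \<le> ?X w"
      using e Dt_le
    proof eventually_elim
      case (elim w)
      then show ?case using W_nn[of w] H'.L_nonneg[of s w] mult_nonneg_nonneg[of "W w * Dt w" "L' s w"] by simp
    qed
  qed
  also have "(\<integral>w. ?X w \<partial>P) = rho \<kappa> (s - u) * (\<integral>w. W w * L' s w \<partial>P) + enn2real ?I"
    using iL mb(1,2) i3 by (simp add: cv)
  also have "ennreal \<dots> \<le> ennreal (C * (wmax * (c / (1 - q)) + psi (s - u) * wmax)) + ennreal (C * wmax) * conv epsi epsi (s - u)"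
  proof -
    have "rho \<kappa> (s - u) * (\<integral>w. W w * L' s w \<partial>P) \<le> C * (wmax * (c / (1 - q)) + psi (s - u) * wmax)"
      using WL' C C_nonneg W_nn H'.L_nonneg by (intro mult_mono) auto
    moreover have "ennreal (enn2real ?I) \<le> ennreal (C * wmax) * conv epsi epsi (s - u)"
      using covariance_bound by (rule order_trans[rotated]) (cases ?I; simp)
    moreover have "ennreal (rho \<kappa> (s - u) * (\<integral>w. W w * L' s w \<partial>P) + enn2real ?I) \<le> ennreal (rho \<kappa> (s - u) * (\<integral>w. W w * L' s w \<partial>P)) + ennreal (enn2real ?I)"
      using rho_nonneg[OF \<kappa>_facts] W_nn H'.L_nonneg by (subst ennreal_plus) auto
    ultimately show ?thesis by (meson add_mono ennreal_leI order_trans)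
  qed
  also have "ennreal (C * (wmax * (c / (1 - q)) + psi (s - u) * wmax)) = ennreal (C * wmax) * (ennreal (c / (1 - q)) + epsi (s - u))"
    using C_nonneg w_nonneg psi_nonneg c q by (simp add: ennreal_mult[symmetric] ennreal_plus[symmetric] algebra_simps del: ennreal_plus ennreal_mult')
  finally show ?thesis by (simp add: distrib_left)
qed

text \<open>Tangent at \<open>\<eta>\<close>: \<open>1 / x \<ge> 2 / \<eta> - x / \<eta>\<^sup>2\<close>, which makes the expectation of the ratio computable from covariances.\<close>

lemma ratio_lower:
  assumes \<eta>: "0 < \<eta>"
  shows "AE w in P. 2 * Dt w \<le> \<eta> * (1 - L s w / L' s w) + Dt w * L' s w / \<eta>"
  using Dt_le
proof eventually_elim
  case (elim w)
  show ?case
  proof (cases "L' s w = 0")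
    case True
    then show ?thesis using elim \<eta> L_nonneg[of s w] by simp
  next
    case False
    define x where "x = L' s w"
    have x: "0 < x" using False H'.L_nonneg[of s w] by (simp add: x_def)
    have "2 * \<eta> * x \<le> \<eta> * \<eta> + x * x" using sum_squares_bound[of \<eta> x] by (simp add: power2_eq_square)
    then have "2 \<le> \<eta> / x + x / \<eta>" using x \<eta> by (simp add: field_simps)
    then have "Dt w * 2 \<le> Dt w * (\<eta> / x + x / \<eta>)" using elim by (intro mult_left_mono) auto
    also have "\<dots> = Dt w * (\<eta> / x) + Dt w * x / \<eta>" by (simp add: algebra_simps)
    also have "Dt w * (\<eta> / x) \<le> D s w * (\<eta> / x)" using elim x \<eta> by (intro mult_right_mono) auto
    also have "\<dots> = \<eta> * (1 - L s w / x)" using x by (simp add: x_def field_simps)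
    finally show ?thesis by (simp add: x_def)
  qed
qed

lemma rho_le_ratio:
  assumes \<eta>: "0 < \<eta>"
  shows "ennreal (2 * (\<integral>w. W w \<partial>P)) * ennreal (rho \<kappa> (s - u)) \<le> ennreal \<eta> * (\<integral>\<^sup>+w. ennreal (W w * (1 - L s w / L' s w)) \<partial>P)
    + ennreal (C * wmax / \<eta>) * (ennreal (c / (1 - q)) + epsi (s - u) + conv epsi epsi (s - u))"
proof -
  have "ennreal (2 * (\<integral>w. W w \<partial>P)) * ennreal (rho \<kappa> (s - u)) = ennreal 2 * (\<integral>\<^sup>+w. ennreal (W w * Dt w) \<partial>P)"
    unfolding expect_W_Dt using EW(1) rho_nonneg[OF \<kappa>_facts, of "s - u"] by (simp add: ennreal_mult mult_ac)
  also have "\<dots> = (\<integral>\<^sup>+w. ennreal 2 * ennreal (W w * Dt w) \<partial>P)" by (rule nn_integral_cmult[symmetric]) measurable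
  also have "\<dots> \<le> (\<integral>\<^sup>+w. ennreal \<eta> * ennreal (W w * (1 - L s w / L' s w)) + ennreal (1 / \<eta>) * ennreal (W w * Dt w * L' s w) \<partial>P)"
  proof (rule nn_integral_mono_AE)
    show "AE w in P. ennreal 2 * ennreal (W w * Dt w) \<le> ennreal \<eta> * ennreal (W w * (1 - L s w / L' s w)) + ennreal (1 / \<eta>) * ennreal (W w * Dt w * L' s w)"
      using ratio_lower[OF \<eta>] Dt_le
    proof eventually_elim
      case (elim w)
      have "2 * (W w * Dt w) \<le> \<eta> * (W w * (1 - L s w / L' s w)) + (1 / \<eta>) * (W w * Dt w * L' s w)"
        using mult_left_mono[OF elim(1) W_nn[of w]] by (simp add: algebra_simps)
      then have "ennreal (2 * (W w * Dt w)) \<le> ennreal (\<eta> * (W w * (1 - L s w / L' s w)) + (1 / \<eta>) * (W w * Dt w * L' s w))"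
        by (rule ennreal_leI)
      \<comment> \<open>\<open>ennreal\<close> sends negative numbers to \<open>0\<close>, so it is
        subadditive on summands of either sign.\<close>
      also have "\<dots> \<le> ennreal (\<eta> * (W w * (1 - L s w / L' s w))) + ennreal ((1 / \<eta>) * (W w * Dt w * L' s w))"
        by (cases "0 \<le> \<eta> * (W w * (1 - L s w / L' s w))"; cases "0 \<le> (1 / \<eta>) * (W w * Dt w * L' s w)") (auto simp: ennreal_plus[symmetric] ennreal_neg not_le simp del: ennreal_plus intro!: ennreal_leI)
      finally have "ennreal (2 * (W w * Dt w)) \<le> ennreal (\<eta> * (W w * (1 - L s w / L' s w))) + ennreal ((1 / \<eta>) * (W w * Dt w * L' s w))" .
      moreover have "ennreal (2 * (W w * Dt w)) = ennreal 2 * ennreal (W w * Dt w)"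
        "ennreal (\<eta> * (W w * (1 - L s w / L' s w))) = ennreal \<eta> * ennreal (W w * (1 - L s w / L' s w))"
        "ennreal ((1 / \<eta>) * (W w * Dt w * L' s w)) = ennreal (1 / \<eta>) * ennreal (W w * Dt w * L' s w)"
        using \<eta> by (intro ennreal_mult'; simp)+
      ultimately show ?case by simp
    qed
  qed
  also have "\<dots> = ennreal \<eta> * (\<integral>\<^sup>+w. ennreal (W w * (1 - L s w / L' s w)) \<partial>P) + ennreal (1 / \<eta>) * (\<integral>\<^sup>+w. ennreal (W w * Dt w * L' s w) \<partial>P)"
    by (subst nn_integral_add | subst nn_integral_cmult | simp)+
  also have "\<dots> \<le> ennreal \<eta> * (\<integral>\<^sup>+w. ennreal (W w * (1 - L s w / L' s w)) \<partial>P) + ennreal (1 / \<eta>) * (ennreal (C * wmax) * (ennreal (c / (1 - q)) + epsi (s - u) + conv epsi epsi (s - u)))"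
    by (intro add_left_mono mult_left_mono expect_W_Dt_L') simp
  also have "ennreal (1 / \<eta>) * (ennreal (C * wmax) * (ennreal (c / (1 - q)) + epsi (s - u) + conv epsi epsi (s - u))) =
      ennreal (C * wmax / \<eta>) * (ennreal (c / (1 - q)) + epsi (s - u) + conv epsi epsi (s - u))"
    using \<eta> C_nonneg w_nonneg by (simp add: mult.assoc[symmetric] ennreal_mult[symmetric] del: ennreal_mult')
  finally show ?thesis .
qed

end

text \<open>Integration over \<open>s\<close> turns the error terms into masses of
  \<open>psi\<close>, at most \<open>q / (1 - q)\<close> and its square. For
  \<open>1 - q = 1 / T\<close> the last bracket is at most of order \<open>T\<^sup>2\<close>, which
  determines the size of \<open>\<eta>\<close>.\<close>

lemma ratio_integral_lower:
  assumes \<kappa> [measurable]: "\<kappa> \<in> borel_measurable borel" and \<kappa>': "\<And>t. 0 \<le> \<kappa> t" "\<And>t. \<kappa> t \<le> R"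
    "\<And>t. t \<le> 0 \<Longrightarrow> \<kappa> t = 0" "\<And>t. \<kappa> t \<le> k t" and C: "\<And>t. rho \<kappa> t \<le> C" and \<eta>: "0 < \<eta>"
  shows "ennreal (2 * (\<integral>w. W w \<partial>P)) * (\<integral>\<^sup>+v\<in>{..T - u}. ennreal (rho \<kappa> v) \<partial>lborel) \<le>
    ennreal \<eta> * (\<integral>\<^sup>+s\<in>{u..T}. (\<integral>\<^sup>+w. ennreal (W w * (1 - L s w / L' s w)) \<partial>P) \<partial>lborel)
    + ennreal (C * wmax / \<eta> * (c / (1 - q) * T + q / (1 - q) + (q / (1 - q))\<^sup>2))"
proof -
  note \<kappa>'' = \<kappa> \<kappa>'(1-3)
  note [measurable] = rho_measurable[OF \<kappa>'']
  have Cn: "0 \<le> C" using rho_nonneg[OF \<kappa>''] C order_trans by blast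
  let ?E = "\<lambda>s. \<integral>\<^sup>+w. ennreal (W w * (1 - L s w / L' s w)) \<partial>P"
  have [measurable]: "(\<lambda>p. L (fst p) (snd p)) \<in> borel_measurable (lborel \<Otimes>\<^sub>M P)" "(\<lambda>p. L' (fst p) (snd p)) \<in> borel_measurable (lborel \<Otimes>\<^sub>M P)"
    using predictable_joint_P[OF L_pred] predictable_joint_P[OF H'.L_pred]
    by (auto simp: measurable_cong_sets[OF sets_pair_measure_cong[OF sets_lborel refl] refl])
  have E [measurable]: "?E \<in> borel_measurable lborel" by measurable
  let ?G = "\<lambda>s. ennreal (C * wmax / \<eta>) * (ennreal (c / (1 - q)) * indicator {0..T} s + epsi (s - u) + conv epsi epsi (s - u))"
  have "ennreal (2 * (\<integral>w. W w \<partial>P)) * (\<integral>\<^sup>+v\<in>{..T - u}. ennreal (rho \<kappa> v) \<partial>lborel)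
    = ennreal (2 * (\<integral>w. W w \<partial>P)) * (\<integral>\<^sup>+s. ennreal (rho \<kappa> (s - u)) * indicator {..T - u} (s - u) \<partial>lborel)"
    using nn_integral_lborel_translate[of "\<lambda>v. ennreal (rho \<kappa> v) * indicator {..T - u} v" u] by simp
  also have "\<dots> = (\<integral>\<^sup>+s. ennreal (2 * (\<integral>w. W w \<partial>P)) * (ennreal (rho \<kappa> (s - u)) * indicator {..T - u} (s - u)) \<partial>lborel)"
    by (rule nn_integral_cmult[symmetric]) measurable
  also have "\<dots> \<le> (\<integral>\<^sup>+s. ennreal \<eta> * (?E s * indicator {u..T} s) + ?G s \<partial>lborel)"
  proof (rule nn_integral_mono)
    fix s
    show "ennreal (2 * (\<integral>w. W w \<partial>P)) * (ennreal (rho \<kappa> (s - u)) * indicator {..T - u} (s - u)) \<le> ennreal \<eta> * (?E s * indicator {u..T} s) + ?G s"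
    proof (cases "u \<le> s \<and> s \<le> T")
      case True
      then have s: "0 < s" "s \<le> T" using u by auto
      show ?thesis using rho_le_ratio[OF \<kappa> \<kappa>' C s \<eta>] True s by simp
    next
      case False
      then show ?thesis using rho_supp[OF \<kappa>'', of "s - u"] by (cases "s < u") (auto simp: indicator_def)
    qed
  qed
  also have "\<dots> = ennreal \<eta> * (\<integral>\<^sup>+s\<in>{u..T}. ?E s \<partial>lborel) + (\<integral>\<^sup>+s. ?G s \<partial>lborel)"
    by (subst nn_integral_add) (auto simp: nn_integral_cmult)
  also have "(\<integral>\<^sup>+s. ?G s \<partial>lborel) = ennreal (C * wmax / \<eta>) * ((\<integral>\<^sup>+s\<in>{0..T}. ennreal (c / (1 - q)) \<partial>lborel) + (\<integral>\<^sup>+s. epsi (s - u) \<partial>lborel) + (\<integral>\<^sup>+s. conv epsi epsi (s - u) \<partial>lborel))"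
    by (simp add: nn_integral_cmult nn_integral_add)
  also have "(\<integral>\<^sup>+s. epsi (s - u) \<partial>lborel) = (\<integral>\<^sup>+s. epsi s \<partial>lborel)" by (rule nn_integral_lborel_translate) measurable
  also have "(\<integral>\<^sup>+s. conv epsi epsi (s - u) \<partial>lborel) = (\<integral>\<^sup>+s. epsi s \<partial>lborel) * (\<integral>\<^sup>+s. epsi s \<partial>lborel)"
    by (subst nn_integral_lborel_translate) (auto simp: nn_integral_conv)
  also have "(\<integral>\<^sup>+s\<in>{0..T}. ennreal (c / (1 - q)) \<partial>lborel) = ennreal (c / (1 - q) * T)"
    using T c q by (subst nn_integral_cmult_indicator) (auto simp: ennreal_mult'[symmetric])
  also have "ennreal (C * wmax / \<eta>) * (ennreal (c / (1 - q) * T) + (\<integral>\<^sup>+s. epsi s \<partial>lborel) + (\<integral>\<^sup>+s. epsi s \<partial>lborel) * (\<integral>\<^sup>+s. epsi s \<partial>lborel))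
    \<le> ennreal (C * wmax / \<eta>) * (ennreal (c / (1 - q) * T) + ennreal (q / (1 - q)) + ennreal (q / (1 - q)) * ennreal (q / (1 - q)))"
    by (intro mult_left_mono add_mono mult_mono psi_mass order_refl) auto
  also have "\<dots> = ennreal (C * wmax / \<eta> * (c / (1 - q) * T + q / (1 - q) + (q / (1 - q))\<^sup>2))"
    using Cn w_nonneg \<eta> c q T by (simp add: ennreal_mult[symmetric] ennreal_plus[symmetric] power2_eq_square del: ennreal_plus ennreal_mult')
  finally show ?thesis by (simp add: add_left_mono)
qed

end

text \<open>With \<open>z = e * y\<close>: for \<open>x \<le> H\<close> the right side is at least
  \<open>x\<close>, hence at least \<open>z\<close>; for \<open>x > H\<close> it equals
  \<open>H\<close>, the maximum of the parabola \<open>z - z\<^sup>2 / (4 * H)\<close>. The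
  quadratic minorant replaces the mean of a square root by first and second moments, and a small
  \<open>e\<close> keeps the quadratic term subordinate.\<close>

lemma sqrt_min_lower:
  assumes y: "0 \<le> y" "y \<le> x" and e: "0 \<le> e" "e \<le> 1" and H: "0 < (H :: real)"
  shows "e * y - e\<^sup>2 * y\<^sup>2 / (4 * H) \<le> sqrt H * min (sqrt x) (sqrt H)"
proof -
  define z where "z = e * y"
  have z: "0 \<le> z" "z \<le> x" using y e mult_left_le_one_le[of y e] by (auto simp: z_def)
  have "z - z\<^sup>2 / (4 * H) \<le> sqrt H * min (sqrt x) (sqrt H)"
  proof (cases "x \<le> H")
    case True
    then have "z \<le> sqrt x * sqrt x" using z by simp
    also have "\<dots> \<le> sqrt H * sqrt x" using True z by (intro mult_right_mono) auto
    finally show ?thesis using True H by (simp add: min_def) (smt (verit) divide_nonneg_pos zero_le_power2)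
  next
    case False
    have "0 \<le> (z - 2 * H)\<^sup>2" by simp
    then have "z - z\<^sup>2 / (4 * H) \<le> H" using H by (simp add: field_simps power2_eq_square)
    then show ?thesis using False H by (simp add: min_def)
  qed
  then show ?thesis by (simp add: z_def power_mult_distrib)
qed

text \<open>The intensity dominates its functional with kernel \<open>\<kappa>\<close>, which has
  mean \<open>m\<close> and, by the isometry, a variance controlled by the bound \<open>C\<close> of
  the response. A lower bound on the mean therefore excludes that the intensity is mostly
  small.\<close>

lemma (in hawkes) expect_sqrt_min_lower:
  assumes \<kappa> [measurable]: "\<kappa> \<in> borel_measurable borel" and \<kappa>': "\<And>t. 0 \<le> \<kappa> t" "\<And>t. \<kappa> t \<le> R" "\<And>t. t \<le> 0 \<Longrightarrow> \<kappa> t = 0"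
    and \<kappa>_k: "\<And>t. \<kappa> t \<le> k t" and C: "\<And>t. rho \<kappa> t \<le> C" and s: "0 < s" "s \<le> T" and e: "0 \<le> e" "e \<le> 1" and H: "0 < H"
  defines "m \<equiv> enn2real (\<integral>\<^sup>+v\<in>{0<..<s}. ennreal (rho \<kappa> (s - v)) * ennreal (b v) \<partial>lborel)"
  shows "e * m - e\<^sup>2 * (m\<^sup>2 + C\<^sup>2 * (c / (1 - q)) * T) / (4 * H) \<le> sqrt H * (\<integral>w. min (sqrt (L s w)) (sqrt H) \<partial>P)"
proof -
  note \<kappa>'' = \<kappa> \<kappa>'
  note [measurable] = rho_measurable[OF \<kappa>'']
  have Cn: "0 \<le> C" using rho_nonneg[OF \<kappa>''] C order_trans by blast
  let ?f = "\<lambda>y. ennreal (rho \<kappa> (s - fst (fst y))) * accept L y"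
  let ?M = "Mart ?f s"
  have r1: "dominated ?f" by (rule accept_response(1)[OF \<kappa>'' s(2)])
  have r3: "AE w in P. enn2real (Sint (lag \<kappa> s (accept L)) s w) = m + ?M w"
    unfolding m_def by (rule accept_response(3)[OF \<kappa>'' s(2)])
  have lower: "AE w in P. 0 \<le> m + ?M w \<and> m + ?M w \<le> L s w"
    using r3 L_eq AE_space
  proof eventually_elim
    case (elim w)
    then have w: "w \<in> configs" by (simp add: space_P)
    let ?S = "Sint (lag \<kappa> s (accept L)) s w"
    have e: "m + ?M w = enn2real ?S" using elim by simp
    have "?S \<le> Sint (lag k s (accept L)) s w"
      by (intro kint_mono adapted_kernel_config w mult_right_mono ennreal_leI \<kappa>_k) simp
    also have "\<dots> \<le> ennreal (L s w)" using elim s by simp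
    finally have "enn2real ?S \<le> L s w" using L_nonneg by (simp add: enn2real_leI)
    then show ?case unfolding e by simp
  qed
  note i = Mart_integrable[OF r1 s(2)]
  note v = Mart_covariance[OF r1 r1 s(2)]
  have var: "(\<integral>w. ?M w * ?M w \<partial>P) \<le> C\<^sup>2 * (c / (1 - q)) * T"
  proof -
    have "(\<integral>\<^sup>+w. Aint (\<lambda>x. ?f x * ?f x) s w \<partial>P) = (\<integral>\<^sup>+w. Aint (\<lambda>x. (ennreal (rho \<kappa> (s - fst (fst x))) * ennreal (rho \<kappa> (s - fst (fst x)))) * accept L x) s w \<partial>P)"
      by (intro arg_cong2[where f = "\<lambda>f M. nn_integral M f"] ext arg_cong2[where f = "\<lambda>h s. Aint h s _"]) (auto simp: accept_def indicator_def)
    also have "\<dots> = (\<integral>\<^sup>+r\<in>{0<..<s}. (\<integral>\<^sup>+w. (ennreal (rho \<kappa> (s - r)) * ennreal (rho \<kappa> (s - r))) * ennreal (L r w) \<partial>P) \<partial>lborel)"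
      using expect_Aint[of "\<lambda>p. ennreal (rho \<kappa> (s - fst p)) * ennreal (rho \<kappa> (s - fst p))" L s] L_pred L_nonneg by simp
    also have "\<dots> \<le> (\<integral>\<^sup>+r\<in>{0<..<T}. ennreal (C\<^sup>2 * (c / (1 - q))) \<partial>lborel)"
    proof (rule nn_integral_mono)
      fix r
      show "(\<integral>\<^sup>+w. (ennreal (rho \<kappa> (s - r)) * ennreal (rho \<kappa> (s - r))) * ennreal (L r w) \<partial>P) * indicator {0<..<s} r \<le> ennreal (C\<^sup>2 * (c / (1 - q))) * indicator {0<..<T} r"
      proof (cases "0 < r \<and> r < s")
        case True
        then have r: "0 < r" "r \<le> T" using s by auto
        have "(\<integral>\<^sup>+w. (ennreal (rho \<kappa> (s - r)) * ennreal (rho \<kappa> (s - r))) * ennreal (L r w) \<partial>P) = (ennreal (rho \<kappa> (s - r)) * ennreal (rho \<kappa> (s - r))) * (\<integral>\<^sup>+w. ennreal (L r w) \<partial>P)"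
          by (rule nn_integral_cmult) measurable
        also have "\<dots> \<le> (ennreal C * ennreal C) * ennreal (c / (1 - q))"
          using L_expect_le[OF r] C by (intro mult_mono ennreal_leI) auto
        also have "\<dots> = ennreal (C\<^sup>2 * (c / (1 - q)))"
          using Cn c q by (simp add: ennreal_mult[symmetric] power2_eq_square del: ennreal_mult')
        finally show ?thesis using True s by simp
      qed (auto simp: indicator_def)
    qed
    also have "\<dots> = ennreal (C\<^sup>2 * (c / (1 - q)) * T)"
      using T Cn c q by (subst nn_integral_cmult_indicator) (auto simp: ennreal_mult'[symmetric])
    finally have "enn2real (\<integral>\<^sup>+w. Aint (\<lambda>x. ?f x * ?f x) s w \<partial>P) \<le> C\<^sup>2 * (c / (1 - q)) * T"
      using Cn c q T by (intro enn2real_leI) auto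
    then show ?thesis using v(2) by simp
  qed
  have iW: "integrable P (\<lambda>w. min (sqrt (L s w)) (sqrt H))"
    using H L_nonneg by (intro integrable_const_bound[of _ "sqrt H"]) auto
  let ?Y = "\<lambda>w. e * (m + ?M w) - e\<^sup>2 / (4 * H) * (m\<^sup>2 + 2 * m * ?M w + ?M w * ?M w)"
  have iY: "integrable P ?Y" using i(1) v(1) by auto
  have "(\<integral>w. ?Y w \<partial>P) \<le> (\<integral>w. sqrt H * min (sqrt (L s w)) (sqrt H) \<partial>P)"
  proof (rule integral_mono_AE[OF iY])
    show "integrable P (\<lambda>w. sqrt H * min (sqrt (L s w)) (sqrt H))" using iW by simp
    show "AE w in P. ?Y w \<le> sqrt H * min (sqrt (L s w)) (sqrt H)"
      using lower
    proof eventually_elim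
      case (elim w)
      have "?Y w = e * (m + ?M w) - e\<^sup>2 * (m + ?M w)\<^sup>2 / (4 * H)"
      proof -
        have "(m + ?M w)\<^sup>2 = m\<^sup>2 + 2 * m * ?M w + ?M w * ?M w" by (simp add: power2_eq_square algebra_simps)
        then show ?thesis by simp
      qed
      also have "\<dots> \<le> sqrt H * min (sqrt (L s w)) (sqrt H)" using elim by (intro sqrt_min_lower e H) auto
      finally show ?case .
    qed
  qed
  also have "\<dots> = sqrt H * (\<integral>w. min (sqrt (L s w)) (sqrt H) \<partial>P)" by simp
  also have "(\<integral>w. ?Y w \<partial>P) = e * m - e\<^sup>2 / (4 * H) * (m\<^sup>2 + (\<integral>w. ?M w * ?M w \<partial>P))"
    using i v(1) by (simp add: prob_space)
  finally have "e * m - e\<^sup>2 / (4 * H) * (m\<^sup>2 + (\<integral>w. ?M w * ?M w \<partial>P)) \<le> sqrt H * (\<integral>w. min (sqrt (L s w)) (sqrt H) \<partial>P)" .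
  moreover have "e\<^sup>2 / (4 * H) * (m\<^sup>2 + (\<integral>w. ?M w * ?M w \<partial>P)) \<le> e\<^sup>2 / (4 * H) * (m\<^sup>2 + C\<^sup>2 * (c / (1 - q)) * T)"
    using var H by (intro mult_left_mono add_left_mono) auto
  ultimately show ?thesis by simp
qed

section \<open>The intensity on the canonical space\<close>

lemma add_point_measurable_past:
  assumes u: "u \<le> r"
  shows "add_point (u, v) \<in> measurable (past r) (past r)"
proof -
  have "(\<lambda>w. add_point (u, v) w) \<in> measurable (past r) (sigma configs {{w \<in> configs. emeasure w (S \<times> B) \<in> E} |S B E.
        S \<in> sets borel \<and> S \<subseteq> {..r} \<and> B \<in> sets borel \<and> B \<subseteq> {0..} \<and> E \<in> sets borel})"
  proof (rule measurable_measure_of, goal_cases)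
    case 2 then show ?case by (auto simp: space_past add_point_in_configs)
  next
    case (3 Y)
    then obtain S B E where Y: "Y = {w \<in> configs. emeasure w (S \<times> B) \<in> E}" and
      SB: "S \<in> sets borel" "S \<subseteq> {..r}" "B \<in> sets borel" "B \<subseteq> {0..}" and E: "E \<in> sets borel" by blast
    have hp: "S \<times> B \<in> sets half_plane" using SB by (intro Times_half_plane)
    \<comment> \<open>A rectangle without the point \<open>(u, v)\<close> is no rectangle, but a
      union of two: one off the time \<open>u\<close> and one on it.\<close>
    let ?g = "\<lambda>w. emeasure w ((S - {u}) \<times> B) + emeasure w ((S \<inter> {u}) \<times> (B - {v})) + indicator (S \<times> B) (u, v)"
    have eq: "emeasure (add_point (u, v) w) (S \<times> B) = ?g w" if w: "w \<in> configs" for w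
    proof -
      have "S \<times> B - {(u, v)} = (S - {u}) \<times> B \<union> (S \<inter> {u}) \<times> (B - {v})" by auto
      moreover have "(S - {u}) \<times> B \<in> sets w" "(S \<inter> {u}) \<times> (B - {v}) \<in> sets w"
        using SB sets_config[OF w] by (auto intro!: Times_half_plane)
      ultimately have "emeasure w (S \<times> B - {(u, v)}) = emeasure w ((S - {u}) \<times> B) + emeasure w ((S \<inter> {u}) \<times> (B - {v}))"
        by (subst plus_emeasure) auto
      then show ?thesis by (simp add: emeasure_add_point[OF w hp])
    qed
    have [measurable]: "(\<lambda>w. emeasure w ((S - {u}) \<times> B)) \<in> borel_measurable (past r)"
      "(\<lambda>w. emeasure w ((S \<inter> {u}) \<times> (B - {v}))) \<in> borel_measurable (past r)"
      using SB u by (auto intro!: measurable_emeasure_past)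
    have "?g -` E \<inter> space (past r) \<in> sets (past r)" by (rule measurable_sets[OF _ E]) measurable
    moreover have "(\<lambda>w. add_point (u, v) w) -` Y \<inter> space (past r) = ?g -` E \<inter> space (past r)"
      using eq by (auto simp: Y space_past add_point_in_configs)
    ultimately show ?case by simp
  qed auto
  then show ?thesis by (simp add: past_def)
qed

lemma add_point_past_iff:
  assumes A: "A \<in> sets (past r)" and r: "r < u" and w: "w \<in> configs"
  shows "add_point (u, v) w \<in> A \<longleftrightarrow> w \<in> A"
  using A unfolding sets_past
proof (induction rule: sigma_sets.induct)
  case (Basic a)
  then obtain S B E where a: "a = {w \<in> configs. emeasure w (S \<times> B) \<in> E}" and
    SB: "S \<in> sets borel" "S \<subseteq> {..r}" "B \<in> sets borel" "B \<subseteq> {0..}" by blast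
  have "(u, v) \<notin> S \<times> B" using SB r by auto
  then have "emeasure (add_point (u, v) w) (S \<times> B) = emeasure w (S \<times> B)"
    using emeasure_add_point[OF w Times_half_plane[OF SB(1,3,4)]] by simp
  then show ?case using w by (simp add: a add_point_in_configs)
next
  case (Compl a)
  then show ?case using w by (simp add: add_point_in_configs)
qed auto

lemma add_point_predictable_iff:
  assumes G: "G \<in> sets predictable" and t: "t \<le> u" and w: "w \<in> configs"
  shows "(t, add_point (u, v) w) \<in> G \<longleftrightarrow> (t, w) \<in> G"
  using G unfolding sets_predictable
proof (induction rule: sigma_sets.induct)
  case (Basic a)
  then show ?case
  proof (cases rule: predictable_genE)
    case (1 S)
    then show ?thesis using w by (simp add: add_point_in_configs)
  next
    case (2 s t' A)
    then show ?thesis using add_point_past_iff[OF 2(3) _ w, of u v] t by (cases "s < u") auto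
  qed
next
  case (Compl a)
  then show ?case using w by (simp add: add_point_in_configs)
qed auto

text \<open>The set version is applied to the level set through \<open>(t, w)\<close>. The case
  \<open>t = u\<close> is included: a predictable process does not see a point at the moment it
  occurs.\<close>

lemma predictable_add_point:
  fixes F :: "real \<times> config \<Rightarrow> real"
  assumes F: "F \<in> borel_measurable predictable" and t: "t \<le> u" and w: "w \<in> configs"
  shows "F (t, add_point (u, v) w) = F (t, w)"
proof -
  have "F -` {F (t, w)} \<inter> space predictable \<in> sets predictable" by (rule measurable_sets[OF F]) simp
  from add_point_predictable_iff[OF this t w, of v] show ?thesis
    using w by (auto simp: space_predictable add_point_in_configs)
qed

text \<open>After time \<open>u\<close> a generating rectangle over \<open>{s<..t}\<close> pulls
  back to one over \<open>{max s u<..t}\<close>, because the added point belongs to the past from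
  \<open>u\<close> on. Up to \<open>u\<close> the unshifted function is used.\<close>

lemma measurable_shift_predictable:
  assumes F: "F \<in> borel_measurable predictable" and u: "0 \<le> u"
  shows "(\<lambda>p. if fst p \<le> u then F p else F (fst p, add_point (u, v) (snd p)) :: real) \<in> borel_measurable predictable"
proof -
  let ?S = "{u<..} \<times> configs"
  have S: "?S \<in> sets predictable"
    using predictable_rect_greaterThan[OF u, of configs] sets.top[of "past u"] by (simp add: space_past)
  have Ss: "?S \<inter> space predictable = ?S" by (auto simp: space_predictable)
  have "(\<lambda>p. (fst p, add_point (u, v) (snd p))) \<in> measurable (restrict_space predictable ?S) (sigma (UNIV \<times> configs) predictable_gen)"
  proof (rule measurable_measure_of)
    show "predictable_gen \<subseteq> Pow (UNIV \<times> configs)" by (rule predictable_gen_closed)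
    show "(\<lambda>p. (fst p, add_point (u, v) (snd p))) \<in> space (restrict_space predictable ?S) \<rightarrow> UNIV \<times> configs"
      by (auto simp: space_restrict_space space_predictable add_point_in_configs)
    fix y assume "y \<in> predictable_gen"
    then show "(\<lambda>p. (fst p, add_point (u, v) (snd p))) -` y \<inter> space (restrict_space predictable ?S) \<in> sets (restrict_space predictable ?S)"
    proof (cases rule: predictable_genE)
      case (1 R)
      then have "(\<lambda>p. (fst p, add_point (u, v) (snd p))) -` y \<inter> space (restrict_space predictable ?S) = {}"
        using u by (auto simp: space_restrict_space space_predictable)
      then show ?thesis by simp
    next
      case (2 s t A)
      let ?r = "max s u" and ?A = "add_point (u, v) -` A \<inter> space (past (max s u))"
      have "A \<in> sets (past ?r)" using 2 past_mono[of s ?r] by auto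
      then have A: "?A \<in> sets (past ?r)" by (intro measurable_sets[OF add_point_measurable_past]) auto
      have "(\<lambda>p. (fst p, add_point (u, v) (snd p))) -` y \<inter> space (restrict_space predictable ?S) = {?r<..t} \<times> ?A"
        using 2(1) by (auto simp: space_restrict_space space_predictable space_past)
      moreover have "{?r<..t} \<times> ?A \<in> sets predictable" using u by (intro predictable_rect A) simp
      ultimately show ?thesis
        by (subst sets_restrict_space_iff) (auto simp: Ss S space_past)
    qed
  qed
  then have "(\<lambda>p. F (fst p, add_point (u, v) (snd p))) \<in> borel_measurable (restrict_space predictable ?S)"
    unfolding predictable_def[symmetric] by (rule measurable_compose[OF _ F])
  then have m [measurable]: "(\<lambda>p. indicator ?S p *\<^sub>R F (fst p, add_point (u, v) (snd p))) \<in> borel_measurable predictable"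
    by (subst (asm) borel_measurable_restrict_space_iff) (auto simp: Ss S)
  have "(\<lambda>p. if fst p \<le> u then F p else indicator ?S p *\<^sub>R F (fst p, add_point (u, v) (snd p))) \<in> borel_measurable predictable"
    using F by measurable
  then show ?thesis
    by (rule measurable_cong[THEN iffD1, rotated]) (auto simp: space_predictable)
qed

text \<open>\<open>add_point\<close> first removes any mass at \<open>z\<close>, so one additional
  summand is the correct change only if \<open>w\<close> has no mass there.\<close>

lemma nn_integral_add_point:
  assumes w: "w \<in> configs" and z: "z \<in> space half_plane" "emeasure w {z} = 0" and f: "f \<in> borel_measurable half_plane"
  shows "(\<integral>\<^sup>+x. f x \<partial>add_point z w) = (\<integral>\<^sup>+x. f x \<partial>w) + f z"
  using f
proof (induction f rule: borel_measurable_induct)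
  case (cong f g)
  have "space (add_point z w) = space half_plane" "space w = space half_plane"
    using sets_eq_imp_space_eq sets_add_point sets_config[OF w] by blast+
  with cong z show ?case by (metis (no_types, lifting) nn_integral_cong)
next
  case (set A)
  have zm: "{z} \<in> sets half_plane" using z by (auto simp: sets_half_plane_iff space_half_plane)
  have "emeasure w A = emeasure w (A - {z})"
    using z zm set sets_config[OF w] by (subst emeasure_Diff_null_set) (auto simp: null_sets_def)
  then show ?case using set sets_config[OF w] by (simp add: emeasure_add_point[OF w])
next
  case (mult g c)
  then have "g \<in> borel_measurable (add_point z w)" "g \<in> borel_measurable w"
    by (auto simp: measurable_cong_sets[OF sets_add_point refl] measurable_cong_sets[OF sets_config[OF w] refl])
  then show ?case using mult by (simp add: nn_integral_cmult distrib_left)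
next
  case (add f g)
  then have "f \<in> borel_measurable (add_point z w)" "f \<in> borel_measurable w" "g \<in> borel_measurable (add_point z w)" "g \<in> borel_measurable w"
    by (auto simp: measurable_cong_sets[OF sets_add_point refl] measurable_cong_sets[OF sets_config[OF w] refl])
  then show ?case using add by (simp add: nn_integral_add add_ac)
next
  case (seq U)
  have m: "U i \<in> borel_measurable (add_point z w)" "U i \<in> borel_measurable w" for i
    using seq(1) by (auto simp: measurable_cong_sets[OF sets_add_point refl] measurable_cong_sets[OF sets_config[OF w] refl])
  have U: "incseq U" by fact
  have "(\<integral>\<^sup>+x. (SUP i. U i) x \<partial>add_point z w) = (SUP i. \<integral>\<^sup>+x. U i x \<partial>add_point z w)"
    unfolding SUP_apply by (rule nn_integral_monotone_convergence_SUP[OF U m(1)])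
  also have "\<dots> = (SUP i. (\<integral>\<^sup>+x. U i x \<partial>w) + U i z)" using seq by simp
  also have "\<dots> = (SUP i. \<integral>\<^sup>+x. U i x \<partial>w) + (SUP i. U i z)"
  proof (rule ennreal_SUP_add)
    show "incseq (\<lambda>i. U i z)" using U by (cases z) (simp add: incseq_def le_fun_def)
    show "incseq (\<lambda>i. \<integral>\<^sup>+x. U i x \<partial>w)" using U unfolding incseq_def le_fun_def by (intro allI impI nn_integral_mono) blast
  qed
  also have "(SUP i. \<integral>\<^sup>+x. U i x \<partial>w) = (\<integral>\<^sup>+x. (SUP i. U i) x \<partial>w)"
    unfolding SUP_apply by (rule nn_integral_monotone_convergence_SUP[OF U m(2), symmetric])
  finally show ?case by (simp only: SUP_apply)
qed

text \<open>A version that is total and at least \<open>\<mu>\<close> for every configuration, while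
  \<open>lam\<close> is meaningful only on \<open>{0..T}\<close> and where the equation holds; there
  the two agree at positive times.\<close>

definition regular :: "real \<Rightarrow> real \<Rightarrow> (real \<Rightarrow> config \<Rightarrow> real) \<Rightarrow> real \<Rightarrow> config \<Rightarrow> real" where
  "regular \<mu> T lam t w = (if 0 < t \<and> t \<le> T then max \<mu> (lam t w) else \<mu>)"

text \<open>The target \<open>M\<close> is general, so that the lemma yields both predictability on
  the whole time axis and plain joint measurability.\<close>

lemma predictable_sigma_restrict:
  assumes lam: "(\<lambda>(t, w). lam t w) \<in> borel_measurable (predictable_sigma T)" and T: "0 \<le> T"
    and M: "space M = UNIV \<times> configs" "R \<times> configs \<in> sets M" and R: "R \<subseteq> {0..T}"
    and zero: "\<And>A. A \<in> sets (past 0) \<Longrightarrow> ({0} \<inter> R) \<times> A \<in> sets M"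
    and rect: "\<And>s t A. 0 \<le> s \<Longrightarrow> A \<in> sets (past s) \<Longrightarrow> ({s<..t} \<inter> R) \<times> A \<in> sets M"
  shows "(\<lambda>p. indicator R (fst p) *\<^sub>R lam (fst p) (snd p) :: real) \<in> borel_measurable M"
proof -
  let ?S = "R \<times> configs"
  have Ss: "?S \<inter> space M = ?S" by (auto simp: M)
  have "(\<lambda>p. p) \<in> measurable (restrict_space M ?S) (predictable_sigma T)"
    unfolding predictable_sigma_def
  proof (rule measurable_measure_of, goal_cases)
    case 1
    have "{s<..t} \<times> A \<subseteq> {0..T} \<times> configs" if "0 \<le> s" "t \<le> T" "A \<in> sets (past s)" for s t A
      using that past_subset_configs[OF that(3)] by auto
    moreover have "{0} \<times> A \<subseteq> {0..T} \<times> configs" if "A \<in> sets (past 0)" for A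
      using past_subset_configs[OF that] T by auto
    ultimately show ?case by blast
  next
    case 2
    then show ?case using R by (auto simp: space_restrict_space)
  next
    case (3 y)
    then obtain I A s where y: "y = I \<times> A" "A \<in> sets (past s)" "(I \<inter> R) \<times> A \<in> sets M"
      using zero rect by blast
    have "(\<lambda>p. p) -` y \<inter> space (restrict_space M ?S) = (I \<inter> R) \<times> A" "(I \<inter> R) \<times> A \<subseteq> ?S"
      using past_subset_configs[OF y(2)] by (auto simp: y(1) space_restrict_space M)
    moreover have "?S \<inter> space M \<in> sets M" unfolding Ss by (rule M(2))
    ultimately show ?case using y(3) by (simp only: sets_restrict_space_iff simp_thms)
  qed
  from measurable_compose[OF this lam]
  have "(\<lambda>p. lam (fst p) (snd p)) \<in> borel_measurable (restrict_space M ?S)" by (simp add: split_beta')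
  then have "(\<lambda>p. indicator ?S p *\<^sub>R lam (fst p) (snd p)) \<in> borel_measurable M"
    by (subst (asm) borel_measurable_restrict_space_iff) (auto simp: Ss M(2))
  then show ?thesis
    by (rule measurable_cong[THEN iffD1, rotated]) (auto simp: M indicator_def)
qed

lemma regular_predictable:
  assumes T: "0 \<le> T" and lam: "(\<lambda>(t, w). lam t w) \<in> borel_measurable (predictable_sigma T)"
  shows "(\<lambda>p. regular \<mu> T lam (fst p) (snd p)) \<in> borel_measurable predictable"
proof -
  have [measurable]: "(\<lambda>p. indicator {0<..T} (fst p) *\<^sub>R lam (fst p) (snd p)) \<in> borel_measurable predictable"
  proof (rule predictable_sigma_restrict[OF lam T space_predictable])
    show "{0<..T} \<times> configs \<in> sets predictable"
      using predictable_rect[of 0 configs T] sets.top[of "past 0"] by (simp add: space_past)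
    show "({s<..t} \<inter> {0<..T}) \<times> A \<in> sets predictable" if "0 \<le> s" "A \<in> sets (past s)" for s t A
    proof -
      have "{s<..t} \<inter> {0<..T} = {s<..min t T}" using that by auto
      then show ?thesis using predictable_rect[OF that] by simp
    qed
  qed auto
  have "(\<lambda>p. if 0 < fst p \<and> fst p \<le> T then max \<mu> (indicator {0<..T} (fst p) *\<^sub>R lam (fst p) (snd p)) else \<mu>) \<in> borel_measurable predictable"
    by measurable
  then show ?thesis
    by (rule measurable_cong[THEN iffD1, rotated]) (auto simp: regular_def)
qed

lemma regular_eq:
  assumes eq: "hawkes_equation \<mu> \<phi> T lam w" and \<mu>: "0 < \<mu>" and t: "0 < t" "t \<le> T"
  shows "regular \<mu> T lam t w = lam t w" and "\<mu> \<le> lam t w"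
proof -
  have "ennreal \<mu> \<le> ennreal (lam t w)" using eq t unfolding hawkes_equation_def by auto
  then show "\<mu> \<le> lam t w" using \<mu> by (auto simp: ennreal_le_iff2)
  then show "regular \<mu> T lam t w = lam t w" using t by (simp add: regular_def)
qed

lemma regular_equation:
  assumes eq: "hawkes_equation \<mu> \<phi> T lam w" and \<mu>: "0 < \<mu>" and t: "0 < t" "t \<le> T" and w: "w \<in> configs"
    and k: "\<And>t. 0 < t \<Longrightarrow> t \<le> T \<Longrightarrow> k t = \<phi> t"
  shows "ennreal (regular \<mu> T lam t w) = ennreal \<mu> + Sint (lag k t (accept (regular \<mu> T lam))) t w"
proof -
  have "ennreal (regular \<mu> T lam t w) = ennreal \<mu> + (\<integral>\<^sup>+(s, \<theta>)\<in>{0<..<t} \<times> {0..}. ennreal (\<phi> (t - s) * of_bool (\<theta> \<le> lam s w)) \<partial>w)"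
    using eq t unfolding regular_eq(1)[OF eq \<mu> t] hawkes_equation_def by auto
  also have "(\<integral>\<^sup>+(s, \<theta>)\<in>{0<..<t} \<times> {0..}. ennreal (\<phi> (t - s) * of_bool (\<theta> \<le> lam s w)) \<partial>w) = Sint (lag k t (accept (regular \<mu> T lam))) t w"
    unfolding kint_def
  proof (rule nn_integral_cong)
    fix z assume "z \<in> space w"
    then obtain s \<theta> where z: "z = (s, \<theta>)" "0 \<le> \<theta>" using space_config[OF w] by (cases z) auto
    show "(case z of (s, \<theta>) \<Rightarrow> ennreal (\<phi> (t - s) * of_bool (\<theta> \<le> lam s w))) * indicator ({0<..<t} \<times> {0..}) z =
      ennreal (k (t - fst (fst (mark w z)))) * accept (regular \<mu> T lam) (mark w z) * indicator {0<..<t} (fst z)"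
    proof (cases "0 < s \<and> s < t")
      case True
      then show ?thesis using k[of "t - s"] regular_eq(1)[OF eq \<mu>, of s] t z by (auto simp: accept_mark indicator_def)
    qed (auto simp: z)
  qed
  finally show ?thesis .
qed

lemma (in poisson) AE_no_points:
  assumes B: "B \<in> sets half_plane" "emeasure half_plane B = 0"
  shows "AE w in P. emeasure w B = 0"
proof -
  have m: "{w \<in> space P. emeasure w B = 0} \<in> events" using emeasure_count_measurable[OF B(1)] by measurable
  have *: "\<And>k::nat. measure P {w \<in> space P. emeasure w B = of_nat k} = exp (- measure half_plane B) * measure half_plane B ^ k / fact k"
    using P B unfolding poisson_law_def by auto
  have "prob {w \<in> space P. emeasure w B = 0} = 1" using *[of 0] B by (simp add: measure_def)
  then show ?thesis using m by (simp add: prob_Collect_eq_1)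
qed

text \<open>The mark \<open>0\<close> lies below every intensity that is at least
  \<open>\<mu> > 0\<close>, so the added point is always accepted and contributes exactly
  \<open>k (t - u)\<close>.\<close>

lemma regular_shift_equation:
  assumes eq: "hawkes_equation \<mu> \<phi> T lam (add_point (u, 0) w)" and \<mu>: "0 < \<mu>" and t: "0 < t" "t \<le> T" and w: "w \<in> configs"
    and lam: "(\<lambda>(t, w). lam t w) \<in> borel_measurable (predictable_sigma T)"
    and k [measurable]: "k \<in> borel_measurable borel" and k1: "\<And>t. 0 < t \<Longrightarrow> t \<le> T \<Longrightarrow> k t = \<phi> t" and k0: "\<And>t. t \<le> 0 \<Longrightarrow> k t = 0"
    and wu: "emeasure w {(u, 0)} = 0" and u: "0 < u" and knn: "\<And>t. 0 \<le> k t"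
    and L'_def: "L' = (\<lambda>t w. if t \<le> u then regular \<mu> T lam t w else regular \<mu> T lam t (add_point (u, 0) w))"
  shows "ennreal (L' t w) = ennreal (\<mu> + k (t - u)) + Sint (lag k t (accept L')) t w"
proof -
  let ?w = "add_point (u, 0) w" and ?L = "regular \<mu> T lam"
  have T: "0 \<le> T" using t by simp
  have w': "?w \<in> configs" by (rule add_point_in_configs[OF w])
  have L': "L' s w = ?L s ?w" for s
    using predictable_add_point[OF regular_predictable[OF T lam] _ w, of s u \<mu> 0] by (auto simp: L'_def)
  let ?h = "\<lambda>x. ennreal (k (t - fst (fst x))) * accept ?L x" and ?h' = "\<lambda>x. ennreal (k (t - fst (fst x))) * accept L' x"
  have [measurable]: "(\<lambda>x. ennreal (k (t - fst (fst x)))) \<in> borel_measurable marked"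
    by (rule measurable_marked_time) simp
  have hm: "?h \<in> borel_measurable marked" using accept_measurable[OF regular_predictable[OF T lam]] by measurable
  have same: "?h (mark ?w z) = ?h' (mark w z)" for z by (simp add: accept_mark L')
  have fm: "(\<lambda>z. ?h (mark ?w z) * indicator {0<..<t} (fst z)) \<in> borel_measurable half_plane"
    using measurable_mark_comp[OF hm w'] by measurable
  have "ennreal (L' t w) = ennreal \<mu> + Sint ?h t ?w"
    unfolding L' by (rule regular_equation[OF eq \<mu> t w' k1])
  also have "Sint ?h t ?w = Sint ?h' t w + ?h (mark ?w (u, 0)) * indicator {0<..<t} u"
    unfolding kint_def same[symmetric] using wu by (intro nn_integral_add_point[OF w _ _ fm, of "(u, 0)", simplified fst_conv]) (auto simp: space_half_plane)
  also have "?h (mark ?w (u, 0)) * indicator {0<..<t} u = ennreal (k (t - u))"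
    using \<mu> u k0[of "t - u"] by (auto simp: accept_mark indicator_def regular_def max_def not_less)
  finally show ?thesis using \<mu> knn by (simp add: add_ac)
qed

section \<open>A lower bound for the sensitivity term\<close>

text \<open>The level one half keeps \<open>K A\<close> away from both \<open>0\<close> and
  \<open>1\<close>, as required by the lower and the upper renewal estimate respectively. Existence
  follows from the intermediate value theorem, since a distribution with a density has a continuous
  distribution function.\<close>

lemma exists_median:
  fixes f :: "real \<Rightarrow> real"
  assumes f [measurable]: "f \<in> borel_measurable borel" and supp: "\<And>t. t \<le> 0 \<Longrightarrow> f t = 0"
    and int: "(\<integral>\<^sup>+t. ennreal (f t) \<partial>lborel) = 1"
  shows "\<exists>A>0. (\<integral>\<^sup>+t\<in>{..A}. ennreal (f t) \<partial>lborel) = ennreal (1 / 2)"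
proof -
  let ?M = "density lborel (\<lambda>t. ennreal (f t))"
  have em: "emeasure ?M X = (\<integral>\<^sup>+t. ennreal (f t) * indicator X t \<partial>lborel)" if "X \<in> sets borel" for X
    using that by (simp add: emeasure_density)
  have "prob_space ?M"
    by (rule prob_spaceI) (use int in \<open>simp add: emeasure_density\<close>)
  then interpret real_distribution ?M
    by (intro real_distribution.intro real_distribution_axioms.intro) auto
  have cont: "isCont (cdf ?M) x" for x
  proof -
    have "AE t in lborel. t \<noteq> x" by (rule AE_lborel_singleton)
    then have "AE t in lborel. ennreal (f t) * indicator {x} t = 0" by eventually_elim (simp add: indicator_def)
    then have "emeasure ?M {x} = 0" by (subst em) (simp_all add: nn_integral_0_iff_AE)
    then show ?thesis by (simp add: isCont_cdf measure_def)
  qed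
  have "cdf ?M 0 = 0"
  proof -
    have "ennreal (f t) * indicator {..0} t = 0" for t using supp[of t] by (cases "t \<le> 0") auto
    then have "emeasure ?M {..0} = 0" by (subst em) (auto intro: nn_integral_eq_0I)
    then show ?thesis by (simp add: cdf_def measure_def)
  qed
  moreover have "\<exists>b>0. 1 / 2 \<le> cdf ?M b"
  proof -
    have "eventually (\<lambda>b. 1 / 2 < cdf ?M b) at_top"
      using cdf_lim_at_top_prob by (rule order_tendstoD) simp
    with eventually_gt_at_top[of 0] have "eventually (\<lambda>b. 0 < b \<and> 1 / 2 < cdf ?M b) at_top" by eventually_elim simp
    then show ?thesis by (auto simp: eventually_at_top_linorder intro: less_imp_le)
  qed
  ultimately obtain A where A: "0 \<le> A" "cdf ?M A = 1 / 2"
    using IVT[of "cdf ?M" 0 "1 / 2"] cont by (metis less_imp_le zero_le_divide_1_iff zero_le_numeral)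
  with \<open>cdf ?M 0 = 0\<close> have "0 < A" by (cases "A = 0") auto
  moreover have "(\<integral>\<^sup>+t\<in>{..A}. ennreal (f t) \<partial>lborel) = ennreal (1 / 2)"
  proof -
    have "ennreal (cdf ?M A) = (\<integral>\<^sup>+t\<in>{..A}. ennreal (f t) \<partial>lborel)"
      using em[of "{..A}"] by (simp add: cdf_def emeasure_eq_measure)
    then show ?thesis by (simp only: A(2))
  qed
  ultimately show ?thesis by blast
qed

locale scaled_kernel =
  fixes f :: "real \<Rightarrow> real" and B T :: real
  assumes f_meas [measurable]: "f \<in> borel_measurable borel" and f_nn: "\<And>t. 0 \<le> f t" and f_supp: "\<And>t. t \<le> 0 \<Longrightarrow> f t = 0"
    and f_int: "(\<integral>\<^sup>+t. ennreal (f t) \<partial>lborel) = 1" and f_le: "\<And>t. t \<le> T \<Longrightarrow> f t \<le> B" and T1: "1 < T"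
begin

text \<open>\<open>1 - 1 / T\<close> is \<open>a T\<close>. The cut at \<open>T\<close> turns local
  boundedness into a global bound, and the equation on \<open>{0..T}\<close> involves no larger
  delays.\<close>

definition k :: "real \<Rightarrow> real" where "k t = (if t \<le> T then (1 - 1 / T) * f t else 0)"

lemma a_bounds: "0 \<le> 1 - 1 / T" "1 - 1 / T < 1" using T1 by (auto simp: field_simps)

lemma k_le_f: "k t \<le> f t" using a_bounds f_nn[of t] by (auto simp: k_def intro: mult_left_le_one_le)

sublocale subcritical_kernel k "1 - 1 / T" B
proof
  show "k \<in> borel_measurable borel" unfolding k_def[abs_def] by measurable
  show "0 \<le> k t" for t using a_bounds f_nn by (simp add: k_def)
  show "k t \<le> B" for t
  proof (cases "t \<le> T")
    case True
    then show ?thesis using k_le_f[of t] f_le[of t] by linarith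
  next
    case False
    have "0 \<le> B" using f_nn[of 0] f_le[of 0] T1 by linarith
    then show ?thesis using False by (simp add: k_def)
  qed
  show "t \<le> 0 \<Longrightarrow> k t = 0" for t using f_supp by (simp add: k_def)
  have "(\<integral>\<^sup>+t. ennreal (k t) \<partial>lborel) \<le> (\<integral>\<^sup>+t. ennreal (1 - 1 / T) * ennreal (f t) \<partial>lborel)"
    using a_bounds f_nn by (intro nn_integral_mono) (auto simp: k_def ennreal_mult[symmetric] simp del: ennreal_mult')
  also have "\<dots> = ennreal (1 - 1 / T)" by (simp add: nn_integral_cmult f_int)
  finally show "(\<integral>\<^sup>+t. ennreal (k t) \<partial>lborel) \<le> ennreal (1 - 1 / T)" .
qed (use a_bounds in auto)

lemma ennreal_K_f: "v \<le> T \<Longrightarrow> ennreal (K v) = ennreal (1 - 1 / T) * (\<integral>\<^sup>+t\<in>{..v}. ennreal (f t) \<partial>lborel)"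
  unfolding ennreal_K using a_bounds f_nn
  by (subst nn_integral_cmult[symmetric], measurable)
     (auto intro!: nn_integral_cong simp: k_def ennreal_mult indicator_def simp del: ennreal_mult')

end

text \<open>\<open>A\<close> and \<open>\<beta>\<close> depend on \<open>f\<close> alone and are
  fixed before \<open>T\<close>. \<open>2 \<le> T\<close> keeps \<open>K A\<close> above one
  quarter; \<open>16 * A \<le> T\<close> makes the mass estimates available from the horizon
  \<open>T / 4\<close> on.\<close>

locale nearly_unstable_kernel = scaled_kernel f B T for f B T +
  fixes m A \<beta> :: real
  assumes f_moment: "(\<integral>\<^sup>+t. ennreal (t * f t) \<partial>lborel) \<le> ennreal m" and m: "0 \<le> m"
    and A: "0 < A" and f_half: "(\<integral>\<^sup>+t\<in>{..A}. ennreal (f t) \<partial>lborel) = ennreal (1 / 2)"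
    and \<beta>: "0 < \<beta>" "\<And>t. t \<le> A \<Longrightarrow> f t \<le> \<beta>" and T2: "2 \<le> T" and TA: "16 * A \<le> T"
begin

lemma K_A: "1 / 4 \<le> K A" "K A \<le> 1 / 2"
proof -
  have "ennreal (K A) = ennreal ((1 - 1 / T) * (1 / 2))"
    using ennreal_K_f[of A] TA A a_bounds unfolding f_half by (subst ennreal_mult) auto
  then have "K A = (1 - 1 / T) * (1 / 2)" using a_bounds by (subst (asm) ennreal_inj) (auto simp: K_nonneg)
  moreover have "1 / 2 \<le> 1 - 1 / T" using T2 by (simp add: field_simps)
  ultimately have "1 / 4 \<le> K A \<and> K A \<le> 1 / 2" using a_bounds by argo
  then show "1 / 4 \<le> K A" "K A \<le> 1 / 2" by auto
qed

text \<open>\<open>rho_kt_le\<close> with \<open>\<delta> = 1 / 2\<close>; neither \<open>B\<close>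
  nor \<open>T\<close> appears in the bound.\<close>

lemma rho_bounded: "rho (kt A) v \<le> 3 * \<beta>"
proof -
  have "rho (kt A) v \<le> \<beta> * (1 + 1 / (1 / 2))"
    using K_A k_le_f \<beta> by (intro rho_kt_le) (auto simp: kt_def intro: order_trans)
  then show ?thesis by simp
qed

text \<open>\<open>1 - K v\<close> is the tail of \<open>f\<close> beyond \<open>v\<close> plus at
  most \<open>1 / T\<close> from the factor \<open>1 - 1 / T\<close>. The tails integrate to the
  first moment, the remainder over \<open>{0..S}\<close> to at most one.\<close>

lemma tail_integral:
  assumes S: "0 \<le> S" "S \<le> T"
  shows "(\<integral>\<^sup>+v\<in>{0..S}. ennreal (1 - K v) \<partial>lborel) \<le> ennreal (m + 1)"
proof -
  let ?tail = "\<lambda>v. \<integral>\<^sup>+t\<in>{v<..}. ennreal (f t) \<partial>lborel"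
  have "(\<lambda>v. \<integral>\<^sup>+t. (case (v, t) of (v, t) \<Rightarrow> ennreal (f t) * indicator {p. fst p < snd p} (v, t)) \<partial>lborel) \<in> borel_measurable lborel"
    by (rule lborel.borel_measurable_nn_integral) measurable
  then have tail [measurable]: "?tail \<in> borel_measurable borel"
    by (simp add: indicator_def cong: if_cong)
  have le: "ennreal (1 - K v) \<le> ennreal (1 / T) + ?tail v" if v: "0 \<le> v" "v \<le> T" for v
  proof -
    let ?F = "\<integral>\<^sup>+t\<in>{..v}. ennreal (f t) \<partial>lborel"
    have split: "?F + ?tail v = 1"
      unfolding f_int[symmetric] by (subst nn_integral_add[symmetric]) (auto intro!: nn_integral_cong simp: indicator_def)
    then have "?F \<le> 1" "?tail v \<le> 1" by (metis add_increasing2 order_refl zero_le, metis add_increasing order_refl zero_le)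
    then obtain x y where xy: "?F = ennreal x" "0 \<le> x" "?tail v = ennreal y" "0 \<le> y" by (cases ?F; cases "?tail v") (auto simp: top_unique)
    have "x + y = 1" using split xy by (simp add: ennreal_plus[symmetric] del: ennreal_plus)
    have "ennreal (K v) = ennreal ((1 - 1 / T) * x)" using ennreal_K_f[of v] v xy a_bounds by (simp add: ennreal_mult)
    then have K: "K v = (1 - 1 / T) * x" using xy a_bounds by (subst (asm) ennreal_inj) (auto simp: K_nonneg)
    have "1 - K v = y + x / T" using \<open>x + y = 1\<close> by (simp add: K algebra_simps)
    also have "\<dots> \<le> y + 1 / T" using \<open>x + y = 1\<close> xy T2 by (intro add_left_mono divide_right_mono) auto
    finally show ?thesis using xy T2 by (simp add: ennreal_plus[symmetric] ennreal_leI add.commute del: ennreal_plus)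
  qed
  have "(\<integral>\<^sup>+v\<in>{0..S}. ennreal (1 - K v) \<partial>lborel) \<le> (\<integral>\<^sup>+v. ennreal (1 / T) * indicator {0..S} v + ?tail v * indicator {0..} v \<partial>lborel)"
    using le S by (intro nn_integral_mono) (auto simp: indicator_def)
  also have "\<dots> = ennreal (1 / T) * ennreal S + (\<integral>\<^sup>+v\<in>{0..}. ?tail v \<partial>lborel)"
    using S by (subst nn_integral_add) (auto simp: nn_integral_cmult_indicator)
  also have "(\<integral>\<^sup>+v\<in>{0..}. ?tail v \<partial>lborel) = (\<integral>\<^sup>+v. (\<integral>\<^sup>+t. ennreal (f t) * (indicator {0..} v * indicator {v<..} t) \<partial>lborel) \<partial>lborel)"
    by (subst nn_integral_multc[symmetric]) (auto intro!: nn_integral_cong simp: mult_ac)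
  also have "\<dots> = (\<integral>\<^sup>+t. (\<integral>\<^sup>+v. ennreal (f t) * (indicator {0..} v * indicator {v<..} t) \<partial>lborel) \<partial>lborel)"
    by (rule lborel_pair.Fubini') (simp add: indicator_def)
  also have "\<dots> = (\<integral>\<^sup>+t. ennreal (t * f t) \<partial>lborel)"
  proof (rule nn_integral_cong)
    fix t
    have "(\<integral>\<^sup>+v. ennreal (f t) * (indicator {0..} v * indicator {v<..} t) \<partial>lborel) = (\<integral>\<^sup>+v\<in>{0..<t}. ennreal (f t) \<partial>lborel)"
      by (intro nn_integral_cong) (auto simp: indicator_def)
    also have "\<dots> = ennreal (t * f t)"
      using f_supp[of t] f_nn[of t] by (cases "0 \<le> t") (auto simp: nn_integral_cmult_indicator ennreal_mult mult.commute)
    finally show "(\<integral>\<^sup>+v. ennreal (f t) * (indicator {0..} v * indicator {v<..} t) \<partial>lborel) = ennreal (t * f t)" .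
  qed
  also have "ennreal (1 / T) * ennreal S + \<dots> \<le> ennreal 1 + ennreal m"
    using S T2 f_moment by (intro add_mono) (auto simp: ennreal_mult[symmetric] simp del: ennreal_mult')
  also have "\<dots> = ennreal (m + 1)" using m by (subst ennreal_plus[symmetric]) (auto simp: add.commute)
  finally show ?thesis .
qed

lemma rho_mass_lower:
  assumes S: "4 * A \<le> S" "S \<le> T"
  shows "ennreal (S / (32 * (m + 1))) \<le> (\<integral>\<^sup>+v\<in>{..S}. ennreal (rho (kt A) v) \<partial>lborel)"
proof -
  \<comment> \<open>\<open>32 = 2 * 4 * 4\<close>: removing \<open>2 * A\<close> leaves at least
    half of \<open>S\<close>, and \<open>K A\<close> is at least one quarter.\<close>
  have "S / (32 * (m + 1)) = (S / 2) * (1 / 4)\<^sup>2 / (m + 1)" by (simp add: power2_eq_square field_simps)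
  also have "\<dots> \<le> (S - 2 * A) * (K A)\<^sup>2 / (m + 1)"
    using S A K_A m by (intro divide_right_mono mult_mono power_mono) auto
  finally have "ennreal (S / (32 * (m + 1))) \<le> ennreal ((S - 2 * A) * (K A)\<^sup>2 / (m + 1))" by (rule ennreal_leI)
  also have "\<dots> \<le> (\<integral>\<^sup>+v\<in>{..S}. ennreal (rho (kt A) v) \<partial>lborel)"
    using S A m tail_integral[of S] by (intro rho_kt_lower) auto
  finally show ?thesis .
qed

end

locale scaled_hawkes = scaled_kernel f B T + poisson P
  for f B T P +
  fixes \<mu> :: real and \<phi> :: "real \<Rightarrow> real" and lam :: "real \<Rightarrow> config \<Rightarrow> real"
  assumes mu: "0 < \<mu>" and f_phi: "\<And>t. 0 < t \<Longrightarrow> f t = \<phi> t"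
    and lam: "hawkes_intensity P \<mu> (\<lambda>t. (1 - 1 / T) * \<phi> t) T lam"
begin

abbreviation "L \<equiv> regular \<mu> T lam"

lemma lam_meas: "(\<lambda>(t, w). lam t w) \<in> borel_measurable (predictable_sigma T)"
  and lam_eq: "AE w in P. hawkes_equation \<mu> (\<lambda>t. (1 - 1 / T) * \<phi> t) T lam w"
  and lam_shift_eq: "u \<in> {0..T} \<Longrightarrow> AE w in P. hawkes_equation \<mu> (\<lambda>t. (1 - 1 / T) * \<phi> t) T lam (add_point (u, 0) w)"
  using lam unfolding hawkes_intensity_def by auto

lemma k_phi: "0 < t \<Longrightarrow> t \<le> T \<Longrightarrow> k t = (1 - 1 / T) * \<phi> t"
  using f_phi by (simp add: k_def)

lemma T_pos: "0 < T" using T1 by simp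

lemma regular_ge: "\<mu> \<le> L t w" by (simp add: regular_def)

sublocale hawkes P T "1 - 1 / T" B \<mu> k "\<lambda>_. \<mu>" L
proof
  show "0 < T" "0 \<le> 1 - 1 / T" "1 - 1 / T < 1" "0 \<le> B" "0 \<le> \<mu>" using T1 a_bounds B_nonneg mu by auto
  show "k \<in> borel_measurable borel" "\<And>t. 0 \<le> k t" "\<And>t. k t \<le> B" "\<And>t. t \<le> 0 \<Longrightarrow> k t = 0" "(\<integral>\<^sup>+t. ennreal (k t) \<partial>lborel) \<le> ennreal (1 - 1 / T)"
    using k_measurable k_nn k_bd k_supp k_mass by auto
  show "(\<lambda>p. L (fst p) (snd p)) \<in> borel_measurable predictable" using lam_meas T1 by (intro regular_predictable) auto
  show "0 \<le> L t w" for t w using regular_ge[of t w] mu by linarith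
  show "AE w in P. \<forall>t\<in>{0<..T}. ennreal (L t w) = ennreal \<mu> + Sint (lag k t (accept L)) t w"
    using lam_eq AE_space
  proof eventually_elim
    case (elim w)
    then show ?case using regular_equation[OF elim(1) mu, of _ k] k_phi by (auto simp: space_P)
  qed
qed (use mu in auto)

text \<open>The case distinction makes agreement with \<open>L\<close> up to \<open>u\<close> hold
  for every \<open>w\<close> by definition, and it is the form in which the shifted intensity is
  known to be predictable.\<close>

definition Lp :: "real \<Rightarrow> real \<Rightarrow> config \<Rightarrow> real" where
  "Lp u t w = (if t \<le> u then L t w else L t (add_point (u, 0) w))"

lemma Lp_predictable:
  assumes "0 \<le> u" shows "(\<lambda>p. Lp u (fst p) (snd p)) \<in> borel_measurable predictable"
  using measurable_shift_predictable[OF L_pred assms, of 0] unfolding Lp_def fst_conv snd_conv .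

lemma Lp_eq:
  assumes u: "0 < u" "u < T"
  shows "AE w in P. \<forall>t\<in>{0<..T}. ennreal (Lp u t w) = ennreal (\<mu> + k (t - u)) + Sint (lag k t (accept (Lp u))) t w"
proof -
  have s: "{(u, 0)} \<in> sets half_plane" by (auto simp: sets_half_plane_iff)
  have "emeasure half_plane {(u, 0)} = 0" unfolding emeasure_half_plane[OF s] by simp
  from AE_no_points[OF s this] have no: "AE w in P. emeasure w {(u, 0)} = 0" .
  have "AE w in P. hawkes_equation \<mu> (\<lambda>t. (1 - 1 / T) * \<phi> t) T lam (add_point (u, 0) w)"
    using u by (intro lam_shift_eq) auto
  then show ?thesis using no AE_space
  proof eventually_elim
    case (elim w)
    show ?case
    proof
      fix t assume "t \<in> {0<..T}"
      then show "ennreal (Lp u t w) = ennreal (\<mu> + k (t - u)) + Sint (lag k t (accept (Lp u))) t w"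
        using u k_phi k_supp k_nn elim
        by (intro regular_shift_equation[OF elim(1) mu _ _ _ lam_meas, where k = k and L' = "Lp u"]) (auto simp: space_P Lp_def fun_eq_iff)
    qed
  qed
qed

lemma Lp_pair:
  assumes u: "0 < u" "u < T"
  shows "hawkes_pair P T (1 - 1 / T) B \<mu> k (\<lambda>_. \<mu>) L (\<mu> + B) (\<lambda>t. \<mu> + k (t - u)) (Lp u) u"
proof -
  interpret L': hawkes P T "1 - 1 / T" B "\<mu> + B" k "\<lambda>t. \<mu> + k (t - u)" "Lp u"
  proof
    show "(\<lambda>p. Lp u (fst p) (snd p)) \<in> borel_measurable predictable" using u by (intro Lp_predictable) simp
    show "0 \<le> Lp u t w" for t w using L_nonneg by (simp add: Lp_def)
    show "AE w in P. \<forall>t\<in>{0<..T}. ennreal (Lp u t w) = ennreal (\<mu> + k (t - u)) + Sint (lag k t (accept (Lp u))) t w"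
      by (rule Lp_eq[OF u])
  qed (use T1 a_bounds B_nonneg mu k_nn k_bd k_supp k_mass in \<open>auto intro: add_nonneg_nonneg\<close>)
  show ?thesis by unfold_locales (use u in \<open>auto simp: Lp_def\<close>)
qed

end

section \<open>Explicit constants for large \<open>T\<close>\<close>

locale nearly_unstable = nearly_unstable_kernel f B T m A \<beta> + scaled_hawkes f B T P \<mu> \<phi> lam
  for f B T m A \<beta> P \<mu> \<phi> lam
begin

text \<open>Lower bound, in units of \<open>T\<close>, for the mean of the truncated functional at
  times from \<open>T / 4\<close> on; \<open>128 = 4 * 32\<close> with the constant of
  \<open>rho_mass_lower\<close>.\<close>

definition mean_const :: real where "mean_const = \<mu> / (128 * (m + 1))"

text \<open>The minimum is the parameter \<open>e\<close> of \<open>sqrt_min_lower\<close>, small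
  enough for the quadratic term to take at most half of the linear one. The bracket in its
  denominator bounds the second moment of the truncated functional in units of
  \<open>T\<^sup>2\<close>.\<close>

definition root_const :: real where
  "root_const = min 1 (mean_const / (2 * ((3 * \<beta>)\<^sup>2 * \<mu>\<^sup>2 + (3 * \<beta>)\<^sup>2 * \<mu>))) * mean_const / 2"

lemma const_pos: "0 < mean_const" "0 < root_const"
proof -
  have "0 < m + 1" using m by simp
  then show 1: "0 < mean_const" using mu unfolding mean_const_def by (intro divide_pos_pos mult_pos_pos) auto
  have "0 < (3 * \<beta>)\<^sup>2 * \<mu>\<^sup>2 + (3 * \<beta>)\<^sup>2 * \<mu>" using mu \<beta> by (intro add_pos_pos mult_pos_pos) auto
  then show "0 < root_const" using 1 by (simp add: root_const_def)
qed

lemma kt_bounds: "kt A \<in> borel_measurable borel" "\<And>t. 0 \<le> kt A t" "\<And>t. kt A t \<le> B" "\<And>t. t \<le> 0 \<Longrightarrow> kt A t = 0" "\<And>t. kt A t \<le> k t"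
  using kt_facts by auto

lemma root_expectation_lower:
  assumes u: "T / 4 \<le> u" "u \<le> T / 2"
  shows "sqrt T * root_const \<le> (\<integral>w. min (sqrt (L u w)) (sqrt T) \<partial>P)"
proof -
  note kt = kt_bounds(1-4)
  define mm where "mm = enn2real (\<integral>\<^sup>+v\<in>{0<..<u}. ennreal (rho (kt A) (u - v)) * ennreal \<mu> \<partial>lborel)"
  have u0: "0 < u" "u \<le> T" using u T2 by auto
  have C: "0 \<le> 3 * \<beta>" using \<beta> by simp
  have [measurable]: "rho (kt A) \<in> borel_measurable borel" by (rule rho_measurable[OF kt])
  let ?I = "\<integral>\<^sup>+v\<in>{0<..<u}. ennreal (rho (kt A) (u - v)) * ennreal \<mu> \<partial>lborel"
  have "?I \<le> (\<integral>\<^sup>+v\<in>{0<..<u}. ennreal (3 * \<beta> * \<mu>) \<partial>lborel)"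
  proof (intro nn_integral_mono mult_right_mono)
    fix v
    have "rho (kt A) (u - v) * \<mu> \<le> 3 * \<beta> * \<mu>" using rho_bounded mu by (intro mult_right_mono) auto
    then show "ennreal (rho (kt A) (u - v)) * ennreal \<mu> \<le> ennreal (3 * \<beta> * \<mu>)"
      using rho_nonneg[OF kt] mu by (subst ennreal_mult[symmetric]) (auto intro: ennreal_leI)
  qed simp
  also have "\<dots> = ennreal (3 * \<beta> * \<mu> * u)" using u0 mu \<beta> by (subst nn_integral_cmult_indicator) (auto simp: ennreal_mult)
  finally have up: "?I \<le> ennreal (3 * \<beta> * \<mu> * u)" .
  then have fin: "?I < top" by (rule le_less_trans) simp
  have "mm \<le> 3 * \<beta> * \<mu> * u" unfolding mm_def using up mu \<beta> u0 by (intro enn2real_leI) auto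
  also have "\<dots> \<le> 3 * \<beta> * \<mu> * T" using mu \<beta> u0 by (intro mult_left_mono) auto
  finally have mm_le: "mm \<le> 3 * \<beta> * \<mu> * T" .
  have "ennreal (mean_const * T) \<le> ennreal \<mu> * ennreal (u / (32 * (m + 1)))"
  proof -
    have "mean_const * T \<le> \<mu> * (u / (32 * (m + 1)))"
    proof -
      have "T / 4 * (\<mu> / (32 * (m + 1))) \<le> u * (\<mu> / (32 * (m + 1)))" using u mu m by (intro mult_right_mono) auto
      then show ?thesis by (simp add: mean_const_def mult.commute)
    qed
    then show ?thesis using mu u0 m by (subst ennreal_mult[symmetric]) (auto intro: ennreal_leI)
  qed
  \<comment> \<open>The horizon is admissible, since \<open>16 * A \<le> T\<close> gives
    \<open>4 * A \<le> T / 4 \<le> u\<close>.\<close>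
  also have "\<dots> \<le> ennreal \<mu> * (\<integral>\<^sup>+v\<in>{..u}. ennreal (rho (kt A) v) \<partial>lborel)"
    using u u0 TA A by (intro mult_left_mono rho_mass_lower) auto
  also have "\<dots> = (\<integral>\<^sup>+v. ennreal \<mu> * (ennreal (rho (kt A) v) * indicator {..u} v) \<partial>lborel)"
    by (rule nn_integral_cmult[symmetric]) measurable
  also have "\<dots> = (\<integral>\<^sup>+v. ennreal \<mu> * (ennreal (rho (kt A) (u - v)) * indicator {..u} (u - v)) \<partial>lborel)"
    by (rule nn_integral_lborel_reflect[symmetric]) measurable
  also have "\<dots> = ?I"
  proof (rule nn_integral_cong_AE)
    have "AE v in lborel. v \<noteq> (0 :: real)" by (rule AE_lborel_singleton)
    then show "AE v in lborel. ennreal \<mu> * (ennreal (rho (kt A) (u - v)) * indicator {..u} (u - v)) = ennreal (rho (kt A) (u - v)) * ennreal \<mu> * indicator {0<..<u} v"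
    proof eventually_elim
      case (elim v)
      then show ?case using rho_supp[OF kt, of "u - v"] by (cases "u \<le> v") (auto simp: indicator_def mult.commute)
    qed
  qed
  also have "\<dots> = ennreal mm" using fin by (simp add: mm_def)
  finally have mm_ge: "mean_const * T \<le> mm" by (subst (asm) ennreal_le_iff) (auto simp: mm_def)
  define G where "G = (3 * \<beta>)\<^sup>2 * \<mu>\<^sup>2 + (3 * \<beta>)\<^sup>2 * \<mu>"
  define e where "e = min 1 (mean_const / (2 * G))"
  have G: "0 < G" using mu \<beta> by (auto simp: G_def intro!: add_pos_pos)
  have e: "0 < e" "e \<le> 1" "e * G \<le> mean_const / 2"
    using const_pos G by (auto simp: e_def min_def field_simps)
  have root: "root_const = e * mean_const / 2" by (simp add: root_const_def e_def G_def)
  have "e * mm - e\<^sup>2 * (mm\<^sup>2 + (3 * \<beta>)\<^sup>2 * (\<mu> / (1 - (1 - 1 / T))) * T) / (4 * T) \<le> sqrt T * (\<integral>w. min (sqrt (L u w)) (sqrt T) \<partial>P)"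
    unfolding mm_def using u0 e T_pos rho_bounded by (intro expect_sqrt_min_lower[OF kt_bounds]) auto
  moreover have "\<mu> / (1 - (1 - 1 / T)) = \<mu> * T" using T_pos by simp
  ultimately have "e * mm - e\<^sup>2 * (mm\<^sup>2 + (3 * \<beta>)\<^sup>2 * (\<mu> * T) * T) / (4 * T) \<le> sqrt T * (\<integral>w. min (sqrt (L u w)) (sqrt T) \<partial>P)"
    by (simp only:)
  moreover have "e\<^sup>2 * (mm\<^sup>2 + (3 * \<beta>)\<^sup>2 * (\<mu> * T) * T) / (4 * T) \<le> e * mean_const * T / 2"
  proof -
    have "mm\<^sup>2 \<le> (3 * \<beta> * \<mu> * T)\<^sup>2" using mm_le by (intro power_mono) (auto simp: mm_def)
    then have "mm\<^sup>2 + (3 * \<beta>)\<^sup>2 * (\<mu> * T) * T \<le> G * T\<^sup>2" by (simp add: G_def power2_eq_square algebra_simps)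
    then have "e\<^sup>2 * (mm\<^sup>2 + (3 * \<beta>)\<^sup>2 * (\<mu> * T) * T) / (4 * T) \<le> e\<^sup>2 * (G * T\<^sup>2) / (4 * T)"
      using T_pos by (intro divide_right_mono mult_left_mono) auto
    also have "\<dots> = e * (e * G) * T / 4" using T_pos by (simp add: power2_eq_square field_simps)
    also have "\<dots> \<le> e * (mean_const / 2) * T / 4" using e T_pos by (intro divide_right_mono mult_right_mono mult_left_mono) auto
    also have "\<dots> \<le> e * mean_const * T / 2" using e T_pos const_pos by simp
    finally show ?thesis .
  qed
  moreover have T_root: "T * root_const = e * mean_const * T / 2" by (simp add: root)
  moreover have "e * mean_const * T \<le> e * mm" using mm_ge e by (simp add: mult.assoc)
  ultimately have "T * root_const \<le> sqrt T * (\<integral>w. min (sqrt (L u w)) (sqrt T) \<partial>P)"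
    using T_root by linarith
  then have "sqrt T * (sqrt T * root_const) \<le> sqrt T * (\<integral>w. min (sqrt (L u w)) (sqrt T) \<partial>P)"
    using T_pos by (simp add: mult.assoc[symmetric])
  then show ?thesis using T_pos by simp
qed

text \<open>The quotient of the surviving half \<open>g * T * sqrt T / 2\<close> of the main term by
  \<open>\<eta>\<close>, in units of \<open>sqrt T\<close>; the squared bracket is \<open>g\<close>
  of the following proof.\<close>

definition ratio_const :: real where
  "ratio_const = (root_const / (32 * (m + 1)))\<^sup>2 / (4 * (3 * \<beta>) * (\<mu> + 1))"

lemma ratio_const_pos: "0 < ratio_const"
proof -
  have "0 < m + 1" using m by simp
  then show ?thesis using const_pos \<beta> mu unfolding ratio_const_def by (intro divide_pos_pos mult_pos_pos zero_less_power) auto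
qed

lemma expected_ratio_lower:
  assumes uT: "T / 4 \<le> u" "u \<le> T / 2"
  shows "ennreal (ratio_const * sqrt T) \<le> (\<integral>\<^sup>+s\<in>{u..T}. (\<integral>\<^sup>+w. ennreal (min (sqrt (L u w)) (sqrt T) * (1 - L s w / Lp u s w)) \<partial>P) \<partial>lborel)"
    (is "_ \<le> ?J")
proof -
  \<comment> \<open>The cap \<open>sqrt T\<close> has the typical size of \<open>sqrt (L u)\<close>,
    so capping does not lower the order of the expectation.\<close>
  define W where "W w = min (sqrt (L u w)) (sqrt T)" for w
  have u0: "0 < u" "u < T" using uT T2 by auto
  interpret hawkes_pair P T "1 - 1 / T" B \<mu> k "\<lambda>_. \<mu>" L "\<mu> + B" "\<lambda>t. \<mu> + k (t - u)" "Lp u" u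
    by (rule Lp_pair[OF u0])
  interpret weighted_pair P T "1 - 1 / T" B \<mu> k "\<lambda>_. \<mu>" L "\<mu> + B" "\<lambda>t. \<mu> + k (t - u)" "Lp u" u W "sqrt T"
  proof
    have [measurable]: "(\<lambda>w. L u w) \<in> borel_measurable (past u)"
      using measurable_compose[OF measurable_const_time_past[of u] L_pred] u0 by simp
    show "W \<in> borel_measurable (past u)" unfolding W_def[abs_def] by measurable
    show "0 \<le> W w" for w using L_nonneg[of u w] T_pos by (simp add: W_def)
    show "W w \<le> sqrt T" for w by (simp add: W_def)
  qed
  define g where "g = root_const / (32 * (m + 1))"
  define C where "C = 3 * \<beta>"
  \<comment> \<open>Of the order of the intensity, with the constant chosen so that the error term
    of \<open>ratio_integral_lower\<close> is at most half of the main term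
    \<open>g * T * sqrt T\<close>.\<close>
  define \<eta> where "\<eta> = 2 * C * (\<mu> + 1) / g * T"
  have g: "0 < g" using const_pos m by (simp add: g_def)
  have C: "0 < C" using \<beta> by (simp add: C_def)
  have \<eta>: "0 < \<eta>" using g C mu T_pos by (simp add: \<eta>_def)
  have rC: "rho (kt A) t \<le> C" for t unfolding C_def by (rule rho_bounded)
  have alg: "C * sqrt T / (2 * C * M / g * T) * (M * T\<^sup>2) = g * T * sqrt T / 2"
    "g * T * sqrt T / 2 / (2 * C * M / g * T) = g\<^sup>2 / (4 * C * M) * sqrt T" if "0 < M" for M :: real
    using that C g T_pos by (simp_all add: power2_eq_square field_simps)
  have J: "?J = (\<integral>\<^sup>+s\<in>{u..T}. (\<integral>\<^sup>+w. ennreal (W w * (1 - L s w / Lp u s w)) \<partial>P) \<partial>lborel)" by (simp add: W_def)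
  have q: "1 - (1 - 1 / T) = 1 / T" "(1 - 1 / T) / (1 / T) = T - 1" using T_pos by (auto simp: field_simps)
  have "ennreal (g * T * sqrt T) \<le> ennreal (2 * (\<integral>w. W w \<partial>P)) * ennreal ((T - u) / (32 * (m + 1)))"
  proof -
    have "g * T * sqrt T = (2 * (sqrt T * root_const)) * ((T / 2) / (32 * (m + 1)))" using m by (simp add: g_def field_simps)
    also have "\<dots> \<le> (2 * (\<integral>w. W w \<partial>P)) * ((T - u) / (32 * (m + 1)))"
      using root_expectation_lower[OF uT] EW(1) uT m T_pos const_pos unfolding W_def
      by (intro mult_mono mult_left_mono divide_right_mono) auto
    finally show ?thesis using EW(1) u0 m by (subst ennreal_mult[symmetric]) (auto intro: ennreal_leI)
  qed
  also have "\<dots> \<le> ennreal (2 * (\<integral>w. W w \<partial>P)) * (\<integral>\<^sup>+v\<in>{..T - u}. ennreal (rho (kt A) v) \<partial>lborel)"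
    using uT u0 TA A by (intro mult_left_mono rho_mass_lower) auto
  also have "\<dots> \<le> ennreal \<eta> * ?J + ennreal (C * sqrt T / \<eta> * (\<mu> / (1 - (1 - 1 / T)) * T + (1 - 1 / T) / (1 - (1 - 1 / T)) + ((1 - 1 / T) / (1 - (1 - 1 / T)))\<^sup>2))"
    unfolding J by (rule ratio_integral_lower[OF kt_bounds rC \<eta>])
  also have "\<dots> \<le> ennreal \<eta> * ?J + ennreal (g * T * sqrt T / 2)"
  proof (intro add_left_mono ennreal_leI)
    have "\<mu> / (1 / T) * T + (T - 1) + (T - 1)\<^sup>2 \<le> (\<mu> + 1) * T\<^sup>2"
      using T2 by (simp add: power2_eq_square algebra_simps)
    then have "C * sqrt T / \<eta> * (\<mu> / (1 / T) * T + (T - 1) + (T - 1)\<^sup>2) \<le> C * sqrt T / \<eta> * ((\<mu> + 1) * T\<^sup>2)"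
      using C \<eta> T_pos by (intro mult_left_mono) auto
    also have "\<dots> = g * T * sqrt T / 2" using alg(1)[of "\<mu> + 1"] mu by (simp add: \<eta>_def)
    finally show "C * sqrt T / \<eta> * (\<mu> / (1 - (1 - 1 / T)) * T + (1 - 1 / T) / (1 - (1 - 1 / T)) + ((1 - 1 / T) / (1 - (1 - 1 / T)))\<^sup>2) \<le> g * T * sqrt T / 2"
      unfolding q .
  qed
  finally have main: "ennreal (g * T * sqrt T) \<le> ennreal \<eta> * ?J + ennreal (g * T * sqrt T / 2)" .
  show ?thesis
  proof (cases "?J")
    case (real j)
    have "ennreal (g * T * sqrt T) \<le> ennreal (\<eta> * j + g * T * sqrt T / 2)"
      using main real \<eta> g T_pos by (simp add: ennreal_mult[symmetric] ennreal_plus[symmetric] del: ennreal_plus ennreal_mult')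
    then have "g * T * sqrt T \<le> \<eta> * j + g * T * sqrt T / 2"
      using real \<eta> g T_pos by (subst (asm) ennreal_le_iff) auto
    then have "g * T * sqrt T / 2 / \<eta> \<le> j" using \<eta> by (simp add: field_simps)
    moreover have "g * T * sqrt T / 2 / \<eta> = ratio_const * sqrt T"
      using alg(2)[of "\<mu> + 1"] mu unfolding \<eta>_def ratio_const_def g_def[symmetric] C_def[symmetric] by simp
    ultimately show ?thesis using real by (simp add: ennreal_leI)
  qed simp
qed

end

section \<open>From relative increments to roots of conditional expectations\<close>

lemma add_point_measurable_config:
  assumes z: "z \<in> space half_plane"
  shows "add_point z \<in> measurable config_space config_space"
proof -
  have "(\<lambda>w. add_point z w) \<in> measurable config_space (sigma configs {{w \<in> configs. emeasure w B \<in> E} |B E. B \<in> sets half_plane \<and> E \<in> sets borel})"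
  proof (rule measurable_measure_of, goal_cases)
    case 2 then show ?case by (auto simp: space_config_space add_point_in_configs)
  next
    case (3 Y)
    then obtain B E where Y: "Y = {w \<in> configs. emeasure w B \<in> E}" and B: "B \<in> sets half_plane" and E: "E \<in> sets borel" by blast
    have "B - {z} \<in> sets half_plane" using B by (auto simp: sets_half_plane_iff)
    from measurable_emeasure_config[OF this]
    have [measurable]: "(\<lambda>w. emeasure w (B - {z})) \<in> borel_measurable config_space" .
    have "(\<lambda>w. emeasure w (B - {z}) + indicator B z) -` E \<inter> space config_space \<in> sets config_space"
      by (rule measurable_sets[OF _ E]) measurable
    moreover have "(\<lambda>w. add_point z w) -` Y \<inter> space config_space = (\<lambda>w. emeasure w (B - {z}) + indicator B z) -` E \<inter> space config_space"
      using emeasure_add_point[OF _ B, of _ z] by (auto simp: Y space_config_space add_point_in_configs simp del: split_paired_All)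
    ultimately show ?case by simp
  qed auto
  then show ?thesis by (simp add: config_space_def)
qed

text \<open>Cauchy-Schwarz, from \<open>\<integral> (\<surd>V - I / T)\<^sup>2 \<ge> 0\<close> with \<open>I = \<integral> \<surd>V\<close>.\<close>

lemma integral_sqrt_le:
  fixes V :: "real \<Rightarrow> real"
  assumes [measurable]: "V \<in> borel_measurable borel" and V: "AE s in lborel. s \<in> {u..T} \<longrightarrow> 0 \<le> V s \<and> V s \<le> 1" and u: "0 \<le> u" "u \<le> T" "0 < T"
  shows "(\<integral>\<^sup>+s\<in>{u..T}. ennreal (sqrt (V s)) \<partial>lborel) \<le> ennreal (sqrt T * sqrt (LINT s:{u..T}|lborel. V s))"
proof -
  let ?i = "\<lambda>s. indicator {u..T} s :: real"
  define g where "g s = ?i s * sqrt (V s)" for s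
  have i: "integrable lborel ?i" using u by (simp add: integrable_indicator_iff)
  have g [measurable]: "g \<in> borel_measurable borel" unfolding g_def[abs_def] by measurable
  have bd: "AE s in lborel. 0 \<le> g s \<and> g s \<le> ?i s \<and> g s * g s = ?i s * V s \<and> g s * g s \<le> ?i s"
    using V by eventually_elim (auto simp: g_def indicator_def)
  have "AE s in lborel. norm (g s) \<le> norm (?i s)" using bd by eventually_elim simp
  then have ig: "integrable lborel g" by (rule Bochner_Integration.integrable_bound[OF i, rotated]) simp
  have "AE s in lborel. g s * g s \<le> ?i s" using bd by eventually_elim blast
  then have "AE s in lborel. norm (g s * g s) \<le> norm (?i s)" by eventually_elim simp
  then have igg: "integrable lborel (\<lambda>s. g s * g s)" by (rule Bochner_Integration.integrable_bound[OF i, rotated]) simp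
  define I where "I = (\<integral>s. g s \<partial>lborel)"
  define J where "J = (\<integral>s. g s * g s \<partial>lborel)"
  have J: "(LINT s:{u..T}|lborel. V s) = J"
    unfolding J_def set_lebesgue_integral_def
  proof (rule integral_cong_AE)
    show "AE s in lborel. indicator {u..T} s *\<^sub>R V s = g s * g s" using bd by eventually_elim simp
  qed measurable
  have g0: "AE s in lborel. 0 \<le> g s" using bd by eventually_elim simp
  have I0: "0 \<le> I" unfolding I_def by (rule integral_nonneg_AE[OF g0])
  have eq: "(?i s * (I / T) - g s) * (?i s * (I / T) - g s) = g s * g s - 2 * (I / T) * g s + (I / T)\<^sup>2 * ?i s" for s
    by (auto simp: g_def indicator_def power2_eq_square algebra_simps)
  have "0 \<le> (\<integral>s. (?i s * (I / T) - g s) * (?i s * (I / T) - g s) \<partial>lborel)" by (intro integral_nonneg_AE) auto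
  also have "\<dots> = J - 2 * (I / T) * I + (I / T)\<^sup>2 * (T - u)"
    unfolding eq using ig igg i u by (simp add: I_def J_def)
  also have "\<dots> \<le> J - 2 * (I / T) * I + (I / T)\<^sup>2 * T" using u by (intro add_left_mono mult_left_mono) auto
  finally have "I\<^sup>2 \<le> T * J" using u by (simp add: power2_eq_square field_simps)
  then have "I \<le> sqrt T * sqrt J" using real_le_rsqrt[of I "T * J"] by (simp add: real_sqrt_mult)
  moreover have "(\<integral>\<^sup>+s\<in>{u..T}. ennreal (sqrt (V s)) \<partial>lborel) = ennreal I"
  proof -
    have "(\<integral>\<^sup>+s\<in>{u..T}. ennreal (sqrt (V s)) \<partial>lborel) = (\<integral>\<^sup>+s. ennreal (g s) \<partial>lborel)"
      by (intro nn_integral_cong) (auto simp: g_def indicator_def)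
    also have "\<dots> = ennreal I" unfolding I_def by (rule nn_integral_eq_integral[OF ig g0])
    finally show ?thesis .
  qed
  ultimately show ?thesis unfolding J by (simp add: ennreal_leI)
qed

text \<open>A weight known at \<open>u\<close> may be moved through the conditional expectation of
  \<open>Y\<close>, and Jensen's inequality bounds the square of that expectation by
  \<open>V\<close>.\<close>

lemma (in poisson) cond_exp_root:
  assumes Y [measurable]: "Y \<in> borel_measurable P" and Y01: "AE w in P. 0 \<le> Y w \<and> Y w \<le> (1 :: real)"
    and W: "W \<in> borel_measurable (past u)" and W0: "\<And>w. 0 \<le> W w" "\<And>w. W w \<le> wmax"
  defines "V \<equiv> real_cond_exp P (past u) (\<lambda>w. (Y w)\<^sup>2)"
  shows "AE w in P. 0 \<le> V w \<and> V w \<le> 1"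
    and "(\<integral>\<^sup>+w. ennreal (W w * Y w) \<partial>P) \<le> (\<integral>\<^sup>+w. ennreal (W w * sqrt (V w)) \<partial>P)"
proof -
  have "subalgebra P (past u)" using subalgebra_past[of u] by (simp add: subalgebra_def sets_P space_P space_config_space)
  then interpret C: finite_measure_subalgebra P "past u" by unfold_locales
  have [measurable]: "W \<in> borel_measurable P" using measurable_P[OF measurable_past_config[OF W]] .
  have "AE w in P. norm (Y w) \<le> 1" using Y01 by eventually_elim simp
  then have iY: "integrable P Y" by (rule integrable_const_bound) simp
  have b2: "AE w in P. 0 \<le> (Y w)\<^sup>2 \<and> (Y w)\<^sup>2 \<le> 1"
    using Y01 by eventually_elim (auto simp: power_le_one)
  have "AE w in P. norm ((Y w)\<^sup>2) \<le> 1" using b2 by eventually_elim simp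
  then have iY2: "integrable P (\<lambda>w. (Y w)\<^sup>2)" by (rule integrable_const_bound) simp
  have "AE w in P. 0 \<le> V w" unfolding V_def by (rule C.real_cond_exp_ge_c[OF iY2]) (use b2 in \<open>auto elim!: eventually_mono\<close>)
  moreover have "AE w in P. V w \<le> 1" unfolding V_def by (rule C.real_cond_exp_le_c[OF iY2]) (use b2 in \<open>auto elim!: eventually_mono\<close>)
  ultimately show V01: "AE w in P. 0 \<le> V w \<and> V w \<le> 1" by eventually_elim simp
  let ?Z = "real_cond_exp P (past u) Y"
  have "AE w in P. (?Z w)\<^sup>2 \<le> V w"
    unfolding V_def by (rule C.real_cond_exp_jensens_inequality(2)[OF iY, where I = UNIV]) (auto simp: iY2 convex_power2)
  then have le: "AE w in P. W w * ?Z w \<le> W w * sqrt (V w)"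
    by eventually_elim (auto intro!: mult_left_mono W0 real_le_rsqrt)
  have iWY: "integrable P (\<lambda>w. W w * Y w)"
  proof (rule Bochner_Integration.integrable_bound[of P "\<lambda>w. wmax * Y w"])
    show "AE w in P. norm (W w * Y w) \<le> norm (wmax * Y w)"
      using Y01 by eventually_elim (use W0 in \<open>auto simp: abs_mult intro!: mult_right_mono intro: order_trans[OF _ abs_ge_self]\<close>)
  qed (use iY in auto)
  have "(\<integral>\<^sup>+w. ennreal (W w * Y w) \<partial>P) = ennreal (\<integral>w. W w * Y w \<partial>P)"
    using Y01 W0 by (intro nn_integral_eq_integral iWY) (auto elim!: eventually_mono)
  also have "(\<integral>w. W w * Y w \<partial>P) = (\<integral>w. W w * ?Z w \<partial>P)"
    by (rule C.real_cond_exp_intg(2)[OF iWY W Y, symmetric])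
  also have "ennreal \<dots> = (\<integral>\<^sup>+w. ennreal (W w * ?Z w) \<partial>P)"
  proof (rule nn_integral_eq_integral[symmetric])
    show "integrable P (\<lambda>w. W w * ?Z w)" by (rule C.real_cond_exp_intg(1)[OF iWY W Y])
    have "AE w in P. 0 \<le> ?Z w" by (rule C.real_cond_exp_pos) (use Y01 in \<open>auto elim!: eventually_mono\<close>)
    then show "AE w in P. 0 \<le> W w * ?Z w" by eventually_elim (simp add: W0)
  qed
  also have "\<dots> \<le> (\<integral>\<^sup>+w. ennreal (W w * sqrt (V w)) \<partial>P)"
    using le by (intro nn_integral_mono_AE) (auto elim!: eventually_mono intro: ennreal_leI)
  finally show "(\<integral>\<^sup>+w. ennreal (W w * Y w) \<partial>P) \<le> (\<integral>\<^sup>+w. ennreal (W w * sqrt (V w)) \<partial>P)" .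
qed

context scaled_hawkes
begin

lemma lam_joint: "(\<lambda>p. indicator {0..T} (fst p) *\<^sub>R lam (fst p) (snd p)) \<in> borel_measurable (borel \<Otimes>\<^sub>M config_space)"
proof (rule predictable_sigma_restrict[OF lam_meas])
  show "{0..T} \<times> configs \<in> sets (borel \<Otimes>\<^sub>M config_space)"
    using sets.top[of config_space] by (intro pair_measureI) (auto simp: space_config_space)
qed (use T_pos past_config in \<open>auto intro!: pair_measureI simp: space_pair_measure space_config_space\<close>)

lemma lam_config:
  assumes "s \<in> {0..T}" shows "lam s \<in> borel_measurable config_space"
  using measurable_compose[OF measurable_Pair1' lam_joint, of s] assms by (simp add: space_pair_measure)

text \<open>Translates the quotient of the theorem, formed with \<open>lam\<close>, to the regular
  versions; almost surely, because both the original and the shifted equation must hold along the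
  configuration.\<close>

lemma ratio_eq:
  assumes u: "0 < u" "u < s" "s \<le> T"
  shows "AE w in P. \<bar>1 - lam s w / lam s (add_point (u, 0) w)\<bar>\<^sup>2 = (1 - L s w / Lp u s w)\<^sup>2 \<and> 0 \<le> 1 - L s w / Lp u s w \<and> 1 - L s w / Lp u s w \<le> 1"
proof -
  have uT: "u < T" using u by simp
  interpret hawkes_pair P T "1 - 1 / T" B \<mu> k "\<lambda>_. \<mu>" L "\<mu> + B" "\<lambda>t. \<mu> + k (t - u)" "Lp u" u
    by (rule Lp_pair[OF u(1) uT])
  have "AE w in P. hawkes_equation \<mu> (\<lambda>t. (1 - 1 / T) * \<phi> t) T lam (add_point (u, 0) w)"
    using assms by (intro lam_shift_eq) auto
  then show ?thesis using lam_eq D_eq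
  proof eventually_elim
    case (elim w)
    have s: "0 < s" using assms by simp
    have "lam s (add_point (u, 0) w) = Lp u s w" "lam s w = L s w"
      using regular_eq(1)[OF elim(1) mu s assms(3)] regular_eq(1)[OF elim(2) mu s assms(3)] assms by (auto simp: Lp_def)
    moreover have "L s w \<le> Lp u s w" "0 < L s w" using elim(3) s assms(3) regular_ge[of s w] mu by auto
    ultimately show ?case by (simp add: field_simps)
  qed
qed

end

context nearly_unstable
begin

context
  fixes E :: "real \<Rightarrow> real \<Rightarrow> config \<Rightarrow> real"
  assumes E: "cond_exp_version P T (\<lambda>t s w. \<bar>1 - lam s w / lam s (add_point (t, 0) w)\<bar>\<^sup>2) E"
begin

lemma E_meas: "(\<lambda>(t, s, w). E t s w) \<in> borel_measurable (borel \<Otimes>\<^sub>M borel \<Otimes>\<^sub>M P)"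
  using E by (simp add: cond_exp_version_def)

lemma E_bounds:
  assumes u: "0 < u" "u < s" "s \<le> T" and W: "W \<in> borel_measurable (past u)" and W0: "\<And>w. 0 \<le> W w" "\<And>w. W w \<le> wmax"
  shows "AE w in P. 0 \<le> E u s w \<and> E u s w \<le> 1"
    and "(\<integral>\<^sup>+w. ennreal (W w * (1 - L s w / Lp u s w)) \<partial>P) \<le> (\<integral>\<^sup>+w. ennreal (W w * sqrt (E u s w)) \<partial>P)"
proof -
  define Y where "Y w = 1 - L s w / Lp u s w" for w
  have r: "AE w in P. \<bar>1 - lam s w / lam s (add_point (u, 0) w)\<bar>\<^sup>2 = (Y w)\<^sup>2 \<and> 0 \<le> Y w \<and> Y w \<le> 1"
    using ratio_eq[OF u] by (simp add: Y_def)
  have [measurable]: "(\<lambda>w. Lp u s w) \<in> borel_measurable P"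
    using measurable_P[OF measurable_compose[OF measurable_const_time Lp_predictable]] u by simp
  have Ym [measurable]: "Y \<in> borel_measurable P" unfolding Y_def[abs_def] by measurable
  have [measurable]: "lam s \<in> borel_measurable config_space" using u by (intro lam_config) auto
  have [measurable]: "add_point (u, 0) \<in> measurable config_space config_space"
    by (rule add_point_measurable_config) (simp add: space_half_plane)
  have Xm: "(\<lambda>w. \<bar>1 - lam s w / lam s (add_point (u, 0) w)\<bar>\<^sup>2) \<in> borel_measurable P"
    by (rule measurable_P) measurable
  have "subalgebra P (past u)" using subalgebra_past[of u] by (simp add: subalgebra_def sets_P space_P space_config_space)
  then interpret C: finite_measure_subalgebra P "past u" by unfold_locales
  have "AE w in P. E u s w = real_cond_exp P (past u) (\<lambda>w. \<bar>1 - lam s w / lam s (add_point (u, 0) w)\<bar>\<^sup>2) w"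
    using E u unfolding cond_exp_version_def by auto
  moreover have "AE w in P. real_cond_exp P (past u) (\<lambda>w. \<bar>1 - lam s w / lam s (add_point (u, 0) w)\<bar>\<^sup>2) w = real_cond_exp P (past u) (\<lambda>w. (Y w)\<^sup>2) w"
    by (rule C.real_cond_exp_cong[OF _ Xm]) (use r in \<open>auto elim!: eventually_mono\<close>)
  ultimately have EV: "AE w in P. E u s w = real_cond_exp P (past u) (\<lambda>w. (Y w)\<^sup>2) w" by eventually_elim simp
  have Y01: "AE w in P. 0 \<le> Y w \<and> Y w \<le> 1" using r by eventually_elim simp
  note root = cond_exp_root[OF Ym Y01 W W0]
  show "AE w in P. 0 \<le> E u s w \<and> E u s w \<le> 1" using EV root(1) by eventually_elim simp
  have "(\<integral>\<^sup>+w. ennreal (W w * Y w) \<partial>P) \<le> (\<integral>\<^sup>+w. ennreal (W w * sqrt (real_cond_exp P (past u) (\<lambda>w. (Y w)\<^sup>2) w)) \<partial>P)" by (rule root(2))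
  also have "\<dots> = (\<integral>\<^sup>+w. ennreal (W w * sqrt (E u s w)) \<partial>P)" using EV by (intro nn_integral_cong_AE) (auto elim!: eventually_mono)
  finally show "(\<integral>\<^sup>+w. ennreal (W w * (1 - L s w / Lp u s w)) \<partial>P) \<le> (\<integral>\<^sup>+w. ennreal (W w * sqrt (E u s w)) \<partial>P)"
    by (simp add: Y_def)
qed

lemma E_section: "(\<lambda>(s, w). E u s w) \<in> borel_measurable (lborel \<Otimes>\<^sub>M P)"
proof -
  have "(\<lambda>p. (u, p)) \<in> measurable (lborel \<Otimes>\<^sub>M P) (borel \<Otimes>\<^sub>M borel \<Otimes>\<^sub>M P)"
    by (intro measurable_Pair measurable_const) (auto simp: measurable_cong_sets[OF sets_pair_measure_cong[OF sets_lborel refl] refl])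
  from measurable_compose[OF this E_meas] show ?thesis by (simp add: split_beta')
qed

lemma E_integral_meas:
  "(\<lambda>p. LINT s:{fst p..T}|lborel. E (fst p) s (snd p)) \<in> borel_measurable (lborel \<Otimes>\<^sub>M P)"
proof -
  have "(\<lambda>x. (fst (fst x), snd x, snd (fst x))) \<in> measurable ((lborel \<Otimes>\<^sub>M P) \<Otimes>\<^sub>M lborel) (borel \<Otimes>\<^sub>M borel \<Otimes>\<^sub>M P)"
    by measurable
  from measurable_compose[OF this E_meas]
  have [measurable]: "(\<lambda>x. E (fst (fst x)) (snd x) (snd (fst x))) \<in> borel_measurable ((lborel \<Otimes>\<^sub>M P) \<Otimes>\<^sub>M lborel)" by simp
  have "(\<lambda>x. indicator {x. fst (fst x) \<le> snd x \<and> snd x \<le> T} x *\<^sub>R E (fst (fst x)) (snd x) (snd (fst x))) \<in> borel_measurable ((lborel \<Otimes>\<^sub>M P) \<Otimes>\<^sub>M lborel)"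
    by measurable
  then have "(\<lambda>p. LINT s|lborel. indicator {x. fst (fst x) \<le> snd x \<and> snd x \<le> T} (p, s) *\<^sub>R E (fst p) s (snd p)) \<in> borel_measurable (lborel \<Otimes>\<^sub>M P)"
    by (intro lborel.borel_measurable_lebesgue_integral) (simp add: split_beta')
  also have "(\<lambda>p. LINT s|lborel. indicator {x. fst (fst x) \<le> snd x \<and> snd x \<le> T} (p, s) *\<^sub>R E (fst p) s (snd p)) = (\<lambda>p. LINT s:{fst p..T}|lborel. E (fst p) s (snd p))"
    unfolding set_lebesgue_integral_def by (intro ext Bochner_Integration.integral_cong) (auto simp: indicator_def)
  finally show ?thesis .
qed

lemma root_integral_lower:
  assumes uT: "T / 4 \<le> u" "u \<le> T / 2"
  shows "ennreal ratio_const \<le> (\<integral>\<^sup>+w. ennreal (sqrt (lam u w) * sqrt (LINT s:{u..T}|lborel. E u s w)) \<partial>P)"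
proof -
  interpret pair_sigma_finite lborel P ..
  define W where "W w = min (sqrt (L u w)) (sqrt T)" for w
  have u: "0 < u" "u < T" using uT T2 by auto
  have [measurable]: "(\<lambda>w. L u w) \<in> borel_measurable (past u)"
    using measurable_compose[OF measurable_const_time_past[of u] L_pred] u by simp
  have Wp: "W \<in> borel_measurable (past u)" unfolding W_def[abs_def] by measurable
  have W0: "0 \<le> W w" "W w \<le> sqrt T" for w using L_nonneg[of u w] T_pos by (auto simp: W_def)
  have [measurable]: "W \<in> borel_measurable P" using measurable_P[OF measurable_past_config[OF Wp]] .
  note [measurable] = E_section[of u, unfolded split_beta']
  have [measurable]: "(\<lambda>w. E u s w) \<in> borel_measurable P" for s
    using measurable_compose[OF measurable_Pair1' E_section[of u], of s] by simp
  let ?I = "\<lambda>w. LINT s:{u..T}|lborel. E u s w"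
  have [measurable]: "?I \<in> borel_measurable P"
    using measurable_compose[OF measurable_Pair1' E_integral_meas, of u] by (simp add: space_pair_measure)
  have [measurable]: "lam u \<in> borel_measurable P" using u by (intro measurable_P lam_config) auto
  have "ennreal (ratio_const * sqrt T) \<le> (\<integral>\<^sup>+s\<in>{u..T}. (\<integral>\<^sup>+w. ennreal (W w * (1 - L s w / Lp u s w)) \<partial>P) \<partial>lborel)"
    unfolding W_def by (rule expected_ratio_lower[OF uT])
  also have "\<dots> \<le> (\<integral>\<^sup>+s\<in>{u..T}. (\<integral>\<^sup>+w. ennreal (W w * sqrt (E u s w)) \<partial>P) \<partial>lborel)"
  proof (rule nn_integral_mono_AE)
    have "AE s in lborel. s \<noteq> u" by (rule AE_lborel_singleton)
    then show "AE s in lborel. (\<integral>\<^sup>+w. ennreal (W w * (1 - L s w / Lp u s w)) \<partial>P) * indicator {u..T} s \<le> (\<integral>\<^sup>+w. ennreal (W w * sqrt (E u s w)) \<partial>P) * indicator {u..T} s"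
    proof eventually_elim
      case (elim s)
      then show ?case using E_bounds(2)[OF u(1) _ _ Wp W0, of s] by (auto simp: indicator_def)
    qed
  qed
  also have "\<dots> = (\<integral>\<^sup>+s. (\<integral>\<^sup>+w. ennreal (W w) * (ennreal (sqrt (E u s w)) * indicator {u..T} s) \<partial>P) \<partial>lborel)"
    using W0 by (subst nn_integral_multc[symmetric]) (auto intro!: nn_integral_cong simp: ennreal_mult' mult.assoc)
  also have "\<dots> = (\<integral>\<^sup>+w. (\<integral>\<^sup>+s. ennreal (W w) * (ennreal (sqrt (E u s w)) * indicator {u..T} s) \<partial>lborel) \<partial>P)"
    by (rule Fubini'[symmetric]) measurable
  also have "\<dots> = (\<integral>\<^sup>+w. ennreal (W w) * (\<integral>\<^sup>+s\<in>{u..T}. ennreal (sqrt (E u s w)) \<partial>lborel) \<partial>P)"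
  proof (intro nn_integral_cong nn_integral_cmult)
    fix w assume "w \<in> space P"
    then have "(\<lambda>s. E u s w) \<in> borel_measurable lborel"
      using measurable_compose[OF measurable_Pair2' E_section[of u]] by (simp add: split_beta')
    then show "(\<lambda>s. ennreal (sqrt (E u s w)) * indicator {u..T} s) \<in> borel_measurable lborel" by measurable
  qed
  also have "\<dots> \<le> (\<integral>\<^sup>+w. ennreal (sqrt T) * ennreal (sqrt (lam u w) * sqrt (?I w)) \<partial>P)"
  proof (rule nn_integral_mono_AE)
    \<comment> \<open>The bounds hold for each \<open>s\<close> almost surely. Exchanging the two
      almost-everywhere quantifiers makes Cauchy-Schwarz applicable along almost every
      configuration.\<close>
    have "AE s in lborel. AE w in P. s \<in> {u..T} \<longrightarrow> 0 \<le> E u s w \<and> E u s w \<le> 1"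
    proof -
      have "AE s in lborel. s \<noteq> u" by (rule AE_lborel_singleton)
      then show ?thesis
      proof eventually_elim
        case (elim s)
        then show ?case using E_bounds(1)[OF u(1) _ _ Wp W0, of s] by (cases "u < s \<and> s \<le> T") auto
      qed
    qed
    then have "AE w in P. AE s in lborel. s \<in> {u..T} \<longrightarrow> 0 \<le> E u s w \<and> E u s w \<le> 1"
      by (subst (asm) AE_commute) measurable
    then show "AE w in P. ennreal (W w) * (\<integral>\<^sup>+s\<in>{u..T}. ennreal (sqrt (E u s w)) \<partial>lborel) \<le> ennreal (sqrt T) * ennreal (sqrt (lam u w) * sqrt (?I w))"
      using lam_eq AE_space
    proof eventually_elim
      case (elim w)
      have lamL: "lam u w = L u w" using regular_eq(1)[OF elim(2) mu] u by simp
      have [measurable]: "(\<lambda>s. E u s w) \<in> borel_measurable borel"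
        using measurable_compose[OF measurable_Pair2' E_section[of u]] elim(3) by (simp add: split_beta')
      have "ennreal (W w) * (\<integral>\<^sup>+s\<in>{u..T}. ennreal (sqrt (E u s w)) \<partial>lborel) \<le> ennreal (sqrt (lam u w)) * ennreal (sqrt T * sqrt (?I w))"
        using elim u T_pos by (intro mult_mono integral_sqrt_le) (auto simp: W_def lamL intro: ennreal_leI)
      also have "\<dots> = ennreal (sqrt T) * ennreal (sqrt (lam u w) * sqrt (?I w))"
        using L_nonneg[of u w] T_pos by (simp add: lamL ennreal_mult' mult_ac)
      finally show ?case .
    qed
  qed
  also have "\<dots> = ennreal (sqrt T) * (\<integral>\<^sup>+w. ennreal (sqrt (lam u w) * sqrt (?I w)) \<partial>P)" by (rule nn_integral_cmult) measurable
  finally have "ennreal (sqrt T) * ennreal ratio_const \<le> ennreal (sqrt T) * (\<integral>\<^sup>+w. ennreal (sqrt (lam u w) * sqrt (?I w)) \<partial>P)"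
    using T_pos ratio_const_pos by (simp add: ennreal_mult mult.commute)
  then show ?thesis using T_pos by (simp add: ennreal_mult_le_mult_iff)
qed

text \<open>Only \<open>t\<close> in \<open>{T / 4..T / 2}\<close> is kept: late enough for the
  intensity to have grown to order \<open>T\<close>, early enough for the response to unfold before
  \<open>T\<close>.\<close>

lemma sensitivity_lower:
  "ennreal (ratio_const * T / 4) \<le> (\<integral>\<^sup>+w. (\<integral>\<^sup>+t\<in>{0..T}. ennreal (sqrt (lam t w) * sqrt (LINT s:{t..T}|lborel. E t s w)) \<partial>lborel) \<partial>P)"
proof -
  interpret pair_sigma_finite lborel P ..
  let ?I = "\<lambda>p. LINT s:{fst p..T}|lborel. E (fst p) s (snd p)"
  note [measurable] = E_integral_meas
  have [measurable]: "(\<lambda>p. indicator {0..T} (fst p) *\<^sub>R lam (fst p) (snd p)) \<in> borel_measurable (lborel \<Otimes>\<^sub>M P)"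
    using lam_joint by (simp add: measurable_cong_sets[OF sets_pair_measure_cong[OF sets_lborel sets_P] refl])
  \<comment> \<open>Joint measurability of \<open>lam\<close> is known on \<open>{0..T}\<close>
    only; the indicator in front of it extends it by \<open>0\<close> outside.\<close>
  define h where "h p = ennreal (sqrt (indicator {0..T} (fst p) *\<^sub>R lam (fst p) (snd p)) * sqrt (?I p)) * indicator {T / 4..T / 2} (fst p)" for p
  have h [measurable]: "h \<in> borel_measurable (lborel \<Otimes>\<^sub>M P)" unfolding h_def[abs_def] by measurable
  have "ennreal (ratio_const * T / 4) = (\<integral>\<^sup>+t\<in>{T / 4..T / 2}. ennreal ratio_const \<partial>lborel)"
    using T_pos ratio_const_pos by (subst nn_integral_cmult_indicator) (auto simp: ennreal_mult'[symmetric] field_simps)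
  also have "\<dots> \<le> (\<integral>\<^sup>+t. (\<integral>\<^sup>+w. h (t, w) \<partial>P) \<partial>lborel)"
  proof (rule nn_integral_mono)
    fix t
    show "ennreal ratio_const * indicator {T / 4..T / 2} t \<le> (\<integral>\<^sup>+w. h (t, w) \<partial>P)"
      using root_integral_lower[of t] T_pos by (cases "t \<in> {T / 4..T / 2}") (auto simp: h_def)
  qed
  also have "\<dots> = (\<integral>\<^sup>+w. (\<integral>\<^sup>+t. h (t, w) \<partial>lborel) \<partial>P)" by (rule Fubini'[symmetric]) simp
  also have "\<dots> \<le> (\<integral>\<^sup>+w. (\<integral>\<^sup>+t\<in>{0..T}. ennreal (sqrt (lam t w) * sqrt (LINT s:{t..T}|lborel. E t s w)) \<partial>lborel) \<partial>P)"
    using T_pos by (intro nn_integral_mono) (auto simp: h_def indicator_def)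
  finally show ?thesis .
qed

end

end

section \<open>The normalized martingale has unit variance\<close>

text \<open>The Bochner integral is \<open>0\<close> for a non-integrable function. Spelling out
  this default reduces measurability in the configuration to integrals of nonnegative
  functions.\<close>

lemma integral_positive_negative_parts:
  assumes [measurable]: "f \<in> borel_measurable M"
  shows "(\<integral>x. f x \<partial>M) = (if (\<integral>\<^sup>+x. ennreal (f x) \<partial>M) < \<infinity> \<and> (\<integral>\<^sup>+x. ennreal (- f x) \<partial>M) < \<infinity>
    then enn2real (\<integral>\<^sup>+x. ennreal (f x) \<partial>M) - enn2real (\<integral>\<^sup>+x. ennreal (- f x) \<partial>M) else 0)"
  using real_integrable_def[of M f] real_lebesgue_integral_def[of M f] by (auto simp: not_integrable_integral_eq less_top)

context scaled_hawkes
begin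

definition integrand :: "config \<times> (real \<times> real) \<Rightarrow> real" where
  "integrand p = indicator ({0..T} \<times> {0..}) (snd p) *\<^sub>R (of_bool (snd (snd p) \<le> lam (fst (snd p)) (fst p)) / sqrt (T * lam (fst (snd p)) (fst p)))"

lemma normalized_eq: "normalized_martingale T lam w = (\<integral>z. integrand (w, z) \<partial>w) - (\<integral>z. integrand (w, z) \<partial>half_plane)"
  unfolding normalized_martingale_def set_lebesgue_integral_def integrand_def by (simp add: split_beta')

lemma integrand_measurable [measurable]: "integrand \<in> borel_measurable (config_space \<Otimes>\<^sub>M half_plane)"
proof -
  have "(\<lambda>p. (fst (snd p), fst p)) \<in> measurable (config_space \<Otimes>\<^sub>M half_plane) (borel \<Otimes>\<^sub>M config_space)" by measurable
  from measurable_compose[OF this lam_joint]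
  have [measurable]: "(\<lambda>p. indicator {0..T} (fst (snd p)) *\<^sub>R lam (fst (snd p)) (fst p)) \<in> borel_measurable (config_space \<Otimes>\<^sub>M half_plane)" by simp
  let ?l = "\<lambda>p. indicator {0..T} (fst (snd p)) *\<^sub>R lam (fst (snd p)) (fst p)"
  have "(\<lambda>p. if 0 \<le> fst (snd p) \<and> fst (snd p) \<le> T \<and> 0 \<le> snd (snd p) \<and> snd (snd p) \<le> ?l p then 1 / sqrt (T * ?l p) else 0) \<in> borel_measurable (config_space \<Otimes>\<^sub>M half_plane)"
    by measurable
  then show ?thesis
    by (rule measurable_cong[THEN iffD1, rotated]) (auto simp: integrand_def indicator_def)
qed

lemma integrand_section:
  assumes "w \<in> configs"
  shows "(\<lambda>z. integrand (w, z)) \<in> borel_measurable w" "(\<lambda>z. integrand (w, z)) \<in> borel_measurable half_plane"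
proof -
  show "(\<lambda>z. integrand (w, z)) \<in> borel_measurable half_plane"
    using measurable_compose[OF measurable_Pair1' integrand_measurable] assms by (simp add: space_config_space)
  then show "(\<lambda>z. integrand (w, z)) \<in> borel_measurable w"
    by (simp add: measurable_cong_sets[OF sets_config[OF assms] refl])
qed

lemma normalized_measurable [measurable]: "normalized_martingale T lam \<in> borel_measurable P"
proof -
  interpret H: sigma_finite_measure half_plane
    using adapted_kernelD(3)[OF adapted_kernel_half_plane] all_not_in_conv[of configs] not_empty space_P by auto
  have [measurable]: "(\<lambda>w. \<integral>\<^sup>+z. ennreal (integrand (w, z)) \<partial>w) \<in> borel_measurable config_space" "(\<lambda>w. \<integral>\<^sup>+z. ennreal (- integrand (w, z)) \<partial>w) \<in> borel_measurable config_space"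
    using measurable_nn_integral_config[of "\<lambda>p. ennreal (integrand p)"] measurable_nn_integral_config[of "\<lambda>p. ennreal (- integrand p)"] by auto
  have [measurable]: "(\<lambda>w. \<integral>\<^sup>+z. ennreal (integrand (w, z)) \<partial>half_plane) \<in> borel_measurable config_space" "(\<lambda>w. \<integral>\<^sup>+z. ennreal (- integrand (w, z)) \<partial>half_plane) \<in> borel_measurable config_space"
    by measurable
  let ?J = "\<lambda>a b :: ennreal. if a < \<infinity> \<and> b < \<infinity> then enn2real a - enn2real b else 0"
  have "(\<lambda>w. ?J (\<integral>\<^sup>+z. ennreal (integrand (w, z)) \<partial>w) (\<integral>\<^sup>+z. ennreal (- integrand (w, z)) \<partial>w) -
      ?J (\<integral>\<^sup>+z. ennreal (integrand (w, z)) \<partial>half_plane) (\<integral>\<^sup>+z. ennreal (- integrand (w, z)) \<partial>half_plane)) \<in> borel_measurable config_space"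
    by measurable
  then have "normalized_martingale T lam \<in> borel_measurable config_space"
  proof (rule measurable_cong[THEN iffD1, rotated])
    fix w assume "w \<in> space config_space"
    then have w: "w \<in> configs" by (simp add: space_config_space)
    show "?J (\<integral>\<^sup>+z. ennreal (integrand (w, z)) \<partial>w) (\<integral>\<^sup>+z. ennreal (- integrand (w, z)) \<partial>w) -
      ?J (\<integral>\<^sup>+z. ennreal (integrand (w, z)) \<partial>half_plane) (\<integral>\<^sup>+z. ennreal (- integrand (w, z)) \<partial>half_plane) = normalized_martingale T lam w"
      unfolding normalized_eq integral_positive_negative_parts[OF integrand_section(1)[OF w]] integral_positive_negative_parts[OF integrand_section(2)[OF w]] ..
  qed
  then show ?thesis by (rule measurable_P)
qed

definition weight :: "real \<times> config \<Rightarrow> ennreal" where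
  "weight p = ennreal (1 / sqrt (T * L (fst p) (snd p)))"

lemma weight_measurable [measurable]: "weight \<in> borel_measurable predictable"
  unfolding weight_def[abs_def] using L_pred by measurable

lemma dominated_weight: "dominated (\<lambda>x. weight (fst x) * accept L x)"
  unfolding dominated_def
proof (intro conjI exI allI)
  show "(\<lambda>x. weight (fst x) * accept L x) \<in> borel_measurable marked"
    using measurable_marked_fst[OF weight_measurable] by measurable
  show "0 \<le> 1 / sqrt (T * \<mu>)" using T_pos mu by simp
  have "1 / sqrt (T * L s w) \<le> 1 / sqrt (T * \<mu>)" for s w
    using T_pos mu regular_ge[of s w] by (intro divide_left_mono) (auto intro: mult_pos_pos less_le_trans[OF mu])
  then show "weight (fst x) * accept L x \<le> ennreal (1 / sqrt (T * \<mu>)) * accept L x" for x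
    unfolding weight_def by (intro mult_right_mono ennreal_leI) auto
qed

text \<open>The closed time interval of \<open>normalized_martingale\<close> and the open one of
  \<open>kint\<close> differ by two vertical lines, which are null both for the intensity and for
  almost every configuration.\<close>

lemma integral_integrand:
  assumes w: "w \<in> configs" and eq: "hawkes_equation \<mu> (\<lambda>t. (1 - 1 / T) * \<phi> t) T lam w" and k: "adapted_kernel \<kappa>"
    and m: "(\<lambda>z. integrand (w, z)) \<in> borel_measurable (\<kappa> w)"
    and null: "{0} \<times> {0..} \<in> null_sets (\<kappa> w)" "{T} \<times> {0..} \<in> null_sets (\<kappa> w)"
  shows "(\<integral>z. integrand (w, z) \<partial>\<kappa> w) = enn2real (kint \<kappa> (\<lambda>x. weight (fst x) * accept L x) T w)"
proof -
  have sp: "space (\<kappa> w) = UNIV \<times> {0..}" by (rule adapted_kernelD(2)[OF k w])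
  have ae: "AE z in \<kappa> w. 0 \<le> integrand (w, z) \<and> ennreal (integrand (w, z)) = weight (fst (mark w z)) * accept L (mark w z) * indicator {0<..<T} (fst z)"
    using AE_not_in[OF null(1)] AE_not_in[OF null(2)] AE_space
  proof eventually_elim
    case (elim z)
    obtain t \<theta> where z: "z = (t, \<theta>)" by (cases z)
    with elim sp have t: "t \<noteq> 0" "t \<noteq> T" "0 \<le> \<theta>" by auto
    show ?case
    proof (cases "0 < t \<and> t < T")
      case True
      then have "lam t w = L t w" using regular_eq(1)[OF eq mu, of t] by simp
      moreover have "0 < L t w" using regular_ge[of t w] mu by simp
      ultimately show ?thesis using True t T_pos by (auto simp: z integrand_def weight_def accept_mark indicator_def)
    qed (use t in \<open>auto simp: z integrand_def indicator_def\<close>)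
  qed
  have "(\<integral>z. integrand (w, z) \<partial>\<kappa> w) = enn2real (\<integral>\<^sup>+z. ennreal (integrand (w, z)) \<partial>\<kappa> w)"
    by (rule integral_eq_nn_integral[OF m]) (use ae in eventually_elim, simp)
  also have "(\<integral>\<^sup>+z. ennreal (integrand (w, z)) \<partial>\<kappa> w) = kint \<kappa> (\<lambda>x. weight (fst x) * accept L x) T w"
    unfolding kint_def by (rule nn_integral_cong_AE) (use ae in eventually_elim, simp)
  finally show ?thesis .
qed

lemma normalized_eq_Mart: "AE w in P. normalized_martingale T lam w = Mart (\<lambda>x. weight (fst x) * accept L x) T w"
proof -
  have line: "{r} \<times> {0..} \<in> sets half_plane" "emeasure half_plane ({r} \<times> {0..}) = 0" for r :: real
    using half_plane_vertical_line[of r] by (auto simp: null_sets_def)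
  from AE_no_points[OF line, of 0] AE_no_points[OF line, of T] lam_eq AE_space
  show ?thesis
  proof eventually_elim
    case (elim w)
    then have w: "w \<in> configs" by (simp add: space_P)
    have "(\<integral>z. integrand (w, z) \<partial>w) = enn2real (Sint (\<lambda>x. weight (fst x) * accept L x) T w)"
      using elim line sets_config[OF w]
      by (intro integral_integrand[OF w elim(3) adapted_kernel_config integrand_section(1)[OF w]]) (auto simp: null_sets_def)
    moreover have "(\<integral>z. integrand (w, z) \<partial>half_plane) = enn2real (Aint (\<lambda>x. weight (fst x) * accept L x) T w)"
      using half_plane_vertical_line
      by (intro integral_integrand[OF w elim(3) adapted_kernel_half_plane integrand_section(2)[OF w]]) auto
    ultimately show ?case by (simp add: normalized_eq Mart_def)
  qed
qed

lemma normalized_second_moment: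
  "integrable P (\<lambda>w. (normalized_martingale T lam w)\<^sup>2)" "(\<integral>w. (normalized_martingale T lam w)\<^sup>2 \<partial>P) = 1"
proof -
  let ?f = "\<lambda>x. weight (fst x) * accept L x"
  note cov = Mart_covariance[OF dominated_weight dominated_weight order_refl]
  have ae: "AE w in P. Mart ?f T w * Mart ?f T w = (normalized_martingale T lam w)\<^sup>2"
    using normalized_eq_Mart by eventually_elim (simp add: power2_eq_square)
  have [measurable]: "(\<lambda>w. Mart ?f T w * Mart ?f T w) \<in> borel_measurable P" using cov(1) by (rule borel_measurable_integrable)
  show "integrable P (\<lambda>w. (normalized_martingale T lam w)\<^sup>2)"
    using cov(1) by (rule integrable_cong_AE_imp) (use ae in \<open>auto elim!: eventually_mono\<close>)
  have "(\<integral>w. (normalized_martingale T lam w)\<^sup>2 \<partial>P) = (\<integral>w. Mart ?f T w * Mart ?f T w \<partial>P)"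
    by (rule integral_cong_AE) (use ae in \<open>auto elim!: eventually_mono\<close>)
  also have "\<dots> = enn2real (\<integral>\<^sup>+w. Aint (\<lambda>x. ?f x * ?f x) T w \<partial>P)" by (rule cov(2))
  also have "(\<lambda>x. ?f x * ?f x) = (\<lambda>x. (weight (fst x) * weight (fst x)) * accept L x)"
    by (rule ext) (auto simp: accept_def indicator_def)
  also have "(\<integral>\<^sup>+w. Aint (\<lambda>x. (weight (fst x) * weight (fst x)) * accept L x) T w \<partial>P) =
    (\<integral>\<^sup>+r\<in>{0<..<T}. (\<integral>\<^sup>+w. (weight (r, w) * weight (r, w)) * ennreal (L r w) \<partial>P) \<partial>lborel)"
    using expect_Aint[of "\<lambda>p. weight p * weight p" L T] L_pred L_nonneg by simp
  also have "\<dots> = (\<integral>\<^sup>+r\<in>{0<..<T}. ennreal (1 / T) \<partial>lborel)"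
  proof (intro nn_integral_cong arg_cong2[where f = "(*)"] refl)
    fix r
    \<comment> \<open>The normalisation cancels the intensity exactly, so the variance is the length
      of the interval divided by \<open>T\<close>.\<close>
    have "(weight (r, w) * weight (r, w)) * ennreal (L r w) = ennreal (1 / T)" for w
    proof -
      have "0 < L r w" using regular_ge[of r w] mu by simp
      then show ?thesis using T_pos by (simp add: weight_def ennreal_mult[symmetric] real_sqrt_mult[symmetric] del: ennreal_mult')
    qed
    then show "(\<integral>\<^sup>+w. (weight (r, w) * weight (r, w)) * ennreal (L r w) \<partial>P) = ennreal (1 / T)"
      by (simp add: emeasure_space_1)
  qed
  also have "\<dots> = 1" using T_pos by (subst nn_integral_cmult_indicator) (auto simp: ennreal_mult'[symmetric])
  finally show "(\<integral>w. (normalized_martingale T lam w)\<^sup>2 \<partial>P) = 1" by simp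
qed

end

section \<open>The Wasserstein distance bounded by second moments\<close>

lemma lipschitz_deviation:
  assumes M: "prob_space M" and X [measurable]: "X \<in> borel_measurable M" and i: "integrable M (\<lambda>w. (X w)\<^sup>2)" "(\<integral>w. (X w)\<^sup>2 \<partial>M) \<le> 1"
    and u: "1-lipschitz_on UNIV (u :: real \<Rightarrow> real)"
  shows "\<bar>(\<integral>w. u (X w) \<partial>M) - u 0\<bar> \<le> 1"
proof -
  interpret prob_space M by fact
  have um [measurable]: "u \<in> borel_measurable borel"
    using lipschitz_on_continuous_on[OF u] by (rule borel_measurable_continuous_onI)
  \<comment> \<open>A quadratic majorant of \<open>\<bar>x\<bar>\<close> whose expectation is at
    most one by the second moment.\<close>
  have b: "\<bar>u x - u 0\<bar> \<le> (1 + x\<^sup>2) / 2" for x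
  proof -
    have "\<bar>u x - u 0\<bar> \<le> \<bar>x\<bar>" using lipschitz_onD[OF u, of x 0] by (simp add: dist_real_def)
    moreover have "0 \<le> (\<bar>x\<bar> - 1)\<^sup>2" by simp
    ultimately show ?thesis by (simp add: power2_eq_square algebra_simps)
  qed
  have ib: "integrable M (\<lambda>w. (1 + (X w)\<^sup>2) / 2)" using i(1) by simp
  have iu: "integrable M (\<lambda>w. u (X w) - u 0)"
    by (rule Bochner_Integration.integrable_bound[OF ib]) (use b in \<open>auto simp: abs_of_nonneg\<close>)
  have "integrable M (\<lambda>w. (u (X w) - u 0) + u 0)" using iu by (intro Bochner_Integration.integrable_add) auto
  then have "(\<integral>w. u (X w) \<partial>M) - u 0 = (\<integral>w. u (X w) - u 0 \<partial>M)" by (simp add: prob_space)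
  also have "\<bar>\<dots>\<bar> \<le> (\<integral>w. \<bar>u (X w) - u 0\<bar> \<partial>M)" by (rule integral_abs_bound)
  also have "\<dots> \<le> (\<integral>w. (1 + (X w)\<^sup>2) / 2 \<partial>M)" using iu ib b by (intro integral_mono) auto
  also have "\<dots> \<le> 1" using i by (simp add: prob_space)
  finally show ?thesis .
qed

text \<open>Both variables are compared with the constant \<open>0\<close>: each expectation of
  \<open>u\<close> lies within \<open>1\<close> of \<open>u 0\<close>.\<close>

lemma wasserstein_le_2:
  assumes "prob_space P" "F \<in> borel_measurable P" "integrable P (\<lambda>w. (F w)\<^sup>2)" "(\<integral>w. (F w)\<^sup>2 \<partial>P) \<le> 1"
    and Q: "prob_space Q" and G: "distributed Q lborel G std_normal_density"
  shows "wasserstein P F Q G \<le> 2"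
  unfolding wasserstein_def
proof (rule SUP_least, clarify)
  fix u :: "real \<Rightarrow> real" assume u: "1-lipschitz_on UNIV u"
  have Gm: "G \<in> borel_measurable Q" using distributed_measurable[OF G] by simp
  have Gi: "integrable Q (\<lambda>w. (G w)\<^sup>2)"
    using distributed_integrable[OF G, of "\<lambda>x. x\<^sup>2"] integrable_std_normal_moment[of 2] by simp
  have "(\<integral>w. (G w)\<^sup>2 \<partial>Q) = 1"
    using distributed_integral[OF G, of "\<lambda>x. x\<^sup>2"] integral_std_normal_moment_even[of 1] by (simp add: fact_numeral)
  then have "\<bar>(\<integral>w. u (G w) \<partial>Q) - u 0\<bar> \<le> 1" by (intro lipschitz_deviation[OF Q Gm Gi _ u]) simp
  moreover have "\<bar>(\<integral>w. u (F w) \<partial>P) - u 0\<bar> \<le> 1" by (rule lipschitz_deviation[OF assms(1-4) u])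
  ultimately have "\<bar>(\<integral>w. u (F w) \<partial>P) - (\<integral>w. u (G w) \<partial>Q)\<bar> \<le> 2" by linarith
  then have "ennreal \<bar>(\<integral>w. u (F w) \<partial>P) - (\<integral>w. u (G w) \<partial>Q)\<bar> \<le> ennreal 2" by (rule ennreal_leI)
  then show "ennreal \<bar>(\<integral>w. u (F w) \<partial>P) - (\<integral>w. u (G w) \<partial>Q)\<bar> \<le> 2" by simp
qed

section \<open>The two ranges of \<open>T\<close> and the choice of the constant\<close>

theorem proposition7p5:
  fixes \<mu> m :: real and \<phi> :: "real \<Rightarrow> real" and a :: "real \<Rightarrow> real"
    and P :: "config measure"
    and lam :: "real \<Rightarrow> real \<Rightarrow> config \<Rightarrow> real"
    and E :: "real \<Rightarrow> real \<Rightarrow> real \<Rightarrow> config \<Rightarrow> real"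
    and Q :: "'g measure" and G :: "'g \<Rightarrow> real"
  assumes P: "poisson_law P"
    and mu: "\<mu> > 0"
    and phi_measurable: "set_borel_measurable borel {0..} \<phi>"
    and phi_nonneg: "\<And>t. t \<ge> 0 \<Longrightarrow> \<phi> t \<ge> 0"
    and phi_loc_bounded: "\<And>b. bounded (\<phi> ` {0..b})"
    and phi_integral: "(\<integral>\<^sup>+t\<in>{0..}. ennreal (\<phi> t) \<partial>lborel) = 1"
    and phi_moment: "(\<integral>\<^sup>+t\<in>{0..}. ennreal (t * \<phi> t) \<partial>lborel) = ennreal m"
    and a: "\<And>T. T > 1 \<Longrightarrow> 0 < a T \<and> a T < 1 \<and> T * (1 - a T) = 1"
    and lam: "\<And>T. T > 1 \<Longrightarrow> hawkes_intensity P \<mu> (\<lambda>t. a T * \<phi> t) T (lam T)"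
    and E: "\<And>T. T > 1 \<Longrightarrow> cond_exp_version P T
              (\<lambda>t s \<omega>. \<bar>1 - lam T s \<omega> / lam T s (add_point (t, 0) \<omega>)\<bar>\<^sup>2) (E T)"
    and Q: "prob_space Q"
    and G: "distributed Q lborel G std_normal_density"
  shows "\<exists>C>0. \<forall>T>1.
    wasserstein P (normalized_martingale T (lam T)) Q G \<le>
      ennreal (C / sqrt T) + ennreal (C / T) *
        (\<integral>\<^sup>+\<omega>. (\<integral>\<^sup>+t\<in>{0..T}.
           ennreal (sqrt (lam T t \<omega>) * sqrt (LINT s:{t..T}|lborel. E T t s \<omega>)) \<partial>lborel) \<partial>P)"
proof -
  \<comment> \<open>The equation evaluates the kernel at positive delays only, so the value at
    \<open>0\<close> may be dropped; this gives a kernel on the whole line that vanishes up to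
    \<open>0\<close>.\<close>
  define f where "f t = (if 0 < t then \<phi> t else 0)" for t
  have f_nn: "0 \<le> f t" for t using phi_nonneg[of t] by (simp add: f_def)
  have f_supp: "t \<le> 0 \<Longrightarrow> f t = 0" for t by (simp add: f_def)
  have "(\<lambda>t. indicator {0<..} t *\<^sub>R (indicator {0..} t *\<^sub>R \<phi> t)) \<in> borel_measurable borel"
    using phi_measurable unfolding set_borel_measurable_def by measurable
  moreover have "(\<lambda>t. indicator {0<..} t *\<^sub>R (indicator {0..} t *\<^sub>R \<phi> t)) = f"
    by (auto simp: f_def indicator_def)
  ultimately have f_meas [measurable]: "f \<in> borel_measurable borel" by simp
  have ae: "AE t in lborel. t \<noteq> (0 :: real)" by (rule AE_lborel_singleton)
  have "(\<integral>\<^sup>+t. ennreal (f t) \<partial>lborel) = (\<integral>\<^sup>+t\<in>{0..}. ennreal (\<phi> t) \<partial>lborel)"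
    by (rule nn_integral_cong_AE) (use ae in eventually_elim, auto simp: f_def indicator_def)
  then have f_int: "(\<integral>\<^sup>+t. ennreal (f t) \<partial>lborel) = 1" using phi_integral by simp
  have "(\<integral>\<^sup>+t. ennreal (t * f t) \<partial>lborel) = (\<integral>\<^sup>+t\<in>{0..}. ennreal (t * \<phi> t) \<partial>lborel)"
    by (rule nn_integral_cong_AE) (use ae in eventually_elim, auto simp: f_def indicator_def)
  \<comment> \<open>\<open>ennreal m\<close> tells nothing about the sign of \<open>m\<close>,
    whereas the constants need a nonnegative moment bound.\<close>
  then have f_moment: "(\<integral>\<^sup>+t. ennreal (t * f t) \<partial>lborel) \<le> ennreal (max 0 m)"
    using phi_moment by (simp add: ennreal_leI)
  have f_bound: "\<exists>B>0. \<forall>t\<le>b. f t \<le> B" for b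
  proof -
    obtain B where "\<forall>x\<in>\<phi> ` {0..b}. norm x \<le> B" using phi_loc_bounded[of b] unfolding bounded_iff by blast
    then have B: "\<bar>\<phi> t\<bar> \<le> B" if "t \<in> {0..b}" for t using that by auto
    have "f t \<le> max 1 B" if "t \<le> b" for t
      using B[of t] that by (auto simp: f_def)
    then show ?thesis by (intro exI[of _ "max 1 B"]) auto
  qed
  obtain A where A: "0 < A" "(\<integral>\<^sup>+t. ennreal (f t) * indicator {..A} t \<partial>lborel) = ennreal (1 / 2)"
    using exists_median[OF f_meas f_supp f_int] by blast
  obtain \<beta> where \<beta>: "0 < \<beta>" "\<And>t. t \<le> A \<Longrightarrow> f t \<le> \<beta>" using f_bound[of A] by auto
  have hawkes: "\<exists>B. scaled_hawkes f B T P \<mu> \<phi> (lam T)" if T: "1 < T" for T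
  proof -
    obtain B where B: "\<And>t. t \<le> T \<Longrightarrow> f t \<le> B" using f_bound[of T] by auto
    have "a T = 1 - 1 / T" using a[OF T] T by (simp add: field_simps)
    then have "hawkes_intensity P \<mu> (\<lambda>t. (1 - 1 / T) * \<phi> t) T (lam T)" using lam[OF T] by simp
    then show ?thesis
      using f_meas f_nn f_supp f_int B T P mu
      by (intro exI[of _ B] scaled_hawkes.intro scaled_kernel.intro poisson.intro scaled_hawkes_axioms.intro) (auto simp: f_def)
  qed
  \<comment> \<open>Only the moment, \<open>\<beta>\<close> and \<open>\<mu>\<close> enter, neither
    \<open>T\<close> nor the bound of \<open>f\<close> up to \<open>T\<close>; so the constant can
    be named before \<open>T\<close> is fixed.\<close>
  define R where "R = nearly_unstable.ratio_const (max 0 m) \<beta> \<mu>"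
  define T0 where "T0 = max 2 (16 * A)"
  let ?S = "\<lambda>T. \<integral>\<^sup>+\<omega>. (\<integral>\<^sup>+t\<in>{0..T}. ennreal (sqrt (lam T t \<omega>) * sqrt (LINT s:{t..T}|lborel. E T t s \<omega>)) \<partial>lborel) \<partial>P"
  have W: "wasserstein P (normalized_martingale T (lam T)) Q G \<le> 2" if T: "1 < T" for T
  proof -
    obtain B where "scaled_hawkes f B T P \<mu> \<phi> (lam T)" using hawkes[OF T] by blast
    then interpret scaled_hawkes f B T P \<mu> \<phi> "lam T" .
    show ?thesis
      using normalized_measurable normalized_second_moment Q G by (intro wasserstein_le_2) (auto simp: prob_space_axioms)
  qed
  have large: "ennreal (R * T / 4) \<le> ?S T" "0 < R" if T: "T0 \<le> T" for T
  proof -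
    have T': "1 < T" "2 \<le> T" "16 * A \<le> T" using T by (auto simp: T0_def)
    obtain B where "scaled_hawkes f B T P \<mu> \<phi> (lam T)" using hawkes[OF T'(1)] by blast
    then interpret S: scaled_hawkes f B T P \<mu> \<phi> "lam T" .
    interpret nearly_unstable f B T "max 0 m" A \<beta> P \<mu> \<phi> "lam T"
      by unfold_locales (use f_moment A \<beta> T' in auto)
    show "ennreal (R * T / 4) \<le> ?S T" "0 < R"
      unfolding R_def using sensitivity_lower[OF E[OF T'(1)]] ratio_const_pos by auto
  qed
  \<comment> \<open>Since \<open>R\<close> is independent of \<open>T\<close>, its positivity may be
    read off at \<open>T0\<close>.\<close>
  have R: "0 < R" using large(2)[OF order_refl] .
  \<comment> \<open>\<open>2 * sqrt T0\<close> settles \<open>T \<le> T0\<close> through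
    \<open>C / sqrt T\<close>. For \<open>T > T0\<close> the second term is at least
    \<open>C * R / 4\<close>, and \<open>8 / R\<close> makes this at least \<open>2\<close>.\<close>
  define C where "C = 2 * sqrt T0 + 8 / R"
  have T0: "2 \<le> T0" by (simp add: T0_def)
  have C: "0 < C" "2 * sqrt T0 \<le> C" "8 / R \<le> C" using R T0 by (auto simp: C_def intro: add_pos_pos)
  show ?thesis
  proof (intro exI[of _ C] conjI allI impI C(1))
    fix T :: real assume T: "1 < T"
    have "2 \<le> ennreal (C / sqrt T) + ennreal (C / T) * ?S T"
    proof (cases "T \<le> T0")
      case True
      have "2 * sqrt T \<le> C" using C(2) True by (meson mult_left_mono order_trans real_sqrt_le_mono zero_le_numeral)
      then have "2 \<le> C / sqrt T" using T by (simp add: field_simps)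
      then have "ennreal 2 \<le> ennreal (C / sqrt T)" by (rule ennreal_leI)
      then show ?thesis by (simp add: add_increasing2)
    next
      case False
      have "8 \<le> C * R" using C(3) R by (simp add: field_simps)
      then have "2 \<le> C / T * (R * T / 4)" using T by simp
      then have "ennreal 2 \<le> ennreal (C / T * (R * T / 4))" by (rule ennreal_leI)
      also have "\<dots> = ennreal (C / T) * ennreal (R * T / 4)" using C T R by (intro ennreal_mult) auto
      also have "\<dots> \<le> ennreal (C / T) * ?S T" using large(1)[of T] False by (intro mult_left_mono) auto
      finally show ?thesis by (simp add: add_increasing)
    qed
    with W[OF T] show "wasserstein P (normalized_martingale T (lam T)) Q G \<le> ennreal (C / sqrt T) + ennreal (C / T) * ?S T"
      by (rule order_trans)
  qed
qed

end
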